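(* There is an absolute constant $C$ such that for every portalgon $\mathcal{P}$, every intrinsic Delaunay triangulation of $\mathcal{P}$, regarded as a portalgon whose fragments are the triangles of the triangulation, is $C$-happy. That is, the intrinsic Delaunay triangulation of any portalgon has constant happiness.
   Context: A portalgon is a pair $\mathcal{P}=(\mathcal{F},P)$ where $\mathcal{F}$ is a finite collection of simple polygons (fragments) and $P$ is a collection of portals. A portal is an unordered pair $e=(e^-,e^+)$ of distinct, directed, equally long edges (portal edges) of fragments of $\mathcal{F}$; each portal edge appears in exactly one portal. The surface $\Sigma=\Sigma(\mathcal{P})$ is the quotient of $\bigcup_{F\in\mathcal{F}}F$ identifying corresponding points $p^-\in e^-$ and $p^+\in e^+$ of each portal $e$ (respecting directions). The length of a path in $\Sigma$ is the sum of the Euclidean lengths of its maximal subpaths inside fragments, and $d(s,t)$ is the infimum of lengths of paths between $s$ and $t$. Two portalgons are equivalent if there is a bijective isometry between their surfaces. A triangulation of a portalgon is an equivalent portalgon whose vertex set (as a set of points of $\Sigma$) is the same, and all of whose fragments are triangles. It is an intrinsic Delaunay triangulation if for every interior edge (portal) of the triangulation, with incident triangles $t$ and $t'$, the angles of $t$ and $t'$ at the corners not incident to that edge sum to at most $180$ degrees. Let $\Pi(p,q)$ be the set of all shortest paths between $p,q\in\Sigma$ and let $c(X)$ be the number of connected components of $X$. The happiness of a fragment $F$ is $\mathcal{H}(F)=\max_{p,q\in\Sigma}\max_{\pi\in\Pi(p,q)}c(F\cap\pi)$, the happiness of a portalgon is the maximum happiness of its fragments, and a portalgon is $h$-happy if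 its happiness is at most $h$. *)

theory Defs
  imports "HOL-Analysis.Analysis"
begin

section \<open>Simple polygons\<close>

text \<open>The Euclidean plane is \<^typ>\<open>complex\<close>.  A simple polygon is given by the cyclic list of its
  vertices, in either orientation; consecutive edges are allowed to be collinear.\<close>

definition polygon_edge :: "complex list \<Rightarrow> nat \<Rightarrow> complex set" where
  "polygon_edge F i = closed_segment (F ! i) (F ! (Suc i mod length F))"

definition edge_ends :: "complex list \<Rightarrow> nat \<Rightarrow> complex set" where
  "edge_ends F i = {F ! i, F ! (Suc i mod length F)}"

definition simple_polygon :: "complex list \<Rightarrow> bool" where
  "simple_polygon F \<longleftrightarrow> length F \<ge> 3 \<and> distinct F \<and>
     (\<forall>i < length F. \<forall>j < length F. i \<noteq> j \<longrightarrow>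
        polygon_edge F i \<inter> polygon_edge F j = edge_ends F i \<inter> edge_ends F j)"

definition polygon_boundary :: "complex list \<Rightarrow> complex set" where
  "polygon_boundary F = (\<Union>i < length F. polygon_edge F i)"

definition polygon_region :: "complex list \<Rightarrow> complex set" where
  "polygon_region F = polygon_boundary F \<union> inside (polygon_boundary F)"


section \<open>Portalgons\<close>

text \<open>Edge \<open>(k, i)\<close> is the \<open>i\<close>-th edge of the \<open>k\<close>-th fragment.  In a directed edge
  \<open>((k, i), r)\<close> the flag \<open>r\<close> says whether the direction is opposite to the order of the vertex
  list.\<close>

type_synonym edge = "nat \<times> nat"
type_synonym directed_edge = "edge \<times> bool"

record portalgon =
  fragments :: "complex list list"
  portals :: "directed_edge set set"

definition edges :: "portalgon \<Rightarrow> edge set" where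
  "edges P = {(k, i). k < length (fragments P) \<and> i < length (fragments P ! k)}"

fun directed_edge_point :: "portalgon \<Rightarrow> directed_edge \<Rightarrow> real \<Rightarrow> complex" where
  "directed_edge_point P ((k, i), r) u =
     (let F = fragments P ! k; a = F ! i; b = F ! (Suc i mod length F)
      in if r then (1 - u) *\<^sub>R b + u *\<^sub>R a else (1 - u) *\<^sub>R a + u *\<^sub>R b)"

fun edge_length :: "portalgon \<Rightarrow> edge \<Rightarrow> real" where
  "edge_length P (k, i) =
     (let F = fragments P ! k in dist (F ! i) (F ! (Suc i mod length F)))"

text \<open>A portal is an unordered pair of directed edges.  Being distinct, and lying in only one
  portal, refers to the underlying undirected edges: an edge is never glued to its own reverse.\<close>

definition is_portalgon :: "portalgon \<Rightarrow> bool" where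
  "is_portalgon P \<longleftrightarrow>
     (\<forall>F \<in> set (fragments P). simple_polygon F) \<and>
     (\<forall>e \<in> portals P. \<exists>a b. e = {a, b} \<and> fst a \<in> edges P \<and> fst b \<in> edges P \<and>
        fst a \<noteq> fst b \<and> edge_length P (fst a) = edge_length P (fst b)) \<and>
     (\<forall>e \<in> portals P. \<forall>e' \<in> portals P. e \<noteq> e' \<longrightarrow> fst ` e \<inter> fst ` e' = {})"


section \<open>The surface\<close>

definition fragment_region :: "portalgon \<Rightarrow> nat \<Rightarrow> complex set" where
  "fragment_region P k = polygon_region (fragments P ! k)"

text \<open>The fragments are glued as a disjoint union: their positions in the plane are irrelevant.\<close>

definition fragment_points :: "portalgon \<Rightarrow> (nat \<times> complex) set" where
  "fragment_points P = Sigma {..<length (fragments P)} (fragment_region P)"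

definition glue :: "portalgon \<Rightarrow> (nat \<times> complex) rel" where
  "glue P = {((fst (fst a), directed_edge_point P a u), (fst (fst b), directed_edge_point P b u)) | a b u.
       (\<exists>e \<in> portals P. a \<in> e \<and> b \<in> e) \<and> u \<in> {0..1}}"

type_synonym surface_point = "(nat \<times> complex) set"

definition surface :: "portalgon \<Rightarrow> surface_point set" where
  "surface P = fragment_points P // (glue P)\<^sup>*"

definition to_surface :: "portalgon \<Rightarrow> nat \<times> complex \<Rightarrow> surface_point" where
  "to_surface P x = (glue P)\<^sup>* `` {x}"

definition vertices :: "portalgon \<Rightarrow> surface_point set" where
  "vertices P = {to_surface P (k, fragments P ! k ! i) | k i. (k, i) \<in> edges P}"

definition fragment_topology :: "portalgon \<Rightarrow> (nat \<times> complex) topology" where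
  "fragment_topology P =
     sum_topology (\<lambda>k. top_of_set (fragment_region P k)) {..<length (fragments P)}"

definition surface_topology :: "portalgon \<Rightarrow> surface_point topology" where
  "surface_topology P = topology (\<lambda>U. U \<subseteq> surface P \<and>
     openin (fragment_topology P) {x \<in> fragment_points P. to_surface P x \<in> U})"

lemma to_surface_in_surface: "x \<in> fragment_points P \<Longrightarrow> to_surface P x \<in> surface P"
  unfolding to_surface_def surface_def by (rule quotientI)

lemma surface_eq_image: "surface P = to_surface P ` fragment_points P"
  unfolding to_surface_def surface_def quotient_def by auto

lemma topspace_fragment_topology: "topspace (fragment_topology P) = fragment_points P"
  by (simp add: fragment_topology_def fragment_points_def comp_def)

lemma openin_surface_topology:
  "openin (surface_topology P) U \<longleftrightarrow> U \<subseteq> surface P \<and>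
     openin (fragment_topology P) {x \<in> fragment_points P. to_surface P x \<in> U}"
proof -
  have "istopology (\<lambda>U. U \<subseteq> surface P \<and>
      openin (fragment_topology P) {x \<in> fragment_points P. to_surface P x \<in> U})"
    (is "istopology ?O")
    unfolding istopology_def
  proof (intro conjI allI impI)
    fix S T assume "?O S" "?O T"
    moreover have "{x \<in> fragment_points P. to_surface P x \<in> S \<inter> T} =
        {x \<in> fragment_points P. to_surface P x \<in> S} \<inter> {x \<in> fragment_points P. to_surface P x \<in> T}"
      by auto
    ultimately show "S \<inter> T \<subseteq> surface P"
      and "openin (fragment_topology P) {x \<in> fragment_points P. to_surface P x \<in> S \<inter> T}"
      by auto
  next
    fix K assume K: "\<forall>S\<in>K. ?O S"
    then show "\<Union>K \<subseteq> surface P" by blast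
    have "{x \<in> fragment_points P. to_surface P x \<in> \<Union>K} =
        (\<Union>S\<in>K. {x \<in> fragment_points P. to_surface P x \<in> S})"
      by auto
    then show "openin (fragment_topology P) {x \<in> fragment_points P. to_surface P x \<in> \<Union>K}"
      using K by auto
  qed
  then show ?thesis
    by (simp add: surface_topology_def)
qed

lemma topspace_surface_topology: "topspace (surface_topology P) = surface P"
proof
  show "topspace (surface_topology P) \<subseteq> surface P"
    using openin_surface_topology openin_topspace by blast
  have "{x \<in> fragment_points P. to_surface P x \<in> surface P} = topspace (fragment_topology P)"
    by (auto simp: topspace_fragment_topology to_surface_in_surface)
  then have "openin (surface_topology P) (surface P)"
    by (simp add: openin_surface_topology)
  then show "surface P \<subseteq> topspace (surface_topology P)"
    by (rule openin_subset)
qed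


section \<open>Paths, lengths and distances\<close>

definition curve_length :: "(real \<Rightarrow> complex) \<Rightarrow> real \<Rightarrow> real \<Rightarrow> ennreal" where
  "curve_length \<sigma> a b = (SUP ts \<in> {ts. sorted ts \<and> set ts \<subseteq> {a..b}}.
     \<Sum>i < length ts - 1. ennreal (dist (\<sigma> (ts ! i)) (\<sigma> (ts ! Suc i))))"

text \<open>\<open>fragment_subdivision P \<gamma> n t k \<sigma>\<close>: the \<open>j\<close>-th of the \<open>n\<close> subpaths of \<open>\<gamma>\<close>, over
  \<open>[t j, t (j+1)]\<close>, runs inside fragment \<open>k j\<close>, where it is the plane curve \<open>\<sigma> j\<close>.\<close>

definition fragment_subdivision ::
  "portalgon \<Rightarrow> (real \<Rightarrow> surface_point) \<Rightarrow> nat \<Rightarrow> (nat \<Rightarrow> real) \<Rightarrow> (nat \<Rightarrow> nat) \<Rightarrow>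
     (nat \<Rightarrow> real \<Rightarrow> complex) \<Rightarrow> bool" where
  "fragment_subdivision P \<gamma> n t k \<sigma> \<longleftrightarrow> t 0 = 0 \<and> t n = 1 \<and>
     (\<forall>j < n. t j < t (Suc j) \<and> k j < length (fragments P) \<and>
        continuous_on {t j..t (Suc j)} (\<sigma> j) \<and>
        (\<forall>s \<in> {t j..t (Suc j)}. \<sigma> j s \<in> fragment_region P (k j) \<and>
           \<gamma> s = to_surface P (k j, \<sigma> j s)))"

text \<open>All finite subdivisions into subpaths inside fragments (in particular those into maximal
  ones) give the same sum, because gluing preserves lengths along portal edges and the length of a
  plane curve is additive.  The infimum merely selects this value, and makes the length infinite
  if there is no finite subdivision.  Summing over infinitely many maximal subpaths would be
  wrong: a path that meets a portal edge in a Cantor set can advance along that edge while all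
  its maximal subpaths are arbitrarily short.\<close>

definition path_length :: "portalgon \<Rightarrow> (real \<Rightarrow> surface_point) \<Rightarrow> ennreal" where
  "path_length P \<gamma> = Inf {\<Sum>j<n. curve_length (\<sigma> j) (t j) (t (Suc j)) | n t k \<sigma>.
     fragment_subdivision P \<gamma> n t k \<sigma>}"

definition paths_between ::
  "portalgon \<Rightarrow> surface_point \<Rightarrow> surface_point \<Rightarrow> (real \<Rightarrow> surface_point) set" where
  "paths_between P p q = {\<gamma>. pathin (surface_topology P) \<gamma> \<and> \<gamma> 0 = p \<and> \<gamma> 1 = q}"

text \<open>Surfaces may be disconnected, so distances may be infinite.\<close>

definition surface_dist :: "portalgon \<Rightarrow> surface_point \<Rightarrow> surface_point \<Rightarrow> ennreal" where
  "surface_dist P p q = (INF \<gamma> \<in> paths_between P p q. path_length P \<gamma>)"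

definition shortest_paths ::
  "portalgon \<Rightarrow> surface_point \<Rightarrow> surface_point \<Rightarrow> (real \<Rightarrow> surface_point) set" where
  "shortest_paths P p q = {\<gamma> \<in> paths_between P p q. path_length P \<gamma> = surface_dist P p q}"


section \<open>Intrinsic Delaunay triangulations\<close>

definition surface_isometry ::
  "portalgon \<Rightarrow> portalgon \<Rightarrow> (surface_point \<Rightarrow> surface_point) \<Rightarrow> bool" where
  "surface_isometry P Q f \<longleftrightarrow> bij_betw f (surface P) (surface Q) \<and>
     (\<forall>p \<in> surface P. \<forall>q \<in> surface P. surface_dist Q (f p) (f q) = surface_dist P p q)"

text \<open>The isometry is what allows the vertices of \<open>T\<close> to be regarded as points of the surface
  of \<open>P\<close>.\<close>

definition is_triangulation_of :: "portalgon \<Rightarrow> portalgon \<Rightarrow> bool" where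
  "is_triangulation_of T P \<longleftrightarrow> is_portalgon T \<and>
     (\<exists>f. surface_isometry T P f \<and> f ` vertices T = vertices P) \<and>
     (\<forall>F \<in> set (fragments T). length F = 3)"

definition angle_at :: "complex \<Rightarrow> complex \<Rightarrow> complex \<Rightarrow> real" where
  "angle_at a b c = arccos (((b - a) \<bullet> (c - a)) / (norm (b - a) * norm (c - a)))"

fun opposite_angle :: "portalgon \<Rightarrow> edge \<Rightarrow> real" where
  "opposite_angle T (k, i) =
     (let F = fragments T ! k in angle_at (F ! ((i + 2) mod 3)) (F ! i) (F ! ((i + 1) mod 3)))"

definition is_intrinsic_Delaunay_triangulation_of :: "portalgon \<Rightarrow> portalgon \<Rightarrow> bool" where
  "is_intrinsic_Delaunay_triangulation_of T P \<longleftrightarrow> is_triangulation_of T P \<and>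
     (\<forall>e \<in> portals T. \<forall>a \<in> e. \<forall>b \<in> e. a \<noteq> b \<longrightarrow>
        opposite_angle T (fst a) + opposite_angle T (fst b) \<le> pi)"


section \<open>Happiness\<close>

definition num_components :: "complex set \<Rightarrow> enat" where
  "num_components X = (if finite (components X) then enat (card (components X)) else \<infinity>)"

text \<open>The intersection of a path with a fragment is taken in the fragment itself, before gluing:
  otherwise a fragment glued to itself would count as crossed once however often a path passes
  through its portals.\<close>

definition fragment_inter :: "portalgon \<Rightarrow> nat \<Rightarrow> (real \<Rightarrow> surface_point) \<Rightarrow> complex set" where
  "fragment_inter P k \<gamma> = {x \<in> fragment_region P k. to_surface P (k, x) \<in> \<gamma> ` {0..1}}"

definition fragment_happiness :: "portalgon \<Rightarrow> nat \<Rightarrow> enat" where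
  "fragment_happiness P k = (SUP p \<in> surface P. SUP q \<in> surface P.
     SUP \<gamma> \<in> shortest_paths P p q. num_components (fragment_inter P k \<gamma>))"

definition happiness :: "portalgon \<Rightarrow> enat" where
  "happiness P = (SUP k \<in> {..<length (fragments P)}. fragment_happiness P k)"

definition happy :: "nat \<Rightarrow> portalgon \<Rightarrow> bool" where
  "happy h P \<longleftrightarrow> happiness P \<le> enat h"

end

(* The potential G on a triangle, minus the power of a point with respect to the circumcircle, is
   continuous on the surface.  By the Delaunay condition the power decreases on crossing an edge, so
   along a shortest path, parametrized by arc length s, the function G + s^2 is convex, and the
   circumdisk of an entered triangle, developed along the path, bounds G from below.

   Suppose that the path enters a triangle four times through the half of an edge near one endpoint,
   and that the angle opposite to the edge is not obtuse.  The circumdisk bound, together with the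
   fact that the path is no longer than the segment between two crossings of the edge, forces the
   crossings to approach the endpoint, and puts each later crossing inside the developed circumdisk
   of the second and the third. Hence the path meets no vertex in between, and the development is a
   chain of triangles over a straight line. In such a chain the center of an earlier circumcircle
   cannot lie beyond a later copy of the same edge: the endpoints of that copy lie outside the
   earlier circumdisk, so its line cuts a chord no longer than the edge out of the disk, which fails
   if the center is beyond. For the last three visits these inequalities have incompatible signs. So
   an edge of a triangle with non-obtuse opposite angle is used at most 3 + 3 + 1 times for entering
   it. Of the two angles opposite to an interior edge at most one is obtuse, and reversing the path
   exchanges entries and exits, so every edge is used at most 7 times for leaving the triangle. Each
   component of the intersection contains an endpoint of the path, a vertex, or an exit. *)

theory Submission
  imports Defs
begin

text \<open>A Delaunay step lowers the power only beyond the crossed line, so two circles of a chain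
  can be compared only at points beyond every edge crossed in between. Since the edges turn, the
  comparison is confined to a cone with apex on the first edge that narrows at each step. Of the
  four visits the first one serves to force the later circumcenters ahead of their crossings, by at
  least the distance of the crossing from the midpoint of the edge. This distance shrinks from visit
  to visit, so the crossings move toward the midpoint. The other three visits are then compared
  pairwise. Gluings may reverse orientation, so every copy of an edge carries a sign, and the
  contradiction must hold for all signs. A shortest path is given only as a continuous map; its
  straightness in an unfolded chart is derived from lower bounds on the distance by 1-Lipschitz
  functions. The constant 49 counts 3 corners and at most 2 preimages for each of the 2 ends of the
  path and the 3 * 7 exits.\<close>

section \<open>Power of a point and sides of a line\<close>

text \<open>\<open>R\<close> is the squared radius, so the power is negative inside the circle, and
  rigid motions only have to move the center.\<close>

definition pw :: "complex \<Rightarrow> real \<Rightarrow> complex \<Rightarrow> real" where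
  "pw c R z = (norm (z - c))\<^sup>2 - R"

text \<open>Twice the signed area of the triangle, positive to the right of the line directed from
  \<open>p\<close> to \<open>q\<close>. For an edge directed from \<open>l\<close> below the real
  axis to \<open>u\<close> above it, positive therefore means ahead of the edge.\<close>

definition side :: "complex \<Rightarrow> complex \<Rightarrow> complex \<Rightarrow> real" where
  "side p q z = Re (z - p) * Im (q - p) - Im (z - p) * Re (q - p)"

lemma pw_eq: "pw c R z = (Re z - Re c)\<^sup>2 + (Im z - Im c)\<^sup>2 - R"
  by (simp add: pw_def cmod_power2)

text \<open>Stewart's theorem in terms of powers. For \<open>t\<close> in the unit interval the
  correction is nonpositive, which is the convexity of disks.\<close>

lemma pw_comb: "pw c R ((1-t) *\<^sub>R a + t *\<^sub>R b) =
   (1-t) * pw c R a + t * pw c R b - t*(1-t)*(norm (a-b))\<^sup>2"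
  unfolding pw_eq cmod_power2 by (simp add: power2_eq_square) algebra

lemma pw_comb_less:
  assumes "pw c R a < 0" "pw c R b \<le> 0" "0 \<le> t" "t < 1"
  shows "pw c R ((1-t) *\<^sub>R a + t *\<^sub>R b) < 0"
proof -
  have "(1-t) * pw c R a < 0" using assms by (simp add: mult_pos_neg)
  moreover have "t * pw c R b \<le> 0" using assms by (simp add: mult_nonneg_nonpos)
  moreover have "t*(1-t)*(norm (a-b))\<^sup>2 \<ge> 0" using assms by simp
  ultimately show ?thesis unfolding pw_comb by linarith
qed

lemma side_comb: "side p q ((1-t) *\<^sub>R a + t *\<^sub>R b) = (1-t) * side p q a + t * side p q b"
  unfolding side_def by (simp) algebra

lemma side_self [simp]: "side p q p = 0" "side p q q = 0"
  by (simp_all add: side_def)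

lemma side_cnj: "side (cnj q) (cnj p) (cnj z) = side p q z"
  unfolding side_def by (simp) algebra

lemma pw_cnj: "pw (cnj c) R (cnj z) = pw c R z"
  by (simp add: pw_eq power2_commute)

section \<open>Strips of triangles developed along the real axis\<close>

definition crossing :: "real \<Rightarrow> complex \<Rightarrow> complex \<Rightarrow> bool" where
  "crossing t u l \<longleftrightarrow> Im l < 0 \<and> 0 < Im u \<and> of_real t \<in> open_segment l u"

text \<open>The affine function \<open>side l u\<close> vanishes at the crossing, so along the axis
  only its slope is left.\<close>

lemma crossing_side:
  assumes "crossing t u l"
  shows "side l u (of_real x) = (x - t) * (Im u - Im l)"
proof -
  obtain \<theta> where "of_real t = (1-\<theta>) *\<^sub>R l + \<theta> *\<^sub>R u"
    using assms by (auto simp: crossing_def in_segment)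
  then have 1: "t = (1-\<theta>) * Re l + \<theta> * Re u" and 2: "0 = (1-\<theta>) * Im l + \<theta> * Im u"
    by (simp_all add: complex_eq_iff)
  have 3: "t - Re l = \<theta> * (Re u - Re l)" using 1 by algebra
  have 4: "Im l = - \<theta> * (Im u - Im l)" using 2 by algebra
  have "side l u (of_real x) = (x-t) * (Im u - Im l) + (t - Re l) * (Im u - Im l) + Im l * (Re u - Re l)"
    unfolding side_def by simp algebra
  also have "\<dots> = (x-t) * (Im u - Im l)"
    using 3 4 by algebra
  finally show ?thesis .
qed

lemma crossing_cnj: "crossing t u l \<Longrightarrow> crossing t (cnj l) (cnj u)"
proof -
  assume a: "crossing t u l"
  then obtain \<theta> where \<theta>: "of_real t = (1-\<theta>) *\<^sub>R l + \<theta> *\<^sub>R u" "0 < \<theta>" "\<theta> < 1" "l \<noteq> u"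
    by (auto simp: crossing_def in_segment)
  have "of_real t = cnj (of_real t)" by simp
  also have "\<dots> = (1-(1-\<theta>)) *\<^sub>R cnj u + (1-\<theta>) *\<^sub>R cnj l"
    unfolding \<theta>(1) by (simp add: complex_eq_iff)
  finally have "of_real t \<in> open_segment (cnj u) (cnj l)"
    unfolding in_segment using \<theta> by (intro conjI exI[of _ "1-\<theta>"]) auto
  then show ?thesis using a by (simp add: crossing_def)
qed

lemma crossing_less: "crossing t u l \<Longrightarrow> 0 < Im u - Im l"
  by (auto simp: crossing_def)

type_synonym pstate = "real \<times> complex \<times> complex \<times> complex \<times> real"

text \<open>A step of a developed strip: from the edge \<open>[l, u]\<close>, crossed by the real axis at \<open>t\<close> into a
  triangle with circumcircle \<open>(c, R)\<close>, to the next crossed edge.\<close>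

fun pstep :: "pstate \<Rightarrow> pstate \<Rightarrow> bool" where
  "pstep (t, u, l, c, R) (t', u', l', c', R') \<longleftrightarrow> crossing t u l \<and> crossing t' u' l' \<and> t < t' \<and>
     pw c R u' = 0 \<and> pw c R l' = 0 \<and> side l u u' \<ge> 0 \<and> side l u l' \<ge> 0 \<and>
     (\<forall>z. side l' u' z \<ge> 0 \<longrightarrow> pw c' R' z \<le> pw c R z)"

fun pcnj :: "pstate \<Rightarrow> pstate" where
  "pcnj (t, u, l, c, R) = (t, cnj l, cnj u, cnj c, R)"

text \<open>Reflection in the axis exchanges the two ends of every edge; statements about upper ends
  thus transfer to lower ends.\<close>

lemma pstep_cnj: "pstep s s' \<Longrightarrow> pstep (pcnj s) (pcnj s')"
proof (cases s; cases s')
  fix t u l c R t' u' l' c' R'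
  assume s: "s = (t, u, l, c, R)" "s' = (t', u', l', c', R')" and p: "pstep s s'"
  have "pw (cnj c') R' z \<le> pw (cnj c) R z" if "side (cnj u') (cnj l') z \<ge> 0" for z
  proof -
    have "side l' u' (cnj z) \<ge> 0" using that side_cnj[of u' l' "cnj z"] by simp
    then have "pw c' R' (cnj z) \<le> pw c R (cnj z)" using p s by simp
    then show ?thesis using pw_cnj[of c' R' "cnj z"] pw_cnj[of c R "cnj z"] by simp
  qed
  then show ?thesis using p s crossing_cnj by (auto simp: side_cnj pw_cnj)
qed

text \<open>The sector has its apex at \<open>t0\<close> and is spanned by the positive real
  direction and the direction of \<open>v\<close>. On its part beyond the current edge all steps
  made so far lower the power, so there the current circle can be compared with the first one. The
  point \<open>v\<close> lies on the part of the current edge above the axis and not inside the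
  first disk.\<close>

definition sweep_inv :: "real \<Rightarrow> complex \<Rightarrow> complex \<Rightarrow> complex \<Rightarrow> real \<Rightarrow> pstate \<Rightarrow> bool" where
  "sweep_inv t0 u0 l0 c0 R0 = (\<lambda>(t, u, l, c, R). crossing t u l \<and> t0 < t \<and> (\<exists>v \<mu>. 0 < Im v \<and>
     0 < \<mu> \<and> \<mu> \<le> 1 \<and> v = (1 - \<mu>) *\<^sub>R of_real t + \<mu> *\<^sub>R u \<and> pw c0 R0 v \<ge> 0 \<and> side l0 u0 v \<ge> 0 \<and>
     (\<forall>\<alpha> \<beta>. \<alpha> \<ge> 0 \<longrightarrow> \<beta> \<ge> 0 \<longrightarrow> side l u (of_real (t0 + \<alpha>) + \<beta> *\<^sub>R (v - of_real t0)) \<ge> 0 \<longrightarrow>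
        pw c R (of_real (t0 + \<alpha>) + \<beta> *\<^sub>R (v - of_real t0))
          \<le> pw c0 R0 (of_real (t0 + \<alpha>) + \<beta> *\<^sub>R (v - of_real t0)))))"

lemma sweep_base:
  assumes "pstep (t0, u0, l0, c0, R0) (t, u, l, c, R)"
  shows "sweep_inv t0 u0 l0 c0 R0 (t, u, l, c, R)"
  unfolding sweep_inv_def using assms
  by (auto simp: crossing_def intro!: exI[of _ u] exI[of _ "1::real"])

lemma side_ray: "side p q (of_real (t0 + \<alpha>) + \<beta> *\<^sub>R (v - of_real t0)) =
   side p q (of_real (t0 + \<alpha>)) + \<beta> * (side p q v - side p q (of_real t0))"
  unfolding side_def by simp algebra

text \<open>The segment from \<open>of_real t'\<close> to \<open>u'\<close> either ends inside the cone of swept rays, or leaves it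
  through the extreme ray; in both cases the extreme ray can be advanced.\<close>

lemma sweep_step:
  assumes inv: "sweep_inv t0 u0 l0 c0 R0 (t, u, l, c, R)" and st: "pstep (t, u, l, c, R) (t', u', l', c', R')"
    and st0: "crossing t0 u0 l0" and P0: "pw c0 R0 (of_real t0) < 0"
  shows "sweep_inv t0 u0 l0 c0 R0 (t', u', l', c', R')"
proof -
  obtain v \<mu> where v: "0 < Im v" "0 < \<mu>" "\<mu> \<le> 1" "v = (1 - \<mu>) *\<^sub>R of_real t + \<mu> *\<^sub>R u"
    "pw c0 R0 v \<ge> 0" "side l0 u0 v \<ge> 0"
    and I2: "\<And>\<alpha> \<beta>. \<alpha> \<ge> 0 \<Longrightarrow> \<beta> \<ge> 0 \<Longrightarrow> side l u (of_real (t0 + \<alpha>) + \<beta> *\<^sub>R (v - of_real t0)) \<ge> 0 \<Longrightarrow>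
        pw c R (of_real (t0 + \<alpha>) + \<beta> *\<^sub>R (v - of_real t0))
          \<le> pw c0 R0 (of_real (t0 + \<alpha>) + \<beta> *\<^sub>R (v - of_real t0))"
    and cr: "crossing t u l" and t0t: "t0 < t"
    using inv unfolding sweep_inv_def by auto
  have cr': "crossing t' u' l'" and tt': "t < t'" and Pu: "pw c R u' = 0"
    and su: "side l u u' \<ge> 0" and Q: "\<And>z. side l' u' z \<ge> 0 \<Longrightarrow> pw c' R' z \<le> pw c R z"
    using st by auto
  define H where "H = Im u - Im l"
  define H' where "H' = Im u' - Im l'"
  have H: "H > 0" "H' > 0" using crossing_less[OF cr] crossing_less[OF cr'] by (auto simp: H_def H'_def)
  have sl: "side l u (of_real x) = (x - t) * H" for x using crossing_side[OF cr] by (simp add: H_def)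
  have sl': "side l' u' (of_real x) = (x - t') * H'" for x using crossing_side[OF cr'] by (simp add: H'_def)
  have sl0: "side l0 u0 (of_real x) = (x - t0) * (Im u0 - Im l0)" for x using crossing_side[OF st0] .
  have H0: "Im u0 - Im l0 > 0" using crossing_less[OF st0] .
  have sv: "side l u v = 0" unfolding v(4) side_comb sl by simp
  \<comment> \<open>Oblique coordinates: \<open>z\<close> is \<open>t0 + aa z\<close> plus
    \<open>bb z\<close> times \<open>v - t0\<close>. The sector is where both are
    nonnegative.\<close>
  define bb where "bb z = Im z / Im v" for z
  define aa where "aa z = Re z - t0 - bb z * (Re v - t0)" for z
  have dec: "z = of_real (t0 + aa z) + bb z *\<^sub>R (v - of_real t0)" for z
    using v(1) by (simp add: complex_eq_iff aa_def bb_def)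
  have bb_pos: "bb u' > 0" using v(1) cr' by (simp add: bb_def crossing_def)
  \<comment> \<open>Any point \<open>v'\<close> of the new edge will do that lies in the old sector,
    ahead of the old edge and not inside the first disk, because the sector of \<open>v'\<close> is
    contained in the old one.\<close>
  have main: ?thesis if "0 < \<nu>" "\<nu> \<le> 1" "v' = (1 - \<nu>) *\<^sub>R of_real t' + \<nu> *\<^sub>R u'"
     "aa v' \<ge> 0" "pw c0 R0 v' \<ge> 0" "side l u v' \<ge> 0" for v' \<nu>
  proof -
    have iv': "Im v' > 0" using that cr' by (simp add: crossing_def)
    have bv': "bb v' > 0" using iv' v(1) by (simp add: bb_def)
    have sv': "side l' u' v' = 0" unfolding that(3) side_comb sl' by simp
    have "side l0 u0 v' = (aa v') * (Im u0 - Im l0) + bb v' * side l0 u0 v"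
      by (subst dec) (simp only: side_ray sl0, simp)
    then have s0: "side l0 u0 v' \<ge> 0" using that(4) bv' H0 v(6) by simp
    have "pw c' R' z \<le> pw c0 R0 z"
      if ab: "\<alpha> \<ge> 0" "\<beta> \<ge> 0" and z: "z = of_real (t0 + \<alpha>) + \<beta> *\<^sub>R (v' - of_real t0)"
         and s: "side l' u' z \<ge> 0" for z \<alpha> \<beta>
    proof -
      have "side l' u' z = (t0 + \<alpha> - t') * H' + \<beta> * (t' - t0) * H'"
        unfolding z side_ray sl' sv' by (simp add: algebra_simps)
      also have "\<dots> = H' * (\<alpha> - (t' - t0) * (1 - \<beta>))" by algebra
      finally have al: "\<alpha> \<ge> (t' - t0) * (1 - \<beta>)" using s H(2) by (simp add: zero_le_mult_iff)
      \<comment> \<open>The new edge crosses the axis later, so a point of the new sector beyond the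
        new edge is also beyond the old edge. Hence the old comparison can be used at
        \<open>z\<close> before the new step is added.\<close>
      have al2: "\<alpha> \<ge> (t - t0) * (1 - \<beta>)"
      proof (cases "\<beta> \<ge> 1")
        case True
        then have "(t - t0) * (1 - \<beta>) \<le> 0" using t0t by (simp add: mult_nonneg_nonpos)
        then show ?thesis using ab by linarith
      next
        case False
        then have "(t - t0) * (1 - \<beta>) \<le> (t' - t0) * (1 - \<beta>)" using tt' by (intro mult_right_mono) auto
        then show ?thesis using al by linarith
      qed
      have "side l u z = (t0 + \<alpha> - t) * H + \<beta> * side l u v' + \<beta> * (t - t0) * H"
        unfolding z side_ray sl by algebra
      also have "\<dots> = H * (\<alpha> - (t - t0) * (1 - \<beta>)) + \<beta> * side l u v'" by algebra
      also have "\<dots> \<ge> 0" using al2 H \<open>\<beta> \<ge> 0\<close> \<open>side l u v' \<ge> 0\<close> by simp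
      finally have sz: "side l u z \<ge> 0" .
      have z2: "z = of_real (t0 + (\<alpha> + \<beta> * aa v')) + (\<beta> * bb v') *\<^sub>R (v - of_real t0)"
      proof -
        have "of_real (t0 + \<alpha>) + \<beta> *\<^sub>R (w - of_real t0) = of_real (t0 + (\<alpha> + \<beta> * a)) + (\<beta> * b) *\<^sub>R (v - of_real t0)"
          if "w = of_real (t0 + a) + b *\<^sub>R (v - of_real t0)" for a b w
          unfolding that by (simp add: complex_eq_iff algebra_simps)
        from this[OF dec] show ?thesis unfolding z .
      qed
      have "pw c R z \<le> pw c0 R0 z"
        using I2[of "\<alpha> + \<beta> * aa v'" "\<beta> * bb v'", folded z2] sz bv' ab \<open>aa v' \<ge> 0\<close> by simp
      then show ?thesis using Q[OF s] by linarith
    qed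
    then show ?thesis
      unfolding sweep_inv_def using that iv' s0 cr' t0t tt' by (auto intro!: exI[of _ v'] exI[of _ \<nu>])
  qed
  show ?thesis
  proof (cases "aa u' \<ge> 0")
    case True
    \<comment> \<open>Here \<open>u'\<close> lies in the sector. It is on the current circle, so the
      comparison at \<open>u'\<close> puts it outside or on the first circle.\<close>
    have "pw c R u' \<le> pw c0 R0 u'"
      using I2[of "aa u'" "bb u'", folded dec[of u']] True bb_pos su by simp
    then show ?thesis using main[of 1 u'] True Pu su by simp
  next
    case False
    have aat: "aa (of_real t') = t' - t0" by (simp add: aa_def bb_def)
    \<comment> \<open>Chosen so that \<open>v'\<close> is the point where the segment from
      \<open>t'\<close> to \<open>u'\<close> meets the ray from \<open>t0\<close> through
      \<open>v\<close>.\<close>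
    define \<nu> where "\<nu> = (t' - t0) / ((t' - t0) - aa u')"
    have den: "(t' - t0) - aa u' > 0" using False t0t tt' by linarith
    have \<nu>: "0 < \<nu>" "\<nu> < 1" using False t0t tt' den by (auto simp: \<nu>_def field_simps)
    define v' where "v' = (1 - \<nu>) *\<^sub>R of_real t' + \<nu> *\<^sub>R u'"
    have "aa v' = (1 - \<nu>) * (t' - t0) + \<nu> * aa u'"
      using v(1) by (simp add: aa_def bb_def v'_def field_simps)
    also have "\<dots> = (t' - t0) - \<nu> * ((t' - t0) - aa u')" by algebra
    also have "\<dots> = 0" using den by (simp add: \<nu>_def)
    finally have av': "aa v' = 0" .
    have bv': "bb v' = \<nu> * bb u'" by (simp add: bb_def v'_def)
    then have bv'0: "bb v' > 0" using \<nu> bb_pos by simp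
    have sv': "side l u v' \<ge> 0"
      unfolding v'_def side_comb sl using \<nu> tt' H su by simp
    have "side l u v' = (1 - bb v') * (t0 - t) * H"
      by (subst dec) (simp only: side_ray sl sv av', simp add: algebra_simps)
    then have "(bb v' - 1) * ((t - t0) * H) \<ge> 0" using sv' by (simp add: algebra_simps)
    moreover have "(t - t0) * H > 0" using t0t H by simp
    ultimately have b1: "bb v' \<ge> 1" by (smt (verit) zero_le_mult_iff)
    have vv': "v = (1 - 1 / bb v') *\<^sub>R of_real t0 + (1 / bb v') *\<^sub>R v'"
      using bv'0 by (subst (2) dec) (simp add: av' algebra_simps)
    \<comment> \<open>On the ray from \<open>t0\<close>, which is inside the first disk,
      \<open>v\<close> is not inside and comes no later than \<open>v'\<close>; a convex disk cannot
      be entered again.\<close>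
    have "pw c0 R0 v' \<ge> 0"
    proof (rule ccontr)
      assume "\<not> ?thesis"
      then have v'neg: "pw c0 R0 v' < 0" by simp
      show False
      proof (cases "bb v' = 1")
        case True
        then show ?thesis using vv' v(5) v'neg by simp
      next
        case False
        have "pw c0 R0 ((1 - 1 / bb v') *\<^sub>R of_real t0 + (1 / bb v') *\<^sub>R v') < 0"
          by (rule pw_comb_less) (use P0 v'neg b1 False in \<open>auto simp: field_simps\<close>)
        then show ?thesis using vv' v(5) by simp
      qed
    qed
    then show ?thesis using main[OF \<nu>(1) _ v'_def] \<nu> av' sv' by simp
  qed
qed

lemma sweep:
  assumes "pstep\<^sup>+\<^sup>+ s0 s" and s0: "s0 = (t0, u0, l0, c0, R0)"
    and "crossing t0 u0 l0" "pw c0 R0 (of_real t0) < 0"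
  shows "sweep_inv t0 u0 l0 c0 R0 s"
  using assms(1)
proof (induction rule: tranclp_induct)
  case (base y)
  then show ?case using sweep_base s0 by (cases y) blast
next
  case (step y z)
  then show ?case using sweep_step[OF _ _ assms(3,4)] by (cases y; cases z) blast
qed

text \<open>If the center \<open>c0\<close> lay beyond the later edge, the chord cut out of the first disk by that
  edge would be at least as long as \<open>[l0, u0]\<close>.\<close>

lemma center_before_edge:
  assumes chain: "pstep\<^sup>+\<^sup>+ (t0, u0, l0, c0, R0) (t, u, l, c, R)"
    and cr0: "crossing t0 u0 l0" and P0u: "pw c0 R0 u0 = 0" and P0l: "pw c0 R0 l0 = 0"
    and Pt: "pw c0 R0 (of_real t) < 0" and len: "norm (u - l) = norm (u0 - l0)"
    and c0: "side l0 u0 c0 \<ge> 0"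
  shows "side l u c0 \<le> 0"
proof (rule ccontr)
  assume "\<not> ?thesis"
  then have h: "side l u c0 > 0" by simp
  obtain \<theta>0 where \<theta>0: "of_real t0 = (1-\<theta>0) *\<^sub>R l0 + \<theta>0 *\<^sub>R u0" "0 < \<theta>0" "\<theta>0 < 1" "l0 \<noteq> u0"
    using cr0 by (auto simp: crossing_def in_segment)
  have P0: "pw c0 R0 (of_real t0) < 0"
    unfolding \<theta>0(1) pw_comb P0u P0l using \<theta>0 by simp
  have inv: "sweep_inv t0 u0 l0 c0 R0 (t, u, l, c, R)"
    by (rule sweep[OF chain refl cr0 P0])
  then have cr: "crossing t u l" and t0t: "t0 < t" by (auto simp: sweep_inv_def)
  have chain': "pstep\<^sup>+\<^sup>+ (pcnj (t0, u0, l0, c0, R0)) (pcnj (t, u, l, c, R))"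
    using chain
  proof (induction rule: tranclp_induct)
    case (base y)
    then show ?case using pstep_cnj by blast
  next
    case (step y z)
    then show ?case using pstep_cnj tranclp.trancl_into_trancl by metis
  qed
  \<comment> \<open>The reflected chain supplies the point \<open>w\<close> on the lower part of the
    later edge.\<close>
  have inv': "sweep_inv t0 (cnj l0) (cnj u0) (cnj c0) R0 (t, cnj l, cnj u, cnj c, R)"
  proof (rule sweep)
    show "pstep\<^sup>+\<^sup>+ (t0, cnj l0, cnj u0, cnj c0, R0) (t, cnj l, cnj u, cnj c, R)" using chain' by simp
    show "pw (cnj c0) R0 (of_real t0) < 0" using P0 pw_cnj[of c0 R0 "of_real t0"] by simp
  qed (use crossing_cnj[OF cr0] in auto)
  obtain v \<mu> where v: "0 < \<mu>" "\<mu> \<le> 1" "v = (1 - \<mu>) *\<^sub>R of_real t + \<mu> *\<^sub>R u"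
      "pw c0 R0 v \<ge> 0" "side l0 u0 v \<ge> 0"
    using inv unfolding sweep_inv_def by auto
  obtain w' \<nu> where w': "0 < \<nu>" "\<nu> \<le> 1" "w' = (1 - \<nu>) *\<^sub>R of_real t + \<nu> *\<^sub>R cnj l"
      "pw (cnj c0) R0 w' \<ge> 0" "side (cnj u0) (cnj l0) w' \<ge> 0"
    using inv' unfolding sweep_inv_def by auto
  define w where "w = (1 - \<nu>) *\<^sub>R of_real t + \<nu> *\<^sub>R l"
  have "cnj w' = w" unfolding w'(3) w_def by (simp add: complex_eq_iff)
  then have w: "pw c0 R0 w \<ge> 0" "side l0 u0 w \<ge> 0"
    using w'(4,5) pw_cnj[of c0 R0 w] side_cnj[of u0 l0 w] by auto
  obtain \<theta> where \<theta>: "of_real t = (1-\<theta>) *\<^sub>R l + \<theta> *\<^sub>R u" "0 < \<theta>" "\<theta> < 1" "l \<noteq> u"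
    using cr by (auto simp: crossing_def in_segment)
  define ll where "ll = norm (u - l)"
  have ll: "ll > 0" using \<theta>(4) by (simp add: ll_def)
  \<comment> \<open>Distances of \<open>v\<close> and \<open>w\<close> from the crossing, in units
    of the edge length. They lie on one edge on either side of the crossing, hence
    \<open>x1 + x2 \<le> 1\<close>.\<close>
  define x1 where "x1 = \<mu> * (1-\<theta>)"
  define x2 where "x2 = \<nu> * \<theta>"
  have x12: "x1 > 0" "x2 > 0" "x1 + x2 \<le> 1"
  proof -
    show "x1 > 0" "x2 > 0" using v(1) w'(1) \<theta> by (auto simp: x1_def x2_def)
    have "x1 \<le> 1 * (1-\<theta>)" unfolding x1_def using v \<theta> by (intro mult_right_mono) auto
    moreover have "x2 \<le> 1 * \<theta>" unfolding x2_def using w' \<theta> by (intro mult_right_mono) auto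
    ultimately show "x1 + x2 \<le> 1" by simp
  qed
  define E where "E x = of_real t + x *\<^sub>R (u - l)" for x
  have Ev: "E x1 = v" unfolding E_def v(3) x1_def \<theta>(1) by (simp add: complex_eq_iff algebra_simps)
  have Ew: "E (- x2) = w" unfolding E_def w_def x2_def \<theta>(1) by (simp add: complex_eq_iff algebra_simps)
  have E0: "E 0 = of_real t" by (simp add: E_def)
  \<comment> \<open>\<open>h\<close> is \<open>ll\<close> times the height of \<open>c0\<close> over
    the line of the later edge, and \<open>g\<close> is the position of the foot of the
    perpendicular.\<close>
  define h where "h = side l u c0"
  define g where "g = (Re (c0 - of_real t) * Re (u - l) + Im (c0 - of_real t) * Im (u - l)) / ll\<^sup>2"
  have l2: "ll\<^sup>2 = (Re u - Re l)\<^sup>2 + (Im u - Im l)\<^sup>2" by (simp add: ll_def cmod_power2)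
  have PE: "pw c0 R0 (E x) = ll\<^sup>2 * (x - g)\<^sup>2 + h\<^sup>2 / ll\<^sup>2 - R0" for x
  proof -
    define a b e f where ab: "a = Re (c0 - of_real t)" "b = Im (c0 - of_real t)" "e = Re (u - l)" "f = Im (u - l)"
    have k: "ll\<^sup>2 = e\<^sup>2 + f\<^sup>2" using l2 by (simp add: ab)
    have "side l u c0 = side l u (of_real t) + a * f - b * e" unfolding side_def ab by simp algebra
    then have hh: "h = a * f - b * e" using crossing_side[OF cr, of t] by (simp add: h_def)
    have gg: "g * ll\<^sup>2 = a * e + b * f" using ll by (simp add: g_def ab)
    have "ll\<^sup>2 * pw c0 R0 (E x) = ll\<^sup>2 * ((x * e - a)\<^sup>2 + (x * f - b)\<^sup>2 - R0)"
      unfolding pw_eq E_def ab by (simp add: algebra_simps)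
    also have "\<dots> = (ll\<^sup>2 * x - g * ll\<^sup>2)\<^sup>2 + h\<^sup>2 - ll\<^sup>2 * R0"
      unfolding gg unfolding hh k by algebra
    also have "\<dots> = ll\<^sup>2 * (ll\<^sup>2 * (x - g)\<^sup>2 + h\<^sup>2 / ll\<^sup>2 - R0)"
      using ll by (simp add: field_simps power2_eq_square)
    finally show ?thesis using ll by simp
  qed
  have P1: "pw c0 R0 (E x1) \<ge> 0" "pw c0 R0 (E (-x2)) \<ge> 0" "pw c0 R0 (E 0) < 0"
    using v(4) w(1) Pt by (auto simp: Ev Ew E0)
  \<comment> \<open>Squared half-length, in units of \<open>ll\<close>, of the chord that the later
    line cuts out of the first disk.\<close>
  define \<rho> where "\<rho> = (R0 - h\<^sup>2 / ll\<^sup>2) / ll\<^sup>2"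
  have PE': "pw c0 R0 (E x) = ll\<^sup>2 * ((x - g)\<^sup>2 - \<rho>)" for x
    using ll by (simp add: PE \<rho>_def field_simps)
  have q1: "(x1 - g)\<^sup>2 \<ge> \<rho>" "(x2 + g)\<^sup>2 \<ge> \<rho>" "g\<^sup>2 < \<rho>"
    using P1 ll unfolding PE' by (auto simp: zero_le_mult_iff mult_less_0_iff power2_commute[of "-x2"] add.commute)
  define r where "r = sqrt \<rho>"
  have r: "r > 0" "r\<^sup>2 = \<rho>" using q1(3) by (auto simp: r_def) (smt (verit) zero_le_power2)+
  have gr: "\<bar>g\<bar> < r" using q1(3) r by (metis abs_le_square_iff abs_of_pos not_le)
  have "\<bar>x1 - g\<bar> \<ge> r" "\<bar>x2 + g\<bar> \<ge> r"
    using q1 r by (metis abs_le_square_iff abs_of_pos)+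
  \<comment> \<open>The crossing is inside the disk and \<open>v\<close>, \<open>w\<close> are not,
    so the chord lies between them and is no longer than the edge.\<close>
  then have x1g: "x1 \<ge> g + r" "x2 \<ge> r - g" using gr x12 by linarith+
  then have "2 * r \<le> 1" using x12 by linarith
  then have "(2 * r)\<^sup>2 \<le> 1\<^sup>2" using r by (intro power_mono) auto
  then have rho4: "4 * \<rho> \<le> 1" using r by (simp add: power_mult_distrib)
  \<comment> \<open>An endpoint of the first edge beyond the later line would give a point
    \<open>z\<close> of the first edge on that line and inside the first disk, hence strictly
    between \<open>w\<close> and \<open>v\<close>. But \<open>w\<close> and \<open>v\<close> are not
    behind the first edge and the crossing between them is ahead of it, so nothing strictly between
    them is on the line of the first edge.\<close>
  have ends: "side l u y \<le> 0" if y: "pw c0 R0 y = 0" "y = u0 \<or> y = l0" for y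
  proof (rule ccontr)
    assume "\<not> side l u y \<le> 0"
    then have sy: "side l u y > 0" by simp
    define H where "H = Im u - Im l"
    have H: "H > 0" using crossing_less[OF cr] by (simp add: H_def)
    have st0: "side l u (of_real t0) = (t0 - t) * H" using crossing_side[OF cr] by (simp add: H_def)
    then have st0n: "side l u (of_real t0) < 0" using t0t H by (simp add: mult_neg_pos)
    define m where "m = side l u (of_real t0) / (side l u (of_real t0) - side l u y)"
    have m: "0 < m" "m < 1" using st0n sy by (auto simp: m_def field_simps)
    define z where "z = (1 - m) *\<^sub>R of_real t0 + m *\<^sub>R y"
    have sz: "side l u z = 0"
      using st0n sy unfolding z_def side_comb m_def by (simp add: field_simps)
    have Pz: "pw c0 R0 z < 0" unfolding z_def
      using P0 y(1) m by (intro pw_comb_less) auto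
    have sz0: "side l0 u0 z = 0"
      using y(2) crossing_side[OF cr0, of t0] unfolding z_def side_comb by auto
    obtain x where x: "z = E x"
    proof -
      have "(Re z - t) * Im (u - l) = Im z * Re (u - l)"
      proof -
        have "side l u z - side l u (of_real t) = (Re z - t) * Im (u - l) - Im z * Re (u - l)"
          unfolding side_def by simp algebra
        then show ?thesis using sz crossing_side[OF cr, of t] by simp
      qed
      moreover have "Im z = (Im z / H) * H" using H by simp
      ultimately have "(Re z - t) * H = (Im z / H) * Re (u - l) * H" using H by (simp add: H_def[symmetric])
      then have "Re z - t = (Im z / H) * Re (u - l)" using H by (simp only: mult_right_cancel[of H] less_irrefl)
      then have "z = E (Im z / H)"
        using H by (intro complex_eqI) (simp_all add: E_def H_def[symmetric])
      then show ?thesis using that by blast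
    qed
    have "(x - g)\<^sup>2 < \<rho>" using Pz ll unfolding x PE' by (simp add: mult_less_0_iff)
    then have "\<bar>x - g\<bar> < r" using r by (metis abs_of_pos real_sqrt_abs real_sqrt_less_iff)
    then have xx: "x < x1" "- x2 < x" using x1g by linarith+
    define \<phi> where "\<phi> x = side l0 u0 (E x)" for x
    have \<phi>_lin: "\<phi> x = \<phi> 0 + x * (\<phi> 1 - \<phi> 0)" for x
      unfolding \<phi>_def E_def side_def by simp algebra
    have \<phi>s: "\<phi> x1 \<ge> 0" "\<phi> (-x2) \<ge> 0" "\<phi> 0 > 0" "\<phi> x = 0"
      using v(5) w(2) sz0 crossing_side[OF cr0, of t] crossing_less[OF cr0] t0t
      by (auto simp: \<phi>_def Ev Ew E0 x[symmetric])
    show False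
    proof (cases "x \<ge> 0")
      case True
      have "(\<phi> 1 - \<phi> 0) < 0" using \<phi>s(3,4) \<phi>_lin[of x] True by (smt (verit) mult_nonneg_nonneg)
      then have "x1 * (\<phi> 1 - \<phi> 0) < x * (\<phi> 1 - \<phi> 0)" using xx by (simp add: mult_less_cancel_right)
      then show False using \<phi>s(1,4) \<phi>_lin[of x] \<phi>_lin[of x1] by linarith
    next
      case False
      have "(\<phi> 1 - \<phi> 0) > 0" using \<phi>s(3,4) \<phi>_lin[of x] False by (smt (verit) mult_nonpos_nonpos)
      then have "- x2 * (\<phi> 1 - \<phi> 0) < x * (\<phi> 1 - \<phi> 0)" using xx by (intro mult_strict_right_mono) auto
      then show False using \<phi>s(2,4) \<phi>_lin[of x] \<phi>_lin[of "-x2"] by linarith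
    qed
  qed
  \<comment> \<open>\<open>b\<close> is for the first edge what \<open>h\<close> is for the later
    one. Both lines cut the same circle, the first in a chord of length \<open>ll\<close> and the
    later in one that is no longer; therefore \<open>h\<close> is at least \<open>b\<close>.\<close>
  define b where "b = side l0 u0 c0"
  have l0u0: "ll\<^sup>2 = (Re u0 - Re l0)\<^sup>2 + (Im u0 - Im l0)\<^sup>2"
    using len by (simp add: ll_def cmod_power2)
  define mid where "mid = (1/2) *\<^sub>R (l0 + u0)"
  have perp: "(Re c0 - Re mid) * (Re u0 - Re l0) + (Im c0 - Im mid) * (Im u0 - Im l0) = 0"
  proof -
    have "pw c0 R0 l0 - pw c0 R0 u0 = 2 * ((Re c0 - Re mid) * (Re u0 - Re l0) + (Im c0 - Im mid) * (Im u0 - Im l0))"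
      unfolding pw_eq mid_def by simp algebra
    then show ?thesis using P0u P0l by simp
  qed
  have bb: "b = (Re c0 - Re mid) * (Im u0 - Im l0) - (Im c0 - Im mid) * (Re u0 - Re l0)"
    unfolding b_def side_def mid_def by simp algebra
  define X Y U V where XY: "X = Re c0 - Re mid" "Y = Im c0 - Im mid" "U = Re u0 - Re l0" "V = Im u0 - Im l0"
  have pXY: "X * U + Y * V = 0" and bXY: "b = X * V - Y * U" and lXY: "ll\<^sup>2 = U\<^sup>2 + V\<^sup>2"
    using perp bb l0u0 by (simp_all add: XY)
  have XU: "ll\<^sup>2 * X = b * V" "ll\<^sup>2 * Y = - (b * U)"
  proof -
    have "(U\<^sup>2 + V\<^sup>2) * X = (X * V - Y * U) * V + U * (X * U + Y * V)"
      "(U\<^sup>2 + V\<^sup>2) * Y = - ((X * V - Y * U) * U) + V * (X * U + Y * V)"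
      by (simp_all add: power2_eq_square algebra_simps)
    then show "ll\<^sup>2 * X = b * V" "ll\<^sup>2 * Y = - (b * U)" using pXY lXY bXY by simp_all
  qed
  have R0: "ll\<^sup>2 * R0 = (ll\<^sup>2)\<^sup>2 / 4 + b\<^sup>2"
  proof -
    have "R0 = (Re l0 - Re c0)\<^sup>2 + (Im l0 - Im c0)\<^sup>2" using P0l by (simp add: pw_eq)
    also have "Re l0 - Re c0 = - (X + U/2)" by (simp add: XY mid_def field_simps)
    also have "Im l0 - Im c0 = - (Y + V/2)" by (simp add: XY mid_def field_simps)
    also have "(- (X + U/2))\<^sup>2 + (- (Y + V/2))\<^sup>2 = (X + U/2)\<^sup>2 + (Y + V/2)\<^sup>2"
      by (simp only: power2_minus)
    also have "\<dots> = X\<^sup>2 + Y\<^sup>2 + (U\<^sup>2 + V\<^sup>2) / 4 + (X * U + Y * V)" by (simp add: power2_eq_square field_simps)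
    also have "\<dots> = X\<^sup>2 + Y\<^sup>2 + ll\<^sup>2 / 4" using pXY lXY by simp
    finally have "R0 = X\<^sup>2 + Y\<^sup>2 + ll\<^sup>2 / 4" .
    moreover have "ll\<^sup>2 * (X\<^sup>2 + Y\<^sup>2) = b\<^sup>2"
    proof -
      have "(U\<^sup>2 + V\<^sup>2) * (X\<^sup>2 + Y\<^sup>2) = (X * V - Y * U)\<^sup>2 + (X * U + Y * V)\<^sup>2"
        by (simp add: power2_eq_square algebra_simps)
      then show ?thesis using pXY lXY bXY by simp
    qed
    ultimately show ?thesis by (simp add: algebra_simps power2_eq_square)
  qed
  have "ll\<^sup>2 * (ll\<^sup>2 * \<rho>) = ll\<^sup>2 * R0 - h\<^sup>2" using ll by (simp add: \<rho>_def field_simps)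
  moreover have "ll\<^sup>2 * (ll\<^sup>2 * \<rho>) \<le> ll\<^sup>2 * (ll\<^sup>2 * (1/4))" using rho4 by (intro mult_left_mono) auto
  ultimately have "h\<^sup>2 \<ge> b\<^sup>2" using R0 by (simp add: power2_eq_square)
  then have hb: "h \<ge> b" using \<open>side l u c0 > 0\<close> c0 unfolding h_def b_def
    by (metis less_imp_le power2_le_imp_le)
  define e f where ef: "e = Re u - Re l" "f = Im u - Im l"
  have lef: "ll\<^sup>2 = e\<^sup>2 + f\<^sup>2" using l2 by (simp add: ef)
  have sm: "side l u mid \<le> 0"
  proof -
    have "side l u mid = (side l u l0 + side l u u0) / 2" unfolding side_def mid_def by simp algebra
    then show ?thesis using ends[of u0] ends[of l0] P0u P0l by simp
  qed
  \<comment> \<open>The midpoint of the first edge is not ahead of the later line, and going from it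
    to \<open>c0\<close> raises \<open>side l u\<close> by at most \<open>b\<close>, with equality
    only if the two edge vectors coincide. With \<open>b \<le> h\<close> equality holds throughout,
    and the later line would contain the first edge, although it crosses the axis later.\<close>
  have "h = side l u mid + X * f - Y * e" unfolding h_def side_def XY ef
    by (simp add: algebra_simps)
  then have "ll\<^sup>2 * h = ll\<^sup>2 * side l u mid + (ll\<^sup>2 * X) * f - (ll\<^sup>2 * Y) * e" by algebra
  also have "\<dots> = ll\<^sup>2 * side l u mid + b * (V * f + U * e)" unfolding XU by algebra
  finally have hm: "ll\<^sup>2 * h = ll\<^sup>2 * side l u mid + b * (V * f + U * e)" .
  have VU: "2 * (V * f + U * e) = 2 * ll\<^sup>2 - ((U - e)\<^sup>2 + (V - f)\<^sup>2)"
  proof -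
    have "2 * (V * f + U * e) = (U\<^sup>2 + V\<^sup>2) + (e\<^sup>2 + f\<^sup>2) - ((U - e)\<^sup>2 + (V - f)\<^sup>2)" by algebra
    then show ?thesis using lXY lef by linarith
  qed
  have "ll\<^sup>2 * side l u mid \<le> 0" using sm by (simp add: mult_nonneg_nonpos)
  moreover have "b * (2 * ll\<^sup>2 - ((U - e)\<^sup>2 + (V - f)\<^sup>2)) = 2 * (b * (V * f + U * e))"
    using VU by (metis mult.left_commute)
  ultimately have A: "2 * (ll\<^sup>2 * h) \<le> b * (2 * ll\<^sup>2 - ((U - e)\<^sup>2 + (V - f)\<^sup>2))"
    using hm by linarith
  have B: "ll\<^sup>2 * b \<le> ll\<^sup>2 * h" using hb by (intro mult_left_mono) auto
  have "b * ((U - e)\<^sup>2 + (V - f)\<^sup>2) \<le> 0" using A B by (simp add: algebra_simps)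
  moreover have bpos: "b > 0"
  proof (rule ccontr)
    assume "\<not> b > 0"
    then have "b = 0" using c0 by (simp add: b_def)
    then have "ll\<^sup>2 * h \<le> 0" using A by (simp add: mult.commute)
    then show False using ll \<open>side l u c0 > 0\<close> by (simp add: h_def mult_le_0_iff)
  qed
  ultimately have "(U - e)\<^sup>2 + (V - f)\<^sup>2 \<le> 0" by (simp add: mult_le_0_iff)
  then have UV: "U = e" "V = f" by (auto simp: sum_power2_le_zero_iff)
  have "ll\<^sup>2 * h = ll\<^sup>2 * side l u mid + b * ll\<^sup>2"
    using hm UV lef by (simp add: power2_eq_square add.commute)
  then have "ll\<^sup>2 * h = ll\<^sup>2 * (side l u mid + b)" by algebra
  then have "h = side l u mid + b" using ll by (simp only: mult_cancel_left) simp
  then have sm0: "side l u mid = 0" using sm hb by simp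
  have "of_real t0 = mid + (\<theta>0 - 1/2) *\<^sub>R (u0 - l0)"
    unfolding \<theta>0(1) mid_def by (simp add: complex_eq_iff algebra_simps)
  moreover have "side l u (mid + x *\<^sub>R (u0 - l0)) = side l u mid + x * (U * f - V * e)" for x
    unfolding side_def XY ef by simp algebra
  ultimately have "side l u (of_real t0) = 0" using sm0 UV by simp
  then show False using crossing_side[OF cr, of t0] crossing_less[OF cr] t0t by simp
qed

section \<open>Inequalities for four visits of an edge\<close>

text \<open>At visit \<open>i\<close>, \<open>a i\<close> is the distance of the crossing from the
  midpoint, \<open>C i\<close> and \<open>S i\<close> are cosine and sine of the angle between edge
  and path, \<open>b\<close> is the height of the circumcenter over the edge and \<open>q\<close>
  the squared half-length. The center is then ahead of the crossing by
  \<open>a i * C i + b * S i\<close>. Hypothesis \<open>m\<close> says that the path is no longer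
  than the segment of the edge, and \<open>g\<close> is the circumdisk bound of visit
  \<open>i\<close> at the crossing of visit \<open>j\<close>, for both orders of the two.\<close>

lemma visits_order:
  fixes t a C S :: "nat \<Rightarrow> real" and b q :: real
  assumes t: "\<And>i j. i < j \<Longrightarrow> j \<le> 3 \<Longrightarrow> t i < t j"
    and a: "\<And>i. i \<le> 3 \<Longrightarrow> 0 < a i" "\<And>i. i \<le> 3 \<Longrightarrow> (a i)\<^sup>2 < q"
    and CS: "\<And>i. i \<le> 3 \<Longrightarrow> 0 < S i" "\<And>i. i \<le> 3 \<Longrightarrow> (C i)\<^sup>2 + (S i)\<^sup>2 = 1"
    and b: "b \<ge> 0"
    and m: "\<And>i j. i < j \<Longrightarrow> j \<le> 3 \<Longrightarrow> t j - t i \<le> \<bar>a i - a j\<bar>"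
    and g: "\<And>i j. i \<le> 3 \<Longrightarrow> j \<le> 3 \<Longrightarrow> (a j)\<^sup>2 \<le> (t j - t i)\<^sup>2 - 2 * (t j - t i) * (a i * C i + b * S i) + (a i)\<^sup>2"
  shows "\<And>i j. i < j \<Longrightarrow> j \<le> 3 \<Longrightarrow> a j < a i"
    and "\<And>j. 1 \<le> j \<Longrightarrow> j \<le> 3 \<Longrightarrow> a j \<le> a j * C j + b * S j"
    and "\<And>i j. 1 \<le> i \<Longrightarrow> i < j \<Longrightarrow> j \<le> 3 \<Longrightarrow> (t j - t i)\<^sup>2 - 2 * (t j - t i) * (a i * C i + b * S i) + (a i)\<^sup>2 < q"
proof -
  define \<sigma> where "\<sigma> i = a i * C i + b * S i" for i
  define N where "N i = b * C i - a i * S i" for i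
  \<comment> \<open>If the distance to the midpoint did not shrink, \<open>m\<close> and
    \<open>g\<close> would give \<open>\<sigma> i \<le> - a i\<close>; but \<open>C i > -1\<close>,
    and \<open>b * S i\<close> is nonnegative.\<close>
  have dec: "a j < a i" if ij: "i < j" "j \<le> 3" for i j
  proof (rule ccontr)
    assume "\<not> a j < a i"
    define \<Delta> where "\<Delta> = t j - t i"
    have \<Delta>: "0 < \<Delta>" "\<Delta> \<le> a j - a i" using t[OF ij] m[OF ij] \<open>\<not> a j < a i\<close> by (auto simp: \<Delta>_def)
    have "\<Delta> * (a i + a j) \<le> (a j - a i) * (a i + a j)"
      using \<Delta> a(1)[of i] a(1)[of j] ij by (intro mult_right_mono) auto
    also have "\<dots> = (a j)\<^sup>2 - (a i)\<^sup>2" by algebra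
    also have "\<dots> \<le> \<Delta> * \<Delta> - \<Delta> * (2 * \<sigma> i)"
      using g[of i j] ij by (simp add: \<Delta>_def \<sigma>_def power2_eq_square algebra_simps)
    finally have "\<Delta> * (a i + a j) \<le> \<Delta> * (\<Delta> - 2 * \<sigma> i)" by (simp add: algebra_simps)
    then have "a i + a j \<le> \<Delta> - 2 * \<sigma> i" using \<Delta>(1) by simp
    then have 1: "\<sigma> i \<le> - a i" using \<Delta>(2) by linarith
    have "C i > -1"
    proof (rule ccontr)
      assume "\<not> C i > -1"
      then have "1 \<le> (C i)\<^sup>2" by (smt (verit) one_le_power power2_minus)
      then show False using CS[of i] ij by (smt (verit) zero_less_power2 le_trans less_imp_le order_le_less_trans zero_less_power)
    qed
    then have "a i * C i > a i * (-1)" using a(1)[of i] ij by (intro mult_strict_left_mono) auto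
    moreover have "b * S i \<ge> 0" using b CS(1)[of i] ij by simp
    ultimately show False using 1 by (simp add: \<sigma>_def)
  qed
  \<comment> \<open>Here \<open>g\<close> is read backwards in time, from visit \<open>j\<close> to
    visit 0.\<close>
  have \<sigma>a: "\<sigma> j \<ge> a j" if "1 \<le> j" "j \<le> 3" for j
  proof -
    define \<Delta> where "\<Delta> = t j - t 0"
    have \<Delta>: "0 < \<Delta>" "\<Delta> \<le> a 0 - a j" using t[of 0 j] m[of 0 j] dec[of 0 j] that by (auto simp: \<Delta>_def)
    have "\<Delta> * (a 0 + a j) \<le> (a 0 - a j) * (a 0 + a j)"
      using \<Delta> a(1)[of 0] a(1)[of j] that by (intro mult_right_mono) auto
    also have "\<dots> = (a 0)\<^sup>2 - (a j)\<^sup>2" by algebra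
    also have "\<dots> \<le> \<Delta> * (\<Delta> + 2 * \<sigma> j)"
      using g[of j 0] that by (simp add: \<Delta>_def \<sigma>_def power2_eq_square algebra_simps)
    finally have "a 0 + a j \<le> \<Delta> + 2 * \<sigma> j" using \<Delta>(1) by simp
    then show ?thesis using \<Delta>(2) by linarith
  qed
  show "a j < a i" if "i < j" "j \<le> 3" for i j using dec that by blast
  show "a j \<le> a j * C j + b * S j" if "1 \<le> j" "j \<le> 3" for j using \<sigma>a[OF that] by (simp add: \<sigma>_def)
  show "(t j - t i)\<^sup>2 - 2 * (t j - t i) * (a i * C i + b * S i) + (a i)\<^sup>2 < q" if ij: "1 \<le> i" "i < j" "j \<le> 3" for i j
  proof -
    define \<Delta> where "\<Delta> = t j - t i"
    have \<Delta>: "0 < \<Delta>" "\<Delta> \<le> a i - a j" using t[of i j] m[of i j] dec[of i j] that by (auto simp: \<Delta>_def)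
    have aj: "a j > 0" using a(1) ij by auto
    have s: "\<sigma> i \<ge> a i" using \<sigma>a ij by auto
    have "\<Delta> * (\<Delta> - 2 * \<sigma> i) \<le> 0" using \<Delta> s aj by (intro mult_nonneg_nonpos) auto
    then show ?thesis
      using a(2)[of i] ij by (simp add: power2_eq_square algebra_simps \<Delta>_def \<sigma>_def)
  qed
qed

text \<open>Hypothesis \<open>L\<close> says that the center of visit \<open>i\<close> is not beyond
  the edge of visit \<open>j\<close>; \<open>\<eta>\<close> is the sign with which a developed copy
  of the edge crosses the path. Each pair of visits makes one product negative. The product for (1,
  2) times that for (2, 3) equals the product for (1, 3) times \<open>C 2 * N 2\<close>, and the
  latter factor turns out nonnegative.\<close>

lemma four_visits:
  fixes t a C S :: "nat \<Rightarrow> real" and b q :: real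
  assumes t: "\<And>i j. i < j \<Longrightarrow> j \<le> 3 \<Longrightarrow> t i < t j"
    and a: "\<And>i. i \<le> 3 \<Longrightarrow> 0 < a i" "\<And>i. i \<le> 3 \<Longrightarrow> (a i)\<^sup>2 < q"
    and CS: "\<And>i. i \<le> 3 \<Longrightarrow> 0 < S i" "\<And>i. i \<le> 3 \<Longrightarrow> (C i)\<^sup>2 + (S i)\<^sup>2 = 1"
    and b: "b \<ge> 0"
    and m: "\<And>i j. i < j \<Longrightarrow> j \<le> 3 \<Longrightarrow> t j - t i \<le> \<bar>a i - a j\<bar>"
    and g: "\<And>i j. i \<le> 3 \<Longrightarrow> j \<le> 3 \<Longrightarrow> (a j)\<^sup>2 \<le> (t j - t i)\<^sup>2 - 2 * (t j - t i) * (a i * C i + b * S i) + (a i)\<^sup>2"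
    and \<eta>: "\<And>i. i \<le> 3 \<Longrightarrow> \<eta> i * \<eta> i = (1::real)"
    and L: "\<And>i j. 1 \<le> i \<Longrightarrow> i < j \<Longrightarrow> j \<le> 3 \<Longrightarrow>
       S j * (a i * C i + b * S i - (t j - t i)) + \<eta> i * \<eta> j * C j * (b * C i - a i * S i) \<le> 0"
  shows False
proof -
  have order1: "a j < a i" if "i < j" "j \<le> 3" for i j
    by (rule visits_order(1)[where t=t and a=a and q=q and S=S and C=C and b=b]) (use t a CS b m g that in auto)
  have order2: "a j \<le> a j * C j + b * S j" if "1 \<le> j" "j \<le> 3" for j
    by (rule visits_order(2)[where t=t and a=a and q=q and S=S and C=C and b=b]) (use t a CS b m g that in auto)
  define \<sigma> where "\<sigma> i = a i * C i + b * S i" for i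
  define N where "N i = b * C i - a i * S i" for i
  have dec: "a j < a i" if "i < j" "j \<le> 3" for i j using order1 that by blast
  have \<sigma>a: "\<sigma> j \<ge> a j" if "1 \<le> j" "j \<le> 3" for j using order2[OF that] by (simp add: \<sigma>_def)
  \<comment> \<open>The center of visit \<open>i\<close> is ahead by at least \<open>a i\<close>,
    and the path advances by at most \<open>a i - a j\<close>, so at least \<open>a j\<close>
    remains.\<close>
  have X: "S j * a j + \<eta> i * \<eta> j * C j * N i \<le> 0" if ij: "1 \<le> i" "i < j" "j \<le> 3" for i j
  proof -
    define \<Delta> where "\<Delta> = t j - t i"
    have \<Delta>: "0 < \<Delta>" "\<Delta> \<le> a i - a j" using t[of i j] m[of i j] dec[of i j] that by (auto simp: \<Delta>_def)
    have aj: "a j > 0" using a(1) ij by auto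
    have s: "\<sigma> i \<ge> a i" using \<sigma>a ij by auto
    have "S j * (\<sigma> i - \<Delta>) + \<eta> i * \<eta> j * C j * N i \<le> 0"
      using L[of i j] ij by (simp add: \<Delta>_def \<sigma>_def N_def)
    moreover have "S j * (\<sigma> i - \<Delta>) \<ge> S j * a j"
      using s \<Delta> CS(1)[of j] ij by (intro mult_left_mono) auto
    ultimately show ?thesis by linarith
  qed
  have Sa: "S j * a j > 0" if "j \<le> 3" for j using CS(1) a(1) that by simp
  have X12: "S 2 * a 2 + \<eta> 1 * \<eta> 2 * C 2 * N 1 \<le> 0" "\<eta> 1 * \<eta> 2 * C 2 * N 1 < 0"
    and X23: "\<eta> 2 * \<eta> 3 * C 3 * N 2 < 0" and X13: "\<eta> 1 * \<eta> 3 * C 3 * N 1 < 0"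
    using X[of 1 2] X[of 2 3] X[of 1 3] Sa[of 2] Sa[of 3] by auto
  \<comment> \<open>The squared distance from crossing to circumcenter, computed along the path and
    along the edge. As \<open>\<sigma> 1\<close> is at least \<open>a 1\<close>, the offset
    \<open>N 1\<close> across the path is at most \<open>b\<close> in absolute value.\<close>
  have "(\<sigma> 1)\<^sup>2 + (N 1)\<^sup>2 = ((a 1)\<^sup>2 + b\<^sup>2) * ((C 1)\<^sup>2 + (S 1)\<^sup>2)"
    unfolding \<sigma>_def N_def by (simp add: power2_eq_square algebra_simps)
  then have "(\<sigma> 1)\<^sup>2 + (N 1)\<^sup>2 = (a 1)\<^sup>2 + b\<^sup>2" using CS(2)[of 1] by simp
  moreover have "(\<sigma> 1)\<^sup>2 \<ge> (a 1)\<^sup>2" using \<sigma>a[of 1] a(1)[of 1] by (intro power_mono) auto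
  ultimately have "(N 1)\<^sup>2 \<le> b\<^sup>2" by linarith
  then have N1: "\<bar>N 1\<bar> \<le> b" using b abs_le_square_iff[of "N 1" b] by simp
  have "\<bar>\<eta> 1 * \<eta> 2\<bar> = 1"
  proof -
    have "\<bar>\<eta> i\<bar> = 1" if "i \<le> 3" for i using \<eta>[OF that] by (metis abs_mult abs_mult_self_eq abs_one mult_cancel_right1 power2_eq_square abs_square_eq_1 power2_eq_1_iff)
    then show ?thesis by (simp add: abs_mult)
  qed
  then have "\<bar>\<eta> 1 * \<eta> 2 * C 2 * N 1\<bar> = \<bar>C 2\<bar> * \<bar>N 1\<bar>" by (simp add: abs_mult)
  also have "\<dots> \<le> \<bar>C 2\<bar> * b" using N1 by (intro mult_left_mono) auto
  finally have SC: "S 2 * a 2 \<le> \<bar>C 2\<bar> * b" using X12 by linarith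
  \<comment> \<open>By \<open>SC\<close>, the term \<open>b * C 2\<close> dominates in
    \<open>N 2 = b * C 2 - a 2 * S 2\<close>, so \<open>N 2\<close> cannot have the sign opposite to
    \<open>C 2\<close>.\<close>
  have CN: "C 2 * N 2 \<ge> 0"
  proof (cases "C 2 \<ge> 0")
    case True
    then have "N 2 \<ge> 0" using SC by (simp add: N_def mult.commute)
    then show ?thesis using True by simp
  next
    case False
    then have "b * C 2 \<le> 0" using b by (simp add: mult_nonneg_nonpos)
    then have "N 2 \<le> 0" using Sa[of 2] by (simp add: N_def mult.commute)
    then show ?thesis using False by (simp add: mult_nonpos_nonpos)
  qed
  have "0 < (\<eta> 1 * \<eta> 2 * C 2 * N 1) * (\<eta> 2 * \<eta> 3 * C 3 * N 2)" using X12(2) X23 by (rule mult_neg_neg)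
  also have "\<dots> = (\<eta> 2 * \<eta> 2) * ((\<eta> 1 * \<eta> 3 * C 3 * N 1) * (C 2 * N 2))" by (simp add: algebra_simps)
  also have "\<dots> = (\<eta> 1 * \<eta> 3 * C 3 * N 1) * (C 2 * N 2)" using \<eta>[of 2] by simp
  also have "\<dots> \<le> 0" using X13 CN by (simp add: mult_nonpos_nonneg)
  finally show False by simp
qed

section \<open>Rigid motions\<close>

text \<open>Reflections are included, since gluings may reverse orientation and vertex lists may run
  either way.\<close>

definition rigid :: "(complex \<Rightarrow> complex) \<Rightarrow> bool" where
  "rigid f \<longleftrightarrow> (\<exists>\<alpha> \<beta>. norm \<alpha> = 1 \<and> (f = (\<lambda>z. \<alpha> * z + \<beta>) \<or> f = (\<lambda>z. \<alpha> * cnj z + \<beta>)))"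

lemma rigidE:
  assumes "rigid f"
  obtains \<alpha> \<beta> where "norm \<alpha> = 1" "f = (\<lambda>z. \<alpha> * z + \<beta>)" | \<alpha> \<beta> where "norm \<alpha> = 1" "f = (\<lambda>z. \<alpha> * cnj z + \<beta>)"
  using assms by (auto simp: rigid_def)

lemma rigid_id [simp]: "rigid (\<lambda>z. z)"
  unfolding rigid_def by (intro exI[of _ 1] exI[of _ 0]) auto

lemma rigid_comb: "rigid f \<Longrightarrow> f ((1-t) *\<^sub>R a + t *\<^sub>R b) = (1-t) *\<^sub>R f a + t *\<^sub>R f b"
  by (erule rigidE) (auto simp: scaleR_conv_of_real algebra_simps)

lemma rigid_norm: "rigid f \<Longrightarrow> norm (f x - f y) = norm (x - y)"
proof (erule rigidE)
  fix \<alpha> \<beta> assume *: "norm \<alpha> = 1" "f = (\<lambda>z. \<alpha> * z + \<beta>)"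
  then have "f x - f y = \<alpha> * (x - y)" by (simp add: algebra_simps)
  then show ?thesis using * by (simp add: norm_mult)
next
  fix \<alpha> \<beta> assume *: "norm \<alpha> = 1" "f = (\<lambda>z. \<alpha> * cnj z + \<beta>)"
  then have "f x - f y = \<alpha> * cnj (x - y)" by (simp add: algebra_simps)
  then show ?thesis using * by (simp add: norm_mult del: complex_cnj_diff)
qed

lemma rigid_inverse:
  assumes "rigid f" obtains g where "rigid g" "\<And>x. g (f x) = x" "\<And>x. f (g x) = x"
  using assms
proof (cases rule: rigidE)
  case (1 \<alpha> \<beta>)
  then have a: "\<alpha> \<noteq> 0" by auto
  show ?thesis
  proof (rule that[of "\<lambda>z. (1/\<alpha>) * z + (- \<beta> / \<alpha>)"])
    show "rigid (\<lambda>z. (1/\<alpha>) * z + (- \<beta> / \<alpha>))"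
      unfolding rigid_def using 1 by (intro exI[of _ "1/\<alpha>"] exI[of _ "- \<beta> / \<alpha>"]) (auto simp: norm_divide)
  qed (use a 1 in \<open>auto simp: field_simps\<close>)
next
  case (2 \<alpha> \<beta>)
  then have a: "\<alpha> \<noteq> 0" by auto
  show ?thesis
  proof (rule that[of "\<lambda>z. (1/cnj \<alpha>) * cnj z + (- cnj \<beta> / cnj \<alpha>)"])
    show "rigid (\<lambda>z. (1/cnj \<alpha>) * cnj z + (- cnj \<beta> / cnj \<alpha>))"
      unfolding rigid_def using 2 by (intro exI[of _ "1/cnj \<alpha>"] exI[of _ "- cnj \<beta> / cnj \<alpha>"]) (auto simp: norm_divide)
  qed (use a 2 in \<open>auto simp: field_simps\<close>)
qed

lemma rigid_comp: "rigid f \<Longrightarrow> rigid g \<Longrightarrow> rigid (\<lambda>z. f (g z))"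
proof -
  assume "rigid f" "rigid g"
  then obtain \<alpha> \<beta> \<alpha>' \<beta>' where n: "norm \<alpha> = 1" "norm \<alpha>' = 1"
    and f: "f = (\<lambda>z. \<alpha> * z + \<beta>) \<or> f = (\<lambda>z. \<alpha> * cnj z + \<beta>)" and g: "g = (\<lambda>z. \<alpha>' * z + \<beta>') \<or> g = (\<lambda>z. \<alpha>' * cnj z + \<beta>')"
    unfolding rigid_def by blast
  have "\<exists>\<gamma> \<delta>. norm \<gamma> = 1 \<and> ((\<lambda>z. f (g z)) = (\<lambda>z. \<gamma> * z + \<delta>) \<or> (\<lambda>z. f (g z)) = (\<lambda>z. \<gamma> * cnj z + \<delta>))"
    if "f = (\<lambda>z. \<alpha> * z + \<beta>)"
    using that g n by (intro exI[of _ "\<alpha> * \<alpha>'"] exI[of _ "\<alpha> * \<beta>' + \<beta>"]) (auto simp: norm_mult algebra_simps)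
  moreover have "\<exists>\<gamma> \<delta>. norm \<gamma> = 1 \<and> ((\<lambda>z. f (g z)) = (\<lambda>z. \<gamma> * z + \<delta>) \<or> (\<lambda>z. f (g z)) = (\<lambda>z. \<gamma> * cnj z + \<delta>))"
    if "f = (\<lambda>z. \<alpha> * cnj z + \<beta>)"
    using that g n by (intro exI[of _ "\<alpha> * cnj \<alpha>'"] exI[of _ "\<alpha> * cnj \<beta>' + \<beta>"]) (auto simp: norm_mult algebra_simps)
  ultimately show ?thesis using f unfolding rigid_def by blast
qed

lemma rigid_pw: "rigid f \<Longrightarrow> pw (f c) R (f z) = pw c R z"
  by (simp add: pw_def rigid_norm)

lemma side_mult: "side (\<alpha> * p + \<beta>) (\<alpha> * q + \<beta>) (\<alpha> * z + \<beta>) = (norm \<alpha>)\<^sup>2 * side p q z"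
proof -
  have "side (\<alpha> * p + \<beta>) (\<alpha> * q + \<beta>) (\<alpha> * z + \<beta>) = ((Re \<alpha>)\<^sup>2 + (Im \<alpha>)\<^sup>2) * side p q z"
    unfolding side_def by (simp add: power2_eq_square algebra_simps)
  then show ?thesis by (simp add: cmod_power2)
qed

lemma side_cnj': "side (cnj p) (cnj q) (cnj z) = - side p q z"
  unfolding side_def by (simp add: algebra_simps)

lemma rigid_side:
  assumes "rigid f" obtains \<epsilon> where "\<epsilon> * \<epsilon> = (1::real)" "\<And>p q z. side (f p) (f q) (f z) = \<epsilon> * side p q z"
  using assms
proof (cases rule: rigidE)
  case (1 \<alpha> \<beta>)
  then show ?thesis using that[of 1] by (simp add: side_mult)
next
  case (2 \<alpha> \<beta>)
  then show ?thesis using that[of "-1"] by (simp add: side_mult side_cnj')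
qed

text \<open>Two motions carry one edge to the other; they differ by the reflection in the target
  line, and \<open>\<epsilon>\<close> selects one of them.\<close>

lemma rigid_exists:
  assumes "p \<noteq> q" "norm (q - p) = norm (q' - p')" "\<epsilon> = 1 \<or> \<epsilon> = -1"
  obtains f where "rigid f" "f p = p'" "f q = q'" "\<And>z. side p' q' (f z) = \<epsilon> * side p q z"
proof (cases "\<epsilon> = 1")
  case True
  define \<alpha> where "\<alpha> = (q' - p') / (q - p)"
  define f where "f = (\<lambda>z. \<alpha> * z + (p' - \<alpha> * p))"
  have qp': "q' \<noteq> p'" using assms by (metis eq_iff_diff_eq_0 norm_eq_zero)
  have n: "norm \<alpha> = 1" using assms qp' by (simp add: \<alpha>_def norm_divide)
  have aq: "\<alpha> * (q - p) = q' - p'" using assms(1) by (simp add: \<alpha>_def)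
  have fp: "f p = p'" "f q = q'" using aq by (auto simp: f_def algebra_simps)
  have "side p' q' (f z) = \<epsilon> * side p q z" for z
    using side_mult[of \<alpha> p "p' - \<alpha> * p" q z] n True fp by (simp add: f_def)
  then show ?thesis using that[of f] fp n unfolding rigid_def f_def by blast
next
  case False
  define \<alpha> where "\<alpha> = (q' - p') / cnj (q - p)"
  define f where "f = (\<lambda>z. \<alpha> * cnj z + (p' - \<alpha> * cnj p))"
  have qp': "q' \<noteq> p'" using assms by (metis eq_iff_diff_eq_0 norm_eq_zero)
  have n: "norm \<alpha> = 1" using assms qp' by (simp add: \<alpha>_def norm_divide del: complex_cnj_diff)
  have aq: "\<alpha> * (cnj q - cnj p) = q' - p'" using assms(1) by (simp add: \<alpha>_def)
  have fp: "f p = p'" "f q = q'" using aq by (auto simp: f_def algebra_simps)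
  have "side p' q' (f z) = \<epsilon> * side p q z" for z
    using side_mult[of \<alpha> "cnj p" "p' - \<alpha> * cnj p" "cnj q" "cnj z"] n False assms(3) fp by (simp add: f_def side_cnj')
  then show ?thesis using that[of f] fp n unfolding rigid_def f_def by blast
qed

section \<open>Circumcircles and the Delaunay condition\<close>

text \<open>Also the power of \<open>z\<close> with respect to the circle with diameter
  \<open>[p, q]\<close>; its sign separates acute from obtuse angles at \<open>z\<close>.\<close>

definition dots :: "complex \<Rightarrow> complex \<Rightarrow> complex \<Rightarrow> real" where
  "dots p q z = (p - z) \<bullet> (q - z)"

lemma dots_eq: "dots p q z = (Re z - Re p) * (Re z - Re q) + (Im z - Im p) * (Im z - Im q)"
  by (simp add: dots_def inner_complex_def algebra_simps)

text \<open>The circles through \<open>p\<close> and \<open>q\<close> form a pencil: their powers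
  differ from that of the diameter circle by a multiple of \<open>side p q\<close>, whose
  coefficient is the height of the center.\<close>

lemma pw_edge:
  assumes "pw c R p = 0" "pw c R q = 0"
  shows "(norm (q - p))\<^sup>2 * pw c R z = (norm (q - p))\<^sup>2 * dots p q z - 2 * side p q c * side p q z"
proof -
  define X Y U V x y where d: "X = Re c - Re p" "Y = Im c - Im p" "U = Re q - Re p" "V = Im q - Im p" "x = Re z - Re p" "y = Im z - Im p"
  have n: "(norm (q - p))\<^sup>2 = U\<^sup>2 + V\<^sup>2" by (simp add: cmod_power2 d)
  have R: "R = X\<^sup>2 + Y\<^sup>2" using assms(1) by (simp add: pw_eq d power2_commute)
  have "(U - X)\<^sup>2 + (V - Y)\<^sup>2 - R = 0" using assms(2) by (simp add: pw_eq d)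
  then have UV: "U\<^sup>2 + V\<^sup>2 - 2 * (U * X + V * Y) = 0" unfolding R by (simp add: power2_eq_square algebra_simps)
  have "pw c R z = (x - X)\<^sup>2 + (y - Y)\<^sup>2 - (X\<^sup>2 + Y\<^sup>2)" unfolding pw_eq R d by simp
  moreover have "dots p q z = x * (x - U) + y * (y - V)" unfolding dots_eq d by simp
  moreover have "side p q c = X * V - Y * U" "side p q z = x * V - y * U" unfolding side_def d by simp_all
  moreover have "(U\<^sup>2 + V\<^sup>2) * ((x - X)\<^sup>2 + (y - Y)\<^sup>2 - (X\<^sup>2 + Y\<^sup>2)) =
     (U\<^sup>2 + V\<^sup>2) * (x * (x - U) + y * (y - V)) - 2 * (X * V - Y * U) * (x * V - y * U)
       + (x * U + y * V) * (U\<^sup>2 + V\<^sup>2 - 2 * (U * X + V * Y))"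
    by (simp add: power2_eq_square algebra_simps)
  ultimately show ?thesis unfolding n using UV by simp
qed

lemma center_height:
  assumes "pw c R p = 0" "pw c R q = 0" "pw c R w = 0"
  shows "2 * side p q c * side p q w = (norm (q - p))\<^sup>2 * dots p q w"
  using pw_edge[OF assms(1,2), of w] assms(3) by simp

lemma circumcircle_exists:
  assumes "side p q w \<noteq> 0"
  obtains c R where "pw c R p = 0" "pw c R q = 0" "pw c R w = 0"
proof -
  \<comment> \<open>The cotangent of the angle at \<open>w\<close>, up to sign. The center lies on
    the perpendicular bisector at half the edge length times this cotangent.\<close>
  define k where "k = dots p q w / side p q w"
  define c where "c = (1/2) *\<^sub>R (p + q) + (k/2) *\<^sub>R (- \<i> * (q - p))"
  define R where "R = (norm (p - c))\<^sup>2"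
  have pq: "p \<noteq> q" using assms by (auto simp: side_def)
  have 1: "pw c R p = 0" by (simp add: pw_def R_def)
  have cc: "Re c = (Re p + Re q)/2 + k/2 * (Im q - Im p)" "Im c = (Im p + Im q)/2 - k/2 * (Re q - Re p)"
    by (simp_all add: c_def field_simps)
  have 2: "pw c R q = 0" unfolding R_def pw_eq cmod_power2 minus_complex.sel cc
    by (simp add: power2_eq_square field_simps)
  have sc: "2 * side p q c = k * (norm (q - p))\<^sup>2" unfolding side_def cmod_power2 minus_complex.sel cc
    by (simp add: power2_eq_square field_simps)
  have "(norm (q - p))\<^sup>2 * pw c R w = 0"
    unfolding pw_edge[OF 1 2] sc using assms by (simp add: k_def)
  then show ?thesis using that[OF 1 2] pq by simp
qed

lemma dots_side: "(dots p q z)\<^sup>2 + (side p q z)\<^sup>2 = (norm (p - z) * norm (q - z))\<^sup>2"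
proof -
  have s: "side p q z = (Re q - Re z) * (Im p - Im z) - (Re p - Re z) * (Im q - Im z)"
    unfolding side_def by (simp add: algebra_simps)
  have d: "dots p q z = (Re p - Re z) * (Re q - Re z) + (Im p - Im z) * (Im q - Im z)"
    unfolding dots_eq by (simp add: algebra_simps)
  show ?thesis unfolding power_mult_distrib cmod_power2 s d minus_complex.sel
    by (simp add: power2_eq_square algebra_simps)
qed

text \<open>After division by the four side lengths this is the sine of the angle sum, which lies
  between 0 and \<open>pi\<close>.\<close>

lemma angle_sum_dots:
  assumes w: "side p q w \<noteq> 0" and w': "side p' q' w' \<noteq> 0"
    and ang: "angle_at w p q + angle_at w' p' q' \<le> pi"
  shows "dots p q w * \<bar>side p' q' w'\<bar> + dots p' q' w' * \<bar>side p q w\<bar> \<ge> 0"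
proof -
  have key: "0 < norm (p - w) * norm (q - w) \<and>
      cos (angle_at w p q) = dots p q w / (norm (p - w) * norm (q - w)) \<and>
      sin (angle_at w p q) = \<bar>side p q w\<bar> / (norm (p - w) * norm (q - w)) \<and> 0 \<le> angle_at w p q" if "side p q w \<noteq> 0" for p q w
  proof -
    define n where "n = norm (p - w) * norm (q - w)"
    have "p \<noteq> w" "q \<noteq> w" using that by (auto simp: side_def)
    then have n: "n > 0" by (simp add: n_def)
    have s2: "(dots p q w / n)\<^sup>2 + (\<bar>side p q w\<bar> / n)\<^sup>2 = 1"
    proof -
      have "(dots p q w / n)\<^sup>2 + (\<bar>side p q w\<bar> / n)\<^sup>2 = ((dots p q w)\<^sup>2 + (side p q w)\<^sup>2) / n\<^sup>2"
        by (simp add: power_divide add_divide_distrib)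
      also have "\<dots> = n\<^sup>2 / n\<^sup>2" using dots_side[of p q w] by (simp add: n_def)
      finally show ?thesis using n by simp
    qed
    have a: "angle_at w p q = arccos (dots p q w / n)" by (simp add: angle_at_def dots_def n_def)
    have b: "\<bar>dots p q w / n\<bar> \<le> 1" using s2 by (metis abs_square_le_1 le_add_same_cancel1 zero_le_power2)
    have "sin (arccos (dots p q w / n)) = sqrt (1 - (dots p q w / n)\<^sup>2)" using b unfolding abs_le_iff by (intro sin_arccos) linarith+
    also have "\<dots> = sqrt ((\<bar>side p q w\<bar> / n)\<^sup>2)" using s2 by (metis add_diff_cancel_left')
    also have "\<dots> = \<bar>side p q w\<bar> / n" using n by simp
    finally show ?thesis using a b n cos_arccos_abs[OF b] arccos_lbound[of "dots p q w / n"]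
      unfolding n_def[symmetric] abs_le_iff by auto
  qed
  define n n' where nn: "n = norm (p - w) * norm (q - w)" "n' = norm (p' - w') * norm (q' - w')"
  have k: "0 < n" "0 < n'" using key[OF w] key[OF w'] by (auto simp: nn)
  have "0 \<le> sin (angle_at w p q + angle_at w' p' q')"
    using ang key[OF w] key[OF w'] by (intro sin_ge_zero) auto
  also have "\<dots> = (dots p q w * \<bar>side p' q' w'\<bar> + dots p' q' w' * \<bar>side p q w\<bar>) / (n * n')"
    using key[OF w] key[OF w'] by (simp add: sin_add nn add_divide_distrib mult.commute)
  finally show ?thesis using mult_pos_pos[OF k] by (smt (verit) divide_neg_pos)
qed

text \<open>Both circles are in the pencil through \<open>p\<close> and \<open>q\<close>, so the
  difference of the powers is a multiple of \<open>side p q\<close>. Its coefficient is governed by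
  the sum of the cotangents of the opposite angles; the computation multiplies by the squares of
  \<open>s\<close> and \<open>s'\<close> to stay free of quotients.\<close>

lemma delaunay_pw:
  assumes c: "pw c R p = 0" "pw c R q = 0" "pw c R w = 0"
    and c': "pw c' R' p = 0" "pw c' R' q = 0" "pw c' R' w' = 0"
    and opp: "side p q w * side p q w' < 0" and z: "side p q z * side p q w' \<ge> 0"
    and del: "dots p q w * \<bar>side p q w'\<bar> + dots p q w' * \<bar>side p q w\<bar> \<ge> 0"
  shows "pw c' R' z \<le> pw c R z"
proof -
  define n where "n = (norm (q - p))\<^sup>2"
  have pq: "p \<noteq> q" using opp by (auto simp: side_def)
  then have n: "n > 0" by (simp add: n_def)
  define s s' where ss: "s = side p q w" "s' = side p q w'"
  have nz: "s \<noteq> 0" "s' \<noteq> 0" using opp by (auto simp: ss)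
  have h: "2 * side p q c * s = n * dots p q w" "2 * side p q c' * s' = n * dots p q w'"
    using center_height[OF c] center_height[OF c'] by (auto simp: ss n_def)
  have as: "\<bar>s\<bar> * \<bar>s'\<bar> = - (s * s')" using opp by (simp add: ss abs_mult[symmetric] abs_of_neg)
  have "n * (pw c R z - pw c' R' z) = 2 * (side p q c' - side p q c) * side p q z"
    using pw_edge[OF c(1,2), of z] pw_edge[OF c'(1,2), of z] unfolding n_def[symmetric] by (simp add: algebra_simps)
  then have "(s * s * (s' * s')) * (n * (pw c R z - pw c' R' z)) =
     (s * s * (s' * s')) * (2 * (side p q c' - side p q c) * side p q z)" by simp
  also have "\<dots> = s * s * s' * (s' * side p q z) * (2 * side p q c' ) - s * s' * s' * s * (2 * side p q c) * side p q z"
    by (simp add: algebra_simps)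
  also have "\<dots> = s * s * (s' * side p q z) * (2 * side p q c' * s') - s * (s' * side p q z) * s' * (2 * side p q c * s)"
    by (simp add: algebra_simps)
  also have "\<dots> = n * (s' * side p q z) * (s * s * dots p q w' - s * s' * dots p q w)"
    unfolding h by (simp add: algebra_simps)
  also have "s * s * dots p q w' - s * s' * dots p q w = \<bar>s\<bar> * (dots p q w * \<bar>s'\<bar> + dots p q w' * \<bar>s\<bar>)"
  proof -
    have "\<bar>s\<bar> * (dots p q w * \<bar>s'\<bar> + dots p q w' * \<bar>s\<bar>) = dots p q w * (\<bar>s\<bar> * \<bar>s'\<bar>) + dots p q w' * (\<bar>s\<bar> * \<bar>s\<bar>)"
      by (simp add: algebra_simps)
    then show ?thesis unfolding as by (simp add: algebra_simps)
  qed
  also have "n * (s' * side p q z) * (\<bar>s\<bar> * (dots p q w * \<bar>s'\<bar> + dots p q w' * \<bar>s\<bar>)) \<ge> 0"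
  proof -
    have "s' * side p q z \<ge> 0" using z by (simp add: ss mult.commute)
    then show ?thesis using n del unfolding ss by (intro mult_nonneg_nonneg[OF mult_nonneg_nonneg] mult_nonneg_nonneg[of "\<bar>_\<bar>"]) auto
  qed
  finally have "0 \<le> (s * s * (s' * s') * n) * (pw c R z - pw c' R' z)" by (simp add: mult.assoc)
  moreover have "s * s * (s' * s') * n > 0" using nz n by (simp add: zero_less_mult_iff) (metis linorder_neqE_linordered_idom)
  ultimately show ?thesis by (simp add: zero_le_mult_iff)
qed

lemma pw_on_edge: "pw c R p = 0 \<Longrightarrow> pw c R q = 0 \<Longrightarrow> pw c R ((1-t) *\<^sub>R p + t *\<^sub>R q) = - (t * (1-t) * (norm (p - q))\<^sup>2)"
  by (simp add: pw_comb)

section \<open>Triangles\<close>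

lemma side_rot: "side q w p = side p q w"
  unfolding side_def by (simp add: algebra_simps)

lemma side_sum: "side p q z + side q w z + side w p z = side p q w"
  unfolding side_def by (simp add: algebra_simps)

lemma side_bary: "side p q w *\<^sub>R z = side q w z *\<^sub>R p + side w p z *\<^sub>R q + side p q z *\<^sub>R w"
  unfolding side_def by (simp add: complex_eq_iff algebra_simps)

lemma triangle_hull:
  assumes "side p q w \<noteq> 0"
  shows "z \<in> convex hull {p, q, w} \<longleftrightarrow> 0 \<le> side p q z / side p q w \<and> 0 \<le> side q w z / side p q w \<and> 0 \<le> side w p z / side p q w"
proof
  assume "z \<in> convex hull {p, q, w}"
  then obtain u v x where *: "z = u *\<^sub>R p + v *\<^sub>R q + x *\<^sub>R w" "u \<ge> 0" "v \<ge> 0" "x \<ge> 0" "u + v + x = 1"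
    unfolding convex_hull_3 by blast
  have u: "u = 1 - v - x" using * by simp
  have "side p q z = x * side p q w" "side q w z = u * side p q w" "side w p z = v * side p q w"
    unfolding * u side_def by (simp_all add: algebra_simps)
  then show "0 \<le> side p q z / side p q w \<and> 0 \<le> side q w z / side p q w \<and> 0 \<le> side w p z / side p q w"
    using * assms by simp
next
  assume *: "0 \<le> side p q z / side p q w \<and> 0 \<le> side q w z / side p q w \<and> 0 \<le> side w p z / side p q w"
  have "z = (1 / side p q w) *\<^sub>R (side p q w *\<^sub>R z)" using assms by simp
  also have "\<dots> = (side q w z / side p q w) *\<^sub>R p + (side w p z / side p q w) *\<^sub>R q + (side p q z / side p q w) *\<^sub>R w"
    unfolding side_bary[of p q w z] by (simp add: scaleR_add_right)
  finally show "z \<in> convex hull {p, q, w}" unfolding convex_hull_3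
    using * side_sum[of p q z w] assms
    by (intro CollectI exI[of _ "side q w z / side p q w"] exI[of _ "side w p z / side p q w"] exI[of _ "side p q z / side p q w"])
      (auto simp: add_divide_distrib[symmetric] ac_simps)
qed

lemma side_zero_collinear:
  assumes "side a b c = 0" shows "collinear {a, b, c}"
proof (cases "a = b")
  case False
  define D where "D = (norm (b - a))\<^sup>2"
  have D: "D = (Re b - Re a)\<^sup>2 + (Im b - Im a)\<^sup>2" by (simp add: D_def cmod_power2)
  have D0: "D > 0" using False by (simp add: D_def)
  define x where "x = ((Re c - Re a) * (Re b - Re a) + (Im c - Im a) * (Im b - Im a)) / D"
  have xD: "x * D = (Re c - Re a) * (Re b - Re a) + (Im c - Im a) * (Im b - Im a)" using D0 by (simp add: x_def)
  have s: "(Re c - Re a) * (Im b - Im a) = (Im c - Im a) * (Re b - Re a)" using assms by (simp add: side_def)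
  have "D * (Re c - Re a) = D * (x * (Re b - Re a))"
  proof -
    have "D * (x * (Re b - Re a)) = (x * D) * (Re b - Re a)" by simp
    also have "\<dots> = (Re c - Re a) * (Re b - Re a) * (Re b - Re a) + (Im c - Im a) * (Re b - Re a) * (Im b - Im a)"
      unfolding xD by (simp add: algebra_simps)
    also have "\<dots> = D * (Re c - Re a)" unfolding s[symmetric] D by (simp add: power2_eq_square algebra_simps)
    finally show ?thesis by (rule sym)
  qed
  moreover have "D * (Im c - Im a) = D * (x * (Im b - Im a))"
  proof -
    have "D * (x * (Im b - Im a)) = (x * D) * (Im b - Im a)" by simp
    also have "\<dots> = (Re c - Re a) * (Im b - Im a) * (Re b - Re a) + (Im c - Im a) * (Im b - Im a) * (Im b - Im a)"
      unfolding xD by (simp add: algebra_simps)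
    also have "\<dots> = D * (Im c - Im a)" unfolding s D by (simp add: power2_eq_square algebra_simps)
    finally show ?thesis by (rule sym)
  qed
  ultimately have "c - a = x *\<^sub>R (b - a)" using D0 by (simp add: complex_eq_iff)
  then have "c = a + x *\<^sub>R (b - a)" by (simp add: algebra_simps)
  then show ?thesis unfolding collinear_alt
    by (intro exI[of _ a] exI[of _ "b - a"]) (auto intro: exI[of _ 0] exI[of _ 1])
qed simp

text \<open>Of three collinear vertices one lies on the opposite edge, where it would be an
  intersection of edges that simplicity forbids.\<close>

lemma simple_triangle:
  assumes "simple_polygon [a, b, c]"
  shows "side a b c \<noteq> 0"
proof
  assume "side a b c = 0"
  then have "collinear {a, b, c}" by (rule side_zero_collinear)
  then have bt: "between (b, c) a \<or> between (c, a) b \<or> between (a, b) c"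
    by (simp add: collinear_between_cases)
  have d: "a \<noteq> b" "b \<noteq> c" "a \<noteq> c" using assms by (auto simp: simple_polygon_def)
  have E: "i < 3 \<Longrightarrow> j < 3 \<Longrightarrow> i \<noteq> j \<Longrightarrow>
     polygon_edge [a,b,c] i \<inter> polygon_edge [a,b,c] j = edge_ends [a,b,c] i \<inter> edge_ends [a,b,c] j" for i j
    using assms by (simp add: simple_polygon_def)
  have "polygon_edge [a,b,c] 0 \<inter> polygon_edge [a,b,c] 1 = {b}" "polygon_edge [a,b,c] 1 \<inter> polygon_edge [a,b,c] 2 = {c}"
    "polygon_edge [a,b,c] 2 \<inter> polygon_edge [a,b,c] 0 = {a}"
    using E[of 0 1] E[of 1 2] E[of 2 0] d by (auto simp: edge_ends_def)
  then have "closed_segment a b \<inter> closed_segment b c = {b}" "closed_segment b c \<inter> closed_segment c a = {c}"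
    "closed_segment c a \<inter> closed_segment a b = {a}"
    by (simp_all add: polygon_edge_def)
  then show False using bt d unfolding between_mem_segment by (metis IntI ends_in_segment singletonD closed_segment_commute)
qed

lemma triangle_region:
  "polygon_region [a, b, c] = convex hull {a, b, c}"
proof -
  have b: "polygon_boundary [a, b, c] = closed_segment a b \<union> closed_segment b c \<union> closed_segment c a"
  proof -
    have "{..<length [a,b,c]} = {0, 1, 2}" by auto
    then show ?thesis by (auto simp: polygon_boundary_def polygon_edge_def)
  qed
  have cl: "closed (convex hull {a, b, c})" by (simp add: compact_convex_hull finite_imp_compact compact_imp_closed)
  have f: "frontier (convex hull {a, b, c}) = closed_segment a b \<union> closed_segment b c \<union> closed_segment c a"
    by (rule frontier_of_triangle) simp
  have i: "inside (closed_segment a b \<union> closed_segment b c \<union> closed_segment c a) = interior (convex hull {a, b, c})"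
    by (rule inside_of_triangle) simp
  have "polygon_region [a, b, c] = frontier (convex hull {a, b, c}) \<union> interior (convex hull {a, b, c})"
    by (simp only: polygon_region_def b i f)
  then show ?thesis using cl interior_subset[of "convex hull {a, b, c}"]
    by (auto simp: frontier_def closure_closed)
qed

section \<open>Triangulated portalgons\<close>

declare directed_edge_point.simps [simp del] edge_length.simps [simp del]

locale tri_portalgon =
  fixes T :: portalgon
  assumes portalgon: "is_portalgon T" and tri: "\<And>F. F \<in> set (fragments T) \<Longrightarrow> length F = 3"
begin

abbreviation "N \<equiv> length (fragments T)"
abbreviation "Fr \<equiv> fragment_region T"
abbreviation "cls \<equiv> to_surface T"
abbreviation "dep \<equiv> directed_edge_point T"

text \<open>Reading indices modulo 3 lets \<open>i + 1\<close> and \<open>i + 2\<close> name the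
  other two corners without case distinctions.\<close>

definition V :: "nat \<Rightarrow> nat \<Rightarrow> complex" where "V k i = fragments T ! k ! (i mod 3)"

text \<open>Twice the signed area. Either sign occurs, depending on the orientation of the vertex
  list; dividing by it in \<open>ec\<close> removes the dependence.\<close>

definition DD :: "nat \<Rightarrow> real" where "DD k = side (V k 0) (V k 1) (V k 2)"

text \<open>The barycentric coordinate that vanishes on edge \<open>i\<close>.\<close>

definition ec :: "nat \<Rightarrow> nat \<Rightarrow> complex \<Rightarrow> real" where
  "ec k i z = side (V k i) (V k (i+1)) z / DD k"

lemma lt3: "i < 3 \<longleftrightarrow> i = 0 \<or> i = 1 \<or> i = (2::nat)" by auto

lemma all3: "(\<forall>j<3. P j) \<longleftrightarrow> P 0 \<and> P (Suc 0) \<and> P (2::nat)"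
  and ex3: "(\<exists>j<3. P j) \<longleftrightarrow> P 0 \<or> P (Suc 0) \<or> P (2::nat)"
  by (auto simp: lt3)

lemma cases3: "i < 3 \<Longrightarrow> (i = 0 \<Longrightarrow> Q) \<Longrightarrow> (i = Suc 0 \<Longrightarrow> Q) \<Longrightarrow> (i = 2 \<Longrightarrow> Q) \<Longrightarrow> Q"
  by (auto simp: lt3)

lemma idx: "Suc (Suc 0) = 2" "Suc 2 = 3" "Suc 3 = 4" by simp_all

lemma V_mod: "V k (i mod 3) = V k i" "V k (i + 3) = V k i" "V k (Suc (i mod 3)) = V k (Suc i)"
  by (auto simp: V_def mod_simps)

lemma V3 [simp]: "V k 3 = V k 0" "V k 4 = V k 1" by (simp_all add: V_def)

lemma frag: "k < N \<Longrightarrow> fragments T ! k = [V k 0, V k 1, V k 2]"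
proof -
  assume "k < N"
  then have l: "length (fragments T ! k) = 3" using tri by simp
  then obtain a b c where "fragments T ! k = [a, b, c]"
    by (auto simp: length_Suc_conv numeral_3_eq_3)
  then show ?thesis by (simp add: V_def)
qed

lemma DD: "k < N \<Longrightarrow> DD k \<noteq> 0"
  using portalgon frag[of k] simple_triangle[of "V k 0" "V k 1" "V k 2"] nth_mem[of k "fragments T"]
  unfolding is_portalgon_def DD_def by fastforce

lemma DD_side: "i < 3 \<Longrightarrow> side (V k i) (V k (i+1)) (V k (i+2)) = DD k"
proof -
  assume "i < 3"
  then consider "i = 0" | "i = 1" | "i = 2" unfolding lt3 by blast
  then show ?thesis
  proof cases
    case 1
    then show ?thesis by (simp add: DD_def idx)
  next
    case 2
    then show ?thesis by (simp add: DD_def idx side_rot[of "V k (Suc 0)" "V k 2" "V k 0"])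
  next
    case 3
    then show ?thesis by (simp add: DD_def idx side_rot[of "V k (Suc 0)" "V k 2" "V k 0", symmetric] side_rot[of "V k 0" "V k (Suc 0)" "V k 2", symmetric] )
  qed
qed

lemma Fr_hull: "k < N \<Longrightarrow> Fr k = convex hull {V k 0, V k 1, V k 2}"
  by (simp add: fragment_region_def frag triangle_region)

lemma Fr_iff: "k < N \<Longrightarrow> z \<in> Fr k \<longleftrightarrow> (\<forall>i<3. 0 \<le> ec k i z)"
  using triangle_hull[of "V k 0" "V k 1" "V k 2" z] DD[of k]
  by (auto simp: Fr_hull lt3 ec_def DD_def idx)

lemma ec_sum: "k < N \<Longrightarrow> ec k 0 z + ec k 1 z + ec k 2 z = 1"
  using side_sum[of "V k 0" "V k 1" z "V k 2"] DD[of k]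
  by (simp add: ec_def DD_def add_divide_distrib[symmetric] idx)

lemma ec_comb: "ec k i ((1-t) *\<^sub>R a + t *\<^sub>R b) = (1-t) * ec k i a + t * ec k i b"
  by (simp add: ec_def side_comb add_divide_distrib)

lemma ec_mod: "ec k (i mod 3) z = ec k i z" "ec k (i+3) z = ec k i z"
  using V_mod(2)[of k "Suc i"] by (simp_all add: ec_def V_mod)

lemma ec_V: "k < N \<Longrightarrow> i < 3 \<Longrightarrow> ec k i (V k i) = 0 \<and> ec k i (V k (i+1)) = 0 \<and> ec k i (V k (i+2)) = 1"
  using DD_side[of i k] DD[of k] by (simp add: ec_def)

lemma ec3 [simp]: "ec k 3 z = ec k 0 z" "ec k 4 z = ec k 1 z"
  using ec_mod(2)[of k 0 z] ec_mod(2)[of k 1 z] by simp_all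

lemma ec_cont: "continuous_on S (ec k i)"
  unfolding ec_def side_def by (cases "DD k = 0") (auto intro!: continuous_intros)

lemma Fr_compact: "k < N \<Longrightarrow> compact (Fr k)" and Fr_convex: "k < N \<Longrightarrow> convex (Fr k)"
  by (simp_all add: Fr_hull compact_convex_hull finite_imp_compact)

lemma dep_eq: "k < N \<Longrightarrow> i < 3 \<Longrightarrow> dep ((k, i), r) u =
   (if r then (1-u) *\<^sub>R V k (i+1) + u *\<^sub>R V k i else (1-u) *\<^sub>R V k i + u *\<^sub>R V k (i+1))"
  using tri[of "fragments T ! k"] by (simp add: V_def Let_def directed_edge_point.simps)

lemma edges_iff: "(k, i) \<in> edges T \<longleftrightarrow> k < N \<and> i < 3"
  using tri by (auto simp: edges_def)

lemma dep_lin: "fst a \<in> edges T \<Longrightarrow> dep a u = (1-u) *\<^sub>R dep a 0 + u *\<^sub>R dep a 1"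
  by (cases a) (auto simp: edges_iff dep_eq)

lemma dep_norm: "fst a \<in> edges T \<Longrightarrow> norm (dep a 1 - dep a 0) = edge_length T (fst a)"
  using tri by (cases a) (auto simp: edges_iff dep_eq V_def Let_def dist_norm norm_minus_commute edge_length.simps)

lemma ec_dep: "k < N \<Longrightarrow> i < 3 \<Longrightarrow> ec k i (dep ((k, i), r) u) = 0 \<and>
   ec k (i+1) (dep ((k, i), r) u) = (if r then u else 1 - u) \<and> ec k (i+2) (dep ((k, i), r) u) = (if r then 1 - u else u)"
proof -
  assume k: "k < N" and i: "i < 3"
  have 1: "ec k (i+1) (V k i) = 1" "ec k (i+1) (V k (i+1)) = 0" "ec k (i+2) (V k i) = 0" "ec k (i+2) (V k (i+1)) = 1"
    using i ec_V[OF k, of 0] ec_V[OF k, of 1] ec_V[OF k, of 2]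
    by (auto elim!: cases3 simp: idx)
  show ?thesis using 1 ec_V[OF k i] by (simp add: dep_eq k i ec_comb)
qed

lemma ec_all: "i < 3 \<Longrightarrow> (\<forall>j<3. P (ec k j z)) \<longleftrightarrow> P (ec k i z) \<and> P (ec k (i+1) z) \<and> P (ec k (i+2) z)"
  by (erule cases3) (auto simp: all3 idx)

lemma dep_Fr: "fst a \<in> edges T \<Longrightarrow> u \<in> {0..1} \<Longrightarrow> dep a u \<in> Fr (fst (fst a))"
proof -
  assume a: "fst a \<in> edges T" "u \<in> {0..1}"
  obtain k i r where [simp]: "a = ((k, i), r)" by (metis prod.exhaust)
  have k: "k < N" "i < 3" using a by (auto simp: edges_iff)
  show ?thesis using a ec_dep[OF k, of r u] ec_all[OF k(2), of "\<lambda>x. 0 \<le> x" k "dep a u"]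
    by (auto simp: Fr_iff k)
qed

lemma ec_sum': "k < N \<Longrightarrow> i < 3 \<Longrightarrow> ec k i z + ec k (i+1) z + ec k (i+2) z = 1"
  using ec_sum[of k z] by (auto elim!: cases3 simp: idx)

text \<open>The coordinates sum to 1, so two of them give the third, and the three determine the
  point.\<close>

lemma ec_inj:
  assumes k: "k < N" and i: "i < 3" and "ec k i z = ec k i w" "ec k (i+2) z = ec k (i+2) w"
  shows "z = w"
proof -
  have e: "ec k j z = ec k j w" if "j < 3" for j
  proof -
    have "ec k (i+1) z = ec k (i+1) w" using ec_sum'[OF k i, of z] ec_sum'[OF k i, of w] assms by linarith
    then show ?thesis using assms that i by (auto elim!: cases3 simp: idx)
  qed
  have s: "side (V k j) (V k (j+1)) z = side (V k j) (V k (j+1)) w" if "j < 3" for j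
    using e[OF that] DD[OF k] by (simp add: ec_def)
  have "DD k *\<^sub>R z = DD k *\<^sub>R w"
    unfolding DD_def side_bary[of "V k 0" "V k 1" "V k 2" z] side_bary[of "V k 0" "V k 1" "V k 2" w]
    using s[of 0] s[of 1] s[of 2] by (simp add: idx)
  then show ?thesis using DD[OF k] by simp
qed

lemma on_edge:
  assumes k: "k < N" and i: "i < 3" and z: "ec k i z = 0"
  obtains u where "z = dep ((k, i), r) u" "u = (if r then 1 - ec k (i+2) z else ec k (i+2) z)"
proof -
  define u where "u = (if r then 1 - ec k (i+2) z else ec k (i+2) z)"
  have "z = dep ((k, i), r) u"
    by (rule ec_inj[OF k i]) (use ec_dep[OF k i, of r u] z in \<open>auto simp: u_def\<close>)
  then show ?thesis using that u_def by blast
qed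

lemma on_edge_Fr:
  assumes k: "k < N" and i: "i < 3" and z: "z \<in> Fr k" "ec k i z = 0"
  obtains u where "z = dep ((k, i), r) u" "u \<in> {0..1}"
proof -
  obtain u where u: "z = dep ((k, i), r) u" "u = (if r then 1 - ec k (i+2) z else ec k (i+2) z)"
    using on_edge[OF k i z(2), where r=r] by blast
  have "0 \<le> ec k (i+2) z" "0 \<le> ec k (i+1) z" using z Fr_iff[OF k] ec_all[OF i, of "\<lambda>x. 0 \<le> x"] by auto
  then have "u \<in> {0..1}" unfolding u(2) using ec_sum'[OF k i, of z] z(2) by (cases r) auto
  then show ?thesis using that[OF u(1)] by blast
qed

definition is_vertex :: "nat \<Rightarrow> complex \<Rightarrow> bool" where
  "is_vertex k z \<longleftrightarrow> (\<exists>i<3. z = V k i)"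

lemma vertex_iff: "k < N \<Longrightarrow> is_vertex k z \<longleftrightarrow> (\<exists>i<3. ec k i z = 0 \<and> ec k (i+1) z = 0)"
proof
  assume k: "k < N"
  {
    assume "is_vertex k z"
    then obtain i where i: "i < 3" "z = V k i" by (auto simp: is_vertex_def)
    have 1: "ec k i z = 0" using ec_V[OF k i(1)] i by simp
    have 2: "ec k (i+2) z = 0"
    proof (rule cases3[OF i(1)])
      show "ec k (i+2) z = 0" if "i = 0" using ec_V[OF k, of 2] i(2) that by (simp add: idx)
      show "ec k (i+2) z = 0" if "i = Suc 0" using ec_V[OF k, of 0] i(2) that by (simp add: idx)
      show "ec k (i+2) z = 0" if "i = 2" using ec_V[OF k, of 1] i(2) that by (simp add: idx)
    qed
    show "\<exists>i<3. ec k i z = 0 \<and> ec k (i+1) z = 0"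
      unfolding ex3
    proof (rule cases3[OF i(1)])
      assume "i = 0" then show "ec k 0 z = 0 \<and> ec k (0 + 1) z = 0 \<or> ec k (Suc 0) z = 0 \<and> ec k (Suc 0 + 1) z = 0 \<or> ec k 2 z = 0 \<and> ec k (2 + 1) z = 0"
        using 1 2 by (simp add: idx)
    next
      assume "i = Suc 0" then show "ec k 0 z = 0 \<and> ec k (0 + 1) z = 0 \<or> ec k (Suc 0) z = 0 \<and> ec k (Suc 0 + 1) z = 0 \<or> ec k 2 z = 0 \<and> ec k (2 + 1) z = 0"
        using 1 2 by (simp add: idx)
    next
      assume "i = 2" then show "ec k 0 z = 0 \<and> ec k (0 + 1) z = 0 \<or> ec k (Suc 0) z = 0 \<and> ec k (Suc 0 + 1) z = 0 \<or> ec k 2 z = 0 \<and> ec k (2 + 1) z = 0"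
        using 1 2 by (simp add: idx)
    qed
  }
  assume "\<exists>i<3. ec k i z = 0 \<and> ec k (i+1) z = 0"
  then obtain i where i: "i < 3" "ec k i z = 0" "ec k (i+1) z = 0" by auto
  have "ec k (i+2) z = 1" using ec_sum'[OF k i(1), of z] i by simp
  moreover have "ec k i (V k (i+1)) = 0" "ec k (i+2) (V k (i+1)) = 1"
    using i ec_V[OF k, of 0] ec_V[OF k, of 1] ec_V[OF k, of 2]
    by (auto elim!: cases3 simp: idx)
  ultimately have "z = V k (i+1)" using i by (intro ec_inj[OF k i(1)]) auto
  then have "z = V k ((i+1) mod 3)" by (simp add: V_mod)
  then show "is_vertex k z" unfolding is_vertex_def by (intro exI[of _ "(i+1) mod 3"]) simp
qed

lemma vertex_dep: "k < N \<Longrightarrow> i < 3 \<Longrightarrow> is_vertex k (dep ((k, i), r) u) \<longleftrightarrow> u = 0 \<or> u = 1"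
proof -
  assume k: "k < N" and i: "i < 3"
  let ?z = "dep ((k, i), r) u"
  have e: "ec k i ?z = 0" "ec k (i+1) ?z = (if r then u else 1 - u)" "ec k (i+2) ?z = (if r then 1 - u else u)"
    using ec_dep[OF k i] by auto
  have "is_vertex k ?z \<longleftrightarrow> (ec k i ?z = 0 \<and> ec k (i+1) ?z = 0) \<or> (ec k (i+1) ?z = 0 \<and> ec k (i+2) ?z = 0) \<or> (ec k (i+2) ?z = 0 \<and> ec k i ?z = 0)"
    unfolding vertex_iff[OF k] ex3 using i by (elim cases3) (auto simp: idx)
  then show ?thesis using e by auto
qed

lemma interior_or_edge:
  assumes k: "k < N" and z: "z \<in> Fr k" "\<not> is_vertex k z"
  obtains "\<forall>i<3. 0 < ec k i z" | i where "i < 3" "ec k i z = 0" "0 < ec k (i+1) z" "0 < ec k (i+2) z"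
proof (cases "\<forall>i<3. 0 < ec k i z")
  case False
  then obtain i where i: "i < 3" "ec k i z = 0" using z Fr_iff[OF k] by (metis order_le_less)
  have nn: "0 \<le> ec k (i+1) z" "0 \<le> ec k (i+2) z" using z Fr_iff[OF k] ec_all[OF i(1), of "\<lambda>x. 0 \<le> x"] by auto
  obtain u where u: "z = dep ((k, i), False) u" using on_edge[OF k i] by metis
  have "u \<noteq> 0 \<and> u \<noteq> 1" using z u vertex_dep[OF k i(1)] by simp
  then have "ec k (i+1) z \<noteq> 0" "ec k (i+2) z \<noteq> 0" using ec_dep[OF k i(1), of False u] u by auto
  then show ?thesis using that(2)[OF i] nn by auto
qed (use that in blast)

section \<open>Gluing\<close>

lemma portal_edge: "e \<in> portals T \<Longrightarrow> a \<in> e \<Longrightarrow> fst a \<in> edges T"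
  using portalgon unfolding is_portalgon_def by fastforce

lemma portal_len: "e \<in> portals T \<Longrightarrow> a \<in> e \<Longrightarrow> b \<in> e \<Longrightarrow> edge_length T (fst a) = edge_length T (fst b)"
  using portalgon unfolding is_portalgon_def by (metis empty_iff insert_iff)

lemma portal_unique:
  assumes "e \<in> portals T" "a \<in> e" "e' \<in> portals T" "a' \<in> e'" "fst a = fst a'"
  shows "e = e'" "a = a'"
proof -
  show e: "e = e'" using assms portalgon unfolding is_portalgon_def by (metis IntI empty_iff image_eqI)
  obtain x y where "e = {x, y}" "fst x \<noteq> fst y" using portalgon assms(1) unfolding is_portalgon_def by metis
  then show "a = a'" using assms e by auto
qed

lemma portal_pair:
  assumes "e \<in> portals T" "a \<in> e" "b \<in> e" "c \<in> e" "a \<noteq> b" shows "c = a \<or> c = b"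
proof -
  obtain x y where "e = {x, y}" using portalgon assms(1) unfolding is_portalgon_def by metis
  then show ?thesis using assms by auto
qed

lemma portal_other:
  assumes "e \<in> portals T" "a \<in> e" obtains b where "b \<in> e" "b \<noteq> a"
proof -
  obtain x y where "e = {x, y}" "fst x \<noteq> fst y" using portalgon assms(1) unfolding is_portalgon_def by metis
  then show ?thesis using that[of x] that[of y] assms(2) by blast
qed

lemma glueE:
  assumes "(x, y) \<in> glue T"
  obtains e a b u where "e \<in> portals T" "a \<in> e" "b \<in> e" "u \<in> {0..1}" "x = (fst (fst a), dep a u)" "y = (fst (fst b), dep b u)"
  using assms unfolding glue_def by blast

lemma glueI: "e \<in> portals T \<Longrightarrow> a \<in> e \<Longrightarrow> b \<in> e \<Longrightarrow> u \<in> {0..1} \<Longrightarrow> ((fst (fst a), dep a u), (fst (fst b), dep b u)) \<in> glue T"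
  unfolding glue_def by blast

lemma glue_sym: "sym (glue T)"
  unfolding sym_def glue_def by blast

lemma cls_eq_iff: "cls x = cls y \<longleftrightarrow> (x, y) \<in> (glue T)\<^sup>*"
proof
  assume "cls x = cls y"
  then have "y \<in> (glue T)\<^sup>* `` {x}" unfolding to_surface_def by blast
  then show "(x, y) \<in> (glue T)\<^sup>*" by blast
next
  assume *: "(x, y) \<in> (glue T)\<^sup>*"
  then have "(y, x) \<in> (glue T)\<^sup>*" using sym_rtrancl[OF glue_sym] by (auto dest: symD)
  then show "cls x = cls y" unfolding to_surface_def using * by (auto intro: rtrancl_trans)
qed

lemma glue_cls: "(x, y) \<in> glue T \<Longrightarrow> cls x = cls y" by (simp add: cls_eq_iff r_into_rtrancl)

lemma cls_invariant:
  assumes "\<And>x y. (x, y) \<in> glue T \<Longrightarrow> f x = f y" "cls x = cls y" shows "f x = f y"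
  using assms(2)[unfolded cls_eq_iff] by (induction rule: rtrancl_induct) (auto simp: assms(1))

text \<open>Gluing classes are computed with this rule: a candidate set that is closed under single
  gluing steps contains the class of each of its points.\<close>

lemma cls_closed:
  assumes "\<And>x y. x \<in> W \<Longrightarrow> (x, y) \<in> glue T \<Longrightarrow> y \<in> W" "x \<in> W" "cls x = cls y" shows "y \<in> W"
  using assms(3)[unfolded cls_eq_iff] by (induction rule: rtrancl_induct) (use assms in auto)

text \<open>In the relative interior of an edge exactly one barycentric coordinate vanishes, which
  identifies the edge; another one recovers the parameter.\<close>

lemma dep_eq_edge:
  assumes e: "fst a \<in> edges T" "fst b \<in> edges T" "fst (fst a) = fst (fst b)" "dep a u = dep b v" and u: "0 < u" "u < 1" "v \<in> {0..1}"
  shows "fst a = fst b" "snd a = snd b \<Longrightarrow> u = v"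
proof -
  obtain k i r where a: "a = ((k, i), r)" by (metis prod.exhaust)
  obtain j s where b: "b = ((k, j), s)" using e(3) a by (metis fst_conv prod.exhaust)
  have k: "k < N" "i < 3" "j < 3" using e by (auto simp: a b edges_iff)
  have z: "ec k j (dep a u) = 0" using ec_dep[OF k(1,3), of s v] e by (simp add: b)
  have "ec k i (dep a u) = 0" "ec k (i+1) (dep a u) > 0" "ec k (i+2) (dep a u) > 0"
    using ec_dep[OF k(1,2), of r u] u by (auto simp: a)
  then have "j = i" using z k by (auto elim!: cases3 simp: idx)
  then show "fst a = fst b" by (simp add: a b)
  show "u = v" if "snd a = snd b"
  proof -
    have "s = r" using that a b by simp
    then have "dep ((k, i), r) u = dep ((k, i), r) v" using e(4) \<open>j = i\<close> by (simp only: a b)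
    then have "(if r then u else 1 - u) = (if r then v else 1 - v)"
      using ec_dep[OF k(1,2), of r u] ec_dep[OF k(1,2), of r v] by metis
    then show ?thesis by (simp split: if_splits)
  qed
qed

lemma cls_interior:
  assumes k: "k < N" "\<forall>i<3. 0 < ec k i z" and "cls (k, z) = cls y"
  shows "y = (k, z)"
proof -
  have "y \<in> {(k, z)}"
  proof (rule cls_closed[OF _ _ assms(3)])
    fix x y assume "x \<in> {(k, z)}" "(x, y) \<in> glue T"
    then obtain e a u where e: "e \<in> portals T" "a \<in> e" "(k, z) = (fst (fst a), dep a u)" by (metis glueE singletonD)
    obtain k' i r where a: "a = ((k', i), r)" by (metis prod.exhaust)
    have "fst a \<in> edges T" using portal_edge e by blast
    then have "ec k i z = 0" "i < 3" using e(3) ec_dep[of k i r u] by (auto simp: a edges_iff)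
    then show "y \<in> {(k, z)}" using k(2) by force
  qed simp
  then show ?thesis by simp
qed

text \<open>Away from the corners a point lies on one edge of its triangle, and this edge belongs to
  one portal, so gluing only alternates between the two sides of that portal.\<close>

lemma cls_edge:
  assumes e: "e \<in> portals T" "a \<in> e" "b \<in> e" "a \<noteq> b" and u: "0 < u" "u < 1"
    and "cls (fst (fst a), dep a u) = cls y"
  shows "y = (fst (fst a), dep a u) \<or> y = (fst (fst b), dep b u)"
proof -
  let ?W = "{(fst (fst a), dep a u), (fst (fst b), dep b u)}"
  have "y \<in> ?W"
  proof (rule cls_closed[OF _ _ assms(7)])
    fix x y assume x: "x \<in> ?W" "(x, y) \<in> glue T"
    obtain e' a' b' u' where e': "e' \<in> portals T" "a' \<in> e'" "b' \<in> e'" "u' \<in> {0..1}" "x = (fst (fst a'), dep a' u')" "y = (fst (fst b'), dep b' u')"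
      by (rule glueE[OF x(2)])
    obtain c where c: "c \<in> e" "x = (fst (fst c), dep c u)" using x(1) e(2,3) by (elim insertE) auto
    have "fst c = fst a'" 
      by (rule dep_eq_edge(1)[of _ _ u u']) (use c e e' u portal_edge in auto)
    then have "c = a'" "e = e'" using portal_unique e c e' by blast+
    then have "u = u'" using dep_eq_edge(2)[of c a' u u'] c e' u portal_edge by auto
    then show "y \<in> ?W" using portal_pair[OF e(1) e(2) e(3) _ e(4), of b'] e' \<open>e = e'\<close> by auto
  qed simp
  then show ?thesis by simp
qed

lemma cls_boundary:
  assumes ki: "k < N" "i < 3" and nb: "\<And>e r. e \<in> portals T \<Longrightarrow> ((k, i), r) \<notin> e" and u: "0 < u" "u < 1"
    and "cls (k, dep ((k, i), r) u) = cls y"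
  shows "y = (k, dep ((k, i), r) u)"
proof -
  have "y \<in> {(k, dep ((k, i), r) u)}"
  proof (rule cls_closed[OF _ _ assms(6)])
    fix x y assume "x \<in> {(k, dep ((k, i), r) u)}" "(x, y) \<in> glue T"
    then obtain e a u' where e: "e \<in> portals T" "a \<in> e" "u' \<in> {0..1}" "(k, dep ((k, i), r) u) = (fst (fst a), dep a u')" by (metis glueE singletonD)
    have "k = fst (fst a)" "dep ((k, i), r) u = dep a u'" using e(4) by (metis prod.inject)+
    then have "fst ((k, i), r) = fst a"
      using dep_eq_edge(1)[of "((k, i), r)" a u u'] e(3) u ki portal_edge[OF e(1,2)] by (simp add: edges_iff)
    then have "((k, i), snd a) \<in> e" using e(2) by (metis fst_conv prod.collapse)
    then show "y \<in> {(k, dep ((k, i), r) u)}" using nb e by blast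
  qed simp
  then show ?thesis by simp
qed

end

section \<open>The distance on the surface\<close>

lemma curve_length_ge3:
  assumes "a \<le> x" "x \<le> y" "y \<le> b"
  shows "ennreal (dist (\<sigma> a) (\<sigma> x)) + ennreal (dist (\<sigma> x) (\<sigma> y)) + ennreal (dist (\<sigma> y) (\<sigma> b)) \<le> curve_length \<sigma> a b"
proof -
  have *: "sorted [a, x, y, b] \<and> set [a, x, y, b] \<subseteq> {a..b}" using assms by auto
  have "(\<Sum>i < length [a, x, y, b] - 1. ennreal (dist (\<sigma> ([a, x, y, b] ! i)) (\<sigma> ([a, x, y, b] ! Suc i)))) \<le> curve_length \<sigma> a b"
    unfolding curve_length_def by (rule SUP_upper) (use * in blast)
  then show ?thesis by (simp add: numeral_3_eq_3 add.assoc)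
qed

lemma curve_length_ge: "a \<le> b \<Longrightarrow> ennreal (dist (\<sigma> a) (\<sigma> b)) \<le> curve_length \<sigma> a b"
  using curve_length_ge3[of a a b b \<sigma>] by simp

lemma curve_length_affine:
  assumes "a \<le> b" and "\<And>s. s \<in> {a..b} \<Longrightarrow> \<sigma> s = p + s *\<^sub>R w"
  shows "curve_length \<sigma> a b \<le> ennreal (norm w * (b - a))"
  unfolding curve_length_def
proof (rule SUP_least)
  fix ts :: "real list" assume "ts \<in> {ts. sorted ts \<and> set ts \<subseteq> {a..b}}"
  then have ts: "sorted ts" "set ts \<subseteq> {a..b}" by auto
  show "(\<Sum>i<length ts - 1. ennreal (dist (\<sigma> (ts ! i)) (\<sigma> (ts ! Suc i)))) \<le> ennreal (norm w * (b - a))"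
  proof (cases "ts = []")
    case False
    have "dist (\<sigma> (ts ! i)) (\<sigma> (ts ! Suc i)) = norm w * (ts ! Suc i - ts ! i)" if "i < length ts - 1" for i
    proof -
      have m: "ts ! i \<in> {a..b}" "ts ! Suc i \<in> {a..b}" using that ts(2) by (metis nth_mem subsetD less_diff_conv Suc_eq_plus1 Suc_lessD)+
      have le: "ts ! i \<le> ts ! Suc i" using ts(1) that by (simp add: sorted_nth_mono)
      have "\<sigma> (ts ! i) - \<sigma> (ts ! Suc i) = (ts ! i - ts ! Suc i) *\<^sub>R w" using m by (simp add: assms(2) scaleR_diff_left)
      then show ?thesis using le by (simp add: dist_norm)
    qed
    then have "(\<Sum>i<length ts - 1. ennreal (dist (\<sigma> (ts ! i)) (\<sigma> (ts ! Suc i)))) = (\<Sum>i<length ts - 1. ennreal (norm w * (ts ! Suc i - ts ! i)))"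
      by (intro sum.cong) auto
    also have "\<dots> = ennreal (\<Sum>i<length ts - 1. norm w * (ts ! Suc i - ts ! i))"
      using ts(1) by (intro sum_ennreal) (auto simp: sorted_nth_mono)
    also have "(\<Sum>i<length ts - 1. norm w * (ts ! Suc i - ts ! i)) = norm w * (ts ! (length ts - 1) - ts ! 0)"
      by (simp add: sum_distrib_left[symmetric] sum_lessThan_telescope)
    also have "\<dots> \<le> norm w * (b - a)"
    proof -
      have "ts ! (length ts - 1) \<in> {a..b}" "ts ! 0 \<in> {a..b}" using False ts(2) by (metis nth_mem subsetD diff_less length_greater_0_conv zero_less_one)+
      then show ?thesis by (intro mult_left_mono) auto
    qed
    finally show ?thesis by (simp add: ennreal_leI)
  qed simp
qed

context tri_portalgon
begin

abbreviation "sd \<equiv> surface_dist T"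

lemma cls_mem: "k < N \<Longrightarrow> z \<in> Fr k \<Longrightarrow> cls (k, z) \<in> surface T"
  by (rule to_surface_in_surface) (simp add: fragment_points_def)

lemma surface_rep: "p \<in> surface T \<Longrightarrow> \<exists>k z. k < N \<and> z \<in> Fr k \<and> p = cls (k, z)"
  unfolding surface_eq_image fragment_points_def by auto

text \<open>The source of all lower bounds on distances: such a function descends to the surface,
  and its increments telescope along any subdivision of any path.\<close>

lemma lipschitz_dist:
  assumes inv: "\<And>x y. (x, y) \<in> glue T \<Longrightarrow> f x = f y"
    and lip: "\<And>k x y. k < N \<Longrightarrow> x \<in> Fr k \<Longrightarrow> y \<in> Fr k \<Longrightarrow> \<bar>f (k, x) - f (k, y)\<bar> \<le> norm (x - y)"
  shows "ennreal \<bar>f x - f y\<bar> \<le> sd (cls x) (cls y)"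
  unfolding surface_dist_def
proof (rule INF_greatest)
  fix \<gamma> assume \<gamma>: "\<gamma> \<in> paths_between T (cls x) (cls y)"
  define h where "h p = f (SOME x. cls x = p)" for p
  have h: "h (cls z) = f z" for z
    unfolding h_def
  proof (rule cls_invariant[of f, OF inv])
    show "cls (SOME x. cls x = cls z) = cls z" by (rule someI[of "\<lambda>x. cls x = cls z" z]) simp
  qed
  show "ennreal \<bar>f x - f y\<bar> \<le> path_length T \<gamma>"
    unfolding path_length_def
  proof (rule Inf_greatest, clarify)
    fix n t k \<sigma> assume s: "fragment_subdivision T \<gamma> n t k \<sigma>"
    have st: "t j < t (Suc j)" "k j < N" "\<sigma> j (t j) \<in> Fr (k j)" "\<sigma> j (t (Suc j)) \<in> Fr (k j)"
      "\<gamma> (t j) = cls (k j, \<sigma> j (t j))" "\<gamma> (t (Suc j)) = cls (k j, \<sigma> j (t (Suc j)))" if "j < n" for j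
      using s that unfolding fragment_subdivision_def by (auto simp: less_imp_le)
    have tel: "\<bar>h (\<gamma> (t m)) - h (\<gamma> (t 0))\<bar> \<le> (\<Sum>j<m. norm (\<sigma> j (t j) - \<sigma> j (t (Suc j))))" if "m \<le> n" for m
      using that
    proof (induction m)
      case (Suc m)
      then have "\<bar>h (\<gamma> (t m)) - h (\<gamma> (t (Suc m)))\<bar> \<le> norm (\<sigma> m (t m) - \<sigma> m (t (Suc m)))"
        using st[of m] lip by (simp add: h)
      then show ?case using Suc by simp
    qed simp
    have "\<bar>f x - f y\<bar> \<le> (\<Sum>j<n. norm (\<sigma> j (t j) - \<sigma> j (t (Suc j))))"
      using tel[of n] \<gamma> s unfolding fragment_subdivision_def paths_between_def by (simp add: h abs_minus_commute)
    then have "ennreal \<bar>f x - f y\<bar> \<le> (\<Sum>j<n. ennreal (dist (\<sigma> j (t j)) (\<sigma> j (t (Suc j)))))"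
      by (simp add: dist_norm ennreal_leI)
    also have "\<dots> \<le> (\<Sum>j<n. curve_length (\<sigma> j) (t j) (t (Suc j)))"
      using st by (intro sum_mono curve_length_ge) (auto simp: less_imp_le)
    finally show "ennreal \<bar>f x - f y\<bar> \<le> (\<Sum>j<n. curve_length (\<sigma> j) (t j) (t (Suc j)))" .
  qed
qed

text \<open>A discrete substitute for paths: straight segments inside fragments whose ends are
  glued. Chains can be concatenated and reversed without any reparametrization of the unit
  interval.\<close>

definition chain :: "nat \<Rightarrow> (nat \<Rightarrow> nat) \<Rightarrow> (nat \<Rightarrow> complex) \<Rightarrow> (nat \<Rightarrow> complex) \<Rightarrow> surface_point \<Rightarrow> surface_point \<Rightarrow> bool" where
  "chain n k a b p q \<longleftrightarrow> 0 < n \<and> (\<forall>j<n. k j < N \<and> a j \<in> Fr (k j) \<and> b j \<in> Fr (k j)) \<and>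
     p = cls (k 0, a 0) \<and> q = cls (k (n - 1), b (n - 1)) \<and>
     (\<forall>j. Suc j < n \<longrightarrow> cls (k j, b j) = cls (k (Suc j), a (Suc j)))"

lemma cls_continuous:
  assumes "k < N" shows "continuous_map (top_of_set (Fr k)) (surface_topology T) (\<lambda>z. cls (k, z))"
  unfolding continuous_map
proof (intro conjI allI impI)
  show "(\<lambda>z. cls (k, z)) ` topspace (top_of_set (Fr k)) \<subseteq> topspace (surface_topology T)"
    using assms cls_mem by (auto simp: topspace_surface_topology)
  fix U assume "openin (surface_topology T) U"
  then have "openin (fragment_topology T) {x \<in> fragment_points T. cls x \<in> U}" by (simp add: openin_surface_topology)
  then have "openin (top_of_set (Fr k)) {z. (k, z) \<in> {x \<in> fragment_points T. cls x \<in> U}}"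
    using assms unfolding fragment_topology_def openin_sum_topology by auto
  then show "openin (top_of_set (Fr k)) {x \<in> topspace (top_of_set (Fr k)). cls (k, x) \<in> U}"
    using assms by (simp add: fragment_points_def)
qed

lemma chain_dist:
  assumes c: "chain n k a b p q"
  shows "sd p q \<le> ennreal (\<Sum>j<n. norm (a j - b j))"
proof -
  have n: "n > 0" and ch: "\<And>j. j < n \<Longrightarrow> k j < N \<and> a j \<in> Fr (k j) \<and> b j \<in> Fr (k j)"
    and pq: "p = cls (k 0, a 0)" "q = cls (k (n - 1), b (n - 1))"
    and nx: "\<And>j. Suc j < n \<Longrightarrow> cls (k j, b j) = cls (k (Suc j), a (Suc j))"
    using c unfolding chain_def by auto
  define t where "t j = real j / real n" for j
  define \<sigma> where "\<sigma> j s = (1 - (real n * s - real j)) *\<^sub>R a j + (real n * s - real j) *\<^sub>R b j" for j s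
  \<comment> \<open>Index of the segment in use at time \<open>s\<close>. The minimum covers
    \<open>s = 1\<close>, where the floor would be \<open>n\<close>.\<close>
  define ix where "ix s = min (n - 1) (nat \<lfloor>real n * s\<rfloor>)" for s :: real
  define \<gamma> where "\<gamma> s = cls (k (ix s), \<sigma> (ix s) s)" for s
  have tt: "t j < t (Suc j)" for j using n by (simp add: t_def divide_strict_right_mono)
  have I: "s \<in> {t j..t (Suc j)} \<longleftrightarrow> real n * s - real j \<in> {0..1}" for j s
    using n by (auto simp: t_def field_simps)
  have mem: "\<sigma> j s \<in> Fr (k j)" if "j < n" "s \<in> {t j..t (Suc j)}" for j s
  proof -
    have "real n * s - real j \<in> {0..1}" using that(2) unfolding I .
    then show ?thesis unfolding \<sigma>_def using ch[OF that(1)] Fr_convex[of "k j"]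
      by (intro convexD) auto
  qed
  have ends: "\<sigma> j (t j) = a j" "\<sigma> j (t (Suc j)) = b j" for j
    using n by (simp_all add: \<sigma>_def t_def)
  have \<gamma>: "\<gamma> s = cls (k j, \<sigma> j s)" if j: "j < n" and s: "s \<in> {t j..t (Suc j)}" for j s
  proof -
    have js: "real j \<le> real n * s" "real n * s \<le> real j + 1" using s unfolding I by auto
    show ?thesis
    proof (cases "real n * s < real j + 1")
      case True
      then have "nat \<lfloor>real n * s\<rfloor> = j" using js by (simp add: floor_eq_iff nat_eq_iff)
      then have "ix s = j" using j by (simp add: ix_def)
      then show ?thesis by (simp add: \<gamma>_def)
    next
      case False
      then have e: "real n * s = real (Suc j)" using js by simp
      then have fl: "nat \<lfloor>real n * s\<rfloor> = Suc j" by (metis floor_of_nat nat_int)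
      have s: "s = t (Suc j)" using e n by (simp add: t_def field_simps)
      show ?thesis
      proof (cases "Suc j < n")
        case True
        then have "ix s = Suc j" using fl by (simp add: ix_def)
        then show ?thesis unfolding \<gamma>_def using nx[OF True] ends by (simp add: s)
      next
        case False
        then have "ix s = j" using fl j by (simp add: ix_def)
        then show ?thesis by (simp add: \<gamma>_def)
      qed
    qed
  qed
  have cov: "\<exists>j<n. s \<in> {t j..t (Suc j)}" if "s \<in> {0..1}" for s
  proof -
    have "real (nat \<lfloor>real n * s\<rfloor>) \<le> real n * s" using that by (intro of_nat_floor) simp
    moreover have "ix s \<le> nat \<lfloor>real n * s\<rfloor>" by (simp add: ix_def)
    ultimately have "real (ix s) \<le> real n * s" by linarith
    moreover have "real n * s \<le> real (ix s) + 1"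
    proof (cases "nat \<lfloor>real n * s\<rfloor> \<le> n - 1")
      case True
      then show ?thesis using that by (simp add: ix_def min_absorb2)
    next
      case False
      then have "ix s = n - 1" by (simp add: ix_def)
      then show ?thesis using n that by (simp add: of_nat_diff mult_left_le)
    qed
    ultimately show ?thesis unfolding I by (intro exI[of _ "ix s"]) (use n in \<open>auto simp: ix_def\<close>)
  qed
  have cont: "continuous_on S (\<sigma> j)" for S j unfolding \<sigma>_def by (intro continuous_intros)
  have "pathin (surface_topology T) \<gamma>"
    unfolding pathin_def
  proof (rule pasting_lemma_closed[where I = "{..<n}" and T = "\<lambda>j. {0..1} \<inter> {t j..t (Suc j)}" and f = "\<lambda>j s. cls (k j, \<sigma> j s)"])
    fix j assume j: "j \<in> {..<n}"
    show "closedin (top_of_set {0..1}) ({0..1} \<inter> {t j..t (Suc j)})" by (intro closedin_closed_Int) auto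
    have "continuous_map (top_of_set ({0..1} \<inter> {t j..t (Suc j)})) (top_of_set (Fr (k j))) (\<sigma> j)"
      using mem j cont by auto
    then have "continuous_map (top_of_set ({0..1} \<inter> {t j..t (Suc j)})) (surface_topology T) ((\<lambda>z. cls (k j, z)) \<circ> \<sigma> j)"
      using cls_continuous[of "k j"] ch j continuous_map_compose by blast
    then show "continuous_map (subtopology (top_of_set {0..1}) ({0..1} \<inter> {t j..t (Suc j)})) (surface_topology T) (\<lambda>s. cls (k j, \<sigma> j s))"
      by (simp add: subtopology_subtopology o_def)
  next
    fix i j x assume "i \<in> {..<n}" "j \<in> {..<n}" "x \<in> topspace (top_of_set {0..1}) \<inter> ({0..1} \<inter> {t i..t (Suc i)}) \<inter> ({0..1} \<inter> {t j..t (Suc j)})"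
    then show "cls (k i, \<sigma> i x) = cls (k j, \<sigma> j x)" using \<gamma>[of i x] \<gamma>[of j x] by auto
  next
    fix x :: real assume "x \<in> topspace (top_of_set {0..1})"
    then show "\<exists>j. j \<in> {..<n} \<and> x \<in> {0..1} \<inter> {t j..t (Suc j)} \<and> \<gamma> x = cls (k j, \<sigma> j x)"
      using cov[of x] \<gamma> by auto
  qed simp
  moreover have t0: "t 0 = 0" "t n = 1" using n by (simp_all add: t_def)
  moreover have "\<gamma> 0 = p" using \<gamma>[of 0 0] n tt[of 0] ends(1)[of 0] pq(1) t0 by simp
  moreover have "\<gamma> 1 = q"
  proof -
    have "1 = t (Suc (n - 1))" using t0 n by simp
    then show ?thesis using \<gamma>[of "n - 1" 1] n tt[of "n - 1"] ends(2)[of "n - 1"] pq(2) by (simp add: less_imp_le)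
  qed
  ultimately have path: "\<gamma> \<in> paths_between T p q" by (simp add: paths_between_def)
  have sub: "fragment_subdivision T \<gamma> n t k \<sigma>"
    unfolding fragment_subdivision_def using t0 tt ch cont mem \<gamma> by auto
  have "sd p q \<le> path_length T \<gamma>" unfolding surface_dist_def by (rule INF_lower[OF path])
  also have "\<dots> \<le> (\<Sum>j<n. curve_length (\<sigma> j) (t j) (t (Suc j)))"
    unfolding path_length_def by (rule Inf_lower) (use sub in blast)
  also have "\<dots> \<le> (\<Sum>j<n. ennreal (norm (a j - b j)))"
  proof (rule sum_mono)
    fix j assume "j \<in> {..<n}"
    have "curve_length (\<sigma> j) (t j) (t (Suc j)) \<le> ennreal (norm (real n *\<^sub>R (b j - a j)) * (t (Suc j) - t j))"
      by (rule curve_length_affine[where p = "(1 + real j) *\<^sub>R a j - real j *\<^sub>R b j"])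
        (use tt[of j] in \<open>auto simp: \<sigma>_def less_imp_le algebra_simps\<close>)
    also have "norm (real n *\<^sub>R (b j - a j)) * (t (Suc j) - t j) = norm (a j - b j)"
      using n by (simp add: t_def norm_minus_commute diff_divide_distrib[symmetric])
    finally show "curve_length (\<sigma> j) (t j) (t (Suc j)) \<le> ennreal (norm (a j - b j))" .
  qed
  finally show ?thesis by simp
qed

lemma chain_single: "k < N \<Longrightarrow> x \<in> Fr k \<Longrightarrow> y \<in> Fr k \<Longrightarrow> chain 1 (\<lambda>_. k) (\<lambda>_. x) (\<lambda>_. y) (cls (k, x)) (cls (k, y))"
  by (simp add: chain_def)

lemma dist_fragment: "k < N \<Longrightarrow> x \<in> Fr k \<Longrightarrow> y \<in> Fr k \<Longrightarrow> sd (cls (k, x)) (cls (k, y)) \<le> ennreal (norm (x - y))"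
  using chain_dist[OF chain_single] by simp

lemma chain_append:
  assumes "chain n k a b p q" "chain n' k' a' b' q r"
  shows "chain (n + n') (\<lambda>j. if j < n then k j else k' (j - n)) (\<lambda>j. if j < n then a j else a' (j - n))
     (\<lambda>j. if j < n then b j else b' (j - n)) p r"
proof -
  have e: "cls (k (n - 1), b (n - 1)) = cls (k' 0, a' 0)" using assms unfolding chain_def by auto
  show ?thesis
    unfolding chain_def
  proof (intro conjI allI impI)
    fix j assume j: "Suc j < n + n'"
    consider "Suc j < n" | "Suc j = n" | "n \<le> j" by linarith
    then show "cls (if j < n then k j else k' (j - n), if j < n then b j else b' (j - n)) =
         cls (if Suc j < n then k (Suc j) else k' (Suc j - n), if Suc j < n then a (Suc j) else a' (Suc j - n))"
    proof cases
      case 2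
      then have "j = n - 1" by simp
      then show ?thesis using e 2 by simp
    next
      case 3
      then show ?thesis using assms(2) j unfolding chain_def by (auto simp: Suc_diff_le)
    qed (use assms in \<open>auto simp: chain_def\<close>)
  qed (use assms in \<open>auto simp: chain_def\<close>)
qed

lemma chain_append_sum:
  fixes n n' :: nat
  shows "(\<Sum>j<n + n'. norm ((if j < n then a j else a' (j - n)) - (if j < n then b j else b' (j - n)))) =
   (\<Sum>j<n. norm (a j - b j)) + (\<Sum>j<n'. norm (a' j - b' j :: complex))"
proof -
  have "(\<Sum>j<n + n'. norm ((if j < n then a j else a' (j - n)) - (if j < n then b j else b' (j - n)))) =
     (\<Sum>j<n. norm (a j - b j)) + (\<Sum>j\<in>{n..<n + n'}. norm (a' (j - n) - b' (j - n)))"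
  proof -
    have "{..<n + n'} = {..<n} \<union> {n..<n + n'}" by auto
    then show ?thesis by (simp add: sum.union_disjoint ivl_disj_int)
  qed
  also have "(\<Sum>j\<in>{n..<n + n'}. norm (a' (j - n) - b' (j - n))) = (\<Sum>j<n'. norm (a' j - b' j))"
    by (rule sum.reindex_bij_witness[of _ "\<lambda>j. j + n" "\<lambda>j. j - n"]) auto
  finally show ?thesis .
qed

lemma subdivision_chain:
  assumes s: "fragment_subdivision T \<gamma> n t k \<sigma>"
  shows "chain n k (\<lambda>j. \<sigma> j (t j)) (\<lambda>j. \<sigma> j (t (Suc j))) (\<gamma> 0) (\<gamma> 1)"
proof -
  have n: "n > 0" using s unfolding fragment_subdivision_def by (metis gr0I zero_neq_one)
  have st: "t j < t (Suc j)" "k j < N" "\<sigma> j (t j) \<in> Fr (k j)" "\<sigma> j (t (Suc j)) \<in> Fr (k j)"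
      "\<gamma> (t j) = cls (k j, \<sigma> j (t j))" "\<gamma> (t (Suc j)) = cls (k j, \<sigma> j (t (Suc j)))" if "j < n" for j
      using s that unfolding fragment_subdivision_def by (auto simp: less_imp_le)
  have "t 0 = 0" "t n = 1" using s unfolding fragment_subdivision_def by auto
  moreover have "cls (k j, \<sigma> j (t (Suc j))) = cls (k (Suc j), \<sigma> (Suc j) (t (Suc j)))" if "Suc j < n" for j
    using st(6)[of j] st(5)[of "Suc j"] that by simp
  ultimately show ?thesis unfolding chain_def using n st(2-4) st(5)[of 0] st(6)[of "n - 1"] by simp
qed

text \<open>Replacing each piece of a subdivision by its chord does not increase the length.\<close>

lemma chain_approx:
  assumes "sd p q < ennreal r"
  obtains n k a b where "chain n k a b p q" "(\<Sum>j<n. norm (a j - b j)) < r"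
proof -
  obtain \<gamma> where g: "\<gamma> \<in> paths_between T p q" "path_length T \<gamma> < ennreal r"
    using assms unfolding surface_dist_def INF_less_iff by blast
  obtain n t k \<sigma> where s: "fragment_subdivision T \<gamma> n t k \<sigma>" "(\<Sum>j<n. curve_length (\<sigma> j) (t j) (t (Suc j))) < ennreal r"
    using g(2) unfolding path_length_def Inf_less_iff by blast
  have "ennreal (\<Sum>j<n. norm (\<sigma> j (t j) - \<sigma> j (t (Suc j)))) = (\<Sum>j<n. ennreal (dist (\<sigma> j (t j)) (\<sigma> j (t (Suc j)))))"
    by (simp add: dist_norm)
  also have "\<dots> \<le> (\<Sum>j<n. curve_length (\<sigma> j) (t j) (t (Suc j)))"
    using s(1) by (intro sum_mono curve_length_ge) (auto simp: fragment_subdivision_def less_imp_le)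
  also note s(2)
  finally have "(\<Sum>j<n. norm (\<sigma> j (t j) - \<sigma> j (t (Suc j)))) < r" by (simp add: ennreal_less_iff sum_nonneg)
  then show ?thesis using that subdivision_chain[OF s(1)] g(1) by (simp add: paths_between_def)
qed

lemma sd_triangle: "sd p r \<le> sd p q + sd q r"
proof (cases "sd p q = top \<or> sd q r = top")
  case False
  show ?thesis
  proof (rule ennreal_le_epsilon)
    fix e :: real assume e: "0 < e"
    obtain x where x: "sd p q = ennreal x" "x \<ge> 0" using False by (metis ennreal_cases)
    obtain y where y: "sd q r = ennreal y" "y \<ge> 0" using False by (metis ennreal_cases)
    obtain n k a b where 1: "chain n k a b p q" "(\<Sum>j<n. norm (a j - b j)) < x + e/2"
    proof -
      have "sd p q < ennreal (x + e/2)" using x e by (simp add: ennreal_less_iff)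
      then show ?thesis using chain_approx that by blast
    qed
    obtain n' k' a' b' where 2: "chain n' k' a' b' q r" "(\<Sum>j<n'. norm (a' j - b' j)) < y + e/2"
    proof -
      have "sd q r < ennreal (y + e/2)" using y e by (simp add: ennreal_less_iff)
      then show ?thesis using chain_approx that by blast
    qed
    have "sd p r \<le> ennreal ((\<Sum>j<n. norm (a j - b j)) + (\<Sum>j<n'. norm (a' j - b' j)))"
      using chain_dist[OF chain_append[OF 1(1) 2(1)]] unfolding chain_append_sum .
    also have "\<dots> \<le> ennreal (x + y + e)" using 1 2 by (intro ennreal_leI) simp
    also have "\<dots> = sd p q + sd q r + ennreal e" using x y e by (simp add: ennreal_plus)
    finally show "sd p r \<le> sd p q + sd q r + ennreal e" .
  qed
qed auto

lemma sd_self: "p \<in> surface T \<Longrightarrow> sd p p = 0"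
  using surface_rep[of p] dist_fragment by fastforce

lemma chain_finite: "chain n k a b p q \<Longrightarrow> sd p q < top"
  using chain_dist[of n k a b p q] by (metis ennreal_less_top le_less_trans)

section \<open>Shortest paths as isometric curves\<close>

text \<open>In \<open>ennreal\<close> a path of infinite length between points at infinite distance
  would count as shortest. This cannot happen: the set of points reachable by chains is open and
  closed, and the image of a path is connected.\<close>

lemma path_dist_finite:
  assumes "\<gamma> \<in> paths_between T p q" shows "sd p q < top"
proof -
  define W where "W = {q \<in> surface T. \<exists>n k a b. chain n k a b p q}"
  have g: "pathin (surface_topology T) \<gamma>" "\<gamma> 0 = p" "\<gamma> 1 = q" using assms by (auto simp: paths_between_def)
  have mem: "\<gamma> s \<in> surface T" if "s \<in> {0..1}" for s
    using g(1) that unfolding pathin_def continuous_map by (auto simp: topspace_surface_topology)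
  have step: "cls (k, y) \<in> W" if kxy: "k < N" "x \<in> Fr k" "y \<in> Fr k" "cls (k, x) \<in> W" for k x y
  proof -
    obtain n k' a b where "chain n k' a b p (cls (k, x))" using kxy(4) by (auto simp: W_def)
    from chain_append[OF this chain_single[OF kxy(1-3)]] show ?thesis
      using kxy cls_mem unfolding W_def by blast
  qed
  have pW: "p \<in> W"
  proof -
    obtain k z where "k < N" "z \<in> Fr k" "p = cls (k, z)" using surface_rep[OF mem[of 0]] g(2) by auto
    then show ?thesis unfolding W_def using chain_single cls_mem by blast
  qed
  \<comment> \<open>A set that contains every fragment it meets has a union of whole fragments as
    its preimage, hence is open. This applies to \<open>W\<close> and to its complement.\<close>
  have op: "openin (surface_topology T) U"
    if U: "U \<subseteq> surface T" "\<And>k x y. k < N \<Longrightarrow> x \<in> Fr k \<Longrightarrow> y \<in> Fr k \<Longrightarrow> cls (k, x) \<in> U \<Longrightarrow> cls (k, y) \<in> U" for U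
    unfolding openin_surface_topology
  proof (intro conjI U(1))
    define K where "K = {k. k < N \<and> (\<exists>x \<in> Fr k. cls (k, x) \<in> U)}"
    have "{x \<in> fragment_points T. cls x \<in> U} = Sigma {..<N} (\<lambda>k. if k \<in> K then Fr k else {})"
    proof -
      have *: "cls (k, x) \<in> U \<longleftrightarrow> k \<in> K" if "k < N" "x \<in> Fr k" for k x
        using U(2) that unfolding K_def by blast
      have "(k, x) \<in> {x \<in> fragment_points T. cls x \<in> U} \<longleftrightarrow> (k, x) \<in> Sigma {..<N} (\<lambda>k. if k \<in> K then Fr k else {})" for k x
        using *[of k x] by (simp add: fragment_points_def) blast
      then show ?thesis by (simp only: set_eq_iff split_paired_All) blast
    qed
    moreover have "openin (fragment_topology T) \<dots>"
      unfolding fragment_topology_def openin_disjoint_union by simp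
    ultimately show "openin (fragment_topology T) {x \<in> fragment_points T. cls x \<in> U}" by simp
  qed
  have W1: "openin (surface_topology T) W" 
  proof (rule op)
    show "W \<subseteq> surface T" by (auto simp: W_def)
  qed (rule step)
  have W2: "openin (surface_topology T) (surface T - W)"
  proof (rule op)
    show "cls (k, y) \<in> surface T - W" if "k < N" "x \<in> Fr k" "y \<in> Fr k" "cls (k, x) \<in> surface T - W" for k x y
      using that step[of k y x] cls_mem by (meson DiffD2 DiffI)
  qed blast
  have "connectedin (surface_topology T) (\<gamma> ` {0..1})"
    using g(1) connectedin_path_image by blast
  then have "\<not> (\<exists>E1 E2. openin (surface_topology T) E1 \<and> openin (surface_topology T) E2 \<and> \<gamma> ` {0..1} \<subseteq> E1 \<union> E2 \<and> E1 \<inter> E2 \<inter> \<gamma> ` {0..1} = {} \<and> E1 \<inter> \<gamma> ` {0..1} \<noteq> {} \<and> E2 \<inter> \<gamma> ` {0..1} \<noteq> {})"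
    unfolding connectedin by blast
  moreover have "\<gamma> ` {0..1} \<subseteq> W \<union> (surface T - W)" using mem by blast
  moreover have "W \<inter> \<gamma> ` {0..1} \<noteq> {}" using pW g(2) by force
  ultimately have "(surface T - W) \<inter> \<gamma> ` {0..1} = {}" using W1 W2 by blast
  then have "q \<in> W" using mem[of 1] g(3) by force
  then show ?thesis using chain_finite by (auto simp: W_def)
qed

text \<open>\<open>cl j\<close> clamps a parameter to the \<open>j\<close>-th interval. Pieces
  outside \<open>[u, v]\<close> then contribute zero, and one sum serves all positions of
  \<open>u\<close> and \<open>v\<close>.\<close>

lemma subdivision_dist:
  assumes s: "fragment_subdivision T \<gamma> n t k \<sigma>" and uv: "0 \<le> u" "u \<le> v" "v \<le> 1"
  defines "cl \<equiv> (\<lambda>j x. max (t j) (min (t (Suc j)) x))"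
  shows "sd (\<gamma> u) (\<gamma> v) \<le> (\<Sum>j<n. ennreal (dist (\<sigma> j (cl j u)) (\<sigma> j (cl j v))))"
proof -
  have st: "t j < t (Suc j)" "k j < N" if "j < n" for j
      using s that unfolding fragment_subdivision_def by auto
  have st': "\<sigma> j x \<in> Fr (k j)" "\<gamma> x = cls (k j, \<sigma> j x)" if "j < n" "x \<in> {t j..t (Suc j)}" for j x
      using s that unfolding fragment_subdivision_def by auto
  have t01: "t 0 = 0" "t n = 1" using s unfolding fragment_subdivision_def by auto
  have n: "n > 0" using t01 by (metis gr0I zero_neq_one)
  define w where "w m = max u (min v (t m))" for m
  have "\<gamma> u \<in> surface T"
  proof -
    have "\<exists>j<n. u \<in> {t j..t (Suc j)}"
    proof -
      define j where "j = (LEAST j. u \<le> t (Suc j))"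
      have "u \<le> t (Suc (n - 1))" using t01 uv n by simp
      then have 1: "u \<le> t (Suc j)" "j \<le> n - 1" unfolding j_def by (rule LeastI, rule Least_le)
      have "t j \<le> u"
      proof (cases j)
        case (Suc i)
        then have "\<not> u \<le> t (Suc i)" using not_less_Least[of i "\<lambda>j. u \<le> t (Suc j)"] by (simp add: j_def)
        then show ?thesis using Suc by simp
      qed (use t01 uv in simp)
      then show ?thesis using 1 n by (intro exI[of _ j]) auto
    qed
    then show ?thesis using st' st cls_mem by metis
  qed
  have "sd (\<gamma> u) (\<gamma> (w m)) \<le> (\<Sum>j<m. ennreal (dist (\<sigma> j (cl j u)) (\<sigma> j (cl j v)))) \<and> \<gamma> (w m) \<in> surface T" if "m \<le> n" for m
    using that
  proof (induction m)
    case 0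
    then show ?case using \<open>\<gamma> u \<in> surface T\<close> uv t01 sd_self by (simp add: w_def)
  next
    case (Suc m)
    then have m: "m < n" by simp
    have "sd (\<gamma> (w m)) (\<gamma> (w (Suc m))) \<le> ennreal (dist (\<sigma> m (cl m u)) (\<sigma> m (cl m v))) \<and> \<gamma> (w (Suc m)) \<in> surface T"
    proof (cases "w m = w (Suc m)")
      case True
      then show ?thesis using Suc sd_self by simp
    next
      case False
      then have "w m = cl m u" "w (Suc m) = cl m v" "w m \<in> {t m..t (Suc m)}" "w (Suc m) \<in> {t m..t (Suc m)}"
        using st(1)[OF m] uv unfolding w_def cl_def by (auto simp: max_def min_def split: if_splits)
      then show ?thesis using st'[OF m] st(2)[OF m] dist_fragment cls_mem by (metis dist_norm)
    qed
    then show ?case using Suc sd_triangle[of "\<gamma> u" "\<gamma> (w (Suc m))" "\<gamma> (w m)"] m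
      by (auto intro: order_trans add_mono)
  qed
  from this[of n] show ?thesis using uv t01 by (simp add: w_def)
qed

text \<open>The bound holds for each subdivision separately, even if \<open>u\<close> and
  \<open>v\<close> are not among its points; this is what makes it pass to the infimum in
  \<open>path_length\<close>.\<close>

lemma subdivision_split:
  assumes s: "fragment_subdivision T \<gamma> n t k \<sigma>" and uv: "0 \<le> u" "u \<le> v" "v \<le> 1"
  shows "sd (\<gamma> 0) (\<gamma> u) + sd (\<gamma> u) (\<gamma> v) + sd (\<gamma> v) (\<gamma> 1) \<le> (\<Sum>j<n. curve_length (\<sigma> j) (t j) (t (Suc j)))"
proof -
  define cl where "cl = (\<lambda>j x. max (t j) (min (t (Suc j)) x))"
  have t01: "t 0 = 0" "t n = 1" using s unfolding fragment_subdivision_def by auto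
  have tj: "t j < t (Suc j)" if "j < n" for j using s that unfolding fragment_subdivision_def by auto
  have tm: "0 \<le> t m" "m \<le> n \<Longrightarrow> t m \<le> 1" if "m \<le> n" for m
  proof -
    show "0 \<le> t m" using that
    proof (induction m)
      case (Suc m) then show ?case using tj[of m] by simp
    qed (simp add: t01)
    show "t m \<le> 1" using that
    proof (induction rule: inc_induct)
      case (step m) then show ?case using tj[of m] by simp
    qed (simp add: t01)
  qed
  have "sd (\<gamma> 0) (\<gamma> u) + sd (\<gamma> u) (\<gamma> v) + sd (\<gamma> v) (\<gamma> 1) \<le>
    (\<Sum>j<n. ennreal (dist (\<sigma> j (cl j 0)) (\<sigma> j (cl j u)))) + (\<Sum>j<n. ennreal (dist (\<sigma> j (cl j u)) (\<sigma> j (cl j v))))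
     + (\<Sum>j<n. ennreal (dist (\<sigma> j (cl j v)) (\<sigma> j (cl j 1))))"
    unfolding cl_def by (intro add_mono subdivision_dist[OF s]) (use uv in auto)
  also have "\<dots> = (\<Sum>j<n. ennreal (dist (\<sigma> j (cl j 0)) (\<sigma> j (cl j u))) + ennreal (dist (\<sigma> j (cl j u)) (\<sigma> j (cl j v)))
     + ennreal (dist (\<sigma> j (cl j v)) (\<sigma> j (cl j 1))))"
    by (simp only: sum.distrib)
  also have "\<dots> \<le> (\<Sum>j<n. curve_length (\<sigma> j) (t j) (t (Suc j)))"
  proof (rule sum_mono)
    fix j assume "j \<in> {..<n}"
    then have "cl j 0 = t j" "cl j 1 = t (Suc j)" "t j \<le> cl j u" "cl j u \<le> cl j v" "cl j v \<le> t (Suc j)"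
      using tj[of j] tm[of j] tm[of "Suc j"] uv by (auto simp: cl_def)
    then show "ennreal (dist (\<sigma> j (cl j 0)) (\<sigma> j (cl j u))) + ennreal (dist (\<sigma> j (cl j u)) (\<sigma> j (cl j v)))
     + ennreal (dist (\<sigma> j (cl j v)) (\<sigma> j (cl j 1))) \<le> curve_length (\<sigma> j) (t j) (t (Suc j))"
      using curve_length_ge3[of "t j" "cl j u" "cl j v" "t (Suc j)" "\<sigma> j"] by simp
  qed
  finally show ?thesis .
qed

end

lemma finite_pos_bound:
  fixes P :: "'a \<Rightarrow> real \<Rightarrow> bool"
  assumes "finite A" "\<And>x. x \<in> A \<Longrightarrow> \<exists>d>0. P x d" "\<And>x d d'. P x d \<Longrightarrow> d' \<le> d \<Longrightarrow> P x d'"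
  shows "\<exists>d>0. \<forall>x\<in>A. P x d"
  using assms(1,2)
proof (induction A rule: finite_induct)
  case empty
  then show ?case by (auto intro: exI[of _ 1])
next
  case (insert x A)
  then obtain d d' where "d > 0" "\<forall>y\<in>A. P y d" "d' > 0" "P x d'" by blast
  then show ?case using assms(3) by (intro exI[of _ "min d d'"]) (auto intro: assms(3)[of _ _ "min d d'"])
qed

text \<open>The distances to two points of the line determine the inner product with its direction
  \<open>u\<close>; then the squared distance of \<open>c s\<close> from its expected place comes
  out as zero.\<close>

lemma isometric_line:
  fixes c :: "real \<Rightarrow> complex"
  assumes iso: "\<And>s s'. s \<in> I \<Longrightarrow> s' \<in> I \<Longrightarrow> norm (c s - c s') = \<bar>s - s'\<bar>" and t: "t \<in> I" "s1 \<in> I" "s1 \<noteq> t"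
  shows "\<exists>u. norm u = 1 \<and> (\<forall>s\<in>I. c s = c t + (s - t) *\<^sub>R u)"
proof -
  define u where "u = (1 / (s1 - t)) *\<^sub>R (c s1 - c t)"
  have u1: "norm u = 1" using iso[OF t(2,1)] t by (simp add: u_def)
  have cs1: "c s1 = c t + (s1 - t) *\<^sub>R u" using t by (simp add: u_def)
  have "c s = c t + (s - t) *\<^sub>R u" if s: "s \<in> I" for s
  proof -
    define w where "w = c s - c t"
    define \<tau> \<sigma> where ts: "\<tau> = s1 - t" "\<sigma> = s - t"
    have 1: "(norm w)\<^sup>2 = \<sigma>\<^sup>2" using iso[OF s t(1)] by (simp add: w_def ts)
    have "w - \<tau> *\<^sub>R u = c s - c s1" by (simp add: w_def ts cs1)
    then have "norm (w - \<tau> *\<^sub>R u) = \<bar>\<sigma> - \<tau>\<bar>" using iso[OF s t(2)] by (simp add: ts)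
    then have n2: "(norm (w - \<tau> *\<^sub>R u))\<^sup>2 = (\<sigma> - \<tau>)\<^sup>2" by simp
    have nx: "(norm (w - x *\<^sub>R u))\<^sup>2 = (norm w)\<^sup>2 - 2 * x * (w \<bullet> u) + x\<^sup>2" for x
    proof -
      have uu: "u \<bullet> u = 1" using u1 by (simp add: norm_eq_1)
      have "(norm (w - x *\<^sub>R u))\<^sup>2 = w \<bullet> w - 2 * x * (w \<bullet> u) + x * x * (u \<bullet> u)"
        unfolding power2_norm_eq_inner by (simp add: inner_diff_left inner_diff_right inner_commute[of u w] algebra_simps)
      then show ?thesis unfolding power2_norm_eq_inner[of w] uu by (simp add: power2_eq_square)
    qed
    have "\<tau> * (w \<bullet> u) = \<tau> * \<sigma>" using n2[unfolded nx] 1 by (simp add: power2_diff)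
    then have wu: "w \<bullet> u = \<sigma>" using t by (simp add: ts)
    have "(norm (w - \<sigma> *\<^sub>R u))\<^sup>2 = 0"
      unfolding nx using 1 wu by (simp add: power2_eq_square)
    then show ?thesis by (simp add: w_def ts algebra_simps)
  qed
  then show ?thesis using u1 by blast
qed

context tri_portalgon
begin

text \<open>Local lower bounds for the distance come from truncated minima of \<open>1\<close>-Lipschitz functions that are
  compatible with the gluing below the truncation level.\<close>

lemma local_dist:
  fixes S :: "nat \<Rightarrow> (complex \<Rightarrow> real) set"
  assumes fin: "\<And>k. finite (S k)" and lip: "\<And>k g x y. g \<in> S k \<Longrightarrow> \<bar>g x - g y\<bar> \<le> norm (x - y)"
    and nn: "\<And>k g x. g \<in> S k \<Longrightarrow> 0 \<le> g x"
    and inv: "\<And>k z k' z' g. ((k, z), (k', z')) \<in> glue T \<Longrightarrow> g \<in> S k \<Longrightarrow> g z < \<rho> \<Longrightarrow> \<exists>g'\<in>S k'. g' z' \<le> g z"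
    and g0: "g0 \<in> S k0" "g0 z0 = 0" and r: "0 \<le> r" "r < \<rho>"
    and d: "sd (cls (k0, z0)) (cls (k1, z1)) \<le> ennreal r"
  shows "\<exists>g\<in>S k1. g z1 \<le> r"
proof -
  define M where "M x = insert \<rho> ((\<lambda>g. g (snd x)) ` S (fst x))" for x :: "nat \<times> complex"
  define f where "f x = Min (M x)" for x
  have fM: "finite (M x)" "M x \<noteq> {}" for x by (simp_all add: M_def fin)
  have le: "f y \<le> f x" if xy: "(x, y) \<in> glue T" for x y
  proof -
    have "f x \<in> M x" unfolding f_def by (rule Min_in) (use fM in auto)
    then consider "f x \<ge> \<rho>" | g where "g \<in> S (fst x)" "f x = g (snd x)" "f x < \<rho>" unfolding M_def by fastforce
    then show ?thesis
    proof cases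
      case 1
      have "f y \<le> \<rho>" unfolding f_def by (rule Min_le) (auto simp: fM M_def fin)
      then show ?thesis using 1 by simp
    next
      case 2
      obtain g' where "g' \<in> S (fst y)" "g' (snd y) \<le> g (snd x)"
        using inv[of "fst x" "snd x" "fst y" "snd y" g] xy 2 by (metis prod.collapse)
      then have "f y \<le> g' (snd y)" unfolding f_def by (intro Min_le) (auto simp: M_def fin)
      then show ?thesis using \<open>g' (snd y) \<le> g (snd x)\<close> 2 by simp
    qed
  qed
  have "ennreal \<bar>f (k0, z0) - f (k1, z1)\<bar> \<le> sd (cls (k0, z0)) (cls (k1, z1))"
  proof (rule lipschitz_dist)
    show "f x = f y" if "(x, y) \<in> glue T" for x y
      using le[OF that] le[of y x] that glue_sym by (auto dest: symD)
    have half: "f (k, x) \<le> f (k, y) + norm (x - y)" for k x y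
    proof -
      have "f (k, y) \<in> M (k, y)" unfolding f_def by (rule Min_in) (use fM in auto)
      then consider "f (k, y) = \<rho>" | g where "g \<in> S k" "f (k, y) = g y" unfolding M_def by auto
      then show ?thesis
      proof cases
        case 1
        have "f (k, x) \<le> \<rho>" unfolding f_def by (rule Min_le) (auto simp: M_def fin)
        then show ?thesis using 1 by (smt (verit) norm_ge_zero)
      next
        case 2
        have "f (k, x) \<le> g x" unfolding f_def by (rule Min_le) (use 2 in \<open>auto simp: M_def fin\<close>)
        then show ?thesis using 2 lip[OF 2(1), of x y] by linarith
      qed
    qed
    show "\<bar>f (k, x) - f (k, y)\<bar> \<le> norm (x - y)" for k x y
      using half[of k x y] half[of k y x] by (simp add: norm_minus_commute)
  qed
  also note d
  finally have "\<bar>f (k0, z0) - f (k1, z1)\<bar> \<le> r" using r by simp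
  moreover have "f (k0, z0) \<le> 0"
    unfolding f_def by (rule Min_le) (use g0 in \<open>auto simp: M_def fin intro: image_eqI[where x = g0]\<close>)
  ultimately have "f (k1, z1) \<le> r" by linarith
  moreover have "f (k1, z1) \<in> M (k1, z1)" unfolding f_def by (rule Min_in) (use fM in auto)
  ultimately show ?thesis using r unfolding M_def by auto
qed

lemma dep_dist: "fst a \<in> edges T \<Longrightarrow> norm (dep a u - dep a v) = \<bar>u - v\<bar> * edge_length T (fst a)"
proof -
  assume a: "fst a \<in> edges T"
  have "dep a u - dep a v = (u - v) *\<^sub>R (dep a 1 - dep a 0)"
    by (subst dep_lin[OF a, of u], subst dep_lin[OF a, of v]) (simp add: algebra_simps)
  then show ?thesis using dep_norm[OF a] by simp
qed

lemma dep_flip: "fst a \<in> edges T \<Longrightarrow> dep (fst a, \<not> snd a) u = dep a (1 - u)"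
  by (cases a) (auto simp: edges_iff dep_eq)

lemma edges_finite: "finite (edges T)"
proof -
  have "edges T \<subseteq> {..<N} \<times> {..<3}" using edges_iff by auto
  then show ?thesis by (rule finite_subset) auto
qed

text \<open>For a boundary point with parameter \<open>v0\<close>, gluing keeps the parameter or,
  through the direction flags, replaces it by \<open>1 - v0\<close>; at corners only 0 and 1 occur.
  Finitely many edges with four parameters cover the class.\<close>

lemma fiber_finite:
  assumes k: "k0 < N" "z0 \<in> Fr k0" shows "finite {x. cls x = cls (k0, z0)}"
proof (cases "\<forall>i<3. 0 < ec k0 i z0")
  case True
  then have "{x. cls x = cls (k0, z0)} \<subseteq> {(k0, z0)}" using cls_interior[OF k(1)] by (metis (mono_tags) mem_Collect_eq singletonI subsetI)
  then show ?thesis by (rule finite_subset) simp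
next
  case False
  then obtain i where i: "i < 3" "ec k0 i z0 = 0" using k Fr_iff by (metis order_le_less)
  obtain v0 where v0: "z0 = dep ((k0, i), False) v0" "v0 \<in> {0..1}" using on_edge_Fr[OF k(1) i(1) k(2) i(2)] by blast
  define U where "U = {v0, 1 - v0, 0, 1}"
  define W where "W = (\<lambda>(e, r, v). (fst e, dep (e, r) v)) ` (edges T \<times> UNIV \<times> U)"
  have WI: "(fst (fst c), dep c v) \<in> W" if "fst c \<in> edges T" "v \<in> U" for c v
    unfolding W_def by (rule image_eqI[of _ _ "(fst c, snd c, v)"]) (use that in auto)
  have "x \<in> W" if x: "cls (k0, z0) = cls x" for x
  proof (rule cls_closed[OF _ _ x])
    show "(k0, z0) \<in> W" using WI[of "((k0, i), False)" v0] v0 i k by (simp add: edges_iff U_def)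
    fix x y assume "x \<in> W" and g: "(x, y) \<in> glue T"
    then obtain c v where c: "x = (fst (fst c), dep c v)" "fst c \<in> edges T" "v \<in> U"
      unfolding W_def by (auto simp: split_beta)
    obtain e a b u where e: "e \<in> portals T" "a \<in> e" "b \<in> e" "u \<in> {0..1}" "x = (fst (fst a), dep a u)" "y = (fst (fst b), dep b u)"
      by (rule glueE[OF g])
    have "u \<in> U"
    proof (cases "u = 0 \<or> u = 1")
      case False
      then have u: "0 < u" "u < 1" using e(4) by auto
      have v: "v \<in> {0..1}" "1 - v \<in> {0..1}" using c(3) v0(2) by (auto simp: U_def)
      have 1: "fst (fst a) = fst (fst c)" "dep a u = dep c v" using c(1) e(5) by auto
      have f: "fst a = fst c" by (rule dep_eq_edge(1)[OF portal_edge[OF e(1,2)] c(2) 1 u v(1)])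
      have "u = v \<or> u = 1 - v"
      proof (cases "snd a = snd c")
        case True
        then show ?thesis using dep_eq_edge(2)[OF portal_edge[OF e(1,2)] c(2) 1 u v(1)] by simp
      next
        case False
        then have "snd a = snd (fst c, \<not> snd c)" by auto
        moreover have "dep a u = dep (fst c, \<not> snd c) (1 - v)" using 1 dep_flip[OF c(2)] by simp
        ultimately show ?thesis using dep_eq_edge(2)[OF portal_edge[OF e(1,2)], of "(fst c, \<not> snd c)" u "1 - v"] c(2) 1(1) u v(2) by simp
      qed
      then show ?thesis using c(3) by (auto simp: U_def)
    qed (auto simp: U_def)
    then show "y \<in> W" using WI[of b u] portal_edge e by simp
  qed
  then have "{x. cls x = cls (k0, z0)} \<subseteq> W" by auto
  then show ?thesis by (rule finite_subset) (auto simp: W_def U_def edges_finite)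
qed

text \<open>\<open>local_dist\<close> is applied to the distances from the finitely many
  representatives of \<open>p\<close>. An edge point closer than \<open>\<rho>\<close> to a
  representative lies on an edge through it, and gluing that edge carries both along without
  changing their distance.\<close>

lemma sd_zero:
  assumes "p \<in> surface T" "q \<in> surface T" "sd p q = 0" shows "p = q"
proof -
  obtain k0 z0 where 0: "k0 < N" "z0 \<in> Fr k0" "p = cls (k0, z0)" using surface_rep[OF assms(1)] by auto
  obtain k1 z1 where 1: "k1 < N" "z1 \<in> Fr k1" "q = cls (k1, z1)" using surface_rep[OF assms(2)] by auto
  define R where "R = {x. cls x = cls (k0, z0)}"
  have finR: "finite R" unfolding R_def by (rule fiber_finite[OF 0(1,2)])
  define Q where "Q k x i d \<longleftrightarrow> (k < N \<longrightarrow> ec k i x \<noteq> 0 \<longrightarrow> (\<forall>z\<in>Fr k. ec k i z = 0 \<longrightarrow> d \<le> dist x z))" for k x i d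
  have "\<exists>d>0. \<forall>y \<in> R \<times> {..<3}. Q (fst (fst y)) (snd (fst y)) (snd y) d"
  proof (rule finite_pos_bound)
    fix y :: "(nat \<times> complex) \<times> nat" assume "y \<in> R \<times> {..<3}"
    define k x i where y: "k = fst (fst y)" "x = snd (fst y)" "i = snd y"
    have "\<exists>d>0. Q k x i d"
    proof (cases "k < N \<and> ec k i x \<noteq> 0")
      case True
      have "closed (Fr k \<inter> (ec k i -` {0}))"
        by (intro continuous_closed_preimage ec_cont compact_imp_closed Fr_compact) (use True in auto)
      moreover have "x \<notin> Fr k \<inter> (ec k i -` {0})" using True by auto
      ultimately have "\<exists>d>0. \<forall>z\<in>Fr k \<inter> (ec k i -` {0}). d \<le> dist x z" by (rule separate_point_closed)
      then obtain d where d: "d > 0" "\<forall>z\<in>Fr k \<inter> (ec k i -` {0}). d \<le> dist x z" by (elim exE conjE)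
      have "Q k x i d" unfolding Q_def using d(2) by simp
      then show ?thesis using d(1) by (intro exI[of _ d] conjI)
    qed (auto simp: Q_def intro: exI[of _ 1])
    then show "\<exists>d>0. Q (fst (fst y)) (snd (fst y)) (snd y) d" by (simp add: y)
  next
    show "Q (fst (fst y)) (snd (fst y)) (snd y) d'" if "Q (fst (fst y)) (snd (fst y)) (snd y) d" "d' \<le> d"
      for y :: "(nat \<times> complex) \<times> nat" and d d' :: real
      using that unfolding Q_def by (meson order_trans)
  qed (use finR in auto)
  then obtain \<rho> where \<rho>0: "\<rho> > 0" "\<And>y. y \<in> R \<times> {..<3} \<Longrightarrow> Q (fst (fst y)) (snd (fst y)) (snd y) \<rho>" by blast
  have \<rho>: "\<rho> > 0" "\<And>k x i z. (k, x) \<in> R \<Longrightarrow> i < 3 \<Longrightarrow> k < N \<Longrightarrow> ec k i x \<noteq> 0 \<Longrightarrow> z \<in> Fr k \<Longrightarrow> ec k i z = 0 \<Longrightarrow> \<rho> \<le> dist x z"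
  proof -
    show "\<rho> \<le> dist x z" if "(k, x) \<in> R" "i < 3" "k < N" "ec k i x \<noteq> 0" "z \<in> Fr k" "ec k i z = 0" for k x i z
      using \<rho>0(2)[of "((k, x), i)"] that by (simp add: Q_def)
  qed (rule \<rho>0(1))
  define S where "S k = (\<lambda>x z. norm (z - x)) ` {x. (k, x) \<in> R \<and> x \<in> Fr k}" for k
  have "\<exists>g\<in>S k1. g z1 \<le> 0"
  proof (rule local_dist[of S \<rho> "\<lambda>z. norm (z - z0)" k0 z0 0 k1 z1])
    show "finite (S k)" for k
    proof -
      have "{x. (k, x) \<in> R \<and> x \<in> Fr k} \<subseteq> snd ` R" by force
      then show ?thesis unfolding S_def using finR finite_subset by blast
    qed
    show "\<bar>g x - g y\<bar> \<le> cmod (x - y)" if g: "g \<in> S k" for k g x y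
    proof -
      obtain w where "g = (\<lambda>z. norm (z - w))" using g by (auto simp: S_def)
      then show ?thesis using norm_triangle_ineq3[of "x - w" "y - w"] by simp
    qed
    show "0 \<le> g x" if "g \<in> S k" for k g x using that by (auto simp: S_def)
    show "(\<lambda>z. cmod (z - z0)) \<in> S k0" using 0 by (auto simp: S_def R_def)
    show "sd (cls (k0, z0)) (cls (k1, z1)) \<le> ennreal 0" using assms(3) 0 1 by simp
    fix k z k' z' g assume gl: "((k, z), (k', z')) \<in> glue T" and g: "g \<in> S k" "g z < \<rho>"
    obtain x where x: "(k, x) \<in> R" "x \<in> Fr k" "g = (\<lambda>z. norm (z - x))" using g by (auto simp: S_def)
    obtain e a b u where e: "e \<in> portals T" "a \<in> e" "b \<in> e" "u \<in> {0..1}" "(k, z) = (fst (fst a), dep a u)" "(k', z') = (fst (fst b), dep b u)"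
      by (rule glueE[OF gl])
    obtain i r where a: "a = ((k, i), r)" using e(5) by (metis fst_conv prod.exhaust)
    have ki: "k < N" "i < 3" using portal_edge[OF e(1,2)] by (auto simp: a edges_iff)
    have z: "z \<in> Fr k" "ec k i z = 0" using dep_Fr[OF portal_edge[OF e(1,2)] e(4)] e(5) ec_dep[OF ki] by (auto simp: a)
    have "ec k i x = 0" using \<rho>(2)[OF x(1) ki(2,1) _ z] g(2) x(3) by (auto simp: dist_norm norm_minus_commute)
    then obtain v where v: "x = dep a v" "v \<in> {0..1}" using on_edge_Fr[OF ki x(2), where r = r] a by auto
    have "((k, x), (k', dep b v)) \<in> glue T" using glueI[OF e(1-3) v(2)] e(5,6) v(1) by simp
    then have "(k', dep b v) \<in> R" using glue_cls x(1) unfolding R_def by (metis mem_Collect_eq)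
    moreover have "dep b v \<in> Fr k'" using dep_Fr[OF portal_edge[OF e(1,3)] v(2)] e(6) by simp
    ultimately have "(\<lambda>z. norm (z - dep b v)) \<in> S k'" by (auto simp: S_def)
    moreover have "norm (z' - dep b v) = g z"
      using e(5,6) v x dep_dist portal_edge e(1-3) portal_len[OF e(1-3)] by simp
    ultimately show "\<exists>g'\<in>S k'. g' z' \<le> g z" by (metis order_refl)
  qed (use \<rho> in auto)
  then obtain x where "(k1, x) \<in> R" "norm (z1 - x) \<le> 0" by (auto simp: S_def)
  then show ?thesis using 0 1 by (simp add: R_def)
qed

section \<open>Charts\<close>

definition geod :: "real \<Rightarrow> (real \<Rightarrow> surface_point) \<Rightarrow> bool" where
  "geod L \<Gamma> \<longleftrightarrow> 0 \<le> L \<and> (\<forall>s\<in>{0..L}. \<Gamma> s \<in> surface T) \<and>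
     (\<forall>s\<in>{0..L}. \<forall>s'\<in>{0..L}. sd (\<Gamma> s) (\<Gamma> s') = ennreal \<bar>s - s'\<bar>)"

text \<open>Rigid placements of fragments that unroll a neighbourhood of \<open>x0\<close>; one
  fragment may be placed twice. Near \<open>x0\<close>, gluing leads from each placement to a
  matching one, plane distances dominate surface distances, and placements of the same fragment do
  not compete.\<close>

definition atlas :: "(nat \<times> (complex \<Rightarrow> complex)) set \<Rightarrow> complex \<Rightarrow> real \<Rightarrow> bool" where
  "atlas \<C> x0 \<rho> \<longleftrightarrow> 0 < \<rho> \<and> finite \<C> \<and> (\<forall>(k, \<iota>) \<in> \<C>. k < N \<and> rigid \<iota>) \<and>
     (\<forall>k z k' z' \<iota>. ((k, z), (k', z')) \<in> glue T \<longrightarrow> (k, \<iota>) \<in> \<C> \<longrightarrow> norm (\<iota> z - x0) < \<rho> \<longrightarrow> (\<exists>\<iota>'. (k', \<iota>') \<in> \<C> \<and> \<iota>' z' = \<iota> z)) \<and>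
     (\<forall>k \<iota> z k' \<iota>' z'. (k, \<iota>) \<in> \<C> \<longrightarrow> (k', \<iota>') \<in> \<C> \<longrightarrow> z \<in> Fr k \<longrightarrow> z' \<in> Fr k' \<longrightarrow> norm (\<iota> z - x0) < \<rho> \<longrightarrow> norm (\<iota>' z' - x0) < \<rho> \<longrightarrow>
        sd (cls (k, z)) (cls (k', z')) \<le> ennreal (norm (\<iota> z - \<iota>' z'))) \<and>
     (\<forall>k \<iota> \<iota>' z. (k, \<iota>) \<in> \<C> \<longrightarrow> (k, \<iota>') \<in> \<C> \<longrightarrow> z \<in> Fr k \<longrightarrow> norm (\<iota> z - x0) < \<rho> \<longrightarrow> norm (\<iota>' z - x0) < \<rho> \<longrightarrow> \<iota> z = \<iota>' z)"

text \<open>\<open>local_dist\<close> shows that unrolling does not increase distances, and the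
  atlas bounds them the other way, so the geodesic becomes an isometric curve in the plane. With
  radius \<open>\<rho> / 4\<close> any two of its points are within \<open>\<rho> / 2\<close> of
  each other, the range in which \<open>near\<close> is valid.\<close>

lemma atlas_straight:
  assumes at: "atlas \<C> x0 \<rho>" and geo: "geod L \<Gamma>" and L: "0 < L" and t: "t \<in> {0..L}"
    and z0: "(k0, \<iota>0) \<in> \<C>" "z0 \<in> Fr k0" "\<iota>0 z0 = x0" "\<Gamma> t = cls (k0, z0)"
  shows "\<exists>u. norm u = 1 \<and> (\<forall>s\<in>{0..L}. \<bar>s - t\<bar> < \<rho> / 4 \<longrightarrow>
     (\<exists>k \<iota> z. (k, \<iota>) \<in> \<C> \<and> z \<in> Fr k \<and> \<iota> z = x0 + (s - t) *\<^sub>R u \<and> \<Gamma> s = cls (k, z)))"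
proof -
  have \<rho>: "\<rho> > 0" and fin: "finite \<C>" and cN: "\<And>k \<iota>. (k, \<iota>) \<in> \<C> \<Longrightarrow> k < N \<and> rigid \<iota>"
    and c2: "\<And>k z k' z' \<iota>. ((k, z), (k', z')) \<in> glue T \<Longrightarrow> (k, \<iota>) \<in> \<C> \<Longrightarrow> norm (\<iota> z - x0) < \<rho> \<Longrightarrow> \<exists>\<iota>'. (k', \<iota>') \<in> \<C> \<and> \<iota>' z' = \<iota> z"
    and c3: "\<And>k \<iota> z k' \<iota>' z'. (k, \<iota>) \<in> \<C> \<Longrightarrow> (k', \<iota>') \<in> \<C> \<Longrightarrow> z \<in> Fr k \<Longrightarrow> z' \<in> Fr k' \<Longrightarrow> norm (\<iota> z - x0) < \<rho> \<Longrightarrow> norm (\<iota>' z' - x0) < \<rho> \<Longrightarrow>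
        sd (cls (k, z)) (cls (k', z')) \<le> ennreal (norm (\<iota> z - \<iota>' z'))"
    and c4: "\<And>k \<iota> \<iota>' z. (k, \<iota>) \<in> \<C> \<Longrightarrow> (k, \<iota>') \<in> \<C> \<Longrightarrow> z \<in> Fr k \<Longrightarrow> norm (\<iota> z - x0) < \<rho> \<Longrightarrow> norm (\<iota>' z - x0) < \<rho> \<Longrightarrow> \<iota> z = \<iota>' z"
    using at unfolding atlas_def by blast+
  have G: "\<And>s. s \<in> {0..L} \<Longrightarrow> \<Gamma> s \<in> surface T" "\<And>s s'. s \<in> {0..L} \<Longrightarrow> s' \<in> {0..L} \<Longrightarrow> sd (\<Gamma> s) (\<Gamma> s') = ennreal \<bar>s - s'\<bar>"
    using geo unfolding geod_def by blast+
  have near: "\<exists>\<iota>. (k', \<iota>) \<in> \<C> \<and> norm (\<iota> z' - \<iota>1 z) \<le> r"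
    if c: "(k, \<iota>1) \<in> \<C>" and y: "norm (\<iota>1 z - x0) < \<rho> / 2" and r: "0 \<le> r" "r < \<rho> / 2" and d: "sd (cls (k, z)) (cls (k', z')) \<le> ennreal r"
    for k \<iota>1 z k' z' r
  proof -
    define S where "S k = (\<lambda>\<iota> w. norm (\<iota> w - \<iota>1 z)) ` {\<iota>. (k, \<iota>) \<in> \<C>}" for k
    have "\<exists>g\<in>S k'. g z' \<le> r"
    proof (rule local_dist[of S "\<rho> / 2" "\<lambda>w. norm (\<iota>1 w - \<iota>1 z)" k z r k' z'])
      show "finite (S k)" for k
      proof -
        have "{\<iota>. (k, \<iota>) \<in> \<C>} \<subseteq> snd ` \<C>" by force
        then show ?thesis unfolding S_def using fin finite_subset by blast
      qed
      show "\<bar>g x - g y\<bar> \<le> cmod (x - y)" if g: "g \<in> S k" for k g x y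
      proof -
        obtain \<iota> where i: "(k, \<iota>) \<in> \<C>" "g = (\<lambda>w. norm (\<iota> w - \<iota>1 z))" using g by (auto simp: S_def)
        then have "norm (\<iota> x - \<iota> y) = norm (x - y)" using rigid_norm cN by blast
        then show ?thesis using norm_triangle_ineq3[of "\<iota> x - \<iota>1 z" "\<iota> y - \<iota>1 z"] i by simp
      qed
      show "0 \<le> g x" if "g \<in> S k" for k g x using that by (auto simp: S_def)
      show "(\<lambda>w. norm (\<iota>1 w - \<iota>1 z)) \<in> S k" using c by (auto simp: S_def)
      fix k z2 k' z2' g assume gl: "((k, z2), (k', z2')) \<in> glue T" and g: "g \<in> S k" "g z2 < \<rho> / 2"
      obtain \<iota> where i: "(k, \<iota>) \<in> \<C>" "g = (\<lambda>w. norm (\<iota> w - \<iota>1 z))" using g by (auto simp: S_def)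
      have "norm (\<iota> z2 - x0) < \<rho>" using g(2) y i(2) norm_triangle_ineq[of "\<iota> z2 - \<iota>1 z" "\<iota>1 z - x0"] by simp
      then obtain \<iota>' where "(k', \<iota>') \<in> \<C>" "\<iota>' z2' = \<iota> z2" using c2[OF gl i(1)] by blast
      then show "\<exists>g'\<in>S k'. g' z2' \<le> g z2" unfolding S_def i by force
    qed (use r d in auto)
    then show ?thesis by (auto simp: S_def)
  qed
  define I where "I = {s\<in>{0..L}. \<bar>s - t\<bar> < \<rho> / 4}"
  have "\<exists>k \<iota> z. (k, \<iota>) \<in> \<C> \<and> z \<in> Fr k \<and> norm (\<iota> z - x0) \<le> \<bar>s - t\<bar> \<and> \<Gamma> s = cls (k, z)" if s: "s \<in> I" for s
  proof -
    obtain k z where kz: "k < N" "z \<in> Fr k" "\<Gamma> s = cls (k, z)" using surface_rep G(1) s by (metis (no_types, lifting) I_def mem_Collect_eq)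
    have "sd (cls (k0, z0)) (cls (k, z)) \<le> ennreal \<bar>s - t\<bar>" using G(2)[of t s] t s kz z0 by (simp add: I_def abs_minus_commute)
    then obtain \<iota> where "(k, \<iota>) \<in> \<C>" "norm (\<iota> z - \<iota>0 z0) \<le> \<bar>s - t\<bar>"
      using near[OF z0(1), of z0 "\<bar>s - t\<bar>" k z] s \<rho> z0(3) by (auto simp: I_def)
    then show ?thesis using kz z0(3) by blast
  qed
  then obtain K J Z where KJZ: "\<And>s. s \<in> I \<Longrightarrow> (K s, J s) \<in> \<C> \<and> Z s \<in> Fr (K s) \<and> norm (J s (Z s) - x0) \<le> \<bar>s - t\<bar> \<and> \<Gamma> s = cls (K s, Z s)"
    by metis
  define c where "c s = J s (Z s)" for s
  have tI: "t \<in> I" using t \<rho> by (simp add: I_def)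
  have "\<exists>s1\<in>I. s1 \<noteq> t"
  proof (cases "t < L")
    case True
    then show ?thesis using t \<rho> by (intro bexI[of _ "min L (t + \<rho> / 8)"]) (auto simp: I_def min_def)
  next
    case False
    then show ?thesis using t \<rho> L by (intro bexI[of _ "max 0 (t - \<rho> / 8)"]) (auto simp: I_def max_def)
  qed
  then obtain s1 where s1: "s1 \<in> I" "s1 \<noteq> t" by blast
  have iso: "norm (c s - c s') = \<bar>s - s'\<bar>" if ss: "s \<in> I" "s' \<in> I" for s s'
  proof -
    have d: "sd (cls (K s, Z s)) (cls (K s', Z s')) = ennreal \<bar>s - s'\<bar>" using G(2)[of s s'] KJZ[OF ss(1)] KJZ[OF ss(2)] ss by (auto simp: I_def)
    have n: "norm (c s - x0) < \<rho> / 4" "norm (c s' - x0) < \<rho> / 4" using KJZ[OF ss(1)] KJZ[OF ss(2)] ss by (auto simp: I_def c_def)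
    have "\<bar>s - t\<bar> < \<rho> / 4" "\<bar>s' - t\<bar> < \<rho> / 4" using ss by (simp_all add: I_def)
    then have "\<bar>s - s'\<bar> < \<rho> / 2" by arith
    then obtain \<iota> where i: "(K s', \<iota>) \<in> \<C>" "norm (\<iota> (Z s') - c s) \<le> \<bar>s - s'\<bar>"
      using near[of "K s" "J s" "Z s" "\<bar>s - s'\<bar>" "K s'" "Z s'"] KJZ[OF ss(1)] n \<rho> d by (auto simp: c_def)
    have "norm (\<iota> (Z s') - x0) < \<rho>" using i(2) n \<open>\<bar>s - s'\<bar> < \<rho> / 2\<close> norm_triangle_ineq[of "\<iota> (Z s') - c s" "c s - x0"] \<rho> by simp
    \<comment> \<open>The placement found from \<open>s\<close> need not be the one chosen for
      \<open>s'\<close>, but by the last atlas condition both put \<open>Z s'\<close> at the same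
      place.\<close>
    then have "\<iota> (Z s') = c s'" using c4[OF i(1), of "J s'" "Z s'"] KJZ[OF ss(2)] n \<rho> by (simp add: c_def)
    then have 1: "norm (c s - c s') \<le> \<bar>s - s'\<bar>" using i(2) by (simp add: norm_minus_commute)
    have "ennreal \<bar>s - s'\<bar> \<le> ennreal (norm (c s - c s'))"
      unfolding d[symmetric] c_def using KJZ[OF ss(1)] KJZ[OF ss(2)] n \<rho> by (intro c3) (auto simp: c_def)
    then show ?thesis using 1 by simp
  qed
  obtain u where u: "norm u = 1" "\<And>s. s \<in> I \<Longrightarrow> c s = c t + (s - t) *\<^sub>R u" using isometric_line[of I c, OF iso tI s1] by blast
  have "c t = x0" using KJZ[OF tI] by (simp add: c_def)
  then show ?thesis using u KJZ unfolding c_def I_def by (intro exI[of _ u]) (metis (no_types, lifting) mem_Collect_eq)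
qed

end

lemma side_swap: "side q p z = - side p q z"
  unfolding side_def by (simp add: algebra_simps)

context tri_portalgon
begin

lemma sd_sym_le: "sd q p \<le> sd p q"
proof (cases "sd p q")
  case (real x)
  show ?thesis
  proof (rule ennreal_le_epsilon)
    fix e :: real assume e: "0 < e"
    have "sd p q < ennreal (x + e)" using real e by (simp add: ennreal_less_iff)
    then obtain n k a b where c: "chain n k a b p q" "(\<Sum>j<n. norm (a j - b j)) < x + e" using chain_approx by blast
    have "chain n (\<lambda>j. k (n - Suc j)) (\<lambda>j. b (n - Suc j)) (\<lambda>j. a (n - Suc j)) q p"
      unfolding chain_def
    proof (intro conjI allI impI)
      fix j assume j: "Suc j < n"
      have "n - Suc j = Suc (n - Suc (Suc j))" using j by simp
      then show "cls (k (n - Suc j), a (n - Suc j)) = cls (k (n - Suc (Suc j)), b (n - Suc (Suc j)))"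
        using c(1) j unfolding chain_def by (metis Suc_lessD diff_less_Suc diff_less zero_less_Suc)
    qed (use c(1) in \<open>auto simp: chain_def\<close>)
    then have "sd q p \<le> ennreal (\<Sum>j<n. norm (b (n - Suc j) - a (n - Suc j)))" by (rule chain_dist)
    also have "(\<Sum>j<n. norm (b (n - Suc j) - a (n - Suc j))) = (\<Sum>j<n. norm (a j - b j))"
      using sum.nat_diff_reindex[of "\<lambda>j. norm (b j - a j)" n] by (simp add: norm_minus_commute)
    also have "ennreal \<dots> \<le> ennreal (x + e)" using c(2) by (simp add: ennreal_leI)
    finally show "sd q p \<le> sd p q + ennreal e" using real e by (simp add: ennreal_plus)
  qed
qed simp

lemma sd_sym: "sd p q = sd q p"
  by (rule antisym) (rule sd_sym_le)+

text \<open>Reparametrization by the distance \<open>\<phi>\<close> from \<open>p\<close>.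
  Minimality makes distances additive along \<open>\<gamma>\<close>, continuity makes
  \<open>\<phi>\<close> onto, and parameters with the same \<open>\<phi>\<close> give points at
  distance zero, hence equal points by \<open>sd_zero\<close>.\<close>

lemma shortest_path_geod:
  assumes "\<gamma> \<in> shortest_paths T p q"
  obtains L \<Gamma> where "geod L \<Gamma>" "\<Gamma> ` {0..L} = \<gamma> ` {0..1}"
proof -
  have \<gamma>: "\<gamma> \<in> paths_between T p q" and len: "path_length T \<gamma> = sd p q" using assms by (auto simp: shortest_paths_def)
  have ends: "\<gamma> 0 = p" "\<gamma> 1 = q" using \<gamma> by (auto simp: paths_between_def)
  have mem: "\<gamma> s \<in> surface T" if "s \<in> {0..1}" for s
    using \<gamma> that unfolding paths_between_def pathin_def continuous_map by (auto simp: topspace_surface_topology)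
  have fin: "sd p q < top" by (rule path_dist_finite[OF \<gamma>])
  have split: "sd p (\<gamma> u) + sd (\<gamma> u) (\<gamma> v) + sd (\<gamma> v) q \<le> sd p q" if "0 \<le> u" "u \<le> v" "v \<le> 1" for u v
    unfolding len[symmetric] path_length_def
    by (rule Inf_greatest) (use subdivision_split[OF _ that] ends in auto)
  have fins: "sd p (\<gamma> u) < top \<and> sd (\<gamma> u) (\<gamma> v) < top \<and> sd (\<gamma> v) q < top" if "0 \<le> u" "u \<le> v" "v \<le> 1" for u v
    using le_less_trans[OF split[OF that] fin] by (simp add: less_top)
  define \<phi> where "\<phi> s = enn2real (sd p (\<gamma> s))" for s
  define \<psi> where "\<psi> s = enn2real (sd (\<gamma> s) q)" for s
  define D where "D u v = enn2real (sd (\<gamma> u) (\<gamma> v))" for u v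
  define L where "L = enn2real (sd p q)"
  have eL: "sd p q = ennreal L" "L \<ge> 0" using fin by (simp_all add: L_def)
  have e\<phi>: "sd p (\<gamma> s) = ennreal (\<phi> s)" "\<phi> s \<ge> 0" "sd (\<gamma> s) q = ennreal (\<psi> s)" "\<psi> s \<ge> 0" if "s \<in> {0..1}" for s
    using fins[of s s] that by (simp_all add: \<phi>_def \<psi>_def)
  have eD: "sd (\<gamma> u) (\<gamma> v) = ennreal (D u v)" "D u v \<ge> 0" if "0 \<le> u" "u \<le> v" "v \<le> 1" for u v
    using fins[OF that] by (simp_all add: D_def)
  have D\<phi>: "D u v = \<phi> v - \<phi> u" if uv: "0 \<le> u" "u \<le> v" "v \<le> 1" for u v
  proof -
    have m: "u \<in> {0..1}" "v \<in> {0..1}" using uv by auto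
    have "ennreal (\<phi> u + D u v + \<psi> v) \<le> ennreal L"
      using split[OF uv] e\<phi>[OF m(1)] e\<phi>[OF m(2)] eD[OF uv] eL by (simp add: ennreal_plus)
    then have 1: "\<phi> u + D u v + \<psi> v \<le> L" using eL by (simp del: ennreal_plus)
    have "ennreal L \<le> ennreal (\<phi> v + \<psi> v)" using sd_triangle[of p q "\<gamma> v"] e\<phi>[OF m(2)] eL by (simp add: ennreal_plus)
    then have 2: "L \<le> \<phi> v + \<psi> v" using e\<phi>[OF m(2)] by (simp del: ennreal_plus)
    have "ennreal (\<phi> v) \<le> ennreal (\<phi> u + D u v)" using sd_triangle[of p "\<gamma> v" "\<gamma> u"] e\<phi>[OF m(1)] e\<phi>[OF m(2)] eD[OF uv] by (simp add: ennreal_plus)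
    then have 3: "\<phi> v \<le> \<phi> u + D u v" using e\<phi>[OF m(1)] eD[OF uv] by (simp del: ennreal_plus)
    show ?thesis using 1 2 3 by linarith
  qed
  have dist: "sd (\<gamma> u) (\<gamma> v) = ennreal \<bar>\<phi> u - \<phi> v\<bar>" if "u \<in> {0..1}" "v \<in> {0..1}" for u v
  proof (cases "u \<le> v")
    case True
    then show ?thesis using eD[of u v] D\<phi>[of u v] that by simp
  next
    case False
    then show ?thesis using eD[of v u] D\<phi>[of v u] that sd_sym[of "\<gamma> u" "\<gamma> v"] by simp
  qed
  obtain n t k \<sigma> where s: "fragment_subdivision T \<gamma> n t k \<sigma>"
    using fin unfolding len[symmetric] path_length_def Inf_less_iff by blast
  define cl where "cl = (\<lambda>j x. max (t j) (min (t (Suc j)) x))"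
  have cont: "continuous_on {0..1} \<phi>"
    unfolding continuous_on_iff
  proof (intro ballI allI impI)
    fix u e :: real assume u: "u \<in> {0..1}" and e: "0 < e"
    \<comment> \<open>\<open>F\<close> is continuous as a finite sum over the pieces, vanishes at
      \<open>u\<close> and dominates the change of \<open>\<phi>\<close>.\<close>
    define F where "F v = (\<Sum>j<n. dist (\<sigma> j (cl j u)) (\<sigma> j (cl j v)))" for v
    have "continuous_on {0..1} F"
      unfolding F_def
    proof (intro continuous_intros)
      fix j assume "j \<in> {..<n}"
      then have j: "continuous_on {t j..t (Suc j)} (\<sigma> j)" "t j < t (Suc j)" using s unfolding fragment_subdivision_def by auto
      have c: "continuous_on {0..1} (cl j)" unfolding cl_def by (intro continuous_intros)
      have "cl j ` {0..1} \<subseteq> {t j..t (Suc j)}" unfolding cl_def using j(2) by (auto simp: max_def min_def)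
      from continuous_on_compose2[OF j(1) c this] show "continuous_on {0..1} (\<lambda>x. \<sigma> j (cl j x))" .
    qed
    then obtain d where d: "d > 0" "\<And>v. v \<in> {0..1} \<Longrightarrow> dist v u < d \<Longrightarrow> dist (F v) (F u) < e"
      using u e unfolding continuous_on_iff by blast
    have F0: "F u = 0" by (simp add: F_def)
    have le: "\<bar>\<phi> u - \<phi> v\<bar> \<le> F v" if v: "v \<in> {0..1}" for v
    proof -
      have "sd (\<gamma> u) (\<gamma> v) \<le> ennreal (F v)"
      proof (cases "u \<le> v")
        case True
        then show ?thesis using subdivision_dist[OF s, of u v] u v by (simp add: F_def cl_def)
      next
        case False
        then show ?thesis using subdivision_dist[OF s, of v u] u v sd_sym[of "\<gamma> u" "\<gamma> v"] by (simp add: F_def cl_def dist_commute)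
      qed
      moreover have "F v \<ge> 0" by (simp add: F_def sum_nonneg)
      ultimately show ?thesis using dist[OF u v] by simp
    qed
    have "dist (\<phi> v) (\<phi> u) < e" if "v \<in> {0..1}" "dist v u < d" for v
      using d(2)[OF that] le[OF that(1)] F0 by (simp add: dist_real_def)
    then show "\<exists>d>0. \<forall>x'\<in>{0..1}. dist x' u < d \<longrightarrow> dist (\<phi> x') (\<phi> u) < e" using d(1) by blast
  qed
  have \<phi>0: "\<phi> 0 = 0" using sd_self mem[of 0] ends by (simp add: \<phi>_def)
  have \<phi>1: "\<phi> 1 = L" using ends by (simp add: \<phi>_def L_def)
  have range: "\<phi> s \<in> {0..L}" if "s \<in> {0..1}" for s
    using D\<phi>[of 0 s] D\<phi>[of s 1] eD(2)[of 0 s] eD(2)[of s 1] that \<phi>0 \<phi>1 by auto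
  have "\<exists>s. s \<in> {0..1} \<and> \<phi> s = x" if "x \<in> {0..L}" for x
    using IVT'[of \<phi> 0 x 1] cont that \<phi>0 \<phi>1 by auto
  then obtain S where S: "\<And>x. x \<in> {0..L} \<Longrightarrow> S x \<in> {0..1} \<and> \<phi> (S x) = x" by metis
  define \<Gamma> where "\<Gamma> x = \<gamma> (S x)" for x
  have g: "geod L \<Gamma>"
    unfolding geod_def \<Gamma>_def using eL(2) S mem dist by auto
  have "\<Gamma> (\<phi> s) = \<gamma> s" if "s \<in> {0..1}" for s
  proof -
    have "sd (\<Gamma> (\<phi> s)) (\<gamma> s) = 0" using dist[of "S (\<phi> s)" s] S[OF range[OF that]] that by (simp add: \<Gamma>_def)
    then show ?thesis using sd_zero mem S[OF range[OF that]] that by (simp add: \<Gamma>_def)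
  qed
  then have "\<gamma> s \<in> \<Gamma> ` {0..L}" if "s \<in> {0..1}" for s using range[OF that] that by (intro image_eqI[of _ _ "\<phi> s"]) auto
  then have "\<gamma> ` {0..1} \<subseteq> \<Gamma> ` {0..L}" by blast
  moreover have "\<Gamma> ` {0..L} \<subseteq> \<gamma> ` {0..1}" unfolding \<Gamma>_def using S by auto
  ultimately show ?thesis using that[OF g] by blast
qed

lemma geod_reverse: "geod L \<Gamma> \<Longrightarrow> geod L (\<lambda>s. \<Gamma> (L - s))"
  unfolding geod_def by (auto simp: abs_minus_commute)

section \<open>Unfolding across an edge\<close>

lemma ec_side: "k < N \<Longrightarrow> i < 3 \<Longrightarrow> side (dep ((k, i), r) 0) (dep ((k, i), r) 1) z = (if r then -1 else 1) * DD k * ec k i z"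
  using DD[of k] side_swap[of "V k (i+1)" "V k i" z] by (simp add: dep_eq ec_def)

lemma dep_neq: "fst a \<in> edges T \<Longrightarrow> dep a 0 \<noteq> dep a 1"
proof -
  assume "fst a \<in> edges T"
  then obtain k i r where a: "a = ((k, i), r)" "k < N" "i < 3" by (metis edges_iff prod.collapse)
  show ?thesis using ec_dep[OF a(2,3), of r 0] ec_dep[OF a(2,3), of r 1] unfolding a(1) by (cases r) auto
qed

text \<open>The motion from the plane of the triangle of \<open>a\<close> to that of
  \<open>b\<close>. The negative factor \<open>- m\<close> puts the two triangles on opposite sides
  of the common edge, so the motion unfolds them side by side.\<close>

definition glue_map :: "directed_edge \<Rightarrow> directed_edge \<Rightarrow> (complex \<Rightarrow> complex) \<Rightarrow> bool" where
  "glue_map a b \<kappa> \<longleftrightarrow> rigid \<kappa> \<and> (\<forall>u. \<kappa> (dep a u) = dep b u) \<and>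
     (\<exists>m>0. \<forall>z. ec (fst (fst b)) (snd (fst b)) (\<kappa> z) = - m * ec (fst (fst a)) (snd (fst a)) z)"

lemma glue_map_exists:
  assumes "e \<in> portals T" "a \<in> e" "b \<in> e"
  obtains \<kappa> where "glue_map a b \<kappa>"
proof -
  have E: "fst a \<in> edges T" "fst b \<in> edges T" using portal_edge assms by auto
  obtain k i r where a: "a = ((k, i), r)" "k < N" "i < 3" using E(1) by (metis edges_iff prod.collapse)
  obtain k' i' r' where b: "b = ((k', i'), r')" "k' < N" "i' < 3" using E(2) by (metis edges_iff prod.collapse)
  define A B where AB: "A = (if r then -1 else 1) * DD k" "B = (if r' then -1 else 1) * DD k'"
  have nz: "A \<noteq> 0" "B \<noteq> 0" using DD a b by (auto simp: AB)
  \<comment> \<open>The signs of \<open>A\<close> and \<open>B\<close> combine vertex order and edge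
    direction; \<open>\<epsilon>\<close> is chosen so that the triangles end up on opposite sides in
    every case.\<close>
  define \<epsilon> :: real where "\<epsilon> = (if A * B > 0 then -1 else 1)"
  have eps: "\<epsilon> = 1 \<or> \<epsilon> = -1" by (simp add: \<epsilon>_def)
  have "norm (dep a 1 - dep a 0) = norm (dep b 1 - dep b 0)" using dep_norm E portal_len[OF assms] by simp
  then obtain \<kappa> where \<kappa>: "rigid \<kappa>" "\<kappa> (dep a 0) = dep b 0" "\<kappa> (dep a 1) = dep b 1"
    "\<And>z. side (dep b 0) (dep b 1) (\<kappa> z) = \<epsilon> * side (dep a 0) (dep a 1) z"
    using rigid_exists[OF dep_neq[OF E(1)], of "dep b 1" "dep b 0" \<epsilon>] eps by blast
  have 1: "\<kappa> (dep a u) = dep b u" for u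
    using rigid_comb[OF \<kappa>(1), of u "dep a 0" "dep a 1"] dep_lin[OF E(1), of u] dep_lin[OF E(2), of u] \<kappa>(2,3) by simp
  have "B * ec k' i' (\<kappa> z) = \<epsilon> * (A * ec k i z)" for z
    using \<kappa>(4)[of z] ec_side[OF a(2,3), of r z] ec_side[OF b(2,3), of r' "\<kappa> z"] by (simp add: a(1) b(1) AB)
  then have "ec k' i' (\<kappa> z) = - (- \<epsilon> * A / B) * ec k i z" for z using nz by (simp add: field_simps)
  moreover have "- \<epsilon> * A / B > 0" using nz unfolding \<epsilon>_def by (auto simp: zero_less_mult_iff field_simps zero_less_divide_iff divide_less_0_iff)
  ultimately have "\<exists>m>0. \<forall>z. ec k' i' (\<kappa> z) = - m * ec k i z" by blast
  then have "glue_map a b \<kappa>" unfolding glue_map_def using 1 \<kappa>(1) a(1) b(1) by simp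
  then show ?thesis using that by blast
qed

lemma ec_pos_ball: "0 < ec k i x \<Longrightarrow> \<exists>d>0. \<forall>z. norm (z - x) < d \<longrightarrow> 0 < ec k i z"
proof -
  assume "0 < ec k i x"
  moreover have "open {z. 0 < ec k i z}" using ec_cont[of UNIV] by (intro open_Collect_less continuous_on_const) auto
  ultimately show ?thesis unfolding open_dist dist_norm by auto
qed

lemma ec_pos_ball_all: "(\<And>i. i \<in> I \<Longrightarrow> 0 < ec k i x) \<Longrightarrow> finite I \<Longrightarrow> \<exists>d>0. \<forall>i\<in>I. \<forall>z. norm (z - x) < d \<longrightarrow> 0 < ec k i z"
  by (rule finite_pos_bound) (use ec_pos_ball in force)+

lemma ec_pos_ball2:
  assumes "0 < ec k i x" "0 < ec k j x"
  obtains d where "0 < d" "\<And>l z. l \<in> {i, j} \<Longrightarrow> norm (z - x) < d \<Longrightarrow> 0 < ec k l z"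
proof -
  have "\<exists>d>0. \<forall>l\<in>{i, j}. \<forall>z. norm (z - x) < d \<longrightarrow> 0 < ec k l z"
    by (rule ec_pos_ball_all) (use assms in auto)
  then show ?thesis using that by metis
qed

text \<open>If nothing is glued near \<open>x\<close>, the identity alone is an atlas. This covers
  interior points and points of edges without a portal.\<close>

lemma local_single:
  assumes geo: "geod L \<Gamma>" "0 < L" "t \<in> {0..L}" and k: "k < N" "x \<in> Fr k" "\<Gamma> t = cls (k, x)"
    and \<rho>: "0 < \<rho>" "\<And>z y. ((k, z), y) \<in> glue T \<Longrightarrow> \<not> norm (z - x) < \<rho>"
  obtains u where "norm u = 1" "\<And>s. s \<in> {0..L} \<Longrightarrow> \<bar>s - t\<bar> < \<rho> / 4 \<Longrightarrow> x + (s - t) *\<^sub>R u \<in> Fr k \<and> \<Gamma> s = cls (k, x + (s - t) *\<^sub>R u)"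
proof -
  have "atlas {(k, \<lambda>z. z)} x \<rho>"
    unfolding atlas_def using \<rho> k dist_fragment by auto
  from atlas_straight[OF this geo, of k "\<lambda>z. z" x] k show ?thesis using that by auto
qed

lemma local_interior:
  assumes geo: "geod L \<Gamma>" "0 < L" "t \<in> {0..L}" and k: "k < N" "\<forall>i<3. 0 < ec k i x" "\<Gamma> t = cls (k, x)"
  obtains u \<delta> where "norm u = 1" "0 < \<delta>" "\<And>s. s \<in> {0..L} \<Longrightarrow> \<bar>s - t\<bar> < \<delta> \<Longrightarrow> (\<forall>i<3. 0 < ec k i (x + (s - t) *\<^sub>R u)) \<and> \<Gamma> s = cls (k, x + (s - t) *\<^sub>R u)"
proof -
  obtain \<rho> where \<rho>: "\<rho> > 0" "\<And>i z. i < 3 \<Longrightarrow> norm (z - x) < \<rho> \<Longrightarrow> 0 < ec k i z"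
    using ec_pos_ball_all[of "{..<3}" k x] k by auto
  have "x \<in> Fr k" using k by (simp add: Fr_iff less_imp_le)
  moreover have "\<not> norm (z - x) < \<rho>" if g: "((k, z), y) \<in> glue T" for z y
  proof
    assume n: "norm (z - x) < \<rho>"
    obtain e a b u where e: "e \<in> portals T" "a \<in> e" "(k, z) = (fst (fst a), dep a u)" by (rule glueE[OF g])
    obtain i r where a: "a = ((k, i), r)" using e(3) by (metis fst_conv prod.exhaust)
    have "i < 3" "ec k i z = 0" using portal_edge[OF e(1,2)] e(3) ec_dep[of k i r u] by (auto simp: a edges_iff)
    then show False using \<rho>(2)[OF _ n] by force
  qed
  ultimately obtain u where u: "norm u = 1" "\<And>s. s \<in> {0..L} \<Longrightarrow> \<bar>s - t\<bar> < \<rho> / 4 \<Longrightarrow> x + (s - t) *\<^sub>R u \<in> Fr k \<and> \<Gamma> s = cls (k, x + (s - t) *\<^sub>R u)"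
    using local_single[OF geo k(1) _ k(3) \<rho>(1)] by blast
  show ?thesis
  proof (rule that[OF u(1), of "\<rho> / 4"])
    show "(\<forall>i<3. 0 < ec k i (x + (s - t) *\<^sub>R u)) \<and> \<Gamma> s = cls (k, x + (s - t) *\<^sub>R u)" if "s \<in> {0..L}" "\<bar>s - t\<bar> < \<rho> / 4" for s
      using u(2)[OF that] \<rho> that(2) u(1) by auto
  qed (use \<rho> in simp)
qed

lemma local_boundary:
  assumes geo: "geod L \<Gamma>" "0 < L" "t \<in> {0..L}" and k: "k < N" "i < 3" "0 < v" "v < 1" "\<Gamma> t = cls (k, dep ((k, i), r) v)"
    and nb: "\<And>e r. e \<in> portals T \<Longrightarrow> ((k, i), r) \<notin> e"
  obtains u \<delta> where "norm u = 1" "0 < \<delta>" "\<And>s. s \<in> {0..L} \<Longrightarrow> \<bar>s - t\<bar> < \<delta> \<Longrightarrow>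
     dep ((k, i), r) v + (s - t) *\<^sub>R u \<in> Fr k \<and> 0 < ec k (i+1) (dep ((k, i), r) v + (s - t) *\<^sub>R u) \<and> 0 < ec k (i+2) (dep ((k, i), r) v + (s - t) *\<^sub>R u)
       \<and> \<Gamma> s = cls (k, dep ((k, i), r) v + (s - t) *\<^sub>R u)"
proof -
  define x where "x = dep ((k, i), r) v"
  have ex: "0 < ec k (i+1) x" "0 < ec k (i+2) x" using ec_dep[OF k(1,2), of r v] k by (auto simp: x_def)
  obtain \<rho> where \<rho>: "\<rho> > 0" "\<And>j z. j \<in> {i+1, i+2} \<Longrightarrow> norm (z - x) < \<rho> \<Longrightarrow> 0 < ec k j z"
    using ec_pos_ball2[of k "i+1" x "i+2"] ex by metis
  have "x \<in> Fr k" using dep_Fr[of "((k, i), r)" v] k by (simp add: x_def edges_iff)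
  moreover have "\<not> norm (z - x) < \<rho>" if g: "((k, z), y) \<in> glue T" for z y
  proof
    assume n: "norm (z - x) < \<rho>"
    obtain e a b u where e: "e \<in> portals T" "a \<in> e" "(k, z) = (fst (fst a), dep a u)" by (rule glueE[OF g])
    obtain j r where a: "a = ((k, j), r)" using e(3) by (metis fst_conv prod.exhaust)
    have j: "j < 3" "ec k j z = 0" using portal_edge[OF e(1,2)] e(3) ec_dep[of k j r u] by (auto simp: a edges_iff)
    have "ec k (i+1) z \<noteq> 0" "ec k (i+2) z \<noteq> 0" using \<rho>(2)[of "i+1" z] \<rho>(2)[of "i+2" z] n by auto
    then have "j = i" using j k(2) by (auto elim!: cases3 simp: idx)
    then show False using nb[OF e(1)] e(2) a by blast
  qed
  ultimately obtain u where u: "norm u = 1" "\<And>s. s \<in> {0..L} \<Longrightarrow> \<bar>s - t\<bar> < \<rho> / 4 \<Longrightarrow> x + (s - t) *\<^sub>R u \<in> Fr k \<and> \<Gamma> s = cls (k, x + (s - t) *\<^sub>R u)"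
    using local_single[OF geo k(1) _ k(5)[folded x_def] \<rho>(1)] by blast
  show ?thesis
  proof (rule that[OF u(1), of "\<rho> / 4", folded x_def])
    show "x + (s - t) *\<^sub>R u \<in> Fr k \<and> 0 < ec k (i+1) (x + (s - t) *\<^sub>R u) \<and> 0 < ec k (i+2) (x + (s - t) *\<^sub>R u) \<and> \<Gamma> s = cls (k, x + (s - t) *\<^sub>R u)"
      if "s \<in> {0..L}" "\<bar>s - t\<bar> < \<rho> / 4" for s
      using u(2)[OF that] \<rho> that(2) u(1) by auto
  qed (use \<rho> in simp)
qed

lemma near_edge_unique:
  assumes e: "e \<in> portals T" "a \<in> e" and k: "fst a = (k, i)" and pos: "0 < ec k (i+1) z" "0 < ec k (i+2) z"
    and g: "((k, z), (k', z')) \<in> glue T"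
  shows "\<exists>b u. b \<in> e \<and> z = dep a u \<and> k' = fst (fst b) \<and> z' = dep b u"
proof -
  obtain e' c d u where c: "e' \<in> portals T" "c \<in> e'" "d \<in> e'" "(k, z) = (fst (fst c), dep c u)" "(k', z') = (fst (fst d), dep d u)" by (rule glueE[OF g])
  obtain j r where cj: "c = ((k, j), r)" using c(4) by (metis fst_conv prod.exhaust)
  have j: "j < 3" "ec k j z = 0" using portal_edge[OF c(1,2)] c(4) ec_dep[of k j r u] by (auto simp: cj edges_iff)
  have "i < 3" using portal_edge[OF e] k by (simp add: edges_iff)
  then have "j = i" using j pos by (auto elim!: cases3 simp: idx)
  then have "fst a = fst c" by (simp add: k cj)
  then have "a = c" "e = e'" using portal_unique e c by blast+
  then show ?thesis using c by (intro exI[of _ d] exI[of _ u]) simp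
qed

text \<open>The atlas consists of the triangle of \<open>a\<close> as it is and the triangle of
  \<open>b\<close> unfolded next to it. They may be the same fragment, which then has two
  placements; \<open>\<rho>3\<close> keeps the two edge points so far apart that no point of it is
  near \<open>x0\<close> in both.\<close>

lemma local_edge:
  assumes geo: "geod L \<Gamma>" "0 < L" "t \<in> {0..L}"
    and e: "e \<in> portals T" "a \<in> e" "b \<in> e" "a \<noteq> b" and fa: "fst a = (ka, ia)" and fb: "fst b = (kb, ib)"
    and \<kappa>: "glue_map a b \<kappa>" and v: "0 < v" "v < 1" and \<Gamma>t: "\<Gamma> t = cls (ka, dep a v)"
  obtains u \<delta> where "norm u = 1" "0 < \<delta>" "\<And>s y. s \<in> {0..L} \<Longrightarrow> \<bar>s - t\<bar> < \<delta> \<Longrightarrow> y = dep a v + (s - t) *\<^sub>R u \<Longrightarrow>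
     0 < ec ka (ia+1) y \<and> 0 < ec ka (ia+2) y \<and> 0 < ec kb (ib+1) (\<kappa> y) \<and> 0 < ec kb (ib+2) (\<kappa> y) \<and>
     (0 \<le> ec ka ia y \<longrightarrow> \<Gamma> s = cls (ka, y)) \<and> (ec ka ia y \<le> 0 \<longrightarrow> \<Gamma> s = cls (kb, \<kappa> y))"
proof -
  have E: "fst a \<in> edges T" "fst b \<in> edges T" using portal_edge e by auto
  have k: "ka < N" "ia < 3" "kb < N" "ib < 3" using E fa fb by (auto simp: edges_iff)
  have fab: "fst a \<noteq> fst b" using portal_unique(2)[OF e(1,2) e(1,3)] e(4) by blast
  define x0 where "x0 = dep a v"
  define x1 where "x1 = dep b v"
  have aa: "a = ((ka, ia), snd a)" "b = ((kb, ib), snd b)" using fa fb by (metis prod.collapse)+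
  have ex: "0 < ec ka (ia+1) x0" "0 < ec ka (ia+2) x0" "0 < ec kb (ib+1) x1" "0 < ec kb (ib+2) x1"
    using ec_dep[OF k(1,2), of "snd a" v] ec_dep[OF k(3,4), of "snd b" v] v unfolding x0_def x1_def by (auto simp flip: aa)
  have r\<kappa>: "rigid \<kappa>" and \<kappa>d: "\<And>u. \<kappa> (dep a u) = dep b u" using \<kappa> by (auto simp: glue_map_def)
  obtain m where m: "m > 0" "\<And>z. ec kb ib (\<kappa> z) = - m * ec ka ia z" using \<kappa> fa fb by (auto simp: glue_map_def)
  obtain \<iota> where \<iota>: "rigid \<iota>" "\<And>z. \<iota> (\<kappa> z) = z" "\<And>z. \<kappa> (\<iota> z) = z" by (rule rigid_inverse[OF r\<kappa>]) blast
  have \<iota>x: "norm (\<iota> z - x0) = norm (z - x1)" for z using rigid_norm[OF \<iota>(1), of z x1] \<iota>(2)[of x0] \<kappa>d by (simp add: x0_def x1_def)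
  obtain \<rho>1 where \<rho>1: "\<rho>1 > 0" "\<And>j z. j \<in> {ia+1, ia+2} \<Longrightarrow> norm (z - x0) < \<rho>1 \<Longrightarrow> 0 < ec ka j z"
    using ec_pos_ball2[of ka "ia+1" x0 "ia+2"] ex by metis
  obtain \<rho>2 where \<rho>2: "\<rho>2 > 0" "\<And>j z. j \<in> {ib+1, ib+2} \<Longrightarrow> norm (z - x1) < \<rho>2 \<Longrightarrow> 0 < ec kb j z"
    using ec_pos_ball2[of kb "ib+1" x1 "ib+2"] ex by metis
  define \<rho>3 where "\<rho>3 = (if x0 = x1 then 1 else norm (x0 - x1) / 2)"
  define \<rho> where "\<rho> = min \<rho>1 (min \<rho>2 \<rho>3)"
  have \<rho>: "\<rho> > 0" "\<rho> \<le> \<rho>1" "\<rho> \<le> \<rho>2" "\<rho> \<le> \<rho>3" using \<rho>1(1) \<rho>2(1) by (auto simp: \<rho>_def \<rho>3_def)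
  have x01: "x0 \<noteq> x1" if "ka = kb" 
  proof
    assume "x0 = x1"
    then have "fst a = fst b" using dep_eq_edge(1)[OF E _ _ v, of v] that fa fb v by (simp add: x0_def x1_def)
    then show False using fab by simp
  qed
  have apart: False if "ka = kb" "norm (z - x0) < \<rho>" "norm (z - x1) < \<rho>" for z
  proof -
    have "norm (x0 - x1) \<le> norm (z - x0) + norm (z - x1)" using norm_triangle_ineq4[of "z - x1" "z - x0"] by (simp add: add.commute)
    moreover have "\<rho>3 = norm (x0 - x1) / 2" using x01[OF that(1)] by (simp add: \<rho>3_def)
    ultimately show False using that \<rho>(4) by linarith
  qed
  define \<C> where "\<C> = {(ka, \<lambda>z. z), (kb, \<iota>)}"
  have FrA: "y \<in> Fr ka" if "norm (y - x0) < \<rho>" "0 \<le> ec ka ia y" for y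
    using that \<rho>1(2)[of "ia+1" y] \<rho>1(2)[of "ia+2" y] \<rho> ec_all[OF k(2), of "\<lambda>x. 0 \<le> x"] by (simp add: Fr_iff[OF k(1)])
  have FrB: "\<kappa> y \<in> Fr kb" if "norm (y - x0) < \<rho>" "ec ka ia y \<le> 0" for y
  proof -
    have "norm (\<kappa> y - x1) < \<rho>" using \<iota>x[of "\<kappa> y"] that \<iota>(2) by simp
    moreover have "0 \<le> ec kb ib (\<kappa> y)" using m that(2) by (simp add: mult_nonneg_nonpos)
    ultimately show ?thesis using \<rho>2(2)[of "ib+1" "\<kappa> y"] \<rho>2(2)[of "ib+2" "\<kappa> y"] \<rho> ec_all[OF k(4), of "\<lambda>x. 0 \<le> x"] by (simp add: Fr_iff[OF k(3)])
  qed
  have signA: "0 \<le> ec ka ia z" if "z \<in> Fr ka" for z using that Fr_iff[OF k(1)] k(2) by blast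
  have signB: "ec ka ia (\<iota> z) \<le> 0" if "z \<in> Fr kb" for z
  proof -
    have "0 \<le> ec kb ib z" using that Fr_iff[OF k(3)] k(4) by blast
    then show ?thesis using m(2)[of "\<iota> z"] m(1) \<iota>(3) by (simp add: zero_le_mult_iff mult_le_0_iff)
  qed
  have on: "\<exists>u\<in>{0..1}. y = dep a u" if "norm (y - x0) < \<rho>" "ec ka ia y = 0" for y
    using on_edge_Fr[OF k(1,2) FrA[OF that(1)] that(2), of "snd a"] that(2) aa by (metis order_refl)
  have same: "cls (ka, y) = cls (kb, \<kappa> y)" if y: "norm (y - x0) < \<rho>" "ec ka ia y = 0" for y
  proof -
    obtain u where u: "u \<in> {0..1}" "y = dep a u" using on[OF y] by blast
    have "((ka, y), (kb, \<kappa> y)) \<in> glue T" using glueI[OF e(1-3) u(1)] u(2) fa fb \<kappa>d by simp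
    then show ?thesis by (rule glue_cls)
  qed
  have cross: "sd (cls (ka, z1)) (cls (kb, z2)) \<le> ennreal (norm (z1 - \<iota> z2))"
    if z: "z1 \<in> Fr ka" "z2 \<in> Fr kb" "norm (z1 - x0) < \<rho>" "norm (\<iota> z2 - x0) < \<rho>" for z1 z2
  proof -
    define c1 c2 where c: "c1 = ec ka ia z1" "c2 = - ec ka ia (\<iota> z2)"
    have c0: "c1 \<ge> 0" "c2 \<ge> 0" using signA signB z by (auto simp: c)
    \<comment> \<open>The unfolded segment from \<open>z1\<close> to the image of \<open>z2\<close>
      meets the edge line at \<open>y\<close>, which is still in the ball, so the detour over
      \<open>y\<close> costs nothing. If both coordinates vanish, the segment is on the edge line
      and \<open>y\<close> is \<open>z1\<close>.\<close>
    define \<theta> where "\<theta> = (if c1 + c2 = 0 then 0 else c1 / (c1 + c2))"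
    have \<theta>: "0 \<le> \<theta>" "\<theta> \<le> 1" using c0 by (auto simp: \<theta>_def field_simps)
    define y where "y = (1 - \<theta>) *\<^sub>R z1 + \<theta> *\<^sub>R \<iota> z2"
    have "ec ka ia y = (1 - \<theta>) * c1 - \<theta> * c2" by (simp add: y_def ec_comb c)
    also have "\<dots> = c1 - \<theta> * (c1 + c2)" by (simp add: algebra_simps)
    also have "\<dots> = 0" using c0 by (auto simp: \<theta>_def)
    finally have ey: "ec ka ia y = 0" .
    have "y \<in> ball x0 \<rho>" unfolding y_def
      by (rule convexD[OF convex_ball]) (use z \<theta> in \<open>auto simp: dist_norm norm_minus_commute\<close>)
    then have ny: "norm (y - x0) < \<rho>" by (simp add: dist_norm norm_minus_commute)
    have "sd (cls (ka, z1)) (cls (kb, z2)) \<le> sd (cls (ka, z1)) (cls (ka, y)) + sd (cls (kb, \<kappa> y)) (cls (kb, z2))"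
      using sd_triangle[of "cls (ka, z1)" "cls (kb, z2)" "cls (ka, y)"] same[OF ny ey] by simp
    also have "\<dots> \<le> ennreal (norm (z1 - y)) + ennreal (norm (\<kappa> y - z2))"
      using FrA[OF ny] FrB[OF ny] ey z k by (intro add_mono dist_fragment) auto
    also have "norm (\<kappa> y - z2) = norm (y - \<iota> z2)" using rigid_norm[OF \<iota>(1), of "\<kappa> y" z2] \<iota>(2) by simp
    also have "ennreal (norm (z1 - y)) + ennreal (norm (y - \<iota> z2)) = ennreal (norm (z1 - \<iota> z2))"
    proof -
      have "z1 - y = \<theta> *\<^sub>R (z1 - \<iota> z2)" "y - \<iota> z2 = (1 - \<theta>) *\<^sub>R (z1 - \<iota> z2)" by (simp_all add: y_def algebra_simps)
      then have "norm (z1 - y) + norm (y - \<iota> z2) = \<theta> * norm (z1 - \<iota> z2) + (1 - \<theta>) * norm (z1 - \<iota> z2)"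
        using \<theta> by (simp only: norm_scaleR)
      also have "\<dots> = norm (z1 - \<iota> z2)" by (simp add: algebra_simps)
      finally have "norm (z1 - y) + norm (y - \<iota> z2) = norm (z1 - \<iota> z2)" .
      then show ?thesis by (simp flip: ennreal_plus)
    qed
    finally show ?thesis .
  qed
  have at: "atlas \<C> x0 \<rho>"
    unfolding atlas_def
  proof (intro conjI allI impI)
    show "\<forall>(k, \<iota>)\<in>\<C>. k < N \<and> rigid \<iota>" using k \<iota>(1) by (auto simp: \<C>_def)
  next
    fix k z k' z' \<iota>' assume g: "((k, z), (k', z')) \<in> glue T" and c: "(k, \<iota>') \<in> \<C>" and n: "norm (\<iota>' z - x0) < \<rho>"
    have in\<C>: "\<exists>\<iota>''. (fst (fst d), \<iota>'') \<in> \<C> \<and> \<iota>'' (dep d u) = dep a u" if de: "d \<in> e" for d u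
    proof -
      consider "d = a" | "d = b" using portal_pair[OF e(1,2,3) de e(4)] by blast
      then show ?thesis
      proof cases
        case 1
        then show ?thesis using fa by (intro exI[of _ "\<lambda>z. z"]) (simp add: \<C>_def)
      next
        case 2
        then show ?thesis using fb \<iota>(2)[of "dep a u"] \<kappa>d by (intro exI[of _ \<iota>]) (simp add: \<C>_def)
      qed
    qed
    consider "k = ka" "\<iota>' = (\<lambda>z. z)" | "k = kb" "\<iota>' = \<iota>" using c by (auto simp: \<C>_def)
    then show "\<exists>\<iota>''. (k', \<iota>'') \<in> \<C> \<and> \<iota>'' z' = \<iota>' z"
    proof cases
      case 1
      have "0 < ec ka (ia+1) z" "0 < ec ka (ia+2) z" using \<rho>1(2)[of _ z] n 1 \<rho> by auto
      then obtain d u where "d \<in> e" "z = dep a u" "k' = fst (fst d)" "z' = dep d u"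
        using near_edge_unique[OF e(1,2) fa] g 1 by blast
      then show ?thesis using in\<C> 1 by auto
    next
      case 2
      have "0 < ec kb (ib+1) z" "0 < ec kb (ib+2) z" using \<rho>2(2)[of _ z] n 2 \<rho> \<iota>x[of z] by auto
      then obtain d u where "d \<in> e" "z = dep b u" "k' = fst (fst d)" "z' = dep d u"
        using near_edge_unique[OF e(1,3) fb] g 2 by blast
      then show ?thesis using in\<C> 2 \<iota>(2)[of "dep a u"] \<kappa>d by auto
    qed
  next
    fix k \<iota>1 z k' \<iota>2 z'
    assume a: "(k, \<iota>1) \<in> \<C>" "(k', \<iota>2) \<in> \<C>" "z \<in> Fr k" "z' \<in> Fr k'" "norm (\<iota>1 z - x0) < \<rho>" "norm (\<iota>2 z' - x0) < \<rho>"
    consider "k = ka" "\<iota>1 = (\<lambda>z. z)" "k' = ka" "\<iota>2 = (\<lambda>z. z)" | "k = kb" "\<iota>1 = \<iota>" "k' = kb" "\<iota>2 = \<iota>"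
      | "k = ka" "\<iota>1 = (\<lambda>z. z)" "k' = kb" "\<iota>2 = \<iota>" | "k = kb" "\<iota>1 = \<iota>" "k' = ka" "\<iota>2 = (\<lambda>z. z)"
      using a(1,2) by (auto simp: \<C>_def)
    then show "sd (cls (k, z)) (cls (k', z')) \<le> ennreal (norm (\<iota>1 z - \<iota>2 z'))"
    proof cases
      case 1
      then show ?thesis using a dist_fragment k by simp
    next
      case 2
      then show ?thesis using a dist_fragment[of kb z z'] k rigid_norm[OF \<iota>(1)] by simp
    next
      case 3
      then show ?thesis using a cross by simp
    next
      case 4
      then show ?thesis using a cross[of z' z] sd_sym[of "cls (k, z)"] by (simp add: norm_minus_commute)
    qed
  next
    fix k \<iota>1 \<iota>2 z
    assume a: "(k, \<iota>1) \<in> \<C>" "(k, \<iota>2) \<in> \<C>" "norm (\<iota>1 z - x0) < \<rho>" "norm (\<iota>2 z - x0) < \<rho>"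
    have "\<not> (ka = kb \<and> norm (z - x0) < \<rho> \<and> norm (\<iota> z - x0) < \<rho>)" using apart[of z] \<iota>x[of z] by auto
    then show "\<iota>1 z = \<iota>2 z" using a by (auto simp: \<C>_def)
  qed (use \<rho> in \<open>auto simp: \<C>_def\<close>)
  have x0F: "x0 \<in> Fr ka" using dep_Fr[OF E(1), of v] v fa by (simp add: x0_def)
  obtain u where u: "norm u = 1" "\<And>s. s \<in> {0..L} \<Longrightarrow> \<bar>s - t\<bar> < \<rho> / 4 \<Longrightarrow>
     (\<exists>k \<iota> z. (k, \<iota>) \<in> \<C> \<and> z \<in> Fr k \<and> \<iota> z = x0 + (s - t) *\<^sub>R u \<and> \<Gamma> s = cls (k, z))"
    using atlas_straight[OF at geo, of ka "\<lambda>z. z" x0] x0F \<Gamma>t by (auto simp: \<C>_def x0_def)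
  show ?thesis
  proof (rule that[OF u(1), of "\<rho> / 4", folded x0_def])
    fix s y assume s: "s \<in> {0..L}" "\<bar>s - t\<bar> < \<rho> / 4" and y: "y = x0 + (s - t) *\<^sub>R u"
    have ny: "norm (y - x0) < \<rho>" using s(2) u(1) \<rho>(1) by (simp add: y)
    have pos: "0 < ec ka (ia+1) y" "0 < ec ka (ia+2) y" using \<rho>1(2)[of _ y] ny \<rho> by auto
    have "norm (\<kappa> y - x1) < \<rho>" using \<iota>x[of "\<kappa> y"] ny \<iota>(2) by simp
    then have pos': "0 < ec kb (ib+1) (\<kappa> y)" "0 < ec kb (ib+2) (\<kappa> y)" using \<rho>2(2)[of _ "\<kappa> y"] \<rho> by auto
    obtain k \<iota>' z where z: "(k, \<iota>') \<in> \<C>" "z \<in> Fr k" "\<iota>' z = y" "\<Gamma> s = cls (k, z)" using u(2)[OF s] y by blast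
    consider "k = ka" "z = y" | "k = kb" "z = \<kappa> y" using z(1,3) \<iota>(3) by (auto simp: \<C>_def)
    then have "(0 \<le> ec ka ia y \<longrightarrow> \<Gamma> s = cls (ka, y)) \<and> (ec ka ia y \<le> 0 \<longrightarrow> \<Gamma> s = cls (kb, \<kappa> y))"
    proof cases
      case 1
      then show ?thesis using signA[of y] z same[OF ny] by auto
    next
      case 2
      then show ?thesis using signB[of "\<kappa> y"] \<iota>(2) z same[OF ny] by auto
    qed
    then show "0 < ec ka (ia+1) y \<and> 0 < ec ka (ia+2) y \<and> 0 < ec kb (ib+1) (\<kappa> y) \<and> 0 < ec kb (ib+2) (\<kappa> y) \<and>
     (0 \<le> ec ka ia y \<longrightarrow> \<Gamma> s = cls (ka, y)) \<and> (ec ka ia y \<le> 0 \<longrightarrow> \<Gamma> s = cls (kb, \<kappa> y))" using pos pos' by blast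
  qed (use \<rho> in simp)
qed

end

section \<open>Convexity along geodesics\<close>

text \<open>At the leftmost positive maximum a support line has to be horizontal, and then the
  maximum is attained further to the left as well.\<close>

lemma no_interior_max:
  fixes h :: "real \<Rightarrow> real"
  assumes cont: "continuous_on {a..b} h" and ab: "a \<le> b" "h a \<le> 0" "h b \<le> 0"
    and sup: "\<And>s. a < s \<Longrightarrow> s < b \<Longrightarrow> \<exists>m \<epsilon>. 0 < \<epsilon> \<and> (\<forall>s'\<in>{a..b}. \<bar>s' - s\<bar> < \<epsilon> \<longrightarrow> h s + m * (s' - s) \<le> h s')"
    and x: "x \<in> {a..b}"
  shows "h x \<le> 0"
proof (rule ccontr)
  assume "\<not> h x \<le> 0"
  obtain y where y: "y \<in> {a..b}" "\<And>z. z \<in> {a..b} \<Longrightarrow> h z \<le> h y"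
    using continuous_attains_sup[OF _ _ cont] ab by auto
  define M where "M = h y"
  have M: "M > 0" using y(2)[OF x] \<open>\<not> h x \<le> 0\<close> by (simp add: M_def)
  define S where "S = {a..b} \<inter> h -` {M}"
  have "compact S"
  proof -
    have "closed S" unfolding S_def by (rule continuous_closed_preimage[OF cont]) auto
    then show ?thesis unfolding S_def by (metis compact_Icc compact_Int_closed closed_Int inf.left_idem)
  qed
  moreover have "S \<noteq> {}" using y by (auto simp: S_def M_def)
  ultimately obtain s where s: "s \<in> S" "\<And>z. z \<in> S \<Longrightarrow> s \<le> z" using compact_attains_inf by metis
  have hs: "h s = M" "s \<in> {a..b}" using s by (auto simp: S_def)
  have s_in: "a < s" "s < b" using hs M ab by (smt (verit) atLeastAtMost_iff)+
  obtain m \<epsilon> where me0: "\<epsilon> > 0" "\<forall>s'\<in>{a..b}. \<bar>s' - s\<bar> < \<epsilon> \<longrightarrow> h s + m * (s' - s) \<le> h s'"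
    using sup[OF s_in] by blast
  have me: "\<epsilon> > 0" "\<And>s'. s' \<in> {a..b} \<Longrightarrow> \<bar>s' - s\<bar> < \<epsilon> \<Longrightarrow> M + m * (s' - s) \<le> h s'"
    using me0 hs(1) by auto
  define d where "d = min (\<epsilon> / 2) (min (s - a) (b - s))"
  have d: "d > 0" "d < \<epsilon>" "d \<le> s - a" "d \<le> b - s" using me(1) s_in by (auto simp: d_def)
  have p: "s + d \<in> {a..b}" "s - d \<in> {a..b}" using d hs s_in by auto
  have "M + m * d \<le> h (s + d)" "M - m * d \<le> h (s - d)"
    using me(2)[OF p(1)] me(2)[OF p(2)] d by auto
  moreover have "h (s + d) \<le> M" "h (s - d) \<le> M" using y(2)[OF p(1)] y(2)[OF p(2)] by (auto simp: M_def)
  ultimately have "h (s - d) = M" by linarith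
  then have "s - d \<in> S" using p by (simp add: S_def)
  then show False using s(2) d(1) by fastforce
qed

text \<open>Local support lines make \<open>h\<close> lie below its chords. A chord with two of its
  three points in the affine piece yields the bound at the third point \<open>x\<close>.\<close>

lemma support_global:
  fixes h :: "real \<Rightarrow> real"
  assumes cont: "continuous_on {0..L} h"
    and sup: "\<And>s. 0 < s \<Longrightarrow> s < L \<Longrightarrow> \<exists>m \<epsilon>. 0 < \<epsilon> \<and> (\<forall>s'\<in>{0..L}. \<bar>s' - s\<bar> < \<epsilon> \<longrightarrow> h s + m * (s' - s) \<le> h s')"
    and lin: "0 \<le> t" "t + \<epsilon> \<le> L" "0 < \<epsilon>" "\<And>s. t \<le> s \<Longrightarrow> s < t + \<epsilon> \<Longrightarrow> h s = A + B * s"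
    and x: "x \<in> {0..L}"
  shows "A + B * x \<le> h x"
proof -
  have chord: "h y \<le> h a + (h b - h a) / (b - a) * (y - a)" if ab: "0 \<le> a" "a < y" "y < b" "b \<le> L" for a b y
  proof -
    define q where "q = (h b - h a) / (b - a)"
    define \<psi> where "\<psi> s = h s - (h a + q * (s - a))" for s
    have "\<psi> y \<le> 0"
    proof (rule no_interior_max[of a b \<psi> y])
      show "continuous_on {a..b} \<psi>" unfolding \<psi>_def
        by (intro continuous_intros continuous_on_subset[OF cont]) (use ab in auto)
      fix s assume s: "a < s" "s < b"
      then obtain m \<epsilon> where me: "\<epsilon> > 0" "\<forall>s'\<in>{0..L}. \<bar>s' - s\<bar> < \<epsilon> \<longrightarrow> h s + m * (s' - s) \<le> h s'" using sup[of s] ab by auto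
      show "\<exists>m \<epsilon>. 0 < \<epsilon> \<and> (\<forall>s'\<in>{a..b}. \<bar>s' - s\<bar> < \<epsilon> \<longrightarrow> \<psi> s + m * (s' - s) \<le> \<psi> s')"
      proof (rule exI[of _ "m - q"], rule exI[of _ \<epsilon>], intro conjI ballI impI me(1))
        fix s' assume "s' \<in> {a..b}" "\<bar>s' - s\<bar> < \<epsilon>"
        then have "h s + m * (s' - s) \<le> h s'" using me(2) ab by auto
        moreover have "(m - q) * (s' - s) = m * (s' - s) - (q * (s' - a) - q * (s - a))"
          by (simp add: algebra_simps)
        ultimately show "\<psi> s + (m - q) * (s' - s) \<le> \<psi> s'"
          unfolding \<psi>_def by linarith
      qed
    qed (use ab in \<open>auto simp: \<psi>_def q_def\<close>)
    then show ?thesis by (simp add: \<psi>_def q_def)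
  qed
  define p q where pq: "p = t + \<epsilon> / 4" "q = t + \<epsilon> / 2"
  have hp: "h p = A + B * p" "h q = A + B * q" using lin by (auto simp: pq)
  consider "x \<in> {t..<t + \<epsilon>}" | "x < t" | "x \<ge> t + \<epsilon>" by fastforce
  then show ?thesis
  proof cases
    case 1
    then show ?thesis using lin(4)[of x] by simp
  next
    case 2
    have "h p \<le> h x + (h q - h x) / (q - x) * (p - x)" by (rule chord) (use 2 x lin in \<open>auto simp: pq\<close>)
    then have "(h p - h x) * (q - x) \<le> (h q - h x) * (p - x)" using 2 lin by (simp add: pq field_simps)
    then have "0 \<le> (h x - (A + B * x)) * (q - p)" unfolding hp by (simp add: algebra_simps)
    then show ?thesis using lin(3) by (simp add: pq zero_le_mult_iff)
  next
    case 3
    have "h q \<le> h p + (h x - h p) / (x - p) * (q - p)" by (rule chord) (use 3 x lin in \<open>auto simp: pq\<close>)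
    then have "(h q - h p) * (x - p) \<le> (h x - h p) * (q - p)" using 3 lin by (simp add: pq field_simps)
    then have "0 \<le> (h x - (A + B * x)) * (q - p)" unfolding hp by (simp add: algebra_simps)
    then show ?thesis using lin(3) by (simp add: pq zero_le_mult_iff)
  qed
qed

lemma dots_norm: "2 * dots p q z = (norm (p - z))\<^sup>2 + (norm (q - z))\<^sup>2 - (norm (p - q))\<^sup>2"
  unfolding dots_eq cmod_power2 by (simp add: power2_eq_square algebra_simps)

lemma rigid_dots: "rigid f \<Longrightarrow> dots (f p) (f q) (f z) = dots p q z"
  using dots_norm[of "f p" "f q" "f z"] dots_norm[of p q z] by (simp add: rigid_norm)

lemma angle_at_swap: "angle_at w p q = angle_at w q p"
  by (simp add: angle_at_def inner_commute mult.commute)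

lemma rigid_affine: "rigid f \<Longrightarrow> f (x + s *\<^sub>R u) = f x + s *\<^sub>R (f (x + u) - f x)"
proof -
  assume f: "rigid f"
  have "x + s *\<^sub>R u = (1 - s) *\<^sub>R x + s *\<^sub>R (x + u)" by (simp add: algebra_simps)
  then have "f (x + s *\<^sub>R u) = (1 - s) *\<^sub>R f x + s *\<^sub>R f (x + u)" using rigid_comb[OF f] by simp
  then show ?thesis by (simp add: algebra_simps)
qed

lemma pw_ray: "norm u = 1 \<Longrightarrow> pw c R (x + \<sigma> *\<^sub>R u) = pw c R x + 2 * \<sigma> * ((x - c) \<bullet> u) + \<sigma>\<^sup>2"
proof -
  assume u: "norm u = 1"
  have "(norm (x + \<sigma> *\<^sub>R u - c))\<^sup>2 = (norm (x - c))\<^sup>2 + 2 * \<sigma> * ((x - c) \<bullet> u) + \<sigma>\<^sup>2 * (norm u)\<^sup>2"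
    unfolding cmod_power2 inner_complex_def by (simp add: power2_eq_square algebra_simps)
  then show ?thesis using u by (simp add: pw_def)
qed

section \<open>The Delaunay potential\<close>

locale delaunay_portalgon = tri_portalgon +
  assumes del: "\<And>e a b. e \<in> portals T \<Longrightarrow> a \<in> e \<Longrightarrow> b \<in> e \<Longrightarrow> a \<noteq> b \<Longrightarrow> opposite_angle T (fst a) + opposite_angle T (fst b) \<le> pi"
begin

definition cR :: "nat \<Rightarrow> complex \<times> real" where
  "cR k = (SOME x. \<forall>i<3. pw (fst x) (snd x) (V k i) = 0)"

definition pk :: "nat \<Rightarrow> complex \<Rightarrow> real" where "pk k = pw (fst (cR k)) (snd (cR k))"

lemma pk_V: "k < N \<Longrightarrow> pk k (V k i) = 0"
proof -
  assume k: "k < N"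
  obtain c R where "pw c R (V k 0) = 0" "pw c R (V k 1) = 0" "pw c R (V k 2) = 0"
    using circumcircle_exists DD[OF k] unfolding DD_def by metis
  then have "\<forall>i<3. pw (fst (c, R)) (snd (c, R)) (V k i) = 0" by (simp add: all3)
  from someI[of "\<lambda>x. \<forall>i<3. pw (fst x) (snd x) (V k i) = 0", OF this]
  have *: "\<forall>i<3. pk k (V k i) = 0" unfolding pk_def cR_def .
  have "i mod 3 < 3" by simp
  then have "pk k (V k (i mod 3)) = 0" using * by blast
  then show ?thesis by (simp add: V_mod)
qed

definition G :: "nat \<times> complex \<Rightarrow> real" where "G x = - pk (fst x) (snd x)"

text \<open>On a chord the power is minus the product of the two parts, whatever the circle. Hence
  the potentials of two triangles agree along a common edge.\<close>

lemma pk_dep: "fst a \<in> edges T \<Longrightarrow> pk (fst (fst a)) (dep a u) = - (u * (1 - u) * (edge_length T (fst a))\<^sup>2)"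
proof -
  assume a: "fst a \<in> edges T"
  obtain k i r where kir: "a = ((k, i), r)" "k < N" "i < 3" using a by (metis edges_iff prod.collapse)
  have 1: "pk k (dep a 0) = 0" "pk k (dep a 1) = 0" using pk_V[OF kir(2)] by (auto simp: kir(1) dep_eq[OF kir(2,3)])
  have "norm (dep a 0 - dep a 1) = edge_length T (fst a)" using dep_norm[OF a] by (simp add: norm_minus_commute)
  then show ?thesis using pw_on_edge[OF 1[unfolded pk_def], of u] dep_lin[OF a, of u] by (simp add: kir(1) pk_def)
qed

lemma G_glue: "(x, y) \<in> glue T \<Longrightarrow> G x = G y"
proof -
  assume g: "(x, y) \<in> glue T"
  obtain e a b u where e: "e \<in> portals T" "a \<in> e" "b \<in> e" "x = (fst (fst a), dep a u)" "y = (fst (fst b), dep b u)" by (rule glueE[OF g])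
  then show ?thesis using pk_dep portal_edge portal_len[OF e(1-3)] by (simp add: G_def)
qed

lemma pk_le0: "k < N \<Longrightarrow> z \<in> Fr k \<Longrightarrow> pk k z \<le> 0"
proof -
  assume k: "k < N" and z: "z \<in> Fr k"
  have "convex {z. pk k z \<le> 0}"
  proof (rule convexI)
    fix x y and u v :: real assume *: "x \<in> {z. pk k z \<le> 0}" "y \<in> {z. pk k z \<le> 0}" "0 \<le> u" "0 \<le> v" "u + v = 1"
    have u: "u = 1 - v" using * by simp
    have "(1 - v) * pk k x \<le> 0" "v * pk k y \<le> 0" "v * (1 - v) * (norm (x - y))\<^sup>2 \<ge> 0"
      using * u by (auto simp: mult_nonneg_nonpos)
    then show "u *\<^sub>R x + v *\<^sub>R y \<in> {z. pk k z \<le> 0}" unfolding u pk_def mem_Collect_eq pw_comb by linarith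
  qed
  then have "convex hull {V k 0, V k 1, V k 2} \<subseteq> {z. pk k z \<le> 0}" by (rule hull_minimal[rotated]) (use pk_V[OF k] in auto)
  then show ?thesis using z Fr_hull[OF k] by auto
qed

text \<open>Any common constant suffices: divided by it, the potential meets the hypothesis of
  \<open>lipschitz_dist\<close>, which makes it continuous along geodesics.\<close>

lemma G_lipschitz: "\<exists>K>0. \<forall>k<N. \<forall>x\<in>Fr k. \<forall>y\<in>Fr k. \<bar>G (k, x) - G (k, y)\<bar> \<le> K * norm (x - y)"
proof -
  define K where "K = 1 + (\<Sum>k<N. 2 * sqrt \<bar>snd (cR k)\<bar>)"
  have K0: "K > 0" unfolding K_def by (intro add_pos_nonneg sum_nonneg) auto
  have "\<bar>G (k, x) - G (k, y)\<bar> \<le> K * norm (x - y)" if k: "k < N" "x \<in> Fr k" "y \<in> Fr k" for k x y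
  proof -
    define c R where cR: "c = fst (cR k)" "R = snd (cR k)"
    have n: "norm (z - c) \<le> sqrt \<bar>R\<bar>" if "z \<in> Fr k" for z
    proof -
      have "(norm (z - c))\<^sup>2 \<le> R" using pk_le0[OF k(1) that] by (simp add: pk_def pw_def cR)
      then show ?thesis by (intro real_le_rsqrt) simp
    qed
    have "G (k, x) - G (k, y) = (norm (y - c))\<^sup>2 - (norm (x - c))\<^sup>2" by (simp add: G_def pk_def pw_def cR)
    also have "\<dots> = (norm (y - c) - norm (x - c)) * (norm (y - c) + norm (x - c))" by (simp add: power2_eq_square algebra_simps)
    finally have "\<bar>G (k, x) - G (k, y)\<bar> = \<bar>norm (y - c) - norm (x - c)\<bar> * (norm (y - c) + norm (x - c))" by (simp add: abs_mult)
    also have "\<dots> \<le> norm (x - y) * (2 * sqrt \<bar>R\<bar>)"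
      using norm_triangle_ineq3[of "y - c" "x - c"] n[OF k(2)] n[OF k(3)] by (intro mult_mono) (auto simp: norm_minus_commute)
    also have "\<dots> \<le> norm (x - y) * K"
    proof (rule mult_left_mono)
      have "2 * sqrt \<bar>snd (cR k)\<bar> \<le> (\<Sum>k<N. 2 * sqrt \<bar>snd (cR k)\<bar>)" using k by (intro member_le_sum) auto
      then show "2 * sqrt \<bar>R\<bar> \<le> K" by (simp add: K_def cR)
    qed simp
    finally show ?thesis by (simp add: mult.commute)
  qed
  then show ?thesis using K0 by blast
qed

definition GS :: "surface_point \<Rightarrow> real" where "GS p = G (SOME x. cls x = p)"

lemma GS_cls: "GS (cls x) = G x"
  unfolding GS_def
proof (rule cls_invariant[of G, OF G_glue])
  show "cls (SOME y. cls y = cls x) = cls x" by (rule someI[of "\<lambda>y. cls y = cls x" x]) simp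
qed

lemma GS_nonneg: "p \<in> surface T \<Longrightarrow> 0 \<le> GS p"
  using surface_rep[of p] pk_le0 by (force simp: GS_cls G_def)

lemma GS_continuous:
  assumes geo: "geod L \<Gamma>" shows "continuous_on {0..L} (\<lambda>s. GS (\<Gamma> s))"
proof -
  obtain K where K: "K > 0" "\<And>k x y. k < N \<Longrightarrow> x \<in> Fr k \<Longrightarrow> y \<in> Fr k \<Longrightarrow> \<bar>G (k, x) - G (k, y)\<bar> \<le> K * norm (x - y)" using G_lipschitz by blast
  have lip: "\<bar>GS (\<Gamma> s) - GS (\<Gamma> s')\<bar> \<le> K * \<bar>s - s'\<bar>" if s: "s \<in> {0..L}" "s' \<in> {0..L}" for s s'
  proof -
    obtain k z k' z' where r: "\<Gamma> s = cls (k, z)" "\<Gamma> s' = cls (k', z')" using geo s surface_rep unfolding geod_def by metis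
    have "ennreal \<bar>G (k, z) / K - G (k', z') / K\<bar> \<le> sd (cls (k, z)) (cls (k', z'))"
    proof (rule lipschitz_dist[of "\<lambda>x. G x / K"])
      show "G x / K = G y / K" if "(x, y) \<in> glue T" for x y using G_glue[OF that] by simp
      show "\<bar>G (k, x) / K - G (k, y) / K\<bar> \<le> norm (x - y)" if "k < N" "x \<in> Fr k" "y \<in> Fr k" for k x y
        using K(2)[OF that] K(1) by (simp add: diff_divide_distrib[symmetric] abs_divide field_simps)
    qed
    also have "\<dots> = ennreal \<bar>s - s'\<bar>" using geo s unfolding r[symmetric] geod_def by blast
    finally have "\<bar>G (k, z) / K - G (k', z') / K\<bar> \<le> \<bar>s - s'\<bar>" by simp
    then show ?thesis using K(1) by (simp add: r GS_cls diff_divide_distrib[symmetric] abs_divide field_simps)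
  qed
  show ?thesis
    unfolding continuous_on_iff
  proof (intro ballI allI impI)
    fix x e :: real assume x: "x \<in> {0..L}" and e: "0 < e"
    have "dist (GS (\<Gamma> x')) (GS (\<Gamma> x)) < e" if "x' \<in> {0..L}" "dist x' x < e / K" for x'
      using lip[OF that(1) x] that(2) K(1) by (simp add: dist_real_def field_simps)
    then show "\<exists>d>0. \<forall>x'\<in>{0..L}. dist x' x < d \<longrightarrow> dist (GS (\<Gamma> x')) (GS (\<Gamma> x)) < e"
      using e K(1) by (intro exI[of _ "e / K"]) simp
  qed
qed

abbreviation apex :: "directed_edge \<Rightarrow> complex" where "apex a \<equiv> V (fst (fst a)) (snd (fst a) + 2)"

text \<open>Nonnegative iff the angle opposite to the edge is at most a right angle.\<close>

definition adot :: "directed_edge \<Rightarrow> real" where "adot a = dots (dep a 0) (dep a 1) (apex a)"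

lemma apex_side: "fst a \<in> edges T \<Longrightarrow> side (dep a 0) (dep a 1) (apex a) = (if snd a then -1 else 1) * DD (fst (fst a))"
  and ec_apex: "fst a \<in> edges T \<Longrightarrow> ec (fst (fst a)) (snd (fst a)) (apex a) = 1"
proof -
  assume a: "fst a \<in> edges T"
  obtain k i r where kir: "a = ((k, i), r)" "k < N" "i < 3" using a by (metis edges_iff prod.collapse)
  show 1: "ec (fst (fst a)) (snd (fst a)) (apex a) = 1" using ec_V[OF kir(2,3)] by (simp add: kir(1))
  show "side (dep a 0) (dep a 1) (apex a) = (if snd a then -1 else 1) * DD (fst (fst a))"
    using ec_side[OF kir(2,3), of r "apex a"] 1 by (simp add: kir(1))
qed

text \<open>The angle condition without trigonometry. If both opposite angles were obtuse, both
  summands would be negative.\<close>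

lemma adot_sum:
  assumes e: "e \<in> portals T" "a \<in> e" "b \<in> e" "a \<noteq> b"
  shows "adot a * \<bar>DD (fst (fst b))\<bar> + adot b * \<bar>DD (fst (fst a))\<bar> \<ge> 0"
proof -
  have ang: "angle_at (apex c) (dep c 0) (dep c 1) = opposite_angle T (fst c)" if c: "fst c \<in> edges T" for c
  proof -
    obtain k i r where kir: "c = ((k, i), r)" "k < N" "i < 3" using c by (metis edges_iff prod.collapse)
    have "opposite_angle T (k, i) = angle_at (V k (i+2)) (V k i) (V k (i+1))"
      using kir by (simp add: Let_def V_def)
    then show ?thesis using angle_at_swap by (auto simp: kir(1) dep_eq[OF kir(2,3)])
  qed
  have E: "fst a \<in> edges T" "fst b \<in> edges T" using e portal_edge by auto
  then have k: "fst (fst a) < N" "fst (fst b) < N" by (metis edges_iff prod.collapse)+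
  have "side (dep a 0) (dep a 1) (apex a) \<noteq> 0" "side (dep b 0) (dep b 1) (apex b) \<noteq> 0" using apex_side E DD k by auto
  then have "dots (dep a 0) (dep a 1) (apex a) * \<bar>side (dep b 0) (dep b 1) (apex b)\<bar> + dots (dep b 0) (dep b 1) (apex b) * \<bar>side (dep a 0) (dep a 1) (apex a)\<bar> \<ge> 0"
    using ang E del[OF e] by (intro angle_sum_dots) auto
  then show ?thesis using apex_side E by (auto simp: adot_def abs_mult split: if_splits)
qed

lemma glue_map_inverse:
  assumes \<kappa>: "glue_map a b \<kappa>"
  obtains \<iota> where "glue_map b a \<iota>" "\<And>z. \<iota> (\<kappa> z) = z" "\<And>z. \<kappa> (\<iota> z) = z"
proof -
  have r: "rigid \<kappa>" and d: "\<And>u. \<kappa> (dep a u) = dep b u" using \<kappa> by (auto simp: glue_map_def)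
  obtain m where m: "m > 0" "\<And>z. ec (fst (fst b)) (snd (fst b)) (\<kappa> z) = - m * ec (fst (fst a)) (snd (fst a)) z" using \<kappa> by (auto simp: glue_map_def)
  obtain \<iota> where \<iota>: "rigid \<iota>" "\<And>z. \<iota> (\<kappa> z) = z" "\<And>z. \<kappa> (\<iota> z) = z" by (rule rigid_inverse[OF r]) blast
  have "ec (fst (fst a)) (snd (fst a)) (\<iota> z) = - (1 / m) * ec (fst (fst b)) (snd (fst b)) z" for z
    using m(2)[of "\<iota> z"] m(1) \<iota>(3) by (simp add: field_simps)
  moreover have "\<iota> (dep b u) = dep a u" for u using d[of u] \<iota>(2)[of "dep a u"] by simp
  ultimately have "glue_map b a \<iota>" unfolding glue_map_def using \<iota>(1) m(1) by (auto intro!: exI[of _ "1 / m"])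
  then show ?thesis using that \<iota> by blast
qed

text \<open>\<open>delaunay_pw\<close> in the plane of \<open>a\<close>, with the triangle of
  \<open>b\<close> pulled back by the inverse of \<open>\<kappa>\<close>.\<close>

lemma delaunay_pk:
  assumes e: "e \<in> portals T" "a \<in> e" "b \<in> e" "a \<noteq> b" and \<kappa>: "glue_map a b \<kappa>" and z: "ec (fst (fst a)) (snd (fst a)) z \<le> 0"
  shows "pk (fst (fst b)) (\<kappa> z) \<le> pk (fst (fst a)) z"
proof -
  have E: "fst a \<in> edges T" "fst b \<in> edges T" using e portal_edge by auto
  obtain ka ia ra where a: "a = ((ka, ia), ra)" "ka < N" "ia < 3" using E(1) by (metis edges_iff prod.collapse)
  obtain kb ib rb where b: "b = ((kb, ib), rb)" "kb < N" "ib < 3" using E(2) by (metis edges_iff prod.collapse)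
  have r: "rigid \<kappa>" and d: "\<And>u. \<kappa> (dep a u) = dep b u" using \<kappa> by (auto simp: glue_map_def)
  obtain m where m: "m > 0" "\<And>z. ec kb ib (\<kappa> z) = - m * ec ka ia z" using \<kappa> a b by (auto simp: glue_map_def)
  obtain \<iota> where \<iota>: "rigid \<iota>" "\<And>z. \<iota> (\<kappa> z) = z" "\<And>z. \<kappa> (\<iota> z) = z" by (rule rigid_inverse[OF r]) blast
  define p q w w' where pq: "p = dep a 0" "q = dep a 1" "w = apex a" "w' = \<iota> (apex b)"
  define A where "A = (if ra then -1 else 1) * DD ka"
  have A: "A \<noteq> 0" using DD a by (simp add: A_def)
  have s: "side p q x = A * ec ka ia x" for x using ec_side[OF a(2,3), of ra x] by (simp add: pq A_def a(1))
  have ew: "ec ka ia w = 1" using ec_apex[OF E(1)] by (simp add: pq a(1))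
  have "1 = - m * ec ka ia w'" using m(2)[of w'] \<iota>(3) ec_apex[OF E(2)] by (simp add: pq b(1))
  then have ew': "ec ka ia w' = - (1 / m)" using m(1) by (simp add: field_simps)
  obtain \<epsilon> where \<epsilon>: "\<epsilon> * \<epsilon> = (1::real)" "\<And>p q z. side (\<kappa> p) (\<kappa> q) (\<kappa> z) = \<epsilon> * side p q z" by (rule rigid_side[OF r]) blast
  have ab1: "\<bar>\<epsilon>\<bar> = 1" using \<epsilon>(1) by (metis abs_mult_self_eq abs_one mult_cancel_right1 abs_square_eq_1 power2_eq_square)
  have sw': "\<bar>side p q w'\<bar> = \<bar>DD kb\<bar>"
  proof -
    have "\<bar>side p q w'\<bar> = \<bar>\<epsilon> * side p q w'\<bar>" using ab1 by (simp add: abs_mult)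
    also have "\<epsilon> * side p q w' = side (dep b 0) (dep b 1) (apex b)" using \<epsilon>(2)[of p q w'] \<iota>(3) d by (simp add: pq)
    also have "\<bar>\<dots>\<bar> = \<bar>DD kb\<bar>" unfolding apex_side[OF E(2)] by (simp add: b(1) abs_mult)
    finally show ?thesis .
  qed
  have sw: "\<bar>side p q w\<bar> = \<bar>DD ka\<bar>" using apex_side[OF E(1)] by (auto simp: pq a(1) abs_mult split: if_splits)
  have dw': "dots p q w' = adot b" using rigid_dots[OF r, of p q w'] \<iota>(3) d by (simp add: pq adot_def)
  have dw: "dots p q w = adot a" by (simp add: pq adot_def)
  have c: "pk ka p = 0" "pk ka q = 0" "pk ka w = 0" using pk_V[OF a(2)] by (auto simp: pq a(1) dep_eq[OF a(2,3)])
  define c' where "c' = \<iota> (fst (cR kb))"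
  have pc': "pw c' (snd (cR kb)) x = pk kb (\<kappa> x)" for x
    using rigid_pw[OF \<iota>(1), of "fst (cR kb)" "snd (cR kb)" "\<kappa> x"] \<iota>(2) by (simp add: c'_def pk_def)
  have c2: "pk kb (\<kappa> p) = 0" "pk kb (\<kappa> q) = 0" "pk kb (\<kappa> w') = 0"
    using pk_V[OF b(2)] \<iota>(3) d by (auto simp: pq b(1) dep_eq[OF b(2,3)])
  have "pw c' (snd (cR kb)) z \<le> pw (fst (cR ka)) (snd (cR ka)) z"
  proof (rule delaunay_pw[of _ _ p q w _ _ w'])
    have "A * A > 0" using A by (metis not_real_square_gt_zero)
    then show "side p q w * side p q w' < 0" unfolding s ew ew' using m(1) by simp
    have "side p q z * side p q w' = (A * A) * (- ec ka ia z) * (1 / m)" unfolding s ew' by simp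
    also have "\<dots> \<ge> 0" using z m(1) by (simp add: a(1) mult_nonneg_nonpos divide_nonpos_pos)
    finally show "side p q z * side p q w' \<ge> 0" .
    show "dots p q w * \<bar>side p q w'\<bar> + dots p q w' * \<bar>side p q w\<bar> \<ge> 0" unfolding sw sw' dw dw' using adot_sum[OF e] by (simp add: a(1) b(1))
  qed (use c c2 in \<open>auto simp: pc' pk_def[symmetric]\<close>)
  then show ?thesis unfolding pc' by (simp add: pk_def a(1) b(1))
qed

lemma point_cases:
  assumes "p \<in> surface T"
  obtains (vertex) k i where "k < N" "i < 3" "p = cls (k, V k i)"
    | (inter) k z where "k < N" "\<forall>i<3. 0 < ec k i z" "p = cls (k, z)"
    | (bound) k i v where "k < N" "i < 3" "0 < v" "v < 1" "\<And>e r. e \<in> portals T \<Longrightarrow> ((k, i), r) \<notin> e" "p = cls (k, dep ((k, i), False) v)"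
    | (edge) e a b v where "e \<in> portals T" "a \<in> e" "b \<in> e" "a \<noteq> b" "0 < v" "v < 1" "p = cls (fst (fst a), dep a v)"
proof -
  obtain k z where kz: "k < N" "z \<in> Fr k" "p = cls (k, z)" using surface_rep[OF assms] by auto
  show ?thesis
  proof (cases "is_vertex k z")
    case True
    then show ?thesis using vertex kz by (auto simp: is_vertex_def)
  next
    case False
    show ?thesis
    proof (rule interior_or_edge[OF kz(1,2) False])
      show ?thesis if "\<forall>i<3. 0 < ec k i z" using inter that kz by blast
      fix i assume i: "i < 3" "ec k i z = 0"
      have v: "\<exists>v. z = dep ((k, i), r) v \<and> 0 < v \<and> v < 1" for r
      proof -
        obtain v where v: "z = dep ((k, i), r) v" "v \<in> {0..1}" using on_edge_Fr[OF kz(1) i(1) kz(2) i(2)] by blast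
        then have "v \<noteq> 0" "v \<noteq> 1" using vertex_dep[OF kz(1) i(1), of r v] False by auto
        then show ?thesis using v by (intro exI[of _ v]) auto
      qed
      show ?thesis
      proof (cases "\<exists>e r. e \<in> portals T \<and> ((k, i), r) \<in> e")
        case True
        then obtain e r where e: "e \<in> portals T" "((k, i), r) \<in> e" by blast
        obtain b where b: "b \<in> e" "b \<noteq> ((k, i), r)" using portal_other[OF e] by blast
        obtain v where "z = dep ((k, i), r) v" "0 < v" "v < 1" using v by blast
        then show ?thesis using edge[OF e b(1)] b(2) kz(3) by auto
      next
        case False
        obtain w where "z = dep ((k, i), False) w" "0 < w" "w < 1" using v by blast
        then show ?thesis using bound[OF kz(1) i(1), of w] False kz(3) by blast
      qed
    qed
  qed
qed

text \<open>Along a line \<open>s^2\<close> cancels the quadratic part of minus the power, so inside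
  a triangle the function is affine. At an edge, the affine function of the triangle of
  \<open>a\<close> continued across it stays below, by the Delaunay inequality. At a vertex the
  potential has its minimum 0, and the tangent of \<open>s^2\<close> supports.\<close>

lemma convex_support:
  assumes geo: "geod L \<Gamma>" and t: "0 < t" "t < L"
  shows "\<exists>m \<epsilon>. 0 < \<epsilon> \<and> (\<forall>s\<in>{0..L}. \<bar>s - t\<bar> < \<epsilon> \<longrightarrow> GS (\<Gamma> t) + t\<^sup>2 + m * (s - t) \<le> GS (\<Gamma> s) + s\<^sup>2)"
proof -
  have L: "0 < L" "t \<in> {0..L}" using t by auto
  have mem: "\<Gamma> s \<in> surface T" if "s \<in> {0..L}" for s using geo that by (simp add: geod_def)
  have key: ?thesis
    if k: "\<Gamma> t = cls (k, x)" and u: "norm u = 1" "0 < \<epsilon>"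
      and le: "\<And>s. s \<in> {0..L} \<Longrightarrow> \<bar>s - t\<bar> < \<epsilon> \<Longrightarrow> - pk k (x + (s - t) *\<^sub>R u) \<le> GS (\<Gamma> s)" for k x u \<epsilon>
  \<comment> \<open>The slope of the affine function that \<open>s^2\<close> minus the power leaves
    along the ray.\<close>
  proof (rule exI[of _ "2 * t - 2 * ((x - fst (cR k)) \<bullet> u)"], rule exI[of _ \<epsilon>], intro conjI ballI impI)
    fix s assume s: "s \<in> {0..L}" "\<bar>s - t\<bar> < \<epsilon>"
    have "pk k (x + (s - t) *\<^sub>R u) = pk k x + 2 * (s - t) * ((x - fst (cR k)) \<bullet> u) + (s - t)\<^sup>2"
      unfolding pk_def by (rule pw_ray[OF u(1)])
    then have "GS (\<Gamma> t) + t\<^sup>2 + (2 * t - 2 * ((x - fst (cR k)) \<bullet> u)) * (s - t) = - pk k (x + (s - t) *\<^sub>R u) + s\<^sup>2"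
      by (simp add: k GS_cls G_def power2_eq_square algebra_simps)
    then show "GS (\<Gamma> t) + t\<^sup>2 + (2 * t - 2 * ((x - fst (cR k)) \<bullet> u)) * (s - t) \<le> GS (\<Gamma> s) + s\<^sup>2" using le[OF s] by linarith
  qed (rule u(2))
  from mem[OF L(2)] show ?thesis
  proof (cases rule: point_cases)
    case (vertex k i)
    have "GS (\<Gamma> t) + t\<^sup>2 + 2 * t * (s - t) \<le> GS (\<Gamma> s) + s\<^sup>2" if "s \<in> {0..L}" for s
    proof -
      have "GS (\<Gamma> t) = 0" using vertex pk_V by (simp add: GS_cls G_def)
      moreover have "t\<^sup>2 + 2 * t * (s - t) \<le> s\<^sup>2" using zero_le_power2[of "s - t"] by (simp add: power2_eq_square algebra_simps)
      ultimately show ?thesis using GS_nonneg[OF mem[OF that]] by linarith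
    qed
    then show ?thesis by (intro exI[of _ "2 * t"] exI[of _ 1]) auto
  next
    case (inter k z)
    obtain u \<delta> where u: "norm u = 1" "0 < \<delta>" "\<And>s. s \<in> {0..L} \<Longrightarrow> \<bar>s - t\<bar> < \<delta> \<Longrightarrow> (\<forall>i<3. 0 < ec k i (z + (s - t) *\<^sub>R u)) \<and> \<Gamma> s = cls (k, z + (s - t) *\<^sub>R u)"
      using local_interior[OF geo L inter] by blast
    show ?thesis by (rule key[OF inter(3) u(1,2)]) (use u(3) in \<open>simp add: GS_cls G_def\<close>)
  next
    case (bound k i v)
    obtain u \<delta> where u: "norm u = 1" "0 < \<delta>" "\<And>s. s \<in> {0..L} \<Longrightarrow> \<bar>s - t\<bar> < \<delta> \<Longrightarrow> \<Gamma> s = cls (k, dep ((k, i), False) v + (s - t) *\<^sub>R u)"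
      using local_boundary[OF geo L bound(1-4,6,5)] by metis
    show ?thesis by (rule key[OF bound(6) u(1,2)]) (use u(3) in \<open>simp add: GS_cls G_def\<close>)
  next
    case (edge e a b v)
    obtain \<kappa> where \<kappa>: "glue_map a b \<kappa>" using glue_map_exists[OF edge(1-3)] by blast
    obtain ka ia kb ib where f: "fst a = (ka, ia)" "fst b = (kb, ib)" by (metis prod.exhaust)
    have \<Gamma>t: "\<Gamma> t = cls (ka, dep a v)" using edge(7) f by simp
    obtain u \<delta> where u: "norm u = 1" "0 < \<delta>" "\<And>s y. s \<in> {0..L} \<Longrightarrow> \<bar>s - t\<bar> < \<delta> \<Longrightarrow> y = dep a v + (s - t) *\<^sub>R u \<Longrightarrow>
        (0 \<le> ec ka ia y \<longrightarrow> \<Gamma> s = cls (ka, y)) \<and> (ec ka ia y \<le> 0 \<longrightarrow> \<Gamma> s = cls (kb, \<kappa> y))"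
      using local_edge[OF geo L edge(1-4) f \<kappa> edge(5,6) \<Gamma>t] by metis
    show ?thesis
    proof (rule key[OF \<Gamma>t u(1,2)])
      fix s assume s: "s \<in> {0..L}" "\<bar>s - t\<bar> < \<delta>"
      define y where "y = dep a v + (s - t) *\<^sub>R u"
      show "- pk ka (dep a v + (s - t) *\<^sub>R u) \<le> GS (\<Gamma> s)"
      proof (cases "0 \<le> ec ka ia y")
        case True
        then show ?thesis using u(3)[OF s y_def] by (simp add: GS_cls G_def y_def)
      next
        case False
        then have "\<Gamma> s = cls (kb, \<kappa> y)" using u(3)[OF s y_def] by simp
        moreover have "pk kb (\<kappa> y) \<le> pk ka y" using delaunay_pk[OF edge(1-4) \<kappa>, of y] False f by simp
        ultimately show ?thesis by (simp add: GS_cls G_def y_def)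
      qed
    qed
  qed
qed

text \<open>Minus the power plus \<open>s^2\<close> is affine on the whole interval and coincides
  with the convex function just after \<open>t\<close>; an affine piece of a convex function
  supports it everywhere.\<close>

lemma disk_lower_bound:
  assumes geo: "geod L \<Gamma>" and t: "0 \<le> t" "t + \<epsilon> \<le> L" "0 < \<epsilon>" and j: "rigid j"
    and \<Gamma>: "\<And>s. t \<le> s \<Longrightarrow> s < t + \<epsilon> \<Longrightarrow> \<Gamma> s = cls (k, j (of_real s))" and s: "s \<in> {0..L}"
  shows "- pk k (j (of_real s)) \<le> GS (\<Gamma> s)"
proof -
  obtain \<iota> where \<iota>: "rigid \<iota>" "\<And>z. \<iota> (j z) = z" "\<And>z. j (\<iota> z) = z" by (rule rigid_inverse[OF j]) blast
  define c R where c: "c = \<iota> (fst (cR k))" "R = snd (cR k)"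
  have pc: "pk k (j z) = pw c R z" for z using rigid_pw[OF \<iota>(1), of "fst (cR k)" R "j z"] \<iota>(2) by (simp add: c pk_def)
  have q: "pw c R (of_real x) = x\<^sup>2 - 2 * Re c * x + ((Re c)\<^sup>2 + (Im c)\<^sup>2 - R)" for x
    by (simp add: pw_eq power2_eq_square algebra_simps)
  have "(R - (Re c)\<^sup>2 - (Im c)\<^sup>2) + (2 * Re c) * s \<le> GS (\<Gamma> s) + s\<^sup>2"
  proof (rule support_global[of L "\<lambda>s. GS (\<Gamma> s) + s\<^sup>2" t \<epsilon>])
    show "continuous_on {0..L} (\<lambda>s. GS (\<Gamma> s) + s\<^sup>2)" by (intro continuous_intros GS_continuous[OF geo])
    show "\<exists>m \<epsilon>. 0 < \<epsilon> \<and> (\<forall>s'\<in>{0..L}. \<bar>s' - s\<bar> < \<epsilon> \<longrightarrow> GS (\<Gamma> s) + s\<^sup>2 + m * (s' - s) \<le> GS (\<Gamma> s') + s'\<^sup>2)" if "0 < s" "s < L" for s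
      by (rule convex_support[OF geo that])
    show "GS (\<Gamma> s) + s\<^sup>2 = (R - (Re c)\<^sup>2 - (Im c)\<^sup>2) + (2 * Re c) * s" if "t \<le> s" "s < t + \<epsilon>" for s
      using \<Gamma>[OF that] pc[of "of_real s"] q[of s] by (simp add: GS_cls G_def)
  qed (use t s in auto)
  then show ?thesis using pc[of "of_real s"] q[of s] by simp
qed

section \<open>Passing through a point\<close>

text \<open>The strict inequalities make the crossing transversal: just before \<open>t\<close> the
  path is in the open triangle of \<open>a\<close>, just after \<open>t\<close> in that of
  \<open>b\<close>. The direction \<open>u\<close> is taken in the plane of \<open>a\<close>, and
  \<open>\<kappa>\<close> continues it into the plane of \<open>b\<close>.\<close>

definition transit :: "real \<Rightarrow> (real \<Rightarrow> surface_point) \<Rightarrow> directed_edge \<Rightarrow> directed_edge \<Rightarrow> (complex \<Rightarrow> complex) \<Rightarrow> real \<Rightarrow> complex \<Rightarrow> bool" where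
  "transit t \<Gamma> a b \<kappa> v u \<longleftrightarrow> (\<exists>e\<in>portals T. a \<in> e \<and> b \<in> e) \<and> a \<noteq> b \<and> glue_map a b \<kappa> \<and> 0 < v \<and> v < 1 \<and> norm u = 1 \<and>
     \<Gamma> t = cls (fst (fst a), dep a v) \<and> (\<exists>\<delta>>0.
       (\<forall>s. t - \<delta> < s \<longrightarrow> s < t \<longrightarrow> (\<forall>i<3. 0 < ec (fst (fst a)) i (dep a v + (s - t) *\<^sub>R u)) \<and> \<Gamma> s = cls (fst (fst a), dep a v + (s - t) *\<^sub>R u)) \<and>
       (\<forall>s. t < s \<longrightarrow> s < t + \<delta> \<longrightarrow> (\<forall>i<3. 0 < ec (fst (fst b)) i (\<kappa> (dep a v + (s - t) *\<^sub>R u))) \<and> \<Gamma> s = cls (fst (fst b), \<kappa> (dep a v + (s - t) *\<^sub>R u))))"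

text \<open>Unit speed fixes the rate up to sign; reversing the directed edge if necessary makes the
  parameter increase with time.\<close>

lemma along_edge:
  assumes a: "fst a = (k, i)" "fst a \<in> edges T" and v: "0 < v" "v < 1" and u: "norm u = 1" "0 < \<delta>"
    and on: "ec k i (dep a v + u) = 0"
    and \<Gamma>: "\<And>s. \<bar>s - t\<bar> < \<delta> \<Longrightarrow> \<Gamma> s = cls (k, dep a v + (s - t) *\<^sub>R u)"
  shows "\<exists>c w \<delta>. fst c \<in> edges T \<and> 0 < w \<and> w < 1 \<and> 0 < \<delta> \<and> (\<forall>s. \<bar>s - t\<bar> < \<delta> \<longrightarrow>
     0 < w + (s - t) / edge_length T (fst c) \<and> w + (s - t) / edge_length T (fst c) < 1 \<and>
     \<Gamma> s = cls (fst (fst c), dep c (w + (s - t) / edge_length T (fst c))))"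
proof -
  have ki: "k < N" "i < 3" using a by (auto simp: edges_iff)
  have aa: "a = ((k, i), snd a)" using a by (metis prod.collapse)
  obtain w1 where w1: "dep a v + u = dep a w1" using on_edge[OF ki on] aa by metis
  define len where "len = edge_length T (fst a)"
  have d: "dep a x - dep a y = (x - y) *\<^sub>R (dep a 1 - dep a 0)" for x y
    by (subst dep_lin[OF a(2), of x], subst dep_lin[OF a(2), of y]) (simp add: algebra_simps)
  have "u = dep a w1 - dep a v" using w1 by (metis add_diff_cancel_left')
  then have uu: "u = (w1 - v) *\<^sub>R (dep a 1 - dep a 0)" by (simp only: d[of w1 v])
  have len: "len = norm (dep a 1 - dep a 0)" using dep_norm[OF a(2)] by (simp add: len_def)
  have len0: "len > 0" using dep_neq[OF a(2)] len by simp
  have w1v: "\<bar>w1 - v\<bar> * len = 1" using u(1) uu len by simp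
  have y: "dep a v + (s - t) *\<^sub>R u = dep a (v + (s - t) * (w1 - v))" for s
  proof -
    have "dep a (v + (s - t) * (w1 - v)) - dep a v = ((s - t) * (w1 - v)) *\<^sub>R (dep a 1 - dep a 0)"
      by (subst d) simp
    also have "\<dots> = (s - t) *\<^sub>R u" unfolding uu by simp
    finally show ?thesis by (metis add.commute diff_add_cancel)
  qed
  define \<delta>' where "\<delta>' = min \<delta> (len * min v (1 - v))"
  have \<delta>': "\<delta>' > 0" "\<delta>' \<le> \<delta>" using u(2) len0 v by (auto simp: \<delta>'_def)
  have small: "\<bar>(s - t) / len\<bar> < min v (1 - v)" if "\<bar>s - t\<bar> < \<delta>'" for s
  proof -
    have "\<bar>s - t\<bar> < len * min v (1 - v)" using that by (simp add: \<delta>'_def)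
    then show ?thesis unfolding abs_divide abs_of_pos[OF len0] pos_divide_less_eq[OF len0] by (simp only: mult.commute)
  qed
  have bnd: "0 < v + (s - t) / len" "v + (s - t) / len < 1" "0 < 1 - v + (s - t) / len" "1 - v + (s - t) / len < 1" if "\<bar>s - t\<bar> < \<delta>'" for s
    using small[OF that] by linarith+
  have \<Gamma>': "\<Gamma> s = cls (k, dep a (v + (s - t) * (w1 - v)))" if "\<bar>s - t\<bar> < \<delta>'" for s
    using \<Gamma>[of s] that \<delta>'(2) unfolding y by simp
  show ?thesis
  proof (cases "w1 - v > 0")
    case True
    then have w: "w1 - v = 1 / len" using w1v len0 by (simp add: field_simps)
    have "0 < v + (s - t) / len \<and> v + (s - t) / len < 1 \<and> \<Gamma> s = cls (fst (fst a), dep a (v + (s - t) / len))" if "\<bar>s - t\<bar> < \<delta>'" for s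
      using bnd(1,2)[OF that] \<Gamma>'[OF that] a(1) by (simp add: w)
    then show ?thesis using \<delta>'(1) v a(2) unfolding len_def by blast
  next
    case False
    then have w: "w1 - v = - (1 / len)" using w1v len0 by (simp add: field_simps)
    define c where "c = (fst a, \<not> snd a)"
    have "dep a (v + (s - t) * (w1 - v)) = dep c (1 - v + (s - t) / len)" for s
      using dep_flip[OF a(2), of "1 - v + (s - t) / len"] by (simp add: w c_def)
    then have "0 < 1 - v + (s - t) / len \<and> 1 - v + (s - t) / len < 1 \<and> \<Gamma> s = cls (fst (fst c), dep c (1 - v + (s - t) / len))" if "\<bar>s - t\<bar> < \<delta>'" for s
      using bnd(3,4)[OF that] \<Gamma>'[OF that] a(1) by (simp add: c_def)
    moreover have "fst c = fst a" "0 < 1 - v" "1 - v < 1" using v by (auto simp: c_def)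
    ultimately show ?thesis using \<delta>'(1) a(2) unfolding len_def by metis
  qed
qed

lemma ec_ray: "ec k i x = 0 \<Longrightarrow> ec k i (x + \<sigma> *\<^sub>R u) = \<sigma> * ec k i (x + u)"
proof -
  assume x: "ec k i x = 0"
  have "x + \<sigma> *\<^sub>R u = (1 - \<sigma>) *\<^sub>R x + \<sigma> *\<^sub>R (x + u)" by (simp add: algebra_simps)
  then show ?thesis using x by (simp add: ec_comb)
qed

lemma passing:
  assumes geo: "geod L \<Gamma>" and t: "0 < t" "t < L" and nv: "\<And>k i. k < N \<Longrightarrow> \<Gamma> t \<noteq> cls (k, V k i)"
  obtains (inside) k x u \<delta> where "k < N" "norm u = 1" "0 < \<delta>" "\<And>s. \<bar>s - t\<bar> < \<delta> \<Longrightarrow> (\<forall>i<3. 0 < ec k i (x + (s - t) *\<^sub>R u)) \<and> \<Gamma> s = cls (k, x + (s - t) *\<^sub>R u)"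
    | (along) c w \<delta> where "fst c \<in> edges T" "0 < w" "w < 1" "0 < \<delta>" "\<And>s. \<bar>s - t\<bar> < \<delta> \<Longrightarrow>
     0 < w + (s - t) / edge_length T (fst c) \<and> w + (s - t) / edge_length T (fst c) < 1 \<and>
     \<Gamma> s = cls (fst (fst c), dep c (w + (s - t) / edge_length T (fst c)))"
    | (transit) a b \<kappa> v u where "transit t \<Gamma> a b \<kappa> v u"
proof -
  have L: "0 < L" "t \<in> {0..L}" using t by auto
  define \<tau> where "\<tau> = min t (L - t)"
  have \<tau>: "\<tau> > 0" "\<And>s. \<bar>s - t\<bar> < \<tau> \<Longrightarrow> s \<in> {0..L}" using t by (auto simp: \<tau>_def abs_less_iff)
  have mem: "\<Gamma> t \<in> surface T" using geo L by (simp add: geod_def)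
  from mem show ?thesis
  proof (cases rule: point_cases)
    case (vertex k i)
    then show ?thesis using nv by blast
  next
    case (inter k z)
    obtain u \<delta> where u: "norm u = 1" "0 < \<delta>" "\<And>s. s \<in> {0..L} \<Longrightarrow> \<bar>s - t\<bar> < \<delta> \<Longrightarrow> (\<forall>i<3. 0 < ec k i (z + (s - t) *\<^sub>R u)) \<and> \<Gamma> s = cls (k, z + (s - t) *\<^sub>R u)"
      using local_interior[OF geo L inter] by blast
    show ?thesis by (rule inside[of k u "min \<delta> \<tau>" z]) (use inter u \<tau> in auto)
  next
    case (bound k i v)
    define x where "x = dep ((k, i), False) v"
    obtain u \<delta> where u: "norm u = 1" "0 < \<delta>" "\<And>s. s \<in> {0..L} \<Longrightarrow> \<bar>s - t\<bar> < \<delta> \<Longrightarrow> x + (s - t) *\<^sub>R u \<in> Fr k \<and> \<Gamma> s = cls (k, x + (s - t) *\<^sub>R u)"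
      using local_boundary[OF geo L bound(1-4,6,5)] unfolding x_def by metis
    have x0: "ec k i x = 0" using ec_dep[OF bound(1,2)] by (simp add: x_def)
    define d where "d = min \<delta> \<tau> / 2"
    have d: "d > 0" "d < \<delta>" "d < \<tau>" using u \<tau> by (auto simp: d_def)
    \<comment> \<open>At an edge without a portal the path is on the same side before and after
      \<open>t\<close>; being straight, it runs along the edge.\<close>
    have "0 \<le> ec k i (x + d *\<^sub>R u)" "0 \<le> ec k i (x + (- d) *\<^sub>R u)"
      using u(3)[of "t + d"] u(3)[of "t - d"] \<tau>(2)[of "t + d"] \<tau>(2)[of "t - d"] d Fr_iff[OF bound(1)] bound(2) by auto
    then have on: "ec k i (x + u) = 0" unfolding ec_ray[OF x0] using d(1) by (auto simp: zero_le_mult_iff mult_le_0_iff)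
    have E: "fst ((k, i), False) = (k, i)" "fst ((k, i), False) \<in> edges T" using bound by (auto simp: edges_iff)
    have on': "ec k i (dep ((k, i), False) v + u) = 0" using on by (simp add: x_def)
    have "\<exists>c w \<delta>. fst c \<in> edges T \<and> 0 < w \<and> w < 1 \<and> 0 < \<delta> \<and> (\<forall>s. \<bar>s - t\<bar> < \<delta> \<longrightarrow>
     0 < w + (s - t) / edge_length T (fst c) \<and> w + (s - t) / edge_length T (fst c) < 1 \<and>
     \<Gamma> s = cls (fst (fst c), dep c (w + (s - t) / edge_length T (fst c))))"
      by (rule along_edge[OF E bound(3,4) u(1) _ on', of "min \<delta> \<tau>"]) (use u \<tau> in \<open>auto simp: x_def\<close>)
    then show ?thesis using along by blast
  next
    case (edge e a b v)
    have E: "fst a \<in> edges T" "fst b \<in> edges T" using edge portal_edge by auto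
    obtain \<kappa> where \<kappa>: "glue_map a b \<kappa>" using glue_map_exists[OF edge(1-3)] by blast
    obtain ka ia kb ib where f: "fst a = (ka, ia)" "fst b = (kb, ib)" by (metis prod.exhaust)
    have k: "ka < N" "ia < 3" "kb < N" "ib < 3" using E f by (auto simp: edges_iff)
    have \<Gamma>t: "\<Gamma> t = cls (ka, dep a v)" using edge(7) f by simp
    obtain u \<delta> where u: "norm u = 1" "0 < \<delta>" "\<And>s y. s \<in> {0..L} \<Longrightarrow> \<bar>s - t\<bar> < \<delta> \<Longrightarrow> y = dep a v + (s - t) *\<^sub>R u \<Longrightarrow>
        0 < ec ka (ia+1) y \<and> 0 < ec ka (ia+2) y \<and> 0 < ec kb (ib+1) (\<kappa> y) \<and> 0 < ec kb (ib+2) (\<kappa> y) \<and>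
        (0 \<le> ec ka ia y \<longrightarrow> \<Gamma> s = cls (ka, y)) \<and> (ec ka ia y \<le> 0 \<longrightarrow> \<Gamma> s = cls (kb, \<kappa> y))"
      using local_edge[OF geo L edge(1-4) f \<kappa> edge(5,6) \<Gamma>t] by metis
    define \<eta> where "\<eta> = ec ka ia (dep a v + u)"
    have x0: "ec ka ia (dep a v) = 0" using ec_dep[OF k(1,2), of "snd a" v] f by (metis prod.collapse)
    have ey: "ec ka ia (dep a v + \<sigma> *\<^sub>R u) = \<sigma> * \<eta>" for \<sigma> using ec_ray[OF x0] by (simp add: \<eta>_def)
    obtain m where m: "m > 0" "\<And>z. ec kb ib (\<kappa> z) = - m * ec ka ia z" using \<kappa> f by (auto simp: glue_map_def)
    have ey': "ec kb ib (\<kappa> (dep a v + \<sigma> *\<^sub>R u)) = - m * (\<sigma> * \<eta>)" for \<sigma> using m(2) ey by simp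
    define \<delta>' where "\<delta>' = min \<delta> \<tau>"
    have \<delta>': "\<delta>' > 0" using u \<tau> by (simp add: \<delta>'_def)
    have U: "0 < ec ka (ia+1) y \<and> 0 < ec ka (ia+2) y \<and> 0 < ec kb (ib+1) (\<kappa> y) \<and> 0 < ec kb (ib+2) (\<kappa> y) \<and>
        (0 \<le> ec ka ia y \<longrightarrow> \<Gamma> s = cls (ka, y)) \<and> (ec ka ia y \<le> 0 \<longrightarrow> \<Gamma> s = cls (kb, \<kappa> y))"
      if "\<bar>s - t\<bar> < \<delta>'" "y = dep a v + (s - t) *\<^sub>R u" for s y
      using u(3)[OF \<tau>(2) _ that(2)] that(1) by (simp add: \<delta>'_def)
    have inA: "(\<forall>i<3. 0 < ec ka i (dep a v + (s - t) *\<^sub>R u)) \<and> \<Gamma> s = cls (ka, dep a v + (s - t) *\<^sub>R u)" if s: "\<bar>s - t\<bar> < \<delta>'" "0 < (s - t) * \<eta>" for s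
      using U[OF s(1) refl] s(2) ey[of "s - t"] ec_all[OF k(2), of "\<lambda>x. 0 < x"] by simp
    have inB: "(\<forall>i<3. 0 < ec kb i (\<kappa> (dep a v + (s - t) *\<^sub>R u))) \<and> \<Gamma> s = cls (kb, \<kappa> (dep a v + (s - t) *\<^sub>R u))" if s: "\<bar>s - t\<bar> < \<delta>'" "(s - t) * \<eta> < 0" for s
      using U[OF s(1) refl] s(2) ey[of "s - t"] ey'[of "s - t"] m(1) ec_all[OF k(4), of "\<lambda>x. 0 < x"] by (simp add: mult_pos_neg)
    consider "\<eta> = 0" | "\<eta> < 0" | "\<eta> > 0" by linarith
    then show ?thesis
    proof cases
      case 1
      have "\<exists>c w \<delta>. fst c \<in> edges T \<and> 0 < w \<and> w < 1 \<and> 0 < \<delta> \<and> (\<forall>s. \<bar>s - t\<bar> < \<delta> \<longrightarrow>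
       0 < w + (s - t) / edge_length T (fst c) \<and> w + (s - t) / edge_length T (fst c) < 1 \<and>
       \<Gamma> s = cls (fst (fst c), dep c (w + (s - t) / edge_length T (fst c))))"
        by (rule along_edge[OF f(1) E(1) edge(5,6) u(1) \<delta>']) (use 1 U ey in \<open>auto simp: \<eta>_def\<close>)
      then show ?thesis using along by blast
    next
      case 2
      have "\<exists>\<delta>>0. (\<forall>s. t - \<delta> < s \<longrightarrow> s < t \<longrightarrow> (\<forall>i<3. 0 < ec ka i (dep a v + (s - t) *\<^sub>R u)) \<and> \<Gamma> s = cls (ka, dep a v + (s - t) *\<^sub>R u)) \<and>
         (\<forall>s. t < s \<longrightarrow> s < t + \<delta> \<longrightarrow> (\<forall>i<3. 0 < ec kb i (\<kappa> (dep a v + (s - t) *\<^sub>R u))) \<and> \<Gamma> s = cls (kb, \<kappa> (dep a v + (s - t) *\<^sub>R u)))"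
      proof (rule exI[of _ \<delta>'], rule conjI[OF \<delta>'], rule conjI; rule allI; rule impI; rule impI)
        fix s assume "t - \<delta>' < s" "s < t"
        then show "(\<forall>i<3. 0 < ec ka i (dep a v + (s - t) *\<^sub>R u)) \<and> \<Gamma> s = cls (ka, dep a v + (s - t) *\<^sub>R u)"
          using 2 by (intro inA) (auto simp: mult_neg_neg)
      next
        fix s assume "t < s" "s < t + \<delta>'"
        then show "(\<forall>i<3. 0 < ec kb i (\<kappa> (dep a v + (s - t) *\<^sub>R u))) \<and> \<Gamma> s = cls (kb, \<kappa> (dep a v + (s - t) *\<^sub>R u))"
          using 2 by (intro inB) (auto simp: mult_pos_neg)
      qed
      then have "transit t \<Gamma> a b \<kappa> v u"
        unfolding transit_def f fst_conv using edge(1-6) \<kappa> u(1) \<Gamma>t by blast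
      then show ?thesis by (rule transit)
    next
      case 3
      \<comment> \<open>Here the path moves from the triangle of \<open>b\<close> into that of
        \<open>a\<close>, so the two edges exchange roles by way of the inverse motion.\<close>
      obtain \<iota> where \<iota>: "glue_map b a \<iota>" "\<And>z. \<iota> (\<kappa> z) = z" "\<And>z. \<kappa> (\<iota> z) = z" by (rule glue_map_inverse[OF \<kappa>]) blast
      have r: "rigid \<kappa>" and \<kappa>d: "\<kappa> (dep a v) = dep b v" using \<kappa> by (auto simp: glue_map_def)
      define u' where "u' = \<kappa> (dep a v + u) - dep b v"
      have yy: "dep b v + \<sigma> *\<^sub>R u' = \<kappa> (dep a v + \<sigma> *\<^sub>R u)" for \<sigma> using rigid_affine[OF r, of "dep a v" \<sigma> u] by (simp add: u'_def \<kappa>d)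
      have nu': "norm u' = 1" using rigid_norm[OF r, of "dep a v + u" "dep a v"] u(1) by (simp add: u'_def \<kappa>d)
      have "((fst (fst a), dep a v), (fst (fst b), dep b v)) \<in> glue T" using glueI[OF edge(1-3), of v] edge(5,6) by simp
      then have \<Gamma>t': "\<Gamma> t = cls (kb, dep b v)" using glue_cls edge(7) f by simp
      have "\<exists>\<delta>>0. (\<forall>s. t - \<delta> < s \<longrightarrow> s < t \<longrightarrow> (\<forall>i<3. 0 < ec kb i (dep b v + (s - t) *\<^sub>R u')) \<and> \<Gamma> s = cls (kb, dep b v + (s - t) *\<^sub>R u')) \<and>
         (\<forall>s. t < s \<longrightarrow> s < t + \<delta> \<longrightarrow> (\<forall>i<3. 0 < ec ka i (\<iota> (dep b v + (s - t) *\<^sub>R u'))) \<and> \<Gamma> s = cls (ka, \<iota> (dep b v + (s - t) *\<^sub>R u')))"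
      proof (rule exI[of _ \<delta>'], rule conjI[OF \<delta>'], rule conjI; rule allI; rule impI; rule impI)
        fix s assume "t - \<delta>' < s" "s < t"
        then show "(\<forall>i<3. 0 < ec kb i (dep b v + (s - t) *\<^sub>R u')) \<and> \<Gamma> s = cls (kb, dep b v + (s - t) *\<^sub>R u')"
          unfolding yy using 3 by (intro inB) (auto simp: mult_neg_pos)
      next
        fix s assume "t < s" "s < t + \<delta>'"
        then show "(\<forall>i<3. 0 < ec ka i (\<iota> (dep b v + (s - t) *\<^sub>R u'))) \<and> \<Gamma> s = cls (ka, \<iota> (dep b v + (s - t) *\<^sub>R u'))"
          unfolding yy \<iota>(2) using 3 by (intro inA) auto
      qed
      then have "transit t \<Gamma> b a \<iota> v u'"
        unfolding transit_def f fst_conv using edge(1-6) \<iota>(1) nu' \<Gamma>t' by blast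
      then show ?thesis by (rule transit)
    qed
  qed
qed

end

lemma affine_eq:
  fixes x u y v :: complex
  assumes "s1 \<noteq> s2" "x + s1 *\<^sub>R u = y + s1 *\<^sub>R v" "x + s2 *\<^sub>R u = y + s2 *\<^sub>R v"
  shows "x + s *\<^sub>R u = y + s *\<^sub>R v"
proof -
  have "(s1 - s2) *\<^sub>R (u - v) = (x + s1 *\<^sub>R u) - (x + s2 *\<^sub>R u) - ((y + s1 *\<^sub>R v) - (y + s2 *\<^sub>R v))" by (simp add: algebra_simps)
  also have "\<dots> = 0" using assms by simp
  finally have "u = v" using assms(1) by simp
  then show ?thesis using assms(2) by simp
qed

lemma rigid_real: "rigid j \<Longrightarrow> j (of_real s) = j 0 + s *\<^sub>R (j 1 - j 0)"
  using rigid_affine[of j 0 s 1] by (simp add: scaleR_conv_of_real)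

lemma rigid_line: "norm u = 1 \<Longrightarrow> rigid (\<lambda>z. x + (z - of_real t) * u)"
  unfolding rigid_def by (intro exI[of _ u] exI[of _ "x - of_real t * u"]) (auto simp: algebra_simps)

lemma rigid_inj: "rigid f \<Longrightarrow> f x = f y \<Longrightarrow> x = y"
  using rigid_norm[of f x y] by simp

context delaunay_portalgon
begin

section \<open>Entries into triangles and the development along a path\<close>

text \<open>\<open>j\<close> lays the real axis, which stands for the straightened path, into the
  plane of fragment \<open>k\<close>. At \<open>t\<close> itself the point may be on the boundary;
  afterwards it is interior.\<close>

definition enter :: "real \<Rightarrow> (real \<Rightarrow> surface_point) \<Rightarrow> real \<Rightarrow> nat \<Rightarrow> (complex \<Rightarrow> complex) \<Rightarrow> bool" where
  "enter L \<Gamma> t k j \<longleftrightarrow> k < N \<and> rigid j \<and> 0 \<le> t \<and> (\<exists>\<epsilon>>0. t + \<epsilon> \<le> L \<and> (\<forall>s. t \<le> s \<longrightarrow> s < t + \<epsilon> \<longrightarrow> \<Gamma> s = cls (k, j (of_real s))) \<and>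
     (\<forall>s. t < s \<longrightarrow> s < t + \<epsilon> \<longrightarrow> (\<forall>i<3. 0 < ec k i (j (of_real s)))))"

definition enter_edge :: "real \<Rightarrow> (real \<Rightarrow> surface_point) \<Rightarrow> real \<Rightarrow> nat \<Rightarrow> nat \<Rightarrow> (complex \<Rightarrow> complex) \<Rightarrow> bool" where
  "enter_edge L \<Gamma> t k i j \<longleftrightarrow> enter L \<Gamma> t k j \<and> i < 3 \<and> ec k i (j (of_real t)) = 0 \<and> 0 < ec k (i+1) (j (of_real t)) \<and> 0 < ec k (i+2) (j (of_real t))"

text \<open>The state is the triangle \<open>k\<close> pulled back by \<open>j\<close>. The factor
  \<open>\<bar>DD k\<bar>\<close> makes \<open>side l u\<close> nonnegative on the triangle for
  either orientation, and the final disjunction leaves open which end of edge \<open>i\<close> is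
  above the path.\<close>

fun placed :: "nat \<Rightarrow> nat \<Rightarrow> (complex \<Rightarrow> complex) \<Rightarrow> pstate \<Rightarrow> bool" where
  "placed k i j (t, u, l, c, R) \<longleftrightarrow> crossing t u l \<and> (\<forall>z. side l u z = \<bar>DD k\<bar> * ec k i (j z)) \<and> (\<forall>z. pw c R z = pk k (j z)) \<and>
     ((j u = V k i \<and> j l = V k (i+1)) \<or> (j u = V k (i+1) \<and> j l = V k i))"

lemma enter_later:
  assumes "enter L \<Gamma> t k j" shows "\<exists>\<epsilon>>0. \<forall>t'. t \<le> t' \<longrightarrow> t' < t + \<epsilon> \<longrightarrow> enter L \<Gamma> t' k j"
proof -
  obtain \<epsilon> where e: "\<epsilon> > 0" "t + \<epsilon> \<le> L" "\<And>s. t \<le> s \<Longrightarrow> s < t + \<epsilon> \<Longrightarrow> \<Gamma> s = cls (k, j (of_real s))"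
     "\<And>s. t < s \<Longrightarrow> s < t + \<epsilon> \<Longrightarrow> (\<forall>i<3. 0 < ec k i (j (of_real s)))" and k: "k < N" "rigid j" "0 \<le> t" using assms unfolding enter_def by blast
  have "enter L \<Gamma> t' k j" if t': "t \<le> t'" "t' < t + \<epsilon>" for t'
    unfolding enter_def
  proof (intro conjI)
    show "\<exists>\<epsilon>'>0. t' + \<epsilon>' \<le> L \<and> (\<forall>s. t' \<le> s \<longrightarrow> s < t' + \<epsilon>' \<longrightarrow> \<Gamma> s = cls (k, j (of_real s))) \<and>
     (\<forall>s. t' < s \<longrightarrow> s < t' + \<epsilon>' \<longrightarrow> (\<forall>i<3. 0 < ec k i (j (of_real s))))"
      by (rule exI[of _ "t + \<epsilon> - t'"]) (use t' e in auto)
  qed (use k t' in auto)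
  then show ?thesis using e(1) by blast
qed

text \<open>Points of an open triangle have a single representative, so the two descriptions of the
  path agree at two nearby times and hence, being affine, at all times. Off the real axis
  \<open>j\<close> remains free up to a reflection.\<close>

lemma enter_agree:
  assumes en: "enter L \<Gamma> t k j" and d: "0 < d" and k': "k' < N"
    and \<Gamma>: "\<And>s. t < s \<Longrightarrow> s < t + d \<Longrightarrow> (\<forall>i<3. 0 < ec k' i (x + s *\<^sub>R u)) \<and> \<Gamma> s = cls (k', x + s *\<^sub>R u)"
  shows "k' = k \<and> (\<forall>s. j (of_real s) = x + s *\<^sub>R u)"
proof -
  obtain \<epsilon> where e: "\<epsilon> > 0" "\<And>s. t \<le> s \<Longrightarrow> s < t + \<epsilon> \<Longrightarrow> \<Gamma> s = cls (k, j (of_real s))"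
     "\<And>s. t < s \<Longrightarrow> s < t + \<epsilon> \<Longrightarrow> (\<forall>i<3. 0 < ec k i (j (of_real s)))" and k: "k < N" "rigid j" using en unfolding enter_def by blast
  have eq: "k' = k \<and> x + s *\<^sub>R u = j (of_real s)" if s: "t < s" "s < t + min d \<epsilon>" for s
  proof -
    have "cls (k, j (of_real s)) = cls (k', x + s *\<^sub>R u)" using e(2)[of s] \<Gamma>[of s] s by simp
    then show ?thesis using cls_interior[OF k(1), of "j (of_real s)"] e(3)[of s] s by auto
  qed
  define s1 s2 where ss: "s1 = t + min d \<epsilon> / 2" "s2 = t + min d \<epsilon> / 3"
  have s: "t < s1" "s1 < t + min d \<epsilon>" "t < s2" "s2 < t + min d \<epsilon>" "s1 \<noteq> s2" using d e(1) by (auto simp: ss)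
  have "x + s *\<^sub>R u = j 0 + s *\<^sub>R (j 1 - j 0)" for s
    by (rule affine_eq[OF s(5)]) (use eq[OF s(1,2)] eq[OF s(3,4)] rigid_real[OF k(2)] in auto)
  then show ?thesis using eq[OF s(1,2)] rigid_real[OF k(2)] by auto
qed

lemma placed_exists:
  assumes "enter_edge L \<Gamma> t k i j"
  obtains u l c R where "placed k i j (t, u, l, c, R)"
proof -
  have k: "k < N" "i < 3" and j: "rigid j" and on: "ec k i (j (of_real t)) = 0" "0 < ec k (i+1) (j (of_real t))" "0 < ec k (i+2) (j (of_real t))"
    using assms unfolding enter_edge_def enter_def by auto
  obtain \<epsilon> where e: "\<epsilon> > 0" "\<And>s. t < s \<Longrightarrow> s < t + \<epsilon> \<Longrightarrow> (\<forall>i<3. 0 < ec k i (j (of_real s)))" using assms unfolding enter_edge_def enter_def by blast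
  obtain \<iota> where \<iota>: "rigid \<iota>" "\<And>z. \<iota> (j z) = z" "\<And>z. j (\<iota> z) = z" by (rule rigid_inverse[OF j]) blast
  define p q where pq: "p = \<iota> (V k i)" "q = \<iota> (V k (i+1))"
  obtain \<epsilon>1 where \<epsilon>1: "\<epsilon>1 * \<epsilon>1 = (1::real)" "\<And>p q z. side (\<iota> p) (\<iota> q) (\<iota> z) = \<epsilon>1 * side p q z" by (rule rigid_side[OF \<iota>(1)]) blast
  have sd: "side p q z = (\<epsilon>1 * DD k) * ec k i (j z)" for z
    using \<epsilon>1(2)[of "V k i" "V k (i+1)" "j z"] \<iota>(2) DD[OF k(1)] by (simp add: pq ec_def)
  have ab: "\<bar>\<epsilon>1 * DD k\<bar> = \<bar>DD k\<bar>"
  proof -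
    have "\<bar>\<epsilon>1\<bar> = 1" using \<epsilon>1(1) by (metis abs_mult_self_eq abs_one mult_cancel_right1 abs_square_eq_1 power2_eq_square)
    then show ?thesis by (simp add: abs_mult)
  qed
  obtain w where w: "j (of_real t) = dep ((k, i), False) w" using on_edge[OF k on(1)] by metis
  have w01: "0 < w" "w < 1" using on ec_dep[OF k, of False w] w by auto
  have "of_real t = \<iota> (dep ((k, i), False) w)" using w \<iota>(2) by metis
  then have tw: "of_real t = (1-w) *\<^sub>R p + w *\<^sub>R q" using rigid_comb[OF \<iota>(1)] by (simp add: dep_eq k pq)
  then have tIm: "0 = (1-w) * Im p + w * Im q" and tRe: "t = (1-w) * Re p + w * Re q" by (simp_all add: complex_eq_iff)
  have pq0: "p \<noteq> q"
  proof
    assume "p = q"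
    then have "side p q z = 0" for z by (simp add: side_def)
    then show False using sd[of "of_real (t + \<epsilon>/2)"] e(1) e(2)[of "t + \<epsilon>/2"] k DD[OF k(1)] \<epsilon>1(1) by auto
  qed
  have seg: "of_real t \<in> open_segment p q" "of_real t \<in> open_segment q p"
    unfolding open_segment_commute[of q p] using pq0 tw w01 unfolding in_segment by blast+
  have sre: "side p q (of_real s) = (s - t) * (Im q - Im p)" for s
  proof -
    have "t - Re p = w * (Re q - Re p)" "Im p = - w * (Im q - Im p)" using tRe tIm by algebra+
    moreover have "side p q (of_real s) = (s - t) * (Im q - Im p) + (t - Re p) * (Im q - Im p) + Im p * (Re q - Re p)"
      unfolding side_def by simp algebra
    ultimately show ?thesis by algebra
  qed
  have pos: "0 < ec k i (j (of_real (t + \<epsilon>/2)))" using e(2)[of "t + \<epsilon>/2"] e(1) k by auto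
  have nz: "Im q \<noteq> Im p"
    using sre[of "t + \<epsilon>/2"] sd[of "of_real (t + \<epsilon>/2)"] pos DD[OF k(1)] \<epsilon>1(1) by auto
  obtain c where c: "c = \<iota> (fst (cR k))" by simp
  have pc: "pw c (snd (cR k)) z = pk k (j z)" for z
    using rigid_pw[OF \<iota>(1), of "fst (cR k)" "snd (cR k)" "j z"] \<iota>(2) by (simp add: c pk_def)
  show ?thesis
  proof (cases "Im q > Im p")
    case True
    have "Im p < 0" "0 < Im q"
    proof -
      have "Im p = - (w * (Im q - Im p))" using tIm by algebra
      then show "Im p < 0" using w01 True by (smt (verit) mult_pos_pos)
      then have "(1-w) * Im p < 0" using w01 by (simp add: mult_pos_neg)
      then have "0 < w * Im q" using tIm by linarith
      then show "0 < Im q" using w01 by (simp add: zero_less_mult_iff)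
    qed
    moreover have "\<epsilon>1 * DD k > 0"
    proof -
      have "0 < side p q (of_real (t + \<epsilon>/2))" unfolding sre using True e(1) by simp
      then show ?thesis unfolding sd using pos by (simp add: zero_less_mult_iff)
    qed
    ultimately have "placed k i j (t, q, p, c, snd (cR k))" using seg sd ab pc \<iota>(3) by (simp add: crossing_def pq)
    then show ?thesis by (rule that)
  next
    case False
    then have lt: "Im q < Im p" using nz by simp
    have "Im q < 0" "0 < Im p"
    proof -
      have "Im p = w * (Im p - Im q)" using tIm by algebra
      then show "0 < Im p" using w01 lt by (smt (verit) mult_pos_pos)
      then have "(1-w) * Im p > 0" using w01 by simp
      then have "w * Im q < 0" using tIm by linarith
      then show "Im q < 0" using w01 by (simp add: mult_less_0_iff)
    qed
    moreover have eneg: "\<epsilon>1 * DD k < 0"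
    proof -
      have "side p q (of_real (t + \<epsilon>/2)) < 0" unfolding sre using lt e(1) by (simp add: mult_pos_neg)
      then show ?thesis unfolding sd using pos by (simp add: mult_less_0_iff)
    qed
    moreover have "side q p z = \<bar>DD k\<bar> * ec k i (j z)" for z
    proof -
      have "side q p z = (- (\<epsilon>1 * DD k)) * ec k i (j z)" using sd[of z] side_swap[of q p z] by simp
      also have "- (\<epsilon>1 * DD k) = \<bar>DD k\<bar>" using eneg ab by simp
      finally show ?thesis .
    qed
    ultimately have "placed k i j (t, p, q, c, snd (cR k))" using seg pc \<iota>(3) by (simp add: crossing_def pq)
    then show ?thesis by (rule that)
  qed
qed

lemma vertex_nonneg: "k < N \<Longrightarrow> i < 3 \<Longrightarrow> 0 \<le> ec k i (V k m)"
proof -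
  assume k: "k < N" "i < 3"
  have "V k (m mod 3) \<in> {V k 0, V k 1, V k 2}"
    by (rule cases3[of "m mod 3"]) simp_all
  then have "V k m \<in> {V k 0, V k 1, V k 2}" by (simp only: V_mod(1))
  then have "V k m \<in> Fr k" unfolding Fr_hull[OF k(1)] by (rule hull_inc)
  then show ?thesis using Fr_iff[OF k(1)] k(2) by blast
qed

lemma transit_enter:
  assumes tr: "transit t \<Gamma> a b \<kappa> v u" and t: "0 \<le> t" "t < L" and rj: "rigid j" and j: "\<And>s. j (of_real s) = dep a v + (s - t) *\<^sub>R u"
  shows "enter_edge L \<Gamma> t (fst (fst b)) (snd (fst b)) (\<lambda>z. \<kappa> (j z))"
proof -
  obtain e where e: "e \<in> portals T" "a \<in> e" "b \<in> e" "a \<noteq> b" and \<kappa>: "glue_map a b \<kappa>" and v: "0 < v" "v < 1" using tr unfolding transit_def by blast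
  obtain \<delta> where \<delta>: "\<delta> > 0" "\<And>s. t < s \<Longrightarrow> s < t + \<delta> \<Longrightarrow> (\<forall>i<3. 0 < ec (fst (fst b)) i (\<kappa> (dep a v + (s - t) *\<^sub>R u))) \<and> \<Gamma> s = cls (fst (fst b), \<kappa> (dep a v + (s - t) *\<^sub>R u))"
    and \<Gamma>t: "\<Gamma> t = cls (fst (fst a), dep a v)" using tr unfolding transit_def by blast
  obtain kb ib rb where b: "b = ((kb, ib), rb)" "kb < N" "ib < 3" using portal_edge[OF e(1,3)] by (metis edges_iff prod.collapse)
  have r\<kappa>: "rigid \<kappa>" and \<kappa>d: "\<And>u. \<kappa> (dep a u) = dep b u" using \<kappa> by (auto simp: glue_map_def)
  have rj': "rigid (\<lambda>z. \<kappa> (j z))" by (rule rigid_comp[OF r\<kappa> rj])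
  have jt: "\<kappa> (j (of_real t)) = dep b v" by (simp add: j \<kappa>d)
  have "((fst (fst a), dep a v), (fst (fst b), dep b v)) \<in> glue T" using glueI[OF e(1-3), of v] v by simp
  then have \<Gamma>t': "\<Gamma> t = cls (kb, \<kappa> (j (of_real t)))" using glue_cls \<Gamma>t jt b by simp
  have "\<exists>\<epsilon>>0. t + \<epsilon> \<le> L \<and> (\<forall>s. t \<le> s \<longrightarrow> s < t + \<epsilon> \<longrightarrow> \<Gamma> s = cls (kb, \<kappa> (j (of_real s)))) \<and>
     (\<forall>s. t < s \<longrightarrow> s < t + \<epsilon> \<longrightarrow> (\<forall>i<3. 0 < ec kb i (\<kappa> (j (of_real s)))))"
  proof (rule exI[of _ "min \<delta> (L - t)"], intro conjI allI impI)
    fix s assume "t \<le> s" "s < t + min \<delta> (L - t)"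
    then show "\<Gamma> s = cls (kb, \<kappa> (j (of_real s)))" using \<delta>(2)[of s] \<Gamma>t' b j by (cases "s = t") auto
  next
    fix s i assume "t < s" "s < t + min \<delta> (L - t)" "i < (3::nat)"
    then show "0 < ec kb i (\<kappa> (j (of_real s)))" using \<delta>(2)[of s] b j by auto
  qed (use \<delta>(1) t in auto)
  then have "enter L \<Gamma> t kb (\<lambda>z. \<kappa> (j z))" unfolding enter_def using b rj' t by auto
  then show ?thesis
    unfolding enter_edge_def using ec_dep[OF b(2,3), of rb v] v b jt by (cases rb) auto
qed

text \<open>The ends of the crossed edge are corners of triangle \<open>k\<close>, therefore on its
  circumcircle and not behind the entry edge. The comparison of powers required by
  \<open>pstep\<close> is \<open>delaunay_pk\<close>.\<close>

lemma transit_step: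
  assumes en: "enter_edge L \<Gamma> t k i j" and pl: "placed k i j (t, u0, l0, c, R)" and tr: "transit t' \<Gamma> a b \<kappa> v u"
    and k: "fst (fst a) = k" and tt': "t < t'" "t' < L" and j: "\<And>s. j (of_real s) = dep a v + (s - t') *\<^sub>R u"
  shows "\<exists>u1 l1 c1 R1. enter_edge L \<Gamma> t' (fst (fst b)) (snd (fst b)) (\<lambda>z. \<kappa> (j z)) \<and>
     placed (fst (fst b)) (snd (fst b)) (\<lambda>z. \<kappa> (j z)) (t', u1, l1, c1, R1) \<and> pstep (t, u0, l0, c, R) (t', u1, l1, c1, R1)"
proof -
  obtain e where e: "e \<in> portals T" "a \<in> e" "b \<in> e" "a \<noteq> b" and \<kappa>: "glue_map a b \<kappa>" and v: "0 < v" "v < 1" using tr unfolding transit_def by blast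
  have E: "fst a \<in> edges T" "fst b \<in> edges T" using e portal_edge by auto
  obtain ia ra where a: "a = ((k, ia), ra)" "k < N" "ia < 3" using E(1) k by (metis edges_iff prod.collapse)
  obtain kb ib rb where b: "b = ((kb, ib), rb)" "kb < N" "ib < 3" using E(2) by (metis edges_iff prod.collapse)
  have rj: "rigid j" and t0: "0 \<le> t" "i < 3" using en unfolding enter_edge_def enter_def by auto
  have r\<kappa>: "rigid \<kappa>" and \<kappa>d: "\<And>u. \<kappa> (dep a u) = dep b u" using \<kappa> by (auto simp: glue_map_def)
  obtain m where m: "m > 0" "\<And>z. ec kb ib (\<kappa> z) = - m * ec k ia z" using \<kappa> a b by (auto simp: glue_map_def)
  have en': "enter_edge L \<Gamma> t' kb ib (\<lambda>z. \<kappa> (j z))"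
    using transit_enter[OF tr _ tt'(2) rj j] t0 tt'(1) b(1) by simp
  obtain u1 l1 c1 R1 where pl': "placed kb ib (\<lambda>z. \<kappa> (j z)) (t', u1, l1, c1, R1)" using placed_exists[OF en'] by blast
  have ends: "\<exists>m. j u1 = V k m" "\<exists>m. j l1 = V k m"
  proof -
    have *: "\<exists>m. z = V k m" if "\<kappa> z = V kb ib \<or> \<kappa> z = V kb (ib+1)" for z
    proof -
      have "\<kappa> z = dep b 0 \<or> \<kappa> z = dep b 1" using that by (auto simp: b(1) dep_eq[OF b(2,3)])
      then have "\<kappa> z = \<kappa> (dep a 0) \<or> \<kappa> z = \<kappa> (dep a 1)" by (simp add: \<kappa>d)
      then have "z = dep a 0 \<or> z = dep a 1" using rigid_inj[OF r\<kappa>] by blast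
      then show ?thesis by (cases ra) (auto simp: a(1) dep_eq[OF a(2,3)])
    qed
    show "\<exists>m. j u1 = V k m" "\<exists>m. j l1 = V k m" using * pl' by auto
  qed
  have "pstep (t, u0, l0, c, R) (t', u1, l1, c1, R1)"
    unfolding pstep.simps
  proof (intro conjI allI impI)
    show "crossing t u0 l0" "crossing t' u1 l1" using pl pl' by auto
    show "pw c R u1 = 0" "pw c R l1 = 0" using pl ends pk_V[OF a(2)] by auto
    have "side l0 u0 u1 = \<bar>DD k\<bar> * ec k i (j u1)" "side l0 u0 l1 = \<bar>DD k\<bar> * ec k i (j l1)" using pl by auto
    then show "0 \<le> side l0 u0 u1" "0 \<le> side l0 u0 l1" using ends vertex_nonneg[OF a(2) t0(2)] by auto
    fix z assume "0 \<le> side l1 u1 z"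
    moreover have "side l1 u1 z = \<bar>DD kb\<bar> * ec kb ib (\<kappa> (j z))" using pl' by simp
    ultimately have "0 \<le> \<bar>DD kb\<bar> * ec kb ib (\<kappa> (j z))" by simp
    then have "0 \<le> ec kb ib (\<kappa> (j z))" using DD[OF b(2)] by (simp add: zero_le_mult_iff)
    then have "0 \<le> - m * ec k ia (j z)" by (simp only: m(2))
    then have "ec k ia (j z) \<le> 0" using m(1) by (simp add: zero_le_mult_iff mult_le_0_iff)
    then have "pk kb (\<kappa> (j z)) \<le> pk k (j z)" using delaunay_pk[OF e \<kappa>, of "j z"] a b by simp
    then show "pw c1 R1 z \<le> pw c R z" using pl pl' by simp
  qed (rule tt'(1))
  then show ?thesis using en' pl' unfolding b fst_conv snd_conv by (intro exI conjI)
qed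

text \<open>Continuous induction on the time reached. Positive potential keeps the path off the
  vertices, so \<open>passing\<close> applies at the supremum; there the path cannot run along an
  edge, because at times shortly before it is inside an open triangle.\<close>

lemma development:
  assumes geo: "geod L \<Gamma>" and en0: "enter_edge L \<Gamma> t0 k0 i0 j0" and pl0: "placed k0 i0 j0 S0" "fst S0 = t0" and t1: "t0 \<le> t1" "t1 < L"
    and pos: "\<And>s. t0 \<le> s \<Longrightarrow> s \<le> t1 \<Longrightarrow> 0 < GS (\<Gamma> s)"
  shows "\<exists>t k i j u l c R. pstep\<^sup>*\<^sup>* S0 (t, u, l, c, R) \<and> enter_edge L \<Gamma> t k i j \<and> placed k i j (t, u, l, c, R) \<and> t \<le> t1 \<and> enter L \<Gamma> t1 k j"
proof -
  define Q where "Q b \<longleftrightarrow> (\<exists>t k i j u l c R. pstep\<^sup>*\<^sup>* S0 (t, u, l, c, R) \<and> enter_edge L \<Gamma> t k i j \<and> placed k i j (t, u, l, c, R) \<and> t \<le> b \<and> enter L \<Gamma> b k j)" for b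
  obtain u0 l0 c0 R0 where S0: "S0 = (t0, u0, l0, c0, R0)" using pl0(2) by (metis prod.collapse)
  have Q0: "Q t0" unfolding Q_def
  proof (intro exI conjI)
    show "pstep\<^sup>*\<^sup>* S0 (t0, u0, l0, c0, R0)" using S0 by simp
    show "enter_edge L \<Gamma> t0 k0 i0 j0" by (rule en0)
    show "placed k0 i0 j0 (t0, u0, l0, c0, R0)" using pl0 S0 by simp
    show "enter L \<Gamma> t0 k0 j0" using en0 by (simp add: enter_edge_def)
  qed simp
  have t00: "0 \<le> t0" using en0 unfolding enter_edge_def enter_def by auto
  define B where "B = {b \<in> {t0..t1}. Q b}"
  have B: "t0 \<in> B" "bdd_above B" using Q0 t1 unfolding B_def by (auto intro: bdd_aboveI[of _ t1])
  define b1 where "b1 = Sup B"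
  have b1: "t0 \<le> b1" using cSup_upper[OF B] by (simp add: b1_def)
  have "b1 \<le> t1" unfolding b1_def by (rule cSup_least) (use B(1) in \<open>auto simp: B_def\<close>)
  note b1 = b1 this
  have Qb1: "Q b1"
  proof (cases "b1 = t0")
    case False
    then have b10: "0 < b1" "b1 < L" "t0 < b1" using b1 t1 t00 by auto
    have nv: "\<Gamma> b1 \<noteq> cls (k, V k i)" if "k < N" for k i
      using pos[OF b1] pk_V[OF that] by (auto simp: GS_cls G_def)
    have near: "\<exists>b\<in>B. b1 - \<delta> < b" if "\<delta> > 0" for \<delta>
      using less_cSupD[of B "b1 - \<delta>"] B that by (auto simp: b1_def)
    have upper: "b \<le> b1" if "b \<in> B" for b using cSup_upper[OF that B(2)] by (simp add: b1_def)
    show ?thesis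
    proof (rule passing[OF geo b10(1,2)])
      show "\<Gamma> b1 \<noteq> cls (k, V k i)" if "k < N" for k i by (rule nv[OF that])
    next
      fix k x u \<delta> assume 1: "k < N" "norm u = 1" "0 < \<delta>" "\<And>s. \<bar>s - b1\<bar> < \<delta> \<Longrightarrow> (\<forall>i<3. 0 < ec k i (x + (s - b1) *\<^sub>R u)) \<and> \<Gamma> s = cls (k, x + (s - b1) *\<^sub>R u)"
      obtain b where b: "b \<in> B" "b1 - \<delta> < b" using near[OF 1(3)] by blast
      then obtain t k' i j u' l c R where st: "pstep\<^sup>*\<^sup>* S0 (t, u', l, c, R)" "enter_edge L \<Gamma> t k' i j" "placed k' i j (t, u', l, c, R)" "t \<le> b" "enter L \<Gamma> b k' j"
        unfolding B_def Q_def by auto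
      show ?thesis
      proof (cases "b = b1")
        case True
        then show ?thesis using b by (simp add: B_def)
      next
        case False
        then have bb1: "b < b1" using upper[OF b(1)] by simp
        have rw: "x + (s - b1) *\<^sub>R u = (x - b1 *\<^sub>R u) + s *\<^sub>R u" for s by (simp add: algebra_simps)
        have ag: "k = k' \<and> (\<forall>s. j (of_real s) = (x - b1 *\<^sub>R u) + s *\<^sub>R u)"
          by (rule enter_agree[OF st(5), of "b1 - b"]) (use 1(1) 1(4)[unfolded rw] bb1 b(2) in auto)
        have "enter L \<Gamma> b1 k' j"
          unfolding enter_def
        proof (intro conjI)
          show "\<exists>\<epsilon>>0. b1 + \<epsilon> \<le> L \<and> (\<forall>s. b1 \<le> s \<longrightarrow> s < b1 + \<epsilon> \<longrightarrow> \<Gamma> s = cls (k', j (of_real s))) \<and>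
             (\<forall>s. b1 < s \<longrightarrow> s < b1 + \<epsilon> \<longrightarrow> (\<forall>i<3. 0 < ec k' i (j (of_real s))))"
            by (rule exI[of _ "min \<delta> (L - b1)"]) (use 1(3) 1(4)[unfolded rw] ag b10 in auto)
        qed (use st(5) b10 in \<open>auto simp: enter_def\<close>)
        then show ?thesis unfolding Q_def using st bb1 by (meson less_imp_le order_trans)
      qed
    next
      fix c w \<delta> assume 2: "fst c \<in> edges T" "0 < w" "w < 1" "0 < \<delta>" "\<And>s. \<bar>s - b1\<bar> < \<delta> \<Longrightarrow>
         0 < w + (s - b1) / edge_length T (fst c) \<and> w + (s - b1) / edge_length T (fst c) < 1 \<and>
         \<Gamma> s = cls (fst (fst c), dep c (w + (s - b1) / edge_length T (fst c)))"
      obtain b where b: "b \<in> B" "b1 - \<delta> < b" using near[OF 2(4)] by blast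
      then obtain k' j where st: "enter L \<Gamma> b k' j" unfolding B_def Q_def by auto
      show ?thesis
      proof (cases "b = b1")
        case True
        then show ?thesis using b by (simp add: B_def)
      next
        case False
        then have bb1: "b < b1" using upper[OF b(1)] by simp
        obtain \<epsilon> where \<epsilon>: "\<epsilon> > 0" "\<And>s. b \<le> s \<Longrightarrow> s < b + \<epsilon> \<Longrightarrow> \<Gamma> s = cls (k', j (of_real s))"
          "\<And>s. b < s \<Longrightarrow> s < b + \<epsilon> \<Longrightarrow> (\<forall>i<3. 0 < ec k' i (j (of_real s)))" and k': "k' < N" using st unfolding enter_def by blast
        obtain s where s: "b < s" "s < b + \<epsilon>" "s < b1" using \<epsilon>(1) bb1 dense[of b "min (b + \<epsilon>) b1"] by auto
        have sb: "\<bar>s - b1\<bar> < \<delta>" using s(1,3) b(2) by linarith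
        have "cls (k', j (of_real s)) = cls (fst (fst c), dep c (w + (s - b1) / edge_length T (fst c)))"
          using 2(5)[OF sb] \<epsilon>(2)[of s] s by simp
        then have *: "(fst (fst c), dep c (w + (s - b1) / edge_length T (fst c))) = (k', j (of_real s))"
          using cls_interior[OF k'] \<epsilon>(3)[of s] s by blast
        obtain k i r where c: "c = ((k, i), r)" "k < N" "i < 3" using 2(1) by (metis edges_iff prod.collapse)
        have "ec k' i (j (of_real s)) = 0" using * ec_dep[OF c(2,3), of r "w + (s - b1) / edge_length T (fst c)"] c(1) by (metis fst_conv prod.inject)
        then show ?thesis using \<epsilon>(3)[of s] s c by force
      qed
    next
      fix a b' \<kappa> v u assume 3: "transit b1 \<Gamma> a b' \<kappa> v u"
      obtain \<delta> where \<delta>: "\<delta> > 0" "\<And>s. b1 - \<delta> < s \<Longrightarrow> s < b1 \<Longrightarrow> (\<forall>i<3. 0 < ec (fst (fst a)) i (dep a v + (s - b1) *\<^sub>R u)) \<and> \<Gamma> s = cls (fst (fst a), dep a v + (s - b1) *\<^sub>R u)"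
        and e: "\<exists>e\<in>portals T. a \<in> e \<and> b' \<in> e" using 3 unfolding transit_def by blast
      obtain b where b: "b \<in> B" "b1 - \<delta> < b" using near[OF \<delta>(1)] by blast
      then obtain t k' i j u' l c R where st: "pstep\<^sup>*\<^sup>* S0 (t, u', l, c, R)" "enter_edge L \<Gamma> t k' i j" "placed k' i j (t, u', l, c, R)" "t \<le> b" "enter L \<Gamma> b k' j"
        unfolding B_def Q_def by auto
      show ?thesis
      proof (cases "b = b1")
        case True
        then show ?thesis using b by (simp add: B_def)
      next
        case False
        then have bb1: "b < b1" using upper[OF b(1)] by simp
        have ka: "fst (fst a) < N" using e portal_edge by (metis edges_iff prod.collapse)
        have rw: "dep a v + (s - b1) *\<^sub>R u = (dep a v - b1 *\<^sub>R u) + s *\<^sub>R u" for s by (simp add: algebra_simps)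
        have ag: "fst (fst a) = k' \<and> (\<forall>s. j (of_real s) = (dep a v - b1 *\<^sub>R u) + s *\<^sub>R u)"
          by (rule enter_agree[OF st(5), of "b1 - b"]) (use ka \<delta>(2)[unfolded rw] bb1 b(2) in auto)
        then have js: "j (of_real s) = dep a v + (s - b1) *\<^sub>R u" for s by (simp only: rw)
        obtain u1 l1 c1 R1 where n: "enter_edge L \<Gamma> b1 (fst (fst b')) (snd (fst b')) (\<lambda>z. \<kappa> (j z))"
           "placed (fst (fst b')) (snd (fst b')) (\<lambda>z. \<kappa> (j z)) (b1, u1, l1, c1, R1)" "pstep (t, u', l, c, R) (b1, u1, l1, c1, R1)"
          using transit_step[OF st(2,3) 3 conjunct1[OF ag] le_less_trans[OF st(4) bb1] b10(2) js] by blast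
        have "pstep\<^sup>*\<^sup>* S0 (b1, u1, l1, c1, R1)" using st(1) n(3) by (rule rtranclp.rtrancl_into_rtrancl)
        then show ?thesis unfolding Q_def using n(1,2) by (metis enter_edge_def order_refl)
      qed
    qed
  qed (use Q0 in simp)
  have "b1 = t1"
  proof (rule ccontr)
    assume "b1 \<noteq> t1"
    then have lt: "b1 < t1" using b1 by simp
    obtain t k i j u l c R where st: "pstep\<^sup>*\<^sup>* S0 (t, u, l, c, R)" "enter_edge L \<Gamma> t k i j" "placed k i j (t, u, l, c, R)" "t \<le> b1" "enter L \<Gamma> b1 k j"
      using Qb1 unfolding Q_def by blast
    obtain \<epsilon> where \<epsilon>: "\<epsilon> > 0" "\<And>t'. b1 \<le> t' \<Longrightarrow> t' < b1 + \<epsilon> \<Longrightarrow> enter L \<Gamma> t' k j" using enter_later[OF st(5)] by blast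
    define b2 where "b2 = min t1 (b1 + \<epsilon> / 2)"
    have b2: "b1 < b2" "b2 \<le> t1" "b2 < b1 + \<epsilon>" using lt \<epsilon>(1) by (auto simp: b2_def)
    have "Q b2" unfolding Q_def using st \<epsilon>(2)[of b2] b2 by (meson less_imp_le order_trans)
    then have "b2 \<in> B" using b1 b2 by (simp add: B_def)
    then have "b2 \<le> b1" using cSup_upper[OF _ B(2)] by (simp add: b1_def)
    then show False using b2 by simp
  qed
  then show ?thesis using Qb1 unfolding Q_def by simp
qed

lemma ec_positive_index:
  assumes "i < 3" "i' < 3" "ec k i' z = 0" "0 < ec k (i+1) z" "0 < ec k (i+2) z"
  shows "i' = i"
proof (rule ccontr)
  assume "i' \<noteq> i"
  then show False using assms(3-5)
    by (rule_tac cases3[OF assms(1)]; rule_tac cases3[OF assms(2)]) (simp_all add: numeral_2_eq_2[symmetric])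
qed

text \<open>The motion \<open>J\<close> obtained by developing agrees with \<open>j1\<close> on the
  real axis but may be its reflection. The state belonging to \<open>J\<close> is the one that is
  linked to \<open>S0\<close> by a chain.\<close>

lemma development_return:
  assumes geo: "geod L \<Gamma>" and en0: "enter_edge L \<Gamma> t0 k i j0" and pl0: "placed k i j0 S0" "fst S0 = t0"
    and en1: "enter_edge L \<Gamma> t1 k i j1" and t: "t0 < t1"
    and pos: "\<And>s. t0 \<le> s \<Longrightarrow> s \<le> t1 \<Longrightarrow> 0 < GS (\<Gamma> s)"
  obtains J S where "enter_edge L \<Gamma> t1 k i J" "placed k i J S" "fst S = t1" "pstep\<^sup>+\<^sup>+ S0 S" "\<forall>s. J (of_real s) = j1 (of_real s)"
proof -
  obtain \<epsilon> where \<epsilon>: "\<epsilon> > 0" "t1 + \<epsilon> \<le> L" "\<And>s. t1 \<le> s \<Longrightarrow> s < t1 + \<epsilon> \<Longrightarrow> \<Gamma> s = cls (k, j1 (of_real s))"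
     "\<And>s. t1 < s \<Longrightarrow> s < t1 + \<epsilon> \<Longrightarrow> (\<forall>i<3. 0 < ec k i (j1 (of_real s)))" and k: "k < N" "rigid j1" "i < 3"
     and z1: "ec k i (j1 (of_real t1)) = 0" "0 < ec k (i+1) (j1 (of_real t1))" "0 < ec k (i+2) (j1 (of_real t1))"
    using en1 unfolding enter_edge_def enter_def by blast
  have t1L: "t1 < L" using \<epsilon> by simp
  obtain t k' i' J u l c R where st: "pstep\<^sup>*\<^sup>* S0 (t, u, l, c, R)" "enter_edge L \<Gamma> t k' i' J" "placed k' i' J (t, u, l, c, R)" "t \<le> t1" "enter L \<Gamma> t1 k' J"
    using development[OF geo en0 pl0 less_imp_le[OF t] t1L pos] by blast
  have j1: "j1 0 + s *\<^sub>R (j1 1 - j1 0) = j1 (of_real s)" for s using rigid_real[OF k(2)] by simp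
  have "k = k' \<and> (\<forall>s. J (of_real s) = j1 0 + s *\<^sub>R (j1 1 - j1 0))"
    by (rule enter_agree[OF st(5) \<epsilon>(1) k(1)]) (use \<epsilon>(3,4) j1 in auto)
  then have kk: "k' = k" and J: "\<And>s. J (of_real s) = j1 (of_real s)" using j1 by auto
  have rJ: "rigid J" and i': "i' < 3" and zt: "ec k i' (J (of_real t)) = 0" "0 < ec k (i'+1) (J (of_real t))" "0 < ec k (i'+2) (J (of_real t))"
    using st(2) unfolding enter_edge_def enter_def kk by auto
  \<comment> \<open>The coordinate \<open>ec k i\<close> along the line is nonnegative at the entry
    time \<open>t\<close>, positive just after \<open>t1\<close> and affine, so it could not vanish
    at a time \<open>t1\<close> strictly in between.\<close>
  have "t = t1"
  proof (rule ccontr)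
    assume "t \<noteq> t1"
    then have lt: "t < t1" using st(4) by simp
    define \<theta> where "\<theta> = (t1 - t) / (t1 + \<epsilon>/2 - t)"
    have \<theta>: "0 < \<theta>" "\<theta> < 1" using lt \<epsilon>(1) by (auto simp: \<theta>_def)
    have "\<theta> * (t1 + \<epsilon>/2 - t) = t1 - t" using lt \<epsilon>(1) by (simp add: \<theta>_def)
    then have "t1 = (1-\<theta>) * t + \<theta> * (t1 + \<epsilon>/2)" by (simp add: algebra_simps)
    then have "complex_of_real t1 = (1-\<theta>) *\<^sub>R of_real t + \<theta> *\<^sub>R of_real (t1 + \<epsilon>/2)"
      by (metis of_real_add of_real_mult scaleR_conv_of_real)
    then have "ec k i (J (of_real t1)) = (1-\<theta>) * ec k i (J (of_real t)) + \<theta> * ec k i (J (of_real (t1 + \<epsilon>/2)))"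
      by (simp only: rigid_comb[OF rJ] ec_comb)
    moreover have "0 \<le> ec k i (J (of_real t))"
      using ec_all[OF i', of "\<lambda>x. 0 \<le> x" k "J (of_real t)"] zt k(3) by auto
    moreover have "0 < ec k i (J (of_real (t1 + \<epsilon>/2)))" unfolding J using \<epsilon>(4)[of "t1 + \<epsilon>/2"] \<epsilon>(1) k(3) by simp
    ultimately have "0 < ec k i (J (of_real t1))" using \<theta> by (simp add: add_nonneg_pos)
    then show False using z1 J by simp
  qed
  moreover have "i' = i" using ec_positive_index[OF k(3) i' _ _ _] zt z1 J \<open>t = t1\<close> by metis
  moreover have "pstep\<^sup>+\<^sup>+ S0 (t1, u, l, c, R)"
    using rtranclpD[OF st(1)] pl0(2) t \<open>t = t1\<close> by auto
  ultimately show ?thesis using that[of J "(t1, u, l, c, R)"] st kk J by auto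
qed

section \<open>Visits of an edge in coordinates\<close>

text \<open>Signed height of the circumcenter over the edge, positive toward the triangle: half the
  edge length times the cotangent of the opposite angle.\<close>

definition hgt :: "directed_edge \<Rightarrow> real" where
  "hgt b = edge_length T (fst b) * adot b / (2 * \<bar>DD (fst (fst b))\<bar>)"

lemma dots_swap: "dots p q z = dots q p z"
  by (simp add: dots_def inner_commute)

text \<open>From the crossing the midpoint is reached by going \<open>a\<close> along the edge, and
  from there the center by going \<open>h\<close> perpendicular to it. The sign
  \<open>\<eta>\<close> is 1 if the directed edge \<open>b\<close> crosses the path downward and -1
  if upward.\<close>

lemma visit_frame:
  assumes b: "fst b = (k, i)" "k < N" "i < 3" and J: "rigid J" and pl: "placed k i J (t, u, l, c, R)"
    and Jt: "J (of_real t) = dep b w" and w: "0 < w" "w < 1"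
  defines "len \<equiv> edge_length T (fst b)" and "h \<equiv> hgt b"
  defines "a \<equiv> len * (1/2 - w)"
  obtains C S \<eta> where "C\<^sup>2 + S\<^sup>2 = 1" "S > 0" "\<eta> * \<eta> = (1::real)" "Re c = t + a * C + h * S" "Im c = \<eta> * (h * C - a * S)"
    "norm (u - l) = len" "side l u c = len * h" "\<And>z. side l u z = len * (\<eta> * C * Im z + S * (Re z - t))"
    "\<And>s. pk k (J (of_real s)) = (s - t)\<^sup>2 - 2 * (s - t) * (a * C + h * S) + a\<^sup>2 - len\<^sup>2 / 4"
proof -
  obtain r where br: "b = ((k, i), r)" using b(1) by (metis prod.collapse)
  have be: "fst b \<in> edges T" using b edges_iff by simp
  have cr: "Im l < 0" "0 < Im u" and sd: "\<And>z. side l u z = \<bar>DD k\<bar> * ec k i (J z)" and pc: "\<And>z. pw c R z = pk k (J z)"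
    using pl by (auto simp: crossing_def)
  have "(J l = dep b 0 \<and> J u = dep b 1) \<or> (J u = dep b 0 \<and> J l = dep b 1)"
    using pl unfolding br dep_eq[OF b(2,3)] by (cases r) auto
  then obtain p q \<eta> where pq: "J p = dep b 0" "J q = dep b 1" "(\<eta> = -1 \<and> p = l \<and> q = u) \<or> (\<eta> = (1::real) \<and> p = u \<and> q = l)" by blast
  have n: "norm (q - p) = len" using rigid_norm[OF J, of q p] pq dep_norm[OF be] by (simp add: len_def)
  have "p \<noteq> q" using dep_neq[OF be] pq by auto
  then have l0: "len > 0" using n by auto
  define C Y where CY: "C = Re (q - p) / len" "Y = Im (q - p) / len"
  define S where "S = - \<eta> * Y"
  have \<eta>2: "\<eta> * \<eta> = 1" using pq(3) by auto
  have Y: "Y = - \<eta> * S" using \<eta>2 by (simp add: S_def flip: mult.assoc)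
  have S0: "S > 0" using pq(3) cr l0 by (auto simp: S_def CY divide_neg_pos)
  have q: "Re q = Re p + len * C" "Im q = Im p + len * Y" using l0 by (simp_all add: CY)
  have "(len * C)\<^sup>2 + (len * Y)\<^sup>2 = len\<^sup>2" using n[symmetric] cmod_power2[of "q - p"] l0 by (simp add: CY)
  then have "len\<^sup>2 * (C\<^sup>2 + Y\<^sup>2) = len\<^sup>2 * 1" by (simp add: power_mult_distrib distrib_left)
  then have CY1: "C\<^sup>2 + Y\<^sup>2 = 1" using l0 by simp
  have "Y\<^sup>2 = (\<eta> * \<eta>) * S\<^sup>2" by (simp add: Y power2_eq_square)
  then have CS1: "C\<^sup>2 + S\<^sup>2 = 1" using CY1 \<eta>2 by simp
  have "J (of_real t) = J ((1-w) *\<^sub>R p + w *\<^sub>R q)" using Jt dep_lin[OF be, of w] pq rigid_comb[OF J] by simp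
  then have "of_real t = (1-w) *\<^sub>R p + w *\<^sub>R q" by (rule rigid_inj[OF J])
  then have "t = (1-w) * Re p + w * Re q" "0 = (1-w) * Im p + w * Im q" by (simp_all add: complex_eq_iff)
  then have p: "Re p = t - w * (len * C)" "Im p = - (w * (len * Y))" unfolding q by (simp_all add: algebra_simps)
  have sidepq: "side p q z = len * ((Re z - t) * Y - Im z * C)" for z
    unfolding side_def minus_complex.simps q p by (simp add: algebra_simps)
  have sidelu: "side l u z = - \<eta> * side p q z" for z
    using pq(3) side_swap[of u l z] by auto
  have side_z: "side l u z = len * (\<eta> * C * Im z + S * (Re z - t))" for z
    unfolding sidelu sidepq S_def by (simp add: algebra_simps)
  have pw0: "pw c R p = 0" "pw c R q = 0" using pc pq pk_V[OF b(2)] by (auto simp: br dep_eq[OF b(2,3)])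
  obtain \<iota> where \<iota>: "\<And>z. J (\<iota> z) = z" by (rule rigid_inverse[OF J]) blast
  define x where "x = \<iota> (apex b)"
  have sx: "side l u x = \<bar>DD k\<bar>" using sd[of x] ec_apex[OF be] \<iota> b by (simp add: x_def)
  have dx: "dots l u x = adot b"
    using rigid_dots[OF J, of p q x] pq \<iota> dots_swap[of u l x] by (auto simp: x_def adot_def)
  have px: "pw c R x = 0" using pc[of x] \<iota> pk_V[OF b(2)] b(1) by (simp add: x_def)
  have pul: "pw c R l = 0" "pw c R u = 0" and nul: "norm (u - l) = len" using pq(3) pw0 n by (auto simp: norm_minus_commute)
  have "2 * side l u c * \<bar>DD k\<bar> = len\<^sup>2 * adot b" using center_height[OF pul px] sx dx nul by simp
  then have sc: "side l u c = len * h" using DD[OF b(2)] b(1) by (simp add: h_def hgt_def len_def field_simps power2_eq_square)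
  define X I where XI: "X = Re c - t" "I = Im c"
  have e1: "\<eta> * C * I + S * X = h" using sc side_z[of c] l0 by (simp add: XI)
  have "pw c R q - pw c R p = 0" using pw0 by simp
  then have "(Re q - Re p) * (Re q + Re p - 2 * Re c) + (Im q - Im p) * (Im q + Im p - 2 * Im c) = 0"
    unfolding pw_eq by (simp add: power2_eq_square algebra_simps)
  then have "(len * C) * (2 * (a * C - X)) + (len * Y) * (2 * (a * Y - I)) = 0"
    unfolding q p XI a_def by (simp add: algebra_simps)
  then have "(2 * len) * (a * (C\<^sup>2 + Y\<^sup>2) - (C * X + Y * I)) = 0" by (simp add: power2_eq_square algebra_simps)
  then have e2: "C * X - \<eta> * S * I = a" using l0 CY1 by (simp add: Y)
  have "X = (C\<^sup>2 + S\<^sup>2) * X" using CS1 by simp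
  also have "\<dots> = C * (C * X - \<eta> * S * I) + S * (\<eta> * C * I + S * X)" by (simp add: power2_eq_square algebra_simps)
  finally have X: "X = a * C + h * S" using e1 e2 by (simp add: mult.commute)
  have "I = (\<eta> * \<eta>) * (C\<^sup>2 + S\<^sup>2) * I" using CS1 \<eta>2 by simp
  also have "\<dots> = \<eta> * (C * (\<eta> * C * I + S * X) - S * (C * X - \<eta> * S * I))" by (simp add: power2_eq_square algebra_simps)
  finally have I: "I = \<eta> * (h * C - a * S)" unfolding e1 e2 by (simp add: mult.commute)
  have pkt: "pk k (J (of_real t)) = a\<^sup>2 - len\<^sup>2/4"
    using pk_dep[OF be, of w] b(1) Jt by (simp add: a_def len_def power2_eq_square algebra_simps)
  have "pk k (J (of_real s)) = (s - t)\<^sup>2 - 2 * (s - t) * (a * C + h * S) + a\<^sup>2 - len\<^sup>2 / 4" for s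
  proof -
    have "pk k (J (of_real s)) - pk k (J (of_real t)) = (s - t)\<^sup>2 - 2 * (s - t) * X"
      unfolding pc[symmetric] pw_eq XI by (simp add: power2_eq_square algebra_simps)
    then show ?thesis unfolding pkt X by simp
  qed
  then show ?thesis using that[OF CS1 S0 \<eta>2 _ _ nul sc side_z] X I by (simp add: XI add.assoc)
qed

text \<open>Restricted to the half of the edge near \<open>dep b 0\<close>; the other half is
  reached by reversing the directed edge.\<close>

definition visiting :: "real \<Rightarrow> (real \<Rightarrow> surface_point) \<Rightarrow> directed_edge \<Rightarrow> real \<Rightarrow> real \<Rightarrow> (complex \<Rightarrow> complex) \<Rightarrow> bool" where
  "visiting L \<Gamma> b t w J \<longleftrightarrow> enter_edge L \<Gamma> t (fst (fst b)) (snd (fst b)) J \<and> J (of_real t) = dep b w \<and> 0 < w \<and> w < 1/2"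

text \<open>Formulated for arbitrary placements because it is applied twice: to unrelated ones, to
  exclude vertices between the visits, and then to those of a single development.\<close>

lemma visits_data:
  fixes w t :: "nat \<Rightarrow> real"
  assumes geo: "geod L \<Gamma>" and v: "\<And>n. n \<le> 3 \<Longrightarrow> visiting L \<Gamma> b (t n) (w n) (J n)"
    and pl: "\<And>n. n \<le> 3 \<Longrightarrow> placed (fst (fst b)) (snd (fst b)) (J n) (t n, u n, l n, c n, R n)"
  defines "len \<equiv> edge_length T (fst b)" and "h \<equiv> hgt b"
  defines "a \<equiv> \<lambda>n. len * (1/2 - w n)"
  obtains C S \<eta> :: "nat \<Rightarrow> real" where "len > 0"
    "\<And>n. n \<le> 3 \<Longrightarrow> (C n)\<^sup>2 + (S n)\<^sup>2 = 1" "\<And>n. n \<le> 3 \<Longrightarrow> 0 < S n" "\<And>n. n \<le> 3 \<Longrightarrow> \<eta> n * \<eta> n = 1"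
    "\<And>n. n \<le> 3 \<Longrightarrow> Re (c n) = t n + a n * C n + h * S n" "\<And>n. n \<le> 3 \<Longrightarrow> Im (c n) = \<eta> n * (h * C n - a n * S n)"
    "\<And>n. n \<le> 3 \<Longrightarrow> norm (u n - l n) = len" "\<And>n. n \<le> 3 \<Longrightarrow> side (l n) (u n) (c n) = len * h"
    "\<And>n z. n \<le> 3 \<Longrightarrow> side (l n) (u n) z = len * (\<eta> n * C n * Im z + S n * (Re z - t n))"
    "\<And>n s. n \<le> 3 \<Longrightarrow> pk (fst (fst b)) (J n (of_real s)) = (s - t n)\<^sup>2 - 2 * (s - t n) * (a n * C n + h * S n) + (a n)\<^sup>2 - len\<^sup>2 / 4"
    "\<And>n. n \<le> 3 \<Longrightarrow> 0 < a n" "\<And>n. n \<le> 3 \<Longrightarrow> (a n)\<^sup>2 < len\<^sup>2 / 4"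
    "\<And>i j. i < j \<Longrightarrow> j \<le> 3 \<Longrightarrow> t j - t i \<le> \<bar>a i - a j\<bar>"
    "\<And>i j. i \<le> 3 \<Longrightarrow> j \<le> 3 \<Longrightarrow> (a j)\<^sup>2 \<le> (t j - t i)\<^sup>2 - 2 * (t j - t i) * (a i * C i + h * S i) + (a i)\<^sup>2"
proof -
  obtain k i where b: "fst b = (k, i)" by (metis prod.collapse)
  have vn: "enter_edge L \<Gamma> (t n) k i (J n)" "J n (of_real (t n)) = dep b (w n)" "0 < w n" "w n < 1/2" if "n \<le> 3" for n
    using v[OF that] b unfolding visiting_def by auto
  have ki: "k < N" "i < 3" using vn(1)[of 0] unfolding enter_edge_def enter_def by auto
  have be: "fst b \<in> edges T" using b ki edges_iff by simp
  have rJ: "rigid (J n)" if "n \<le> 3" for n using vn(1)[OF that] unfolding enter_edge_def enter_def by auto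
  have l0: "len > 0" using dep_norm[OF be] dep_neq[OF be] unfolding len_def by (metis norm_eq_zero norm_ge_zero order_le_less right_minus_eq)
  let ?P = "\<lambda>n C S \<eta>. C\<^sup>2 + S\<^sup>2 = 1 \<and> S > 0 \<and> \<eta> * \<eta> = (1::real) \<and> Re (c n) = t n + a n * C + h * S \<and> Im (c n) = \<eta> * (h * C - a n * S) \<and>
    norm (u n - l n) = len \<and> side (l n) (u n) (c n) = len * h \<and> (\<forall>z. side (l n) (u n) z = len * (\<eta> * C * Im z + S * (Re z - t n))) \<and>
    (\<forall>s. pk k (J n (of_real s)) = (s - t n)\<^sup>2 - 2 * (s - t n) * (a n * C + h * S) + (a n)\<^sup>2 - len\<^sup>2 / 4)"
  have "\<exists>C S \<eta>. ?P n C S \<eta>" if n: "n \<le> 3" for n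
  proof -
    have p: "placed k i (J n) (t n, u n, l n, c n, R n)" using pl[OF n] b by simp
    have w1: "w n < 1" using vn(4)[OF n] by simp
    show ?thesis
      by (rule visit_frame[OF b ki rJ[OF n] p vn(2)[OF n] vn(3)[OF n] w1]) (unfold len_def h_def a_def, blast)
  qed
  then obtain C S \<eta> where f: "?P n (C n) (S n) (\<eta> n)" if "n \<le> 3" for n by metis
  have a: "0 < a n" "a n < len / 2" if n: "n \<le> 3" for n using vn(3,4)[OF n] l0 by (auto simp: a_def field_simps)
  have en: "0 \<le> t n" "\<exists>\<epsilon>>0. t n + \<epsilon> \<le> L \<and> (\<forall>s. t n \<le> s \<longrightarrow> s < t n + \<epsilon> \<longrightarrow> \<Gamma> s = cls (k, J n (of_real s)))" if "n \<le> 3" for n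
    using vn(1)[OF that] unfolding enter_edge_def enter_def by blast+
  have tL: "t n \<in> {0..L}" if "n \<le> 3" for n using en[OF that] by auto
  have \<Gamma>t: "\<Gamma> (t n) = cls (k, dep b (w n))" if n: "n \<le> 3" for n using en(2)[OF n] vn(2)[OF n] by auto
  show ?thesis
  proof (rule that[OF l0])
    show "(a n)\<^sup>2 < len\<^sup>2 / 4" if n: "n \<le> 3" for n
      using power_strict_mono[OF a(2)[OF n], of 2] a(1)[OF n] by (simp add: power_divide)
    show "t j - t i \<le> \<bar>a i - a j\<bar>" if ij: "i < j" "j \<le> 3" for i j
    proof -
      have i3: "i \<le> 3" using ij by simp
      have d: "dep b (w n) \<in> Fr k" if "n \<le> 3" for n using dep_Fr[OF be, of "w n"] vn(3,4)[OF that] b by simp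
      have "ennreal \<bar>t i - t j\<bar> = sd (\<Gamma> (t i)) (\<Gamma> (t j))" using geo tL[OF i3] tL[OF ij(2)] unfolding geod_def by auto
      also have "\<dots> \<le> ennreal (norm (dep b (w i) - dep b (w j)))"
        unfolding \<Gamma>t[OF i3] \<Gamma>t[OF ij(2)] by (rule dist_fragment[OF ki(1) d[OF i3] d[OF ij(2)]])
      finally have "\<bar>t i - t j\<bar> \<le> \<bar>w i - w j\<bar> * len" unfolding dep_dist[OF be] len_def[symmetric] using l0 by (simp add: ennreal_le_iff)
      moreover have "\<bar>a i - a j\<bar> = \<bar>w i - w j\<bar> * len" using l0 by (simp add: a_def abs_mult flip: right_diff_distrib)
      ultimately show ?thesis by simp
    qed
    show "(a j)\<^sup>2 \<le> (t j - t i)\<^sup>2 - 2 * (t j - t i) * (a i * C i + h * S i) + (a i)\<^sup>2" if ij: "i \<le> 3" "j \<le> 3" for i j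
    proof -
      obtain \<epsilon> where \<epsilon>: "\<epsilon> > 0" "t i + \<epsilon> \<le> L" "\<And>s. t i \<le> s \<Longrightarrow> s < t i + \<epsilon> \<Longrightarrow> \<Gamma> s = cls (k, J i (of_real s))" using en(2)[OF ij(1)] by blast
      have "- pk k (J i (of_real (t j))) \<le> GS (\<Gamma> (t j))"
        by (rule disk_lower_bound[OF geo en(1)[OF ij(1)] \<epsilon>(2,1) rJ[OF ij(1)] \<epsilon>(3) tL[OF ij(2)]])
      also have "\<dots> = - pk k (dep b (w j))" by (simp add: \<Gamma>t[OF ij(2)] GS_cls G_def)
      also have "pk k (dep b (w j)) = (a j)\<^sup>2 - len\<^sup>2/4" using pk_dep[OF be, of "w j"] b by (simp add: a_def len_def power2_eq_square algebra_simps)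
      also have "pk k (J i (of_real (t j))) = (t j - t i)\<^sup>2 - 2 * (t j - t i) * (a i * C i + h * S i) + (a i)\<^sup>2 - len\<^sup>2 / 4"
        using f[OF ij(1)] by blast
      finally show ?thesis by simp
    qed
    show "(C n)\<^sup>2 + (S n)\<^sup>2 = 1" "0 < S n" "\<eta> n * \<eta> n = 1" "Re (c n) = t n + a n * C n + h * S n" "Im (c n) = \<eta> n * (h * C n - a n * S n)"
      "norm (u n - l n) = len" "side (l n) (u n) (c n) = len * h" if "n \<le> 3" for n using f[OF that] by blast+
    show "side (l n) (u n) z = len * (\<eta> n * C n * Im z + S n * (Re z - t n))" if "n \<le> 3" for n z using f[OF that] by blast
    show "pk (fst (fst b)) (J n (of_real s)) = (s - t n)\<^sup>2 - 2 * (s - t n) * (a n * C n + h * S n) + (a n)\<^sup>2 - len\<^sup>2 / 4" if "n \<le> 3" for n s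
      using f[OF that] by (simp only: b fst_conv)
  qed (rule a)
qed

text \<open>Convexity in \<open>x\<close>: the quadratic is negative at 0 and at
  \<open>D\<close>.\<close>

lemma quadratic_negative_between:
  fixes x D \<sigma> A :: real
  assumes "0 \<le> x" "x \<le> D" "A < 0" "D\<^sup>2 - 2 * D * \<sigma> + A < 0"
  shows "x\<^sup>2 - 2 * x * \<sigma> + A < 0"
proof (cases "D - 2 * \<sigma> \<le> 0")
  case True
  then have "x * (x - 2 * \<sigma>) \<le> 0" using assms by (intro mult_nonneg_nonpos) auto
  then show ?thesis using assms(3) by (simp add: power2_eq_square algebra_simps)
next
  case False
  have "x * (x - 2 * \<sigma>) \<le> x * (D - 2 * \<sigma>)" using assms by (intro mult_left_mono) auto
  also have "\<dots> \<le> D * (D - 2 * \<sigma>)" using assms False by (intro mult_right_mono) auto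
  finally show ?thesis using assms(4) by (simp add: power2_eq_square algebra_simps)
qed

lemma no_four_visits:
  fixes w t :: "nat \<Rightarrow> real"
  assumes geo: "geod L \<Gamma>" and v: "\<And>n. n \<le> 3 \<Longrightarrow> visiting L \<Gamma> b (t n) (w n) (j n)" and ad: "adot b \<ge> 0"
    and t: "\<And>m n. m < n \<Longrightarrow> n \<le> 3 \<Longrightarrow> t m < t n"
  shows False
proof -
  define k i where ki: "k = fst (fst b)" "i = snd (fst b)"
  have en: "enter_edge L \<Gamma> (t n) k i (j n)" if "n \<le> 3" for n using v[OF that] unfolding visiting_def ki by auto
  have kN: "k < N" using en[of 0] unfolding enter_edge_def enter_def by auto
  have h0: "hgt b \<ge> 0"
  proof -
    have "fst b \<in> edges T" using en[of 0] edges_iff unfolding enter_edge_def enter_def ki by (metis le0 prod.collapse)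
    then have "0 \<le> edge_length T (fst b)" by (metis dep_norm norm_ge_zero)
    then show ?thesis using ad unfolding hgt_def by simp
  qed
  have "\<exists>u l c R. placed k i (j n) (t n, u, l, c, R)" if "n \<le> 3" for n using placed_exists[OF en[OF that]] by metis
  then obtain u l c R where pl: "placed k i (j n) (t n, u n, l n, c n, R n)" if "n \<le> 3" for n by metis
  obtain C S \<eta> where d: "\<And>n. n \<le> 3 \<Longrightarrow> (C n)\<^sup>2 + (S n)\<^sup>2 = 1" "\<And>n. n \<le> 3 \<Longrightarrow> 0 < S n"
    "\<And>n s. n \<le> 3 \<Longrightarrow> pk (fst (fst b)) (j n (of_real s)) = (s - t n)\<^sup>2 - 2 * (s - t n) * (edge_length T (fst b) * (1/2 - w n) * C n + hgt b * S n) + (edge_length T (fst b) * (1/2 - w n))\<^sup>2 - (edge_length T (fst b))\<^sup>2 / 4"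
    "\<And>n. n \<le> 3 \<Longrightarrow> 0 < edge_length T (fst b) * (1/2 - w n)" "\<And>n. n \<le> 3 \<Longrightarrow> (edge_length T (fst b) * (1/2 - w n))\<^sup>2 < (edge_length T (fst b))\<^sup>2 / 4"
    "\<And>i j. i < j \<Longrightarrow> j \<le> 3 \<Longrightarrow> t j - t i \<le> \<bar>edge_length T (fst b) * (1/2 - w i) - edge_length T (fst b) * (1/2 - w j)\<bar>"
    "\<And>i j. i \<le> 3 \<Longrightarrow> j \<le> 3 \<Longrightarrow> (edge_length T (fst b) * (1/2 - w j))\<^sup>2 \<le> (t j - t i)\<^sup>2 - 2 * (t j - t i) * (edge_length T (fst b) * (1/2 - w i) * C i + hgt b * S i) + (edge_length T (fst b) * (1/2 - w i))\<^sup>2"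
    by (rule visits_data[OF geo v pl[unfolded ki]]) (assumption+ | rule that)+
  define a where "a n = edge_length T (fst b) * (1/2 - w n)" for n
  note d' = d[folded a_def]
  have neg: "pk k (j m (of_real s)) < 0" if m: "1 \<le> m" "m < n" "n \<le> 3" and s: "t m \<le> s" "s \<le> t n" for m n s
  proof -
    have m3: "m \<le> 3" using m by simp
    have o: "(t n - t m)\<^sup>2 - 2 * (t n - t m) * (a m * C m + hgt b * S m) + (a m)\<^sup>2 < (edge_length T (fst b))\<^sup>2 / 4"
      by (rule visits_order(3)[where t=t and a=a and q="(edge_length T (fst b))\<^sup>2 / 4" and S=S and C=C and b="hgt b", OF t d'(4,5) d'(2,1) h0 d'(6,7) m])
    have "(s - t m)\<^sup>2 - 2 * (s - t m) * (a m * C m + hgt b * S m) + ((a m)\<^sup>2 - (edge_length T (fst b))\<^sup>2 / 4) < 0"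
      by (rule quadratic_negative_between[of _ "t n - t m"]) (use s o d'(5)[OF m3] in auto)
    then show ?thesis using d'(3)[OF m3, of s] by (simp add: ki)
  qed
  \<comment> \<open>Inside the developed circumdisk of visit \<open>m\<close> the potential is
    positive, whereas it vanishes at vertices. So the path between the visits can be
    developed.\<close>
  have pos: "0 < GS (\<Gamma> s)" if m: "1 \<le> m" "m < n" "n \<le> 3" and s: "t m \<le> s" "s \<le> t n" for m n s
  proof -
    have m3: "m \<le> 3" using m by simp
    obtain \<epsilon> where \<epsilon>: "\<epsilon> > 0" "t m + \<epsilon> \<le> L" "\<And>s. t m \<le> s \<Longrightarrow> s < t m + \<epsilon> \<Longrightarrow> \<Gamma> s = cls (k, j m (of_real s))" and z: "0 \<le> t m" "rigid (j m)"
      using en[OF m3] unfolding enter_edge_def enter_def by blast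
    have "t n \<le> L" using en[OF m(3)] unfolding enter_edge_def enter_def by auto
    then have sL: "s \<in> {0..L}" using s z by auto
    have "- pk k (j m (of_real s)) \<le> GS (\<Gamma> s)" by (rule disk_lower_bound[OF geo z(1) \<epsilon>(2,1) z(2) \<epsilon>(3) sL])
    then show ?thesis using neg[OF m s] by simp
  qed
  have t12: "t 1 < t 2" and t23: "t 2 < t 3" by (rule t; simp)+
  have pos12: "0 < GS (\<Gamma> s)" if "t 1 \<le> s" "s \<le> t 2" for s by (rule pos[OF _ _ _ that]) auto
  have pos23: "0 < GS (\<Gamma> s)" if "t 2 \<le> s" "s \<le> t 3" for s by (rule pos[OF _ _ _ that]) auto
  have en1: "enter_edge L \<Gamma> (t 1) k i (j 1)" and en2: "enter_edge L \<Gamma> (t 2) k i (j 2)" and en3: "enter_edge L \<Gamma> (t 3) k i (j 3)"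
    and pl1: "placed k i (j 1) (t 1, u 1, l 1, c 1, R 1)" by (rule en pl; simp)+
  obtain J2 S2 where 2: "enter_edge L \<Gamma> (t 2) k i J2" "placed k i J2 S2" "fst S2 = t 2" "pstep\<^sup>+\<^sup>+ (t 1, u 1, l 1, c 1, R 1) S2" "\<forall>s. J2 (of_real s) = j 2 (of_real s)"
    by (rule development_return[OF geo en1 pl1 fst_conv en2 t12 pos12])
  obtain J3 S3 where 3: "enter_edge L \<Gamma> (t 3) k i J3" "placed k i J3 S3" "fst S3 = t 3" "pstep\<^sup>+\<^sup>+ S2 S3" "\<forall>s. J3 (of_real s) = j 3 (of_real s)"
    by (rule development_return[OF geo 2(1,2,3) en3 t23 pos23])
  \<comment> \<open>Visits 2 and 3 receive the motions obtained by developing from visit 1, which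
    puts the three states into one chain. On the real axis nothing changes, so the visits stay the
    same.\<close>
  define J where "J n = (if n = 2 then J2 else if n = 3 then J3 else j n)" for n
  define St where "St n = (if n = 2 then S2 else if n = 3 then S3 else (t n, u n, l n, c n, R n))" for n
  define u' l' c' R' where st: "u' n = fst (snd (St n))" "l' n = fst (snd (snd (St n)))" "c' n = fst (snd (snd (snd (St n))))" "R' n = snd (snd (snd (snd (St n))))" for n
  have St: "(t n, u' n, l' n, c' n, R' n) = St n" for n using 2(3) 3(3) by (auto simp: st St_def prod_eq_iff)
  have Jr: "J n (of_real s) = j n (of_real s)" for n s using 2(5) 3(5) by (auto simp: J_def)
  have v': "visiting L \<Gamma> b (t n) (w n) (J n)" if n: "n \<le> 3" for n
  proof -
    have "enter_edge L \<Gamma> (t n) k i (J n)" using en[OF n] 2(1) 3(1) by (auto simp: J_def)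
    then show ?thesis using v[OF n] Jr unfolding visiting_def ki by simp
  qed
  have pl': "placed k i (J n) (t n, u' n, l' n, c' n, R' n)" if n: "n \<le> 3" for n
    unfolding St using pl[OF n] 2(2) 3(2) by (auto simp: J_def St_def)
  have chain: "pstep\<^sup>+\<^sup>+ (t m, u' m, l' m, c' m, R' m) (t n, u' n, l' n, c' n, R' n)" if m: "1 \<le> m" "m < n" "n \<le> 3" for m n
  proof -
    have "m = 1 \<and> n = 2 \<or> m = 2 \<and> n = 3 \<or> m = 1 \<and> n = 3" using m by presburger
    then show ?thesis unfolding St using 2(4) 3(4) tranclp_trans[OF 2(4) 3(4)] by (elim disjE) (simp_all add: St_def)
  qed
  \<comment> \<open>The frames are taken anew, since a motion may have been replaced by its
    reflection and the signs must fit the common development.\<close>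
  obtain C' S' \<eta>' where e: "0 < edge_length T (fst b)" "\<And>n. n \<le> 3 \<Longrightarrow> (C' n)\<^sup>2 + (S' n)\<^sup>2 = 1" "\<And>n. n \<le> 3 \<Longrightarrow> 0 < S' n" "\<And>n. n \<le> 3 \<Longrightarrow> \<eta>' n * \<eta>' n = 1"
    "\<And>n. n \<le> 3 \<Longrightarrow> Re (c' n) = t n + edge_length T (fst b) * (1/2 - w n) * C' n + hgt b * S' n" "\<And>n. n \<le> 3 \<Longrightarrow> Im (c' n) = \<eta>' n * (hgt b * C' n - edge_length T (fst b) * (1/2 - w n) * S' n)"
    "\<And>n. n \<le> 3 \<Longrightarrow> norm (u' n - l' n) = edge_length T (fst b)" "\<And>n. n \<le> 3 \<Longrightarrow> side (l' n) (u' n) (c' n) = edge_length T (fst b) * hgt b"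
    "\<And>n z. n \<le> 3 \<Longrightarrow> side (l' n) (u' n) z = edge_length T (fst b) * (\<eta>' n * C' n * Im z + S' n * (Re z - t n))"
    "\<And>i j. i \<le> 3 \<Longrightarrow> j \<le> 3 \<Longrightarrow> (edge_length T (fst b) * (1/2 - w j))\<^sup>2 \<le> (t j - t i)\<^sup>2 - 2 * (t j - t i) * (edge_length T (fst b) * (1/2 - w i) * C' i + hgt b * S' i) + (edge_length T (fst b) * (1/2 - w i))\<^sup>2"
    by (rule visits_data[OF geo v' pl'[unfolded ki]]) (assumption+ | rule that)+
  note e' = e[folded a_def]
  \<comment> \<open>\<open>center_before_edge\<close> for the center of visit \<open>m\<close> and
    the edge of visit \<open>n\<close>, written out in these frames.\<close>
  have Lc: "S' n * (a m * C' m + hgt b * S' m - (t n - t m)) + \<eta>' m * \<eta>' n * C' n * (hgt b * C' m - a m * S' m) \<le> 0"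
    if m: "1 \<le> m" "m < n" "n \<le> 3" for m n
  proof -
    have m3: "m \<le> 3" using m by simp
    have cr: "crossing (t m) (u' m) (l' m)" and z: "pw (c' m) (R' m) z = pk k (J m z)" and ends: "\<exists>x. J m (u' m) = V k x" "\<exists>x. J m (l' m) = V k x" for z
      using pl'[OF m3] by auto
    have "side (l' n) (u' n) (c' m) \<le> 0"
    proof (rule center_before_edge[OF chain[OF m] cr])
      show "pw (c' m) (R' m) (u' m) = 0" "pw (c' m) (R' m) (l' m) = 0" using z ends pk_V[OF kN] by auto
      show "pw (c' m) (R' m) (of_real (t n)) < 0" using neg[OF m, of "t n"] t[OF m(2,3)] by (simp add: z Jr)
      show "norm (u' n - l' n) = norm (u' m - l' m)" using e'(7)[OF m3] e'(7)[OF m(3)] by simp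
      show "0 \<le> side (l' m) (u' m) (c' m)" using e'(8)[OF m3] e'(1) h0 by simp
    qed
    then have "\<eta>' n * C' n * Im (c' m) + S' n * (Re (c' m) - t n) \<le> 0"
      using e'(9)[OF m(3), of "c' m"] e'(1) by (simp add: mult_le_0_iff)
    then show ?thesis using e'(5,6)[OF m3] by (simp add: algebra_simps)
  qed
  show False
    by (rule four_visits[where t=t and a=a and q="(edge_length T (fst b))\<^sup>2 / 4" and S=S' and C=C' and b="hgt b" and \<eta>=\<eta>', OF t d'(4,5) e'(3,2) h0 d'(6) e'(10) e'(4) Lc])
qed

end

section \<open>Counting\<close>

text \<open>\<open>card\<close> is 0 on infinite sets, hence the explicit finiteness.\<close>

definition few :: "nat \<Rightarrow> 'a set \<Rightarrow> bool" where
  "few n A \<longleftrightarrow> finite A \<and> card A \<le> n"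

lemma few_subset: "few n B \<Longrightarrow> A \<subseteq> B \<Longrightarrow> few n A"
  unfolding few_def by (metis card_mono finite_subset le_trans)

lemma few_Un: "few m A \<Longrightarrow> few n B \<Longrightarrow> few (m + n) (A \<union> B)"
  unfolding few_def by (meson add_mono card_Un_le finite_UnI le_trans)

lemma few_UN: "few m I \<Longrightarrow> (\<And>i. i \<in> I \<Longrightarrow> few n (A i)) \<Longrightarrow> few (m * n) (\<Union>i\<in>I. A i)"
proof -
  assume I: "few m I" and A: "\<And>i. i \<in> I \<Longrightarrow> few n (A i)"
  have fI: "finite I" using I by (simp add: few_def)
  have "card (\<Union>i\<in>I. A i) \<le> (\<Sum>i\<in>I. card (A i))" using card_UN_le[OF fI] .
  also have "\<dots> \<le> of_nat (card I) * n" by (rule sum_bounded_above) (use A in \<open>auto simp: few_def\<close>)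
  also have "\<dots> \<le> m * n" using I by (simp add: few_def)
  finally show ?thesis using fI A by (auto simp: few_def)
qed

lemma few_inj: "inj_on f A \<Longrightarrow> f ` A \<subseteq> B \<Longrightarrow> few n B \<Longrightarrow> few n A"
  unfolding few_def by (metis card_inj_on_le finite_imageD finite_subset le_trans)

text \<open>A larger set would contain \<open>N + 1\<close> elements, which sorting turns into an
  increasing sequence indexed from 0 to \<open>N\<close>.\<close>

lemma few_by_sequence:
  fixes A :: "real set"
  assumes "\<And>t. (\<And>m n. m < n \<Longrightarrow> n \<le> N \<Longrightarrow> t m < t n) \<Longrightarrow> (\<And>n. n \<le> N \<Longrightarrow> t n \<in> A) \<Longrightarrow> False"
  shows "few N A"
proof (rule ccontr)
  assume "\<not> few N A"
  then have "\<exists>B\<subseteq>A. finite B \<and> card B = Suc N"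
    using infinite_arbitrarily_large[of A "Suc N"] obtain_subset_with_card_n[of "Suc N" A] unfolding few_def
    by (metis not_less_eq_eq)
  then obtain B where B: "B \<subseteq> A" "finite B" "card B = Suc N" by blast
  define t where "t n = sorted_list_of_set B ! n" for n
  have len: "length (sorted_list_of_set B) = Suc N" using B by simp
  show False
  proof (rule assms[of t])
    show "t m < t n" if "m < n" "n \<le> N" for m n
      using strict_sorted_list_of_set[of B] that len unfolding t_def by (auto intro: sorted_wrt_nth_less)
    show "t n \<in> A" if "n \<le> N" for n
      using nth_mem[of n "sorted_list_of_set B"] that len B set_sorted_list_of_set[OF B(2)] unfolding t_def by auto
  qed
qed

text \<open>Choosing a point of \<open>S\<close> in each component is injective, since distinct
  components are disjoint.\<close>

lemma few_components:
  assumes S: "few n S" and meet: "\<And>x. x \<in> X \<Longrightarrow> connected_component_set X x \<inter> S \<noteq> {}"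
  shows "few n (components X)"
proof -
  have m: "\<exists>y. y \<in> C \<inter> S" if "C \<in> components X" for C
    using that meet by (auto simp: components_def)
  then obtain f where f: "\<And>C. C \<in> components X \<Longrightarrow> f C \<in> C \<inter> S" by metis
  show ?thesis
  proof (rule few_inj[OF _ _ S])
    show "inj_on f (components X)"
    proof (rule inj_onI)
      fix C D assume CD: "C \<in> components X" "D \<in> components X" "f C = f D"
      then have "C \<inter> D \<noteq> {}" using f by fastforce
      then show "C = D" using components_eq CD by blast
    qed
    show "f ` components X \<subseteq> S" using f by blast
  qed
qed

context delaunay_portalgon
begin

lemma geod_inj: "geod L \<Gamma> \<Longrightarrow> s \<in> {0..L} \<Longrightarrow> s' \<in> {0..L} \<Longrightarrow> \<Gamma> s = \<Gamma> s' \<Longrightarrow> s = s'"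
proof -
  assume geo: "geod L \<Gamma>" and s: "s \<in> {0..L}" "s' \<in> {0..L}" "\<Gamma> s = \<Gamma> s'"
  have "ennreal \<bar>s - s'\<bar> = sd (\<Gamma> s) (\<Gamma> s')" using geo s(1,2) unfolding geod_def by auto
  also have "\<dots> = 0" unfolding s(3) by (rule sd_self) (use geo s in \<open>auto simp: geod_def\<close>)
  finally show ?thesis by simp
qed

lemma enter_edge_bounds: "enter_edge L \<Gamma> t k i j \<Longrightarrow> k < N \<and> i < 3 \<and> rigid j \<and> t \<in> {0..L} \<and> \<Gamma> t = cls (k, j (of_real t))"
  unfolding enter_edge_def enter_def by auto

lemma few_visits:
  assumes geo: "geod L \<Gamma>" and ad: "adot b \<ge> 0"
  shows "few 3 {t. \<exists>w j. visiting L \<Gamma> b t w j}"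
proof (rule few_by_sequence)
  fix t :: "nat \<Rightarrow> real" assume t: "\<And>m n. m < n \<Longrightarrow> n \<le> 3 \<Longrightarrow> t m < t n" and v: "\<And>n. n \<le> 3 \<Longrightarrow> t n \<in> {t. \<exists>w j. visiting L \<Gamma> b t w j}"
  have "\<exists>w j. visiting L \<Gamma> b (t n) w j" if "n \<le> 3" for n using v[OF that] by simp
  then obtain w j where v: "visiting L \<Gamma> b (t n) (w n) (j n)" if "n \<le> 3" for n by metis
  show False by (rule no_four_visits[where t=t and w=w and j=j, OF geo v ad t])
qed

lemma adot_flip: "fst a \<in> edges T \<Longrightarrow> adot (fst a, \<not> snd a) = adot a"
  unfolding adot_def by (simp add: dep_flip dots_swap)

text \<open>The far half of the edge is the near half of the reversed edge, which has the same
  opposite angle. The midpoint occurs once because a geodesic is injective.\<close>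

lemma few_entries:
  assumes geo: "geod L \<Gamma>" and b: "fst b \<in> edges T" and ad: "adot b \<ge> 0"
  shows "few 7 {t. \<exists>j. enter_edge L \<Gamma> t (fst (fst b)) (snd (fst b)) j}"
proof -
  define b' where "b' = (fst b, \<not> snd b)"
  obtain k i r where bk: "b = ((k, i), r)" "k < N" "i < 3" using b by (metis edges_iff prod.collapse)
  have "few 3 {t. \<exists>w j. visiting L \<Gamma> b t w j}" by (rule few_visits[OF geo ad])
  moreover have "few 3 {t. \<exists>w j. visiting L \<Gamma> b' t w j}" by (rule few_visits[OF geo]) (use adot_flip[OF b] ad in \<open>simp add: b'_def\<close>)
  moreover have "few 1 {t \<in> {0..L}. \<Gamma> t = cls (k, dep b (1/2))}"
  proof -
    have "t = s" if "t \<in> {t \<in> {0..L}. \<Gamma> t = cls (k, dep b (1/2))}" "s \<in> {t \<in> {0..L}. \<Gamma> t = cls (k, dep b (1/2))}" for t s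
      by (rule geod_inj[OF geo]) (use that in auto)
    then show ?thesis unfolding few_def by (metis (no_types, lifting) One_nat_def card_le_Suc0_iff_eq finite.emptyI finite_subset is_singletonI' finite.insertI is_singleton_def order_refl)
  qed
  ultimately have "few (3 + 3 + 1) ({t. \<exists>w j. visiting L \<Gamma> b t w j} \<union> {t. \<exists>w j. visiting L \<Gamma> b' t w j} \<union> {t \<in> {0..L}. \<Gamma> t = cls (k, dep b (1/2))})"
    by (intro few_Un)
  then have "few 7 ({t. \<exists>w j. visiting L \<Gamma> b t w j} \<union> {t. \<exists>w j. visiting L \<Gamma> b' t w j} \<union> {t \<in> {0..L}. \<Gamma> t = cls (k, dep b (1/2))})"
    by simp
  then show ?thesis
  proof (rule few_subset, intro subsetI)
    fix t assume "t \<in> {t. \<exists>j. enter_edge L \<Gamma> t (fst (fst b)) (snd (fst b)) j}"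
    then obtain j where en: "enter_edge L \<Gamma> t k i j" by (auto simp: bk)
    then have z: "ec k i (j (of_real t)) = 0" "0 < ec k (i+1) (j (of_real t))" "0 < ec k (i+2) (j (of_real t))" unfolding enter_edge_def by auto
    obtain w where w: "j (of_real t) = dep b w" using on_edge[OF bk(2,3) z(1), of r] bk(1) by metis
    have w01: "0 < w" "w < 1" using z(2,3) ec_dep[OF bk(2,3), of r w] unfolding w bk(1) by (auto split: if_splits)
    consider "w < 1/2" | "w > 1/2" | "w = 1/2" by linarith
    then show "t \<in> {t. \<exists>w j. visiting L \<Gamma> b t w j} \<union> {t. \<exists>w j. visiting L \<Gamma> b' t w j} \<union> {t \<in> {0..L}. \<Gamma> t = cls (k, dep b (1/2))}"
    proof cases
      case 1
      then have "visiting L \<Gamma> b t w j" using en w w01 by (simp add: visiting_def bk(1))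
      then show ?thesis by blast
    next
      case 2
      have "dep b' (1 - w) = dep b w" using dep_flip[OF b] by (simp add: b'_def)
      then have "visiting L \<Gamma> b' t (1 - w) j" using en w w01 2 by (simp add: visiting_def b'_def bk(1))
      then show ?thesis by blast
    next
      case 3
      show ?thesis using enter_edge_bounds[OF en] unfolding w 3 by simp
    qed
  qed
qed

definition exits :: "real \<Rightarrow> (real \<Rightarrow> surface_point) \<Rightarrow> edge \<Rightarrow> real set" where
  "exits L \<Gamma> e = {t. 0 < t \<and> t < L \<and> (\<exists>a b \<kappa> v u. fst a = e \<and> transit t \<Gamma> a b \<kappa> v u)}"

text \<open>At most one of the two triangles at an edge has an obtuse angle opposite to it.  An exit is an
  entry into the neighbour, and also an entry for the reversed path; one of the two entries is
  into a triangle with a non-obtuse opposite angle.\<close>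

lemma few_exits:
  assumes geo: "geod L \<Gamma>" shows "few 7 (exits L \<Gamma> e)"
proof (cases "exits L \<Gamma> e = {}")
  case False
  then obtain a b where ab: "fst a = e" "\<exists>t \<kappa> v u. transit t \<Gamma> a b \<kappa> v u" unfolding exits_def by blast
  then obtain p where p: "p \<in> portals T" "a \<in> p" "b \<in> p" "a \<noteq> b" unfolding transit_def by blast
  \<comment> \<open>An edge lies in at most one portal, so all exits through \<open>e\<close> use
    the same two directed edges.\<close>
  have un: "a' = a \<and> b' = b" if a': "fst a' = e" "transit t \<Gamma> a' b' \<kappa> v u" for a' b' t \<kappa> v u
  proof -
    obtain p' where p': "p' \<in> portals T" "a' \<in> p'" "b' \<in> p'" "a' \<noteq> b'" using a'(2) unfolding transit_def by blast
    have "p = p'" "a = a'" using portal_unique[OF p(1,2) p'(1,2)] ab(1) a'(1) by auto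
    then show ?thesis using portal_pair[OF p(1-3) _ p(4), of b'] p' by blast
  qed
  have E: "fst a \<in> edges T" "fst b \<in> edges T" using p portal_edge by auto
  obtain k i r where a: "a = ((k, i), r)" "k < N" "i < 3" using E(1) by (metis edges_iff prod.collapse)
  have kb: "fst (fst b) < N" using E(2) by (metis edges_iff prod.collapse)
  have ex: "\<exists>\<kappa> v u. transit t \<Gamma> a b \<kappa> v u" if "t \<in> exits L \<Gamma> e" for t
    using that un unfolding exits_def by blast
  show ?thesis
  proof (cases "adot b \<ge> 0")
    case True
    show ?thesis
    proof (rule few_subset[OF few_entries[OF geo E(2) True]], intro subsetI CollectI)
      fix t assume t: "t \<in> exits L \<Gamma> e"
      obtain \<kappa> v u where tr: "transit t \<Gamma> a b \<kappa> v u" using ex[OF t] by blast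
      have u: "norm u = 1" using tr unfolding transit_def by blast
      show "\<exists>j. enter_edge L \<Gamma> t (fst (fst b)) (snd (fst b)) j"
        by (rule exI, rule transit_enter[OF tr _ _ rigid_line[OF u]]) (use t in \<open>auto simp: exits_def scaleR_conv_of_real\<close>)
    qed
  next
    case False
    have "adot a \<ge> 0"
    proof (rule ccontr)
      assume "\<not> adot a \<ge> 0"
      then have "adot a * \<bar>DD (fst (fst b))\<bar> < 0" using DD[OF kb] by (simp add: mult_neg_pos)
      moreover have "adot b * \<bar>DD (fst (fst a))\<bar> < 0" using False DD[OF a(2)] a(1) by (simp add: mult_neg_pos)
      ultimately show False using adot_sum[OF p] by linarith
    qed
    then have f: "few 7 {t. \<exists>j. enter_edge L (\<lambda>s. \<Gamma> (L - s)) t (fst (fst a)) (snd (fst a)) j}"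
      by (rule few_entries[OF geod_reverse[OF geo] E(1)])
    show ?thesis
    proof (rule few_inj[of "\<lambda>t. L - t", OF _ _ f])
      show "(\<lambda>t. L - t) ` exits L \<Gamma> e \<subseteq> {t. \<exists>j. enter_edge L (\<lambda>s. \<Gamma> (L - s)) t (fst (fst a)) (snd (fst a)) j}"
      proof clarify
        fix t assume t: "t \<in> exits L \<Gamma> e"
        have t0: "0 < t" "t < L" using t by (auto simp: exits_def)
        obtain \<kappa> v u where tr: "transit t \<Gamma> a b \<kappa> v u" using ex[OF t] by blast
        obtain \<delta> where \<delta>: "\<delta> > 0" "\<And>s. t - \<delta> < s \<Longrightarrow> s < t \<Longrightarrow> (\<forall>i<3. 0 < ec k i (dep a v + (s - t) *\<^sub>R u)) \<and> \<Gamma> s = cls (k, dep a v + (s - t) *\<^sub>R u)"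
          and v: "0 < v" "v < 1" "\<Gamma> t = cls (k, dep a v)" "norm u = 1" using tr unfolding transit_def a(1) by auto
        define j where "j z = dep a v + (z - of_real (L - t)) * (- u)" for z
        have rj: "rigid j" using rigid_line[of "- u" "dep a v" "L - t"] v(4) by (simp add: j_def[abs_def])
        have j: "j (of_real s) = dep a v + ((L - s) - t) *\<^sub>R u" for s by (simp add: j_def scaleR_conv_of_real algebra_simps)
        have "\<exists>\<epsilon>>0. L - t + \<epsilon> \<le> L \<and> (\<forall>s. L - t \<le> s \<longrightarrow> s < L - t + \<epsilon> \<longrightarrow> \<Gamma> (L - s) = cls (k, j (of_real s))) \<and>
          (\<forall>s. L - t < s \<longrightarrow> s < L - t + \<epsilon> \<longrightarrow> (\<forall>i<3. 0 < ec k i (j (of_real s))))"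
        proof (rule exI[of _ "min \<delta> t"], intro conjI allI impI)
          fix s assume s: "L - t \<le> s" "s < L - t + min \<delta> t"
          show "\<Gamma> (L - s) = cls (k, j (of_real s))"
          proof (cases "s = L - t")
            case False
            then show ?thesis unfolding j using \<delta>(2)[of "L - s"] s by auto
          next
            case True
            have "j (of_real s) = dep a v" unfolding j True by simp
            moreover have "\<Gamma> (L - s) = \<Gamma> t" using True by simp
            ultimately show ?thesis using v(3) by simp
          qed
        next
          fix s m assume "L - t < s" "s < L - t + min \<delta> t" "m < (3::nat)"
          then show "0 < ec k m (j (of_real s))" unfolding j using \<delta>(2)[of "L - s"] by auto
        qed (use \<delta>(1) t0 in auto)
        then have "enter L (\<lambda>s. \<Gamma> (L - s)) (L - t) k j" unfolding enter_def using a(2) rj t0 by auto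
        moreover have "j (of_real (L - t)) = dep a v" unfolding j by simp
        ultimately have "enter_edge L (\<lambda>s. \<Gamma> (L - s)) (L - t) k i j"
          unfolding enter_edge_def using ec_dep[OF a(2,3), of r v] v a(3) by (cases r) (auto simp: a(1))
        then show "\<exists>j. enter_edge L (\<lambda>s. \<Gamma> (L - s)) (L - t) (fst (fst a)) (snd (fst a)) j" by (auto simp: a(1))
      qed
    qed (simp add: inj_on_def)
  qed
qed (simp add: few_def)

section \<open>Components of the intersection with a fragment\<close>

text \<open>For following a path along an edge in the fragment of a given representative
  \<open>y\<close>: the edge is \<open>c\<close> itself or its partner in the portal, directed so
  that parameters match.\<close>

lemma edge_twin:
  assumes c: "fst c \<in> edges T" and w: "0 < w" "w < 1" and y: "cls (fst (fst c), dep c w) = cls y"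
  obtains c' where "fst c' \<in> edges T" "y = (fst (fst c'), dep c' w)" "\<And>u. u \<in> {0..1} \<Longrightarrow> cls (fst (fst c'), dep c' u) = cls (fst (fst c), dep c u)"
proof -
  obtain k i r where ck: "c = ((k, i), r)" "k < N" "i < 3" using c by (metis edges_iff prod.collapse)
  show ?thesis
  proof (cases "\<exists>e\<in>portals T. \<exists>r'. ((k, i), r') \<in> e")
    case False
    have "y = (k, dep ((k, i), r) w)" by (rule cls_boundary[OF ck(2,3) _ w]) (use False y ck(1) in auto)
    then show ?thesis using that[of c] c ck(1) by simp
  next
    case True
    then obtain e a where e: "e \<in> portals T" "a \<in> e" "fst a = (k, i)" by fastforce
    obtain b where b: "b \<in> e" "b \<noteq> a" using portal_other[OF e(1,2)] by metis
    have E: "fst a \<in> edges T" "fst b \<in> edges T" using portal_edge[OF e(1,2)] portal_edge[OF e(1) b(1)] .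
    have g: "cls (fst (fst b), dep b u) = cls (k, dep a u)" if "u \<in> {0..1}" for u
      using glue_cls[OF glueI[OF e(1,2) b(1) that]] e(3) by simp
    have "a = c \<or> a = (fst c, \<not> snd c)" using e(3) ck(1) by (cases a; cases "snd a"; cases r) auto
    then show ?thesis
    proof
      assume ac: "a = c"
      then have "y = (fst (fst c), dep c w) \<or> y = (fst (fst b), dep b w)" using cls_edge[OF e(1,2) b(1) b(2)[symmetric] w] y by simp
      then show ?thesis using that[of c] that[of b] c E(2) g ac e(3) by auto
    next
      assume ac: "a = (fst c, \<not> snd c)"
      have ca: "dep c u = dep a (1 - u)" for u using dep_flip[OF c, of "1 - u"] ac by simp
      have bb: "dep (fst b, \<not> snd b) u = dep b (1 - u)" for u by (rule dep_flip[OF E(2)])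
      have "y = (fst (fst a), dep a (1-w)) \<or> y = (fst (fst b), dep b (1-w))"
        using cls_edge[OF e(1,2) b(1) b(2)[symmetric], of "1-w"] w y ca e(3) ck(1) by simp
      then show ?thesis
      proof
        assume "y = (fst (fst a), dep a (1-w))"
        then show ?thesis using that[of c] c ca ac by simp
      next
        assume "y = (fst (fst b), dep b (1-w))"
        then show ?thesis using that[of "(fst b, \<not> snd b)"] E(2) bb g ca e(3) ck(1) by simp
      qed
    qed
  qed
qed

text \<open>Away from the corners a class consists of at most the two sides of a portal. If there is
  no second point, \<open>z\<close> is \<open>(k, y)\<close> itself.\<close>

lemma nonvertex_fiber:
  assumes k: "k < N" "y \<in> Fr k" "\<not> is_vertex k y"
  obtains z where "\<not> is_vertex (fst z) (snd z)" "\<And>x. cls x = cls (k, y) \<Longrightarrow> x = (k, y) \<or> x = z"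
  using interior_or_edge[OF k]
proof cases
  case 1
  then show ?thesis using that[of "(k, y)"] cls_interior[OF k(1) 1] k(3) by (metis fst_conv snd_conv)
next
  case (2 i)
  obtain u where u: "y = dep ((k, i), False) u" using on_edge[OF k(1) 2(1,2), of False] by metis
  have u01: "0 < u" "u < 1" using 2(3,4) ec_dep[OF k(1) 2(1), of False u] unfolding u by auto
  have edge: "fst ((k, i), False) \<in> edges T" using k 2(1) edges_iff by simp
  show ?thesis
  proof (cases "\<exists>x. cls x = cls (k, y) \<and> x \<noteq> (k, y)")
    case False
    then show ?thesis using that[of "(k, y)"] k(3) by (metis fst_conv snd_conv)
  next
    case True
    then obtain z where z: "cls z = cls (k, y)" "z \<noteq> (k, y)" by blast
    have "\<exists>e\<in>portals T. \<exists>r. ((k, i), r) \<in> e"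
    proof (rule ccontr)
      assume "\<not> ?thesis"
      then have "z = (k, y)" unfolding u by (intro cls_boundary[OF k(1) 2(1) _ u01]) (use z(1) u in auto)
      then show False using z(2) by simp
    qed
    then obtain e r where e: "e \<in> portals T" "((k, i), r) \<in> e" by blast
    obtain b where b: "b \<in> e" "b \<noteq> ((k, i), r)" using portal_other[OF e(1,2)] by metis
    obtain v where v: "y = dep ((k, i), r) v" "0 < v" "v < 1"
    proof (cases r)
      case True
      show ?thesis by (rule that[of "1 - u"]) (use u u01 dep_flip[OF edge, of "1 - u"] True in auto)
    next
      case False
      show ?thesis by (rule that[of u]) (use u u01 False in auto)
    qed
    have two: "x = (k, y) \<or> x = (fst (fst b), dep b v)" if "cls x = cls (k, y)" for x
      using cls_edge[OF e b(1) b(2)[symmetric] v(2,3), of x] that v(1) by simp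
    obtain kb ib rb where bk: "b = ((kb, ib), rb)" "kb < N" "ib < 3" using portal_edge[OF e(1) b(1)] by (metis edges_iff prod.collapse)
    show ?thesis by (rule that[of "(kb, dep b v)"]) (use two vertex_dep[OF bk(2,3), of rb v] v bk(1) in auto)
  qed
qed

lemma vertex_cls:
  assumes k: "k < N" "y \<in> Fr k" "\<not> is_vertex k y" and k': "k' < N"
  shows "cls (k, y) \<noteq> cls (k', V k' i)"
proof
  assume eq: "cls (k, y) = cls (k', V k' i)"
  obtain z where z: "\<not> is_vertex (fst z) (snd z)" "\<And>x. cls x = cls (k, y) \<Longrightarrow> x = (k, y) \<or> x = z" by (rule nonvertex_fiber[OF k]) blast
  have "is_vertex k' (V k' i)" unfolding is_vertex_def using V_mod(1)[of k' i] by (metis mod_less_divisor zero_less_numeral)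
  then show False using z(1) z(2)[of "(k', V k' i)"] eq k(3) by auto
qed

definition trace :: "real \<Rightarrow> (real \<Rightarrow> surface_point) \<Rightarrow> nat \<Rightarrow> complex set" where
  "trace L \<Gamma> k = {x \<in> Fr k. cls (k, x) \<in> \<Gamma> ` {0..L}}"

text \<open>A time is marked through all its non-vertex preimages in \<open>k\<close>; there can be
  two of them when the fragment is glued to itself.\<close>

definition marked :: "real \<Rightarrow> (real \<Rightarrow> surface_point) \<Rightarrow> nat \<Rightarrow> complex set" where
  "marked L \<Gamma> k = {V k 0, V k 1, V k 2} \<union>
     (\<Union>t\<in>{0, L} \<union> (\<Union>i\<in>{..<3}. exits L \<Gamma> (k, i)). {y \<in> Fr k. \<not> is_vertex k y \<and> cls (k, y) = \<Gamma> t})"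

lemma few_marked:
  assumes geo: "geod L \<Gamma>" and k: "k < N"
  shows "few 49 (marked L \<Gamma> k)"
proof -
  have fib: "few 2 {y \<in> Fr k. \<not> is_vertex k y \<and> cls (k, y) = p}" (is "few 2 ?A") for p
  proof (cases "?A = {}")
    case False
    then obtain y where y: "y \<in> Fr k" "\<not> is_vertex k y" "cls (k, y) = p" by blast
    obtain z where z: "\<And>x. cls x = cls (k, y) \<Longrightarrow> x = (k, y) \<or> x = z" by (rule nonvertex_fiber[OF k y(1,2)]) blast
    have "?A \<subseteq> {y, snd z}"
    proof
      fix y' assume "y' \<in> ?A"
      then have "cls (k, y') = cls (k, y)" using y(3) by simp
      then have "(k, y') = (k, y) \<or> (k, y') = z" by (rule z)
      then show "y' \<in> {y, snd z}" by auto
    qed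
    moreover have "few 2 {y, snd z}" unfolding few_def using card_insert_le_m1[of 2 "{snd z}" y] by simp
    ultimately show ?thesis by (rule few_subset[rotated])
  next
    case True
    then show ?thesis unfolding True few_def by simp
  qed
  have e: "few 21 (\<Union>i\<in>{..<3}. exits L \<Gamma> (k, i))"
    using few_UN[of 3 "{..<3::nat}" 7 "\<lambda>i. exits L \<Gamma> (k, i)"] few_exits[OF geo] by (simp add: few_def)
  have "few 2 {0, L}" unfolding few_def using card_insert_le_m1[of 2 "{L}" 0] by simp
  from few_Un[OF this e] have t: "few 23 ({0, L} \<union> (\<Union>i\<in>{..<3}. exits L \<Gamma> (k, i)))" by simp
  have "few (23 * 2) (\<Union>t\<in>{0, L} \<union> (\<Union>i\<in>{..<3}. exits L \<Gamma> (k, i)). {y \<in> Fr k. \<not> is_vertex k y \<and> cls (k, y) = \<Gamma> t})"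
    by (rule few_UN[OF t fib])
  moreover have "few 3 {V k 0, V k 1, V k 2}"
    unfolding few_def using card_insert_le_m1[of 3 "{V k 1, V k 2}" "V k 0"] card_insert_le_m1[of 2 "{V k 2}" "V k 1"] by simp
  ultimately have "few (3 + 23 * 2) (marked L \<Gamma> k)" unfolding marked_def by (intro few_Un)
  then show ?thesis by simp
qed

text \<open>Follows the path forward in time. As long as no mark is met the path cannot leave the
  component: the set \<open>Q\<close> of later times represented in it is closed and extends to the
  right, so it reaches the end \<open>L\<close>, which is a mark. Going forward, only exits can
  interrupt, and entries need no mark.\<close>

lemma component_marked:
  assumes geo: "geod L \<Gamma>" and k: "k < N" and x: "x \<in> trace L \<Gamma> k"
  shows "connected_component_set (trace L \<Gamma> k) x \<inter> marked L \<Gamma> k \<noteq> {}"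
proof
  assume none: "connected_component_set (trace L \<Gamma> k) x \<inter> marked L \<Gamma> k = {}"
  define X where "X = trace L \<Gamma> k"
  define Cc where "Cc = connected_component_set X x"
  obtain t0 where t0: "t0 \<in> {0..L}" "cls (k, x) = \<Gamma> t0" and xF: "x \<in> Fr k" using x unfolding trace_def by blast
  have xC: "x \<in> Cc" using x unfolding Cc_def X_def by (simp add: connected_component_refl_eq)
  have CX: "Cc \<subseteq> X" unfolding Cc_def by (rule connected_component_subset)
  have CF: "y \<in> Fr k" if "y \<in> Cc" for y using CX that unfolding X_def trace_def by blast
  have nv: "\<not> is_vertex k y" if yC: "y \<in> Cc" for y
  proof
    assume "is_vertex k y"
    then have "y \<in> {V k 0, V k 1, V k 2}" unfolding is_vertex_def ex3 by auto
    then show False using none yC unfolding Cc_def X_def marked_def by blast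
  qed
  have unmarked: "cls (k, y) \<noteq> \<Gamma> t" if yC: "y \<in> Cc" and t: "t \<in> {0, L} \<union> (\<Union>i\<in>{..<3}. exits L \<Gamma> (k, i))" for y t
  proof
    assume "cls (k, y) = \<Gamma> t"
    then have "y \<in> marked L \<Gamma> k" unfolding marked_def using CF[OF yC] nv[OF yC] t by blast
    then show False using none yC unfolding Cc_def X_def by blast
  qed
  define Q where "Q = {s \<in> {t0..L}. \<exists>y\<in>Cc. cls (k, y) = \<Gamma> s}"
  \<comment> \<open>A continuous lift of the path into \<open>k\<close> that starts in the component
    remains in it, because its image is connected.\<close>
  have extend: "{s..s1} \<subseteq> Q" if s: "t0 \<le> s" "s \<le> s1" "s1 \<le> L" and f: "continuous_on {s..s1} f" "f s \<in> Cc"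
     "\<And>s'. s \<le> s' \<Longrightarrow> s' \<le> s1 \<Longrightarrow> f s' \<in> Fr k \<and> cls (k, f s') = \<Gamma> s'" for s s1 f
  proof -
    have "f ` {s..s1} \<subseteq> X" using f(3) s t0(1) unfolding X_def trace_def by auto
    moreover have "connected (f ` {s..s1})" using f(1) by (rule connected_continuous_image) simp
    moreover have "f s \<in> f ` {s..s1}" using s by simp
    ultimately have "f ` {s..s1} \<subseteq> connected_component_set X (f s)" by (intro connected_component_maximal)
    moreover have "connected_component_set X (f s) = Cc" using f(2) unfolding Cc_def by (metis connected_component_eq)
    ultimately show ?thesis using f(3) s unfolding Q_def by fastforce
  qed
  have ray: "continuous_on A (\<lambda>s'. p + (s' - s) *\<^sub>R u)" for A p s and u :: complex by (intro continuous_intros)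
  have right: "\<exists>s1>s. s1 \<le> L \<and> {s..s1} \<subseteq> Q" if s: "s \<in> Q" "s < L" for s
  proof -
    obtain y where y: "y \<in> Cc" "cls (k, y) = \<Gamma> s" and st: "t0 \<le> s" using s unfolding Q_def by auto
    have "s \<noteq> 0" using unmarked[OF y(1), of 0] y(2) by auto
    then have s0: "0 < s" using st t0(1) by simp
    show ?thesis
    proof (rule passing[OF geo s0 s(2)])
      show "\<Gamma> s \<noteq> cls (k', V k' i)" if "k' < N" for k' i
        unfolding y(2)[symmetric] by (rule vertex_cls[OF k CF[OF y(1)] nv[OF y(1)] that])
    next
      fix k' p u \<delta> assume in': "k' < N" "norm u = 1" "0 < \<delta>" "\<And>s'. \<bar>s' - s\<bar> < \<delta> \<Longrightarrow> (\<forall>i<3. 0 < ec k' i (p + (s' - s) *\<^sub>R u)) \<and> \<Gamma> s' = cls (k', p + (s' - s) *\<^sub>R u)"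
      have "(k, y) = (k', p)" using in'(4)[of s] in'(3) y(2) by (intro cls_interior[OF in'(1)]) auto
      then have kp: "k' = k" "p = y" by auto
      define s1 where "s1 = min (s + \<delta>/2) L"
      have s1: "s < s1" "s1 \<le> L" "s1 < s + \<delta>" using in'(3) s(2) by (auto simp: s1_def)
      have "{s..s1} \<subseteq> Q"
      proof (rule extend[OF st _ s1(2) ray[of _ y s u]])
        fix s' assume "s \<le> s'" "s' \<le> s1"
        then show "y + (s' - s) *\<^sub>R u \<in> Fr k \<and> cls (k, y + (s' - s) *\<^sub>R u) = \<Gamma> s'"
          using in'(4)[of s'] s1 Fr_iff[OF k] unfolding kp by (auto intro: less_imp_le)
      qed (use s1 y in auto)
      then show ?thesis using s1 by blast
    next
      fix c w \<delta> assume al: "fst c \<in> edges T" "0 < w" "w < 1" "0 < \<delta>" "\<And>s'. \<bar>s' - s\<bar> < \<delta> \<Longrightarrow>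
         0 < w + (s' - s) / edge_length T (fst c) \<and> w + (s' - s) / edge_length T (fst c) < 1 \<and>
         \<Gamma> s' = cls (fst (fst c), dep c (w + (s' - s) / edge_length T (fst c)))"
      have "cls (fst (fst c), dep c w) = cls (k, y)" using al(5)[of s] al(4) y(2) by simp
      then obtain c' where c': "fst c' \<in> edges T" "(k, y) = (fst (fst c'), dep c' w)"
        "\<And>u. u \<in> {0..1} \<Longrightarrow> cls (fst (fst c'), dep c' u) = cls (fst (fst c), dep c u)" by (rule edge_twin[OF al(1-3)]) blast
      define f where "f s' = dep c' (w + (s' - s) / edge_length T (fst c))" for s'
      have f: "f = (\<lambda>s'. (1 - (w + (s' - s) / edge_length T (fst c))) *\<^sub>R dep c' 0 + (w + (s' - s) / edge_length T (fst c)) *\<^sub>R dep c' 1)"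
        unfolding f_def by (subst dep_lin[OF c'(1)]) (rule refl)
      define s1 where "s1 = min (s + \<delta>/2) L"
      have s1: "s < s1" "s1 \<le> L" "s1 < s + \<delta>" using al(4) s(2) by (auto simp: s1_def)
      have "{s..s1} \<subseteq> Q"
      proof (rule extend[OF st _ s1(2)])
        show "continuous_on {s..s1} f" unfolding f divide_inverse by (intro continuous_intros)
        fix s' assume s': "s \<le> s'" "s' \<le> s1"
        then have *: "w + (s' - s) / edge_length T (fst c) \<in> {0..1}" "\<Gamma> s' = cls (fst (fst c), dep c (w + (s' - s) / edge_length T (fst c)))"
          using al(5)[of s'] s1 by auto
        show "f s' \<in> Fr k \<and> cls (k, f s') = \<Gamma> s'"
          unfolding f_def *(2) using dep_Fr[OF c'(1) *(1)] c'(3)[OF *(1)] c'(2) by simp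
      qed (use s1 y c'(2) in \<open>auto simp: f_def\<close>)
      then show ?thesis using s1 by blast
    next
      fix a b \<kappa> v u assume tr: "transit s \<Gamma> a b \<kappa> v u"
      obtain e where e: "e \<in> portals T" "a \<in> e" "b \<in> e" "a \<noteq> b" and \<kappa>: "glue_map a b \<kappa>" and v: "0 < v" "v < 1" using tr unfolding transit_def by blast
      obtain \<delta> where \<delta>: "\<delta> > 0" "\<And>s'. s < s' \<Longrightarrow> s' < s + \<delta> \<Longrightarrow> (\<forall>i<3. 0 < ec (fst (fst b)) i (\<kappa> (dep a v + (s' - s) *\<^sub>R u))) \<and> \<Gamma> s' = cls (fst (fst b), \<kappa> (dep a v + (s' - s) *\<^sub>R u))"
        and \<Gamma>s: "\<Gamma> s = cls (fst (fst a), dep a v)" using tr unfolding transit_def by blast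
      have r\<kappa>: "rigid \<kappa>" and \<kappa>d: "\<kappa> (dep a v) = dep b v" using \<kappa> by (auto simp: glue_map_def)
      have "(k, y) = (fst (fst a), dep a v) \<or> (k, y) = (fst (fst b), dep b v)"
        by (rule cls_edge[OF e v]) (use \<Gamma>s y(2) in simp)
      \<comment> \<open>On the side of \<open>a\<close> the time \<open>s\<close> would be an exit
        from \<open>k\<close> and \<open>y\<close> a mark. So \<open>y\<close> is on the side being
        entered, and the lift continues in \<open>k\<close>.\<close>
      moreover have "(k, y) \<noteq> (fst (fst a), dep a v)"
      proof
        assume ky: "(k, y) = (fst (fst a), dep a v)"
        obtain i where i: "fst a = (k, i)" "i < 3" using portal_edge[OF e(1,2)] ky by (metis edges_iff fst_conv prod.collapse)
        have "s \<in> exits L \<Gamma> (k, i)" unfolding exits_def using s0 s(2) tr i(1) by blast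
        then show False using unmarked[OF y(1), of s] y(2) i(2) by blast
      qed
      ultimately have ky: "fst (fst b) = k" "y = dep b v" by auto
      define s1 where "s1 = min (s + \<delta>/2) L"
      have s1: "s < s1" "s1 \<le> L" "s1 < s + \<delta>" using \<delta>(1) s(2) by (auto simp: s1_def)
      define f where "f s' = \<kappa> (dep a v + (s' - s) *\<^sub>R u)" for s'
      have fr: "f = (\<lambda>s'. \<kappa> (dep a v) + (s' - s) *\<^sub>R (\<kappa> (dep a v + u) - \<kappa> (dep a v)))"
        unfolding f_def using rigid_affine[OF r\<kappa>] by blast
      have "{s..s1} \<subseteq> Q"
      proof (rule extend[OF st _ s1(2)])
        show "continuous_on {s..s1} f" unfolding fr by (rule ray)
        show "f s \<in> Cc" using y(1) ky(2) by (simp add: f_def \<kappa>d)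
        fix s' assume s': "s \<le> s'" "s' \<le> s1"
        show "f s' \<in> Fr k \<and> cls (k, f s') = \<Gamma> s'"
        proof (cases "s' = s")
          case True
          then show ?thesis using CF[OF y(1)] y(2) ky(2) by (simp add: f_def \<kappa>d)
        next
          case False
          then show ?thesis using \<delta>(2)[of s'] s' s1 Fr_iff[OF k] unfolding f_def ky(1) by (auto intro: less_imp_le)
        qed
      qed (use s1 in auto)
      then show ?thesis using s1 by blast
    qed
  qed
  \<comment> \<open>Representatives in the component accumulate by compactness of the fragment.
    Their limit is at distance zero from the limit point of the path, hence represents it, and
    components are closed in the trace.\<close>
  have "closed Q"
    unfolding closed_sequential_limits
  proof (intro allI impI)
    fix \<sigma> m assume "(\<forall>n. \<sigma> n \<in> Q) \<and> \<sigma> \<longlonglongrightarrow> m"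
    then have \<sigma>: "\<And>n. \<sigma> n \<in> Q" "\<sigma> \<longlonglongrightarrow> m" by auto
    have "closed {t0..L}" by simp
    then have m: "m \<in> {t0..L}" using \<sigma> unfolding closed_sequential_limits Q_def by blast
    have "\<exists>y. y \<in> Cc \<and> cls (k, y) = \<Gamma> (\<sigma> n)" for n using \<sigma>(1)[of n] unfolding Q_def by blast
    then obtain y where y: "\<And>n. y n \<in> Cc" "\<And>n. cls (k, y n) = \<Gamma> (\<sigma> n)" by metis
    obtain l r where l: "l \<in> Fr k" "strict_mono r" "(y \<circ> r) \<longlonglongrightarrow> l"
      using Fr_compact[OF k] CF[OF y(1)] unfolding compact_def by metis
    have sr: "(\<sigma> \<circ> r) \<longlonglongrightarrow> m" using \<sigma>(2) l(2) by (rule LIMSEQ_subseq_LIMSEQ)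
    have b: "sd (cls (k, l)) (\<Gamma> m) \<le> ennreal (norm (l - y (r n)) + \<bar>\<sigma> (r n) - m\<bar>)" for n
    proof -
      have "sd (cls (k, l)) (\<Gamma> m) \<le> sd (cls (k, l)) (cls (k, y (r n))) + sd (cls (k, y (r n))) (\<Gamma> m)" by (rule sd_triangle)
      also have "\<dots> \<le> ennreal (norm (l - y (r n))) + ennreal \<bar>\<sigma> (r n) - m\<bar>"
      proof (rule add_mono)
        show "sd (cls (k, l)) (cls (k, y (r n))) \<le> ennreal (norm (l - y (r n)))" by (rule dist_fragment[OF k l(1) CF[OF y(1)]])
        have "\<sigma> (r n) \<in> {0..L}" "m \<in> {0..L}" using \<sigma>(1)[of "r n"] m t0(1) unfolding Q_def by auto
        then show "sd (cls (k, y (r n))) (\<Gamma> m) \<le> ennreal \<bar>\<sigma> (r n) - m\<bar>" unfolding y(2) using geo unfolding geod_def by auto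
      qed
      also have "\<dots> = ennreal (norm (l - y (r n)) + \<bar>\<sigma> (r n) - m\<bar>)" by (rule ennreal_plus[symmetric]) auto
      finally show ?thesis .
    qed
    have "(\<lambda>n. norm (l - (y \<circ> r) n) + \<bar>(\<sigma> \<circ> r) n - m\<bar>) \<longlonglongrightarrow> norm (l - l) + \<bar>m - m\<bar>"
      by (intro tendsto_intros l(3) sr)
    then have "(\<lambda>n. ennreal (norm (l - y (r n)) + \<bar>\<sigma> (r n) - m\<bar>)) \<longlonglongrightarrow> ennreal 0"
      by (intro tendsto_ennrealI) simp
    then have "sd (cls (k, l)) (\<Gamma> m) \<le> ennreal 0" by (rule LIMSEQ_le_const) (use b in blast)
    then have "sd (cls (k, l)) (\<Gamma> m) = 0" by simp
    moreover have "\<Gamma> m \<in> surface T" using geo m t0(1) unfolding geod_def by auto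
    ultimately have lm: "cls (k, l) = \<Gamma> m" using sd_zero[OF cls_mem[OF k l(1)]] by blast
    then have lX: "l \<in> X" using l(1) m t0(1) unfolding X_def trace_def by auto
    obtain W where W: "closed W" "Cc = X \<inter> W"
      using closedin_connected_component[of X x] unfolding Cc_def closedin_closed by blast
    have "l \<in> W" by (rule closed_sequentially[OF W(1) _ l(3)]) (use y(1) W(2) in auto)
    then show "m \<in> Q" using lX W(2) m lm unfolding Q_def by blast
  qed
  \<comment> \<open>Otherwise the infimum \<open>m\<close> of the missing times would belong to
    \<open>Q\<close> by closedness, and \<open>right\<close> would extend \<open>Q\<close> beyond
    it.\<close>
  have "L \<in> Q"
  proof (rule ccontr)
    assume LQ: "L \<notin> Q"
    define U where "U = {t0..L} - Q"
    have U: "L \<in> U" "bdd_below U" using LQ t0(1) by (auto simp: U_def intro: bdd_belowI[of _ t0])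
    define m where "m = Inf U"
    have "m \<le> L" unfolding m_def by (rule cInf_lower[OF U])
    moreover have "t0 \<le> m" unfolding m_def by (rule cInf_greatest) (use U(1) in \<open>auto simp: U_def\<close>)
    ultimately have mL: "m \<le> L" "t0 \<le> m" by auto
    have tQ: "t0 \<in> Q" using xC t0 unfolding Q_def by auto
    have "{t0..<m} \<subseteq> Q"
    proof
      fix s assume s: "s \<in> {t0..<m}"
      show "s \<in> Q"
      proof (rule ccontr)
        assume "s \<notin> Q"
        then have "s \<in> U" using s mL by (simp add: U_def)
        then have "m \<le> s" unfolding m_def by (rule cInf_lower[OF _ U(2)])
        then show False using s by simp
      qed
    qed
    then have "closure {t0..<m} \<subseteq> Q" using \<open>closed Q\<close> by (rule closure_minimal)
    then have mQ: "m \<in> Q" using tQ mL by (cases "m = t0") auto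
    then have "m \<noteq> L" using LQ by auto
    then obtain s1 where s1: "s1 > m" "s1 \<le> L" "{m..s1} \<subseteq> Q" using right[OF mQ] mL by auto
    have "s1 \<le> Inf U"
    proof (rule cInf_greatest)
      fix u assume u: "u \<in> U"
      have "m \<le> u" unfolding m_def by (rule cInf_lower[OF u U(2)])
      then show "s1 \<le> u" using u s1(3) \<open>m \<le> u\<close> by (cases "u \<le> s1") (auto simp: U_def subset_eq)
    qed (use U in auto)
    then show False using s1(1) by (simp add: m_def)
  qed
  then show False using unmarked[of _ L] unfolding Q_def by blast
qed

end

theorem mainTheorem4:
  shows "\<exists>C :: nat. \<forall>P T :: portalgon.
    is_portalgon P \<longrightarrow> is_intrinsic_Delaunay_triangulation_of T P \<longrightarrow> happy C T"
proof (intro exI[of _ 49] allI impI)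
  fix P T :: portalgon assume T: "is_intrinsic_Delaunay_triangulation_of T P"
  interpret delaunay_portalgon T
    by unfold_locales (use T in \<open>auto simp: is_intrinsic_Delaunay_triangulation_of_def is_triangulation_of_def\<close>)
  have "num_components (fragment_inter T k \<gamma>) \<le> enat 49" if k: "k < length (fragments T)" and \<gamma>: "\<gamma> \<in> shortest_paths T p q" for k p q \<gamma>
  proof -
    obtain L \<Gamma> where geo: "geod L \<Gamma>" and im: "\<Gamma> ` {0..L} = \<gamma> ` {0..1}" by (rule shortest_path_geod[OF \<gamma>])
    have "few 49 (components (trace L \<Gamma> k))" by (rule few_components[OF few_marked[OF geo k] component_marked[OF geo k]])
    moreover have "trace L \<Gamma> k = fragment_inter T k \<gamma>" unfolding trace_def fragment_inter_def im by simp
    ultimately show ?thesis by (simp add: few_def num_components_def)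
  qed
  then show "happy 49 T"
    unfolding happy_def happiness_def fragment_happiness_def by (intro SUP_least) auto
qed

end
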